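(* Let $n\in\{1,2\}$, let $J\subset\{0,\dots,n+1\}$ with $1\le|J|\le n$, let $E_J$ be the corresponding face of the standard Lagrangian coamoeba $C$, and let $k\in\{0,\dots,n+1\}\setminus J$. With the notation of the context, the map $$\mathbf g_{J,k}=(\mathbf y_{J,k},\mathbf h_{J,k}):\ \mathrm{Int}\,\tilde{\mathcal W}_{J,k}\longrightarrow \tilde E_J\times\mathrm{Int}\,\Gamma_J$$ is a diffeomorphism. In particular $\Phi(\mathrm{Int}\,\tilde{\mathcal W}_{J,k})$ is the graph of the differential of a Legendre transform $G$ of $F$ defined on $\tilde E_J\times\mathrm{Int}\,\Gamma_J$. Moreover $\mathbf h_{J,k}:\mathrm{Int}\,\tilde{\mathcal W}_{J,k}\to\mathrm{Int}\,\Gamma_J$ is a trivial fibre bundle over $\mathrm{Int}\,\Gamma_J$ with fibre $\tilde E_J$.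
   Context: $T=\mathbb R^{n+1}/\pi\mathbb Z^{n+1}$ has coordinates $y$, $T^*T=M_{\mathbb R}\times T$ with $M_{\mathbb R}=\mathbb R^{n+1}$ (coordinates $x$) and $\omega=\frac1\pi\sum dx_i\wedge dy_i$; $x\cdot y=\sum x_iy_i$. Int denotes (relative) interior. Coamoeba. $p_0=0$, $p_k=\frac\pi2e_k$ ($1\le k\le n+1$). $C^+\subset T$: points represented by a vertex or interior point of the simplex with vertices $p_0,\dots,p_{n+1}$; $C^-=-C^+$; $C=C^+\cup C^-$. For $J\subsetneq\{0,\dots,n+1\}$, $E_J^+$ is the set of points represented by a vertex or relative interior point of the simplex with vertices $\{p_i\}_{i\notin J}$, $E_J^-=-E_J^+$, $E_J=E_J^+\cup E_J^-$. $\mathrm{Int}\,C$ and $\mathrm{Int}\,E_J$ denote the unions of the relative interiors of the two simplices forming $C$, respectively $E_J$. Blow up. For a vertex $p$ and a small neighborhood $U_p\subset C$ let $\tilde U_p=\{(q,\ell):q\in U_p,\ q-p\in\ell\}$, $\ell$ ranging over lines through $0$ spanned by a vector pointing from $p$ into the interior of the simplex (coordinates near $p_0$: $(\alpha_1,\dots,\alpha_n,t)\mapsto(t\alpha_1,\dots,t\alpha_n,t)$, $\alpha_j>0$). $\tilde C$ is the manifold obtained by gluing these to $C$ minus its vertices; $\pi:\tilde C\to C$ is the projection. $\tilde E_J$ is the analogous blow up of the lower dimensional coamoeba $E_J$ at its vertices if $\dim E_J>1$; $\tilde E_J=E_J$ (a circle) if $\dim E_J=1$. Function. $F=\big(\cos(\sum_jy_j)\prod_j\sin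 y_j\big)^{1/(n+1)}$ on $C^+$, extended to $C^-$ by $F(-y)=-F(y)$. $\mathbf h=(F_{y_1},\dots,F_{y_{n+1}})$ extends smoothly to $\tilde C$, and $\Phi=(\mathbf h,\pi):\tilde C\to M_{\mathbb R}\times T$. Cones. $u_i=e_i$ for $1\le i\le n+1$, $u_0=-\sum_ie_i$, $\Gamma_J=\{\sum_{j\in J}t_ju_j:t_j\ge0\}$, $V_J=\mathrm{span}\,\Gamma_J$. Neighborhoods. For $j\neq k$, $\Delta_{jk}\subset C^+$ is the set of $y$ with $\lambda_k(y)\ge\lambda_j(y)$, where $\lambda_0,\dots,\lambda_{n+1}$ are barycentric coordinates with respect to $p_0,\dots,p_{n+1}$ (the half of $C^+$ containing $p_k$ cut by the hyperplane through the midpoint of $p_jp_k$ and all other vertices). $\mathcal W^+_{J,k}=\bigcap_{j\in J}\Delta_{jk}$, $\mathcal W_{J,k}=\mathcal W^+_{J,k}\cup(-\mathcal W^+_{J,k})$, $\tilde{\mathcal W}_{J,k}=\pi^{-1}(\mathcal W_{J,k})$; its interior is taken in $\tilde C$. Projections. Let $L=\mathrm{span}\{p_j-p_k:j\in J\}\subset\mathbb R^{n+1}$ and $L^\perp=\{x:x\cdot y=0\ \forall y\in L\}$. For $y\in\mathrm{Int}\,C$, $\mathbf y_{J,k}(y)$ is the unique $y'\in\mathrm{Int}\,E_J$, in the same simplex ($C^+$ or $C^-$) as $y$, with $y-y'\in L$; it extends to a map $\pi^{-1}(\mathrm{Int}\,C\cup\{p_i\}_{i\notin J})\to\tilde E_J$.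 $\mathbf x_{J,k}:M_{\mathbb R}\to V_J$ is the projection along $L^\perp$, and $\mathbf h_{J,k}=\mathbf x_{J,k}\circ\mathbf h$. Graph and Legendre transform. The Legendre transform is the function $G$ determined by $G(\mathbf g_{J,k}(y))=-F(y)+\mathbf h_{J,k}(y)\cdot(y-\mathbf y_{J,k}(y))$, where $y-\mathbf y_{J,k}(y)\in L$ is computed with representatives in the same simplex. Let $T_J$ be the smallest subtorus (translate allowed) containing $E_J$. A pair $(\ell',\ell)\in L^\perp\times L$ is identified with the covector $(v,w)\mapsto \ell\cdot v-\ell'\cdot w$ on $V_J\times T_J$ ($v$ tangent to $V_J$, $w$ tangent to $T_J$), and a covector $(\ell',\ell)$ at $(x',y')\in V_J\times T_J$ is sent to the point $(x'+\ell',y'+\ell)\in M_{\mathbb R}\times T$. "Graph of $dG$" is understood through this identification, extended by continuity over the exceptional part of $\tilde E_J$. *)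

theory Defs
  imports "HOL-Analysis.Analysis"
begin

section \<open>Smooth maps between manifolds given by parametrizations\<close>

text \<open>\<open>Ck_on k U f\<close> is meant for open \<open>U\<close>: all iterated directional derivatives up to order
  \<open>k\<close> exist and are differentiable (continuous for the last one).\<close>

primrec Ck_on :: "nat \<Rightarrow> 'a::euclidean_space set \<Rightarrow> ('a \<Rightarrow> 'b::real_normed_vector) \<Rightarrow> bool" where
  "Ck_on 0 U f \<longleftrightarrow> continuous_on U f"
| "Ck_on (Suc k) U f \<longleftrightarrow> (\<forall>x\<in>U. f differentiable (at x)) \<and>
     (\<forall>v. Ck_on k U (\<lambda>x. frechet_derivative f (at x) v))"

text \<open>Smoothness on an arbitrary subset of a Euclidean space means local extendability to
  smooth functions on open sets. For a relatively open subset of an affine subspace this is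
  ordinary smoothness.\<close>

definition smooth_on_set :: "'a::euclidean_space set \<Rightarrow> ('a \<Rightarrow> 'b::euclidean_space) \<Rightarrow> bool" where
  "smooth_on_set S f \<longleftrightarrow> (\<forall>x\<in>S. \<exists>U g. open U \<and> x \<in> U \<and> (\<forall>k. Ck_on k U g) \<and>
     (\<forall>y\<in>S \<inter> U. g y = f y))"

text \<open>A manifold is presented by a set of injective parametrizations \<open>(D, \<phi>)\<close>, where \<open>D\<close> is a
  relatively open subset of an affine subspace of a Euclidean space (so that the dimension of
  the manifold need not be the dimension of a type). Transition maps are smooth in all
  instances below. The topology is the one glued from the domains \<open>D\<close>.\<close>

type_synonym ('e, 'p) mfd = "('e set \<times> ('e \<Rightarrow> 'p)) set"

definition mpts :: "('e, 'p) mfd \<Rightarrow> 'p set" where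
  "mpts X = (\<Union>(D, \<phi>)\<in>X. \<phi> ` D)"

definition mtop :: "('e::euclidean_space, 'p) mfd \<Rightarrow> 'p topology" where
  "mtop X = topology (\<lambda>U. U \<subseteq> mpts X \<and>
     (\<forall>(D, \<phi>)\<in>X. openin (top_of_set D) {z \<in> D. \<phi> z \<in> U}))"

lemma openin_mtop:
  fixes X :: "('a::euclidean_space, 'b) mfd"
  shows "openin (mtop X) U \<longleftrightarrow>
     U \<subseteq> mpts X \<and> (\<forall>(D, \<phi>)\<in>X. openin (top_of_set D) {z \<in> D. \<phi> z \<in> U})"
proof -
  have 1: "openin (top_of_set D) {z \<in> D. \<phi> z \<in> S \<inter> T}"
    if "openin (top_of_set D) {z \<in> D. \<phi> z \<in> S}" "openin (top_of_set D) {z \<in> D. \<phi> z \<in> T}"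
    for D :: "'a set" and \<phi> :: "'a \<Rightarrow> 'b" and S T
  proof -
    have "{z \<in> D. \<phi> z \<in> S \<inter> T} = {z \<in> D. \<phi> z \<in> S} \<inter> {z \<in> D. \<phi> z \<in> T}" by auto
    then show ?thesis using openin_Int[OF that] by simp
  qed
  have 2: "openin (top_of_set D) {z \<in> D. \<phi> z \<in> \<Union>K}"
    if "\<And>S. S \<in> K \<Longrightarrow> openin (top_of_set D) {z \<in> D. \<phi> z \<in> S}"
    for D :: "'a set" and \<phi> :: "'a \<Rightarrow> 'b" and K
  proof -
    have "{z \<in> D. \<phi> z \<in> \<Union>K} = (\<Union>S\<in>K. {z \<in> D. \<phi> z \<in> S})" by auto
    moreover have "openin (top_of_set D) (\<Union>S\<in>K. {z \<in> D. \<phi> z \<in> S})"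
      by (rule openin_Union) (use that in auto)
    ultimately show ?thesis by metis
  qed
  have "istopology (\<lambda>U. U \<subseteq> mpts X \<and>
     (\<forall>(D, \<phi>)\<in>X. openin (top_of_set D) {z \<in> D. \<phi> z \<in> U}))"
    unfolding istopology_def
  proof (intro conjI allI impI, goal_cases)
    case (1 S T) then show ?case by blast
  next
    case (2 S T) then show ?case using 1 by fast
  next
    case (3 K) then show ?case by blast
  next
    case (4 K) then show ?case using 2[of K] by fast
  qed
  then show ?thesis unfolding mtop_def by (simp add: topology_inverse')
qed

definition smooth_map ::
    "('e::euclidean_space, 'p) mfd \<Rightarrow> ('f::euclidean_space, 'q) mfd \<Rightarrow> ('p \<Rightarrow> 'q) \<Rightarrow> bool" where
  "smooth_map X Y f \<longleftrightarrow> continuous_map (mtop X) (mtop Y) f \<and>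
     (\<forall>(D, \<phi>)\<in>X. \<forall>(D', \<psi>)\<in>Y.
        smooth_on_set {z \<in> D. f (\<phi> z) \<in> \<psi> ` D'} (\<lambda>z. inv_into D' \<psi> (f (\<phi> z))))"

definition diffeomorphism ::
    "('e::euclidean_space, 'p) mfd \<Rightarrow> ('f::euclidean_space, 'q) mfd \<Rightarrow> ('p \<Rightarrow> 'q) \<Rightarrow> bool" where
  "diffeomorphism X Y f \<longleftrightarrow> bij_betw f (mpts X) (mpts Y) \<and> smooth_map X Y f \<and>
     smooth_map Y X (inv_into (mpts X) f)"

definition mprod :: "('e, 'p) mfd \<Rightarrow> ('f, 'q) mfd \<Rightarrow> ('e \<times> 'f, 'p \<times> 'q) mfd" where
  "mprod X Y = (\<lambda>((D, \<phi>), (D', \<psi>)). (D \<times> D', map_prod \<phi> \<psi>)) ` (X \<times> Y)"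

definition mopen :: "('e, 'p) mfd \<Rightarrow> 'p set \<Rightarrow> ('e, 'p) mfd" where
  "mopen X W = (\<lambda>(D, \<phi>). ({z \<in> D. \<phi> z \<in> W}, \<phi>)) ` X"

definition msub :: "'e set \<Rightarrow> ('e, 'e) mfd" where
  "msub S = {(S, id)}"

definition trivial_fibre_bundle ::
    "('e::euclidean_space, 'p) mfd \<Rightarrow> ('f::euclidean_space, 'b) mfd \<Rightarrow>
     ('g::euclidean_space, 'q) mfd \<Rightarrow> ('p \<Rightarrow> 'b) \<Rightarrow> bool" where
  "trivial_fibre_bundle X B Fib pr \<longleftrightarrow>
     (\<exists>\<tau>. diffeomorphism X (mprod B Fib) \<tau> \<and> (\<forall>\<xi>\<in>mpts X. fst (\<tau> \<xi>) = pr \<xi>))"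


section \<open>The torus and the coamoeba\<close>

text \<open>Coordinates \<open>1, \<dots>, n + 1\<close> are the elements of the finite type \<open>'n\<close>, with
  \<open>n + 1 = CARD('n)\<close>. The indices \<open>0, 1, \<dots>, n + 1\<close> of the vertices are the elements of
  \<open>'n option\<close>, \<open>None\<close> being the index \<open>0\<close>. A point of the torus is a coset of the lattice
  \<open>\<pi> \<int>\<^sup>n\<^sup>+\<^sup>1\<close>.\<close>

definition tor :: "real^'n \<Rightarrow> (real^'n) set" where
  "tor y = {y'. \<exists>z. (\<forall>i. z $ i \<in> \<int>) \<and> y' = y + pi *\<^sub>R z}"

definition tneg :: "(real^'n) set \<Rightarrow> (real^'n) set" where
  "tneg q = uminus ` q"

definition Tmfd :: "(real^'n, (real^'n) set) mfd" where
  "Tmfd = {(U, tor) | U. open U \<and> inj_on tor U}"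

definition pvert :: "'n option \<Rightarrow> real^'n" where
  "pvert i = (case i of None \<Rightarrow> 0 | Some j \<Rightarrow> (pi / 2) *\<^sub>R axis j 1)"

definition face :: "'n option set \<Rightarrow> (real^'n) set" where
  "face J = convex hull (pvert ` (- J))"

definition IntE :: "'n option set \<Rightarrow> (real^'n) set set" where
  "IntE J = tor ` rel_interior (face J) \<union> tneg ` tor ` rel_interior (face J)"

definition Eplus :: "'n option set \<Rightarrow> (real^'n) set set" where
  "Eplus J = tor ` (pvert ` (- J) \<union> rel_interior (face J))"

definition EJ :: "'n option set \<Rightarrow> (real^'n) set set" where
  "EJ J = Eplus J \<union> tneg ` Eplus J"

text \<open>The coamoeba is the case \<open>J = {}\<close>.\<close>

abbreviation IntC :: "(real^'n) set set" where
  "IntC \<equiv> IntE {}"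

text \<open>The representative in one of the two closed simplices. It is unique, except that a vertex
  has the two representatives \<open>\<plusminus> pvert i\<close>.\<close>

definition lift :: "(real^'n) set \<Rightarrow> real^'n" where
  "lift q = (SOME y. (y \<in> face {} \<or> - y \<in> face {}) \<and> tor y = q)"

text \<open>Barycentric coordinates with respect to all the \<open>pvert i\<close>.\<close>

definition bary :: "real^'n \<Rightarrow> 'n option \<Rightarrow> real" where
  "bary y i = (case i of None \<Rightarrow> 1 - (\<Sum>j\<in>UNIV. 2 * y $ j / pi) | Some j \<Rightarrow> 2 * y $ j / pi)"

lemma sum_UNIV_option:
  "(\<Sum>i\<in>UNIV. f i) = f None + (\<Sum>j\<in>UNIV. f (Some j))"
  for f :: "'n::finite option \<Rightarrow> 'a::comm_monoid_add"
  by (simp add: UNIV_option_conv sum.reindex)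

lemma bary:
  fixes y :: "real^'n"
  shows "(\<Sum>i\<in>UNIV. bary y i) = 1" "(\<Sum>i\<in>UNIV. bary y i *\<^sub>R pvert i) = y"
proof -
  show "(\<Sum>i\<in>UNIV. bary y i) = 1" by (simp add: sum_UNIV_option bary_def)
  have "(\<Sum>i\<in>UNIV. bary y i *\<^sub>R pvert i) = (\<Sum>j\<in>UNIV. (y $ j) *\<^sub>R axis j 1)"
    by (simp add: sum_UNIV_option bary_def pvert_def)
  also have "\<dots> = y" by (metis basis_expansion scalar_mult_eq_scaleR)
  finally show "(\<Sum>i\<in>UNIV. bary y i *\<^sub>R pvert i) = y" .
qed


section \<open>The blow up\<close>

datatype ('n::finite) bpoint = Pt "(real^'n) set" | Exc "'n option" "(real^'n) set"

text \<open>The dimension of \<open>EJ J\<close> is \<open>card (- J) - 1\<close>; a circle is not blown up.\<close>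

definition Etil :: "'n::finite option set \<Rightarrow> 'n bpoint set" where
  "Etil J = (if 2 < card (- J)
     then Pt ` IntE J \<union>
       {Exc i (span {v}) | i v. i \<notin> J \<and> pvert i + v \<in> rel_interior (face J)}
     else Pt ` EJ J)"

abbreviation Ctil :: "'n::finite bpoint set" where
  "Ctil \<equiv> Etil {}"

text \<open>Blow up coordinates at the vertex \<open>i\<close>: the point with coordinates \<open>(t, a)\<close> is
  \<open>pvert i + t a\<close> together with the line spanned by \<open>a\<close>. The direction \<open>a\<close> is normalized by
  requiring that \<open>pvert i + a\<close> lies in the facet opposite to \<open>i\<close>; other affine normalizations,
  such as last coordinate equal to 1 when \<open>i = 0\<close>, give the same smooth structure. Points
  with \<open>t > 0\<close> are in the interior of the simplex, those with \<open>t < 0\<close> are in the interior of the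
  opposite one, since \<open>2 pvert i\<close> is in the lattice. The charts at all vertices together cover
  everything, and away from \<open>t = 0\<close> they are compatible with the coordinates of the torus. If
  \<open>EJ J\<close> is a circle, \<open>a\<close> takes only one value and \<open>t\<close> is an affine coordinate on the circle.\<close>

definition blow_dom :: "'n::finite option set \<Rightarrow> 'n option \<Rightarrow> (real \<times> (real^'n)) set" where
  "blow_dom J i = {-1<..<1} \<times> {a. pvert i + a \<in> rel_interior (face (insert i J))}"

definition blow_par :: "'n::finite option set \<Rightarrow> 'n option \<Rightarrow> real \<times> (real^'n) \<Rightarrow> 'n bpoint" where
  "blow_par J i = (\<lambda>(t, a). if t = 0 \<and> 2 < card (- J) then Exc i (span {a})
     else Pt (tor (pvert i + t *\<^sub>R a)))"

definition Emfd :: "'n::finite option set \<Rightarrow> (real \<times> (real^'n), 'n bpoint) mfd" where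
  "Emfd J = (\<lambda>i. (blow_dom J i, blow_par J i)) ` (- J)"

abbreviation Cmfd :: "(real \<times> (real^'n), 'n::finite bpoint) mfd" where
  "Cmfd \<equiv> Emfd {}"

fun proj :: "'n::finite bpoint \<Rightarrow> (real^'n) set" where
  "proj (Pt q) = q"
| "proj (Exc i l) = tor (pvert i)"


section \<open>The function and its gradient\<close>

definition Fplus :: "real^'n \<Rightarrow> real" where
  "Fplus y = root CARD('n) (cos (\<Sum>i\<in>UNIV. y $ i) * (\<Prod>i\<in>UNIV. sin (y $ i)))"

text \<open>\<open>F\<close> on representatives in the two simplices. Both formulas give \<open>0\<close> at the vertices.\<close>

definition Flift :: "real^'n \<Rightarrow> real" where
  "Flift y = (if y \<in> face {} then Fplus y else - Fplus (- y))"

definition F :: "(real^'n) set \<Rightarrow> real" where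
  "F q = Flift (lift q)"

definition gradF :: "(real^'n) set \<Rightarrow> real^'n" where
  "gradF q = (\<chi> i. deriv (\<lambda>s. Flift (lift q + s *\<^sub>R axis i 1)) 0)"

text \<open>The smooth extension to the blow up, unique since the regular points are dense.\<close>

definition hmap :: "'n::finite bpoint \<Rightarrow> real^'n" where
  "hmap = (SOME g. smooth_map Cmfd (msub UNIV) g \<and> (\<forall>q\<in>IntC. g (Pt q) = gradF q))"

definition \<Phi> :: "'n::finite bpoint \<Rightarrow> (real^'n) \<times> (real^'n) set" where
  "\<Phi> \<xi> = (hmap \<xi>, proj \<xi>)"


section \<open>Cones, neighborhoods and projections\<close>

definition uvec :: "'n option \<Rightarrow> real^'n" where
  "uvec i = (case i of None \<Rightarrow> - (\<Sum>j\<in>UNIV. axis j 1) | Some j \<Rightarrow> axis j 1)"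

definition Gam :: "'n::finite option set \<Rightarrow> (real^'n) set" where
  "Gam J = {\<Sum>j\<in>J. t j *\<^sub>R uvec j | t. \<forall>j\<in>J. 0 \<le> t j}"

abbreviation VJ :: "'n::finite option set \<Rightarrow> (real^'n) set" where
  "VJ J \<equiv> span (Gam J)"

abbreviation IntGam :: "'n::finite option set \<Rightarrow> (real^'n) set" where
  "IntGam J \<equiv> rel_interior (Gam J)"

definition Delta :: "'n option \<Rightarrow> 'n option \<Rightarrow> (real^'n) set set" where
  "Delta j k = tor ` {y \<in> pvert ` UNIV \<union> rel_interior (face {}). bary y j \<le> bary y k}"

definition Wplus :: "'n option set \<Rightarrow> 'n option \<Rightarrow> (real^'n) set set" where
  "Wplus J k = (\<Inter>j\<in>J. Delta j k)"

definition Wtil :: "'n::finite option set \<Rightarrow> 'n option \<Rightarrow> 'n bpoint set" where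
  "Wtil J k = {\<xi> \<in> Ctil. proj \<xi> \<in> Wplus J k \<union> tneg ` Wplus J k}"

definition IntWtil :: "'n::finite option set \<Rightarrow> 'n option \<Rightarrow> 'n bpoint set" where
  "IntWtil J k = mtop Cmfd interior_of Wtil J k"

definition LJ :: "'n option set \<Rightarrow> 'n option \<Rightarrow> (real^'n) set" where
  "LJ J k = span {pvert j - pvert k | j. j \<in> J}"

definition Lperp :: "'n option set \<Rightarrow> 'n option \<Rightarrow> (real^'n) set" where
  "Lperp J k = {x. \<forall>y\<in>LJ J k. x \<bullet> y = 0}"

definition yproj :: "'n option set \<Rightarrow> 'n option \<Rightarrow> (real^'n) set \<Rightarrow> (real^'n) set" where
  "yproj J k q = tor (THE y'. lift q - y' \<in> LJ J k \<and>
     (lift q \<in> rel_interior (face {}) \<and> y' \<in> rel_interior (face J) \<or>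
      - lift q \<in> rel_interior (face {}) \<and> - y' \<in> rel_interior (face J)))"

text \<open>The continuous extension over the exceptional points above the vertices of \<open>EJ J\<close>.\<close>

definition ymap :: "'n::finite option set \<Rightarrow> 'n option \<Rightarrow> 'n bpoint \<Rightarrow> 'n bpoint" where
  "ymap J k = (SOME g.
     continuous_map
       (subtopology (mtop Cmfd) {\<xi> \<in> Ctil. proj \<xi> \<in> IntC \<union> tor ` pvert ` (- J)})
       (mtop (Emfd J)) g \<and>
     (\<forall>q\<in>IntC. g (Pt q) = Pt (yproj J k q)))"

definition xproj :: "'n::finite option set \<Rightarrow> 'n option \<Rightarrow> real^'n \<Rightarrow> real^'n" where
  "xproj J k x = (THE v. v \<in> VJ J \<and> x - v \<in> Lperp J k)"

definition hJ :: "'n::finite option set \<Rightarrow> 'n option \<Rightarrow> 'n bpoint \<Rightarrow> real^'n" where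
  "hJ J k \<xi> = xproj J k (hmap \<xi>)"

definition gmap :: "'n::finite option set \<Rightarrow> 'n option \<Rightarrow> 'n bpoint \<Rightarrow> 'n bpoint \<times> (real^'n)" where
  "gmap J k \<xi> = (ymap J k \<xi>, hJ J k \<xi>)"


section \<open>Legendre transform and graph of its differential\<close>

text \<open>At exceptional points both lifts are the lift of the same vertex, so their difference is \<open>0\<close>.\<close>

definition is_legendre_transform ::
    "'n::finite option set \<Rightarrow> 'n option \<Rightarrow> ('n bpoint \<times> (real^'n) \<Rightarrow> real) \<Rightarrow> bool" where
  "is_legendre_transform J k G \<longleftrightarrow> (\<forall>\<xi>\<in>IntWtil J k.
     G (gmap J k \<xi>) = - F (proj \<xi>) + hJ J k \<xi> \<bullet> (lift (proj \<xi>) - lift (proj (ymap J k \<xi>))))"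

definition subtorus_translate :: "(real^'n) set set \<Rightarrow> bool" where
  "subtorus_translate A \<longleftrightarrow>
     (\<exists>a S. subspace S \<and> closed {y. tor y \<in> tor ` S} \<and> A = tor ` (\<lambda>v. a + v) ` S)"

definition TJ :: "'n option set \<Rightarrow> (real^'n) set set" where
  "TJ J = \<Inter>{A. subtorus_translate A \<and> EJ J \<subseteq> A}"

text \<open>\<open>A\<close> is the graph of \<open>dG\<close>, for \<open>G\<close> defined on \<open>Etil J \<times> IntGam J\<close>. The set of pairs \<open>(x, y)\<close>
  with \<open>x \<in> VJ J\<close> and \<open>tor y \<in> TJ J\<close> is a covering of \<open>VJ J \<times> TJ J\<close>, and a derivative within
  it is the differential on \<open>VJ J \<times> TJ J\<close>. The map \<open>\<sigma>\<close> sends a point of the base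
  to the point of the graph above it: this is the covector \<open>dG\<close> at the non exceptional points,
  and the continuous extension at the exceptional ones.\<close>

definition is_graph_of_differential ::
    "'n::finite option set \<Rightarrow> 'n option \<Rightarrow> ('n bpoint \<times> (real^'n) \<Rightarrow> real) \<Rightarrow>
     ((real^'n) \<times> (real^'n) set) set \<Rightarrow> bool" where
  "is_graph_of_differential J k G A \<longleftrightarrow> (\<exists>\<sigma>.
     continuous_map (mtop (mprod (Emfd J) (msub (IntGam J)))) (mtop (mprod (msub UNIV) Tmfd)) \<sigma> \<and>
     (\<forall>q x. Pt q \<in> Etil J \<and> x \<in> IntGam J \<longrightarrow>
       (\<exists>y. \<exists>l'\<in>Lperp J k. \<exists>l\<in>LJ J k. tor y = q \<and>
         ((\<lambda>(x, y). G (Pt (tor y), x)) has_derivative (\<lambda>(v, w). l \<bullet> v - l' \<bullet> w))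
           (at (x, y) within (VJ J \<times> {y. tor y \<in> TJ J})) \<and>
         \<sigma> (Pt q, x) = (x + l', tor (y + l)))) \<and>
     A = \<sigma> ` (Etil J \<times> IntGam J))"


section \<open>Consistency of the atlas with the set of points of the blow up\<close>

lemma tor_uminus: fixes y :: "real^'n" shows "tor (- y) = tneg (tor y)"
proof -
  have "x \<in> tneg (tor y)" if x: "x \<in> tor (- y)" for x :: "real^'n"
  proof -
    obtain z where z: "\<forall>i. z $ i \<in> \<int>" "x = - y + pi *\<^sub>R z" using x unfolding tor_def by blast
    have "x = - (y + pi *\<^sub>R (- z))" "\<forall>i. (- z) $ i \<in> \<int>" using z by auto
    then show ?thesis unfolding tor_def tneg_def by blast
  qed
  moreover have "x \<in> tor (- y)" if x: "x \<in> tneg (tor y)" for x :: "real^'n"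
  proof -
    obtain z where z: "\<forall>i. z $ i \<in> \<int>" "x = - (y + pi *\<^sub>R z)" using x unfolding tor_def tneg_def by blast
    have "x = - y + pi *\<^sub>R (- z)" "\<forall>i. (- z) $ i \<in> \<int>" using z by auto
    then show ?thesis unfolding tor_def by blast
  qed
  ultimately show ?thesis by blast
qed

lemma tor_shift: fixes y z :: "real^'n" assumes "\<forall>i. z $ i \<in> \<int>" shows "tor (y + pi *\<^sub>R z) = tor y"
proof -
  have "x \<in> tor y" if x: "x \<in> tor (y + pi *\<^sub>R z)" and zz: "\<forall>i. z $ i \<in> \<int>" for x y z :: "real^'n"
  proof -
    obtain w where w: "\<forall>i. w $ i \<in> \<int>" "x = y + pi *\<^sub>R z + pi *\<^sub>R w" using x unfolding tor_def by blast
    have "x = y + pi *\<^sub>R (z + w)" "\<forall>i. (z + w) $ i \<in> \<int>" using w zz by (auto simp: algebra_simps)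
    then show ?thesis unfolding tor_def by blast
  qed
  from this[of _ y z] this[of _ "y + pi *\<^sub>R z" "- z"] assms show ?thesis by auto
qed

lemma tor_pvert_minus: fixes v :: "real^'n" shows "tor (pvert i - v) = tneg (tor (pvert i + v))"
proof -
  have "pvert i - v = - (pvert i + v) + pi *\<^sub>R (case i of None \<Rightarrow> 0 | Some j \<Rightarrow> axis j 1)"
    by (auto simp: pvert_def vec_eq_iff axis_def algebra_simps split: option.split)
  moreover have "\<forall>l. (case i of None \<Rightarrow> 0 :: real^'n | Some j \<Rightarrow> axis j 1) $ l \<in> \<int>"
    by (auto simp: axis_def split: option.split)
  ultimately show ?thesis using tor_shift tor_uminus by metis
qed

lemma inj_pvert: "inj (pvert :: 'n::finite option \<Rightarrow> real^'n)"
  by (auto simp: inj_def pvert_def axis_eq_axis split: option.splits)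

lemma sum_pvert: fixes c :: "'n::finite option \<Rightarrow> real"
  shows "(\<Sum>i\<in>UNIV. c i *\<^sub>R pvert i) $ l = pi / 2 * c (Some l)"
proof -
  have "(\<Sum>i\<in>UNIV. c i *\<^sub>R pvert i) $ l = (\<Sum>j\<in>UNIV. c (Some j) * (pi/2 * (if j = l then 1 else 0)))"
    by (simp add: sum_UNIV_option pvert_def axis_def eq_commute[of l] algebra_simps)
  also have "\<dots> = (\<Sum>j\<in>UNIV. if j = l then c (Some j) * (pi/2) else 0)" by (intro sum.cong) auto
  finally show ?thesis by simp
qed

lemma indep_pvert: "\<not> affine_dependent (pvert ` I :: (real^'n) set)"
proof
  assume "affine_dependent (pvert ` I :: (real^'n) set)"
  then obtain U where U: "sum U (pvert ` I) = 0" "\<exists>v\<in>pvert ` I. U v \<noteq> 0" "(\<Sum>v\<in>pvert ` I. U v *\<^sub>R v) = (0::real^'n)"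
    by (auto simp: affine_dependent_explicit_finite)
  define c where "c i = (if i \<in> I then U (pvert i) else 0)" for i :: "'n option"
  have inj: "inj_on (pvert :: 'n option \<Rightarrow> _) I" using inj_pvert inj_on_subset by blast
  have 1: "sum c UNIV = 0" using U(1) inj by (simp add: c_def sum.reindex sum.If_cases)
  have "(\<Sum>i\<in>UNIV. c i *\<^sub>R pvert i) = (\<Sum>i\<in>UNIV. if i \<in> I then U (pvert i) *\<^sub>R pvert i else 0)"
    by (intro sum.cong) (auto simp: c_def)
  also have "\<dots> = 0" using U(3) inj by (simp add: sum.reindex sum.If_cases)
  finally have "c (Some l) = 0" for l using sum_pvert[of c l] by simp
  moreover from this have "c None = 0" using 1 by (simp add: sum_UNIV_option)
  ultimately have "c i = 0" for i by (cases i) auto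
  then have "U (pvert i) = 0" if "i \<in> I" for i using c_def[of i] that by simp
  then show False using U(2) by blast
qed

lemma rel_interior_face:
  fixes J :: "'n::finite option set"
  shows "rel_interior (face J) = {\<Sum>i\<in>- J. c i *\<^sub>R pvert i | c. (\<forall>i\<in>- J. 0 < c i) \<and> sum c (- J) = 1}"
    (is "?A = ?B")
proof -
  have inj: "inj_on (pvert :: 'n option \<Rightarrow> _) (- J)" using inj_pvert inj_on_subset by blast
  have A: "?A = {y. \<exists>u. (\<forall>x\<in>pvert ` (- J). 0 < u x) \<and> sum u (pvert ` (- J)) = 1 \<and>
    (\<Sum>x\<in>pvert ` (- J). u x *\<^sub>R x) = y}"
    unfolding face_def by (rule rel_interior_convex_hull_explicit[OF indep_pvert])
  have "\<exists>c. (\<forall>i\<in>- J. 0 < c i) \<and> sum c (- J) = 1 \<and> y = (\<Sum>i\<in>- J. c i *\<^sub>R pvert i)" if "y \<in> ?A" for y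
  proof -
    from that obtain u where "(\<forall>x\<in>pvert ` (- J). 0 < u x) \<and> sum u (pvert ` (- J)) = 1 \<and>
    (\<Sum>x\<in>pvert ` (- J). u x *\<^sub>R x) = y" unfolding A by blast
    then show ?thesis using inj by (intro exI[of _ "\<lambda>i. u (pvert i)"]) (auto simp: sum.reindex)
  qed
  moreover have "(\<Sum>i\<in>- J. c i *\<^sub>R pvert i) \<in> ?A" if "\<forall>i\<in>- J. 0 < c i" "sum c (- J) = 1" for c
    unfolding A using that inj inj_pvert
    by (auto intro!: exI[of _ "\<lambda>v. c (inv pvert v)"] simp: sum.reindex inv_f_f[OF inj_pvert])
  ultimately show ?thesis by blast
qed

lemma face_cone:
  fixes J :: "'n::finite option set"
  assumes "i \<notin> J" "0 < t" "t < 1" "pvert i + a \<in> rel_interior (face (insert i J))"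
  shows "pvert i + t *\<^sub>R a \<in> rel_interior (face J)"
proof -
  obtain c where c: "pvert i + a = (\<Sum>m\<in>- insert i J. c m *\<^sub>R pvert m)" "\<forall>m\<in>- insert i J. 0 < c m"
    "sum c (- insert i J) = 1" using assms(4) unfolding rel_interior_face by blast
  have e: "- J = insert i (- insert i J)" using assms(1) by auto
  define d where "d m = (if m = i then 1 - t else t * c m)" for m
  have s: "sum f (- J) = f i + sum f (- insert i J)" for f :: "_ \<Rightarrow> 'x::comm_monoid_add"
    by (subst e, subst sum.insert) auto
  have "(\<Sum>m\<in>- insert i J. d m *\<^sub>R pvert m) = (\<Sum>m\<in>- insert i J. t *\<^sub>R (c m *\<^sub>R pvert m))"
    by (intro sum.cong) (auto simp: d_def)
  then have "(\<Sum>m\<in>- J. d m *\<^sub>R pvert m) = (1 - t) *\<^sub>R pvert i + t *\<^sub>R (pvert i + a)"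
    by (simp add: s d_def c(1) scaleR_sum_right)
  then have 1: "(\<Sum>m\<in>- J. d m *\<^sub>R pvert m) = pvert i + t *\<^sub>R a" by (simp add: algebra_simps)
  have "(\<Sum>m\<in>- insert i J. d m) = (\<Sum>m\<in>- insert i J. t * c m)"
    by (intro sum.cong) (auto simp: d_def)
  then have 2: "sum d (- J) = 1" using c(3) by (simp add: s d_def sum_distrib_left[symmetric])
  have 3: "\<forall>m\<in>- J. 0 < d m" using assms c(2) by (auto simp: d_def)
  show ?thesis unfolding rel_interior_face using 1[symmetric] 2 3 by blast
qed

lemma face_cone_conv:
  fixes J :: "'n::finite option set"
  assumes "i \<notin> J" "2 \<le> card (- J)" "y \<in> rel_interior (face J)"
  obtains t a where "0 < t" "t < 1" "pvert i + a \<in> rel_interior (face (insert i J))"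
    "y = pvert i + t *\<^sub>R a"
proof -
  obtain d where d: "y = (\<Sum>m\<in>- J. d m *\<^sub>R pvert m)" "\<forall>m\<in>- J. 0 < d m"
    "sum d (- J) = 1" using assms(3) unfolding rel_interior_face by blast
  have e: "- J = insert i (- insert i J)" using assms(1) by auto
  have s: "sum f (- J) = f i + sum f (- insert i J)" for f :: "_ \<Rightarrow> 'x::comm_monoid_add"
    by (subst e, subst sum.insert) auto
  have "- insert i J \<noteq> {}"
  proof
    assume "- insert i J = {}" then have "- J = {i}" using e by simp
    then show False using assms(2) by simp
  qed
  then have pos: "0 < sum d (- insert i J)" using d(2) by (intro sum_pos) auto
  define t where "t = sum d (- insert i J)"
  have t: "d i = 1 - t" using d(3) s[of d] t_def by simp
  have "0 < d i" using d(2) assms(1) by auto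
  then have t1: "0 < t" "t < 1" using pos t t_def by auto
  define a where "a = (\<Sum>m\<in>- insert i J. (d m / t) *\<^sub>R pvert m) - pvert i"
  have "t *\<^sub>R (\<Sum>m\<in>- insert i J. (d m / t) *\<^sub>R pvert m) = (\<Sum>m\<in>- insert i J. d m *\<^sub>R pvert m)"
    using t1 by (simp add: scaleR_sum_right)
  then have "y = pvert i + t *\<^sub>R a" unfolding d(1) a_def s t by (simp add: algebra_simps)
  moreover have "pvert i + a \<in> rel_interior (face (insert i J))"
  proof -
    have "(\<Sum>m\<in>- insert i J. d m / t) = 1" using t1 t_def by (simp add: sum_divide_distrib[symmetric])
    then show ?thesis unfolding rel_interior_face a_def using d(2) t1
      by (auto intro!: exI[of _ "\<lambda>m. d m / t"])
  qed
  ultimately show ?thesis using that t1 by blast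
qed

lemma blow_Pt: fixes J :: "'n::finite option set"
  assumes "2 \<le> card (- J)" "i \<notin> J"
  shows "(\<lambda>(t, a). Pt (tor (pvert i + t *\<^sub>R a))) ` {(t, a)\<in>blow_dom J i. t \<noteq> 0} = Pt ` IntE J"
proof -
  have "tor (pvert i + t *\<^sub>R a) \<in> IntE J" if "(t, a) \<in> blow_dom J i" "t \<noteq> 0" for t a
  proof (cases "t > 0")
    case True
    then show ?thesis using face_cone[OF assms(2), of t a] that by (auto simp: IntE_def blow_dom_def)
  next
    case False
    then have "pvert i + (- t) *\<^sub>R a \<in> rel_interior (face J)"
      using face_cone[OF assms(2), of "- t" a] that by (auto simp: blow_dom_def)
    then show ?thesis using tor_pvert_minus[of i "(- t) *\<^sub>R a"] by (auto simp: IntE_def)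
  qed
  moreover have "Pt q \<in> (\<lambda>(t, a). Pt (tor (pvert i + t *\<^sub>R a))) ` {(t, a)\<in>blow_dom J i. t \<noteq> 0}"
    if q: "q \<in> IntE J" for q
  proof -
    from q obtain y where y: "y \<in> rel_interior (face J)" "q = tor y \<or> q = tneg (tor y)"
      by (auto simp: IntE_def)
    obtain t a where ta: "0 < t" "t < 1" "pvert i + a \<in> rel_interior (face (insert i J))"
      "y = pvert i + t *\<^sub>R a" using face_cone_conv[OF assms(2,1) y(1)] .
    from y(2) show ?thesis
    proof
      assume "q = tor y" then show ?thesis using ta
        by (intro image_eqI[of _ _ "(t, a)"]) (auto simp: blow_dom_def)
    next
      assume "q = tneg (tor y)" then show ?thesis using ta tor_pvert_minus[of i "t *\<^sub>R a"]
        by (intro image_eqI[of _ _ "(- t, a)"]) (auto simp: blow_dom_def)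
    qed
  qed
  ultimately show ?thesis by fastforce
qed

lemma blow_dom_ne: fixes J :: "'n::finite option set"
  assumes "2 \<le> card (- J)" "i \<notin> J"
  obtains a where "pvert i + a \<in> rel_interior (face (insert i J))"
proof -
  have "- insert i J \<noteq> {}"
  proof
    assume "- insert i J = {}" then have "- J = {i}" using assms by auto
    then show False using assms by simp
  qed
  then have "rel_interior (face (insert i J)) \<noteq> {}"
    by (simp add: face_def rel_interior_eq_empty del: Compl_insert)
  then obtain b where b: "b \<in> rel_interior (face (insert i J))" by blast
  show ?thesis by (rule that[of "b - pvert i"]) (use b in simp)
qed

lemma mpts_Emfd:
  fixes J :: "'n::finite option set"
  assumes "2 \<le> card (- J)"
  shows "mpts (Emfd J) = Etil J"
proof -
  define P where "P i = (\<lambda>(t, a). Pt (tor (pvert i + t *\<^sub>R a)) :: 'n bpoint)" for i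
  have split: "blow_dom J i = {(t, a)\<in>blow_dom J i. t \<noteq> 0} \<union> {(t, a)\<in>blow_dom J i. t = 0}" for i by auto
  have ne: "- J \<noteq> {}" using assms by (metis card.empty not_numeral_le_zero)
  have reg: "blow_par J i ` {(t, a)\<in>blow_dom J i. t \<noteq> 0} = Pt ` IntE J" if "i \<in> - J" for i
  proof -
    have "blow_par J i ` {(t, a)\<in>blow_dom J i. t \<noteq> 0} = P i ` {(t, a)\<in>blow_dom J i. t \<noteq> 0}"
      by (intro image_cong) (auto simp: blow_par_def P_def)
    then show ?thesis using blow_Pt[OF assms, of i] that by (simp add: P_def)
  qed
  have "mpts (Emfd J) = (\<Union>i\<in>- J. blow_par J i ` blow_dom J i)" by (simp add: mpts_def Emfd_def)
  also have "\<dots> = (\<Union>i\<in>- J. Pt ` IntE J \<union> blow_par J i ` {(t, a)\<in>blow_dom J i. t = 0})"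
    by (intro SUP_cong refl, subst split, subst image_Un) (use reg in blast)
  also have "\<dots> = Pt ` IntE J \<union> (\<Union>i\<in>- J. blow_par J i ` {(t, a)\<in>blow_dom J i. t = 0})"
    using ne by blast
  also have "\<dots> = Etil J"
  proof (cases "2 < card (- J)")
    case True
    have "(\<Union>i\<in>- J. blow_par J i ` {(t, a)\<in>blow_dom J i. t = 0}) =
      {Exc i (span {a}) | i a. i \<notin> J \<and> pvert i + a \<in> rel_interior (face (insert i J))}"
      using True by (auto simp: blow_par_def blow_dom_def image_iff) blast
    also have "\<dots> = {Exc i (span {v}) | i v. i \<notin> J \<and> pvert i + v \<in> rel_interior (face J)}"
      (is "?A = ?B")
    proof (intro equalityI subsetI)
      have sp: "span {t *\<^sub>R a} = span {a}" if "t \<noteq> 0" for t and a :: "real^'n"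
        using span_image_scale[of "{a}" "\<lambda>_. t"] that by simp
      fix \<xi> :: "'n bpoint"
      show "\<xi> \<in> ?B" if "\<xi> \<in> ?A"
      proof -
        from that obtain i a where ia: "\<xi> = Exc i (span {a})" "i \<notin> J"
          "pvert i + a \<in> rel_interior (face (insert i J))" by blast
        have "pvert i + (1/2) *\<^sub>R a \<in> rel_interior (face J)"
          by (rule face_cone[OF ia(2) _ _ ia(3)]) auto
        moreover have "\<xi> = Exc i (span {(1/2) *\<^sub>R a})" using ia(1) sp[of "1/2" a] by simp
        ultimately show ?thesis using ia(2) by blast
      qed
      show "\<xi> \<in> ?A" if "\<xi> \<in> ?B"
      proof -
        from that obtain i v where iv: "\<xi> = Exc i (span {v})" "i \<notin> J"
          "pvert i + v \<in> rel_interior (face J)" by blast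
        obtain t a where ta: "0 < t" "t < 1" "pvert i + a \<in> rel_interior (face (insert i J))"
          "pvert i + v = pvert i + t *\<^sub>R a" using face_cone_conv[OF iv(2) assms iv(3)] .
        have "\<xi> = Exc i (span {a})" using iv(1) ta(1,4) sp[of t a] by simp
        then show ?thesis using iv(2) ta(3) by blast
      qed
    qed
    finally show ?thesis using True by (simp add: Etil_def)
  next
    case False
    have "(\<Union>i\<in>- J. blow_par J i ` {(t, a)\<in>blow_dom J i. t = 0}) = Pt ` tor ` pvert ` (- J)"
    proof -
      have "blow_par J i ` {(t, a)\<in>blow_dom J i. t = 0} = {Pt (tor (pvert i))}" if i: "i \<in> - J" for i
      proof -
        obtain a where "pvert i + a \<in> rel_interior (face (insert i J))"
          using blow_dom_ne[OF assms] i by blast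
        then have ne: "{(t, a)\<in>blow_dom J i. t = 0} \<noteq> {}" by (auto simp: blow_dom_def)
        have eq: "blow_par J i z = Pt (tor (pvert i))" if "z \<in> {(t, a)\<in>blow_dom J i. t = 0}" for z
          using that False by (auto simp: blow_par_def)
        have "blow_par J i ` {(t, a)\<in>blow_dom J i. t = 0} =
            (\<lambda>_. Pt (tor (pvert i))) ` {(t, a)\<in>blow_dom J i. t = 0}"
          by (rule image_cong[OF refl eq])
        with ne show ?thesis by (simp only: image_constant_conv if_False)
      qed
      then show ?thesis by auto
    qed
    moreover have "tneg (tor (pvert i)) = tor (pvert i)" for i :: "'n option"
      using tor_pvert_minus[of i 0] by simp
    then have "EJ J = IntE J \<union> tor ` pvert ` (- J)"
      by (auto simp: EJ_def Eplus_def IntE_def image_Un image_image)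
    ultimately show ?thesis using False by (simp add: Etil_def image_Un)
  qed
  finally show ?thesis .
qed

end

theory Submission
  imports Defs
begin

text \<open>
  Write \<open>\<theta>\<^sub>l = pi / 2 * bary y l\<close> for the \<open>n + 2\<close> vertices \<open>l\<close> of the simplex. Then \<open>F\<close> is the
  \<open>(n + 1)\<close>-st root of the product of all \<open>sin \<theta>\<^sub>l\<close>, and \<open>uvec l\<close> is the differential of \<open>\<theta>\<^sub>l\<close>, so no vertex is
  distinguished. The gradient of \<open>F\<close> is \<open>\<Sum>l. slope l *\<^sub>R uvec l\<close> with
  \<open>slope l = F / (n + 1) * cot \<theta>\<^sub>l\<close>. The space \<open>L\<close> has the basis \<open>wvec k j\<close>, \<open>j \<in> J\<close>, dual to the basis \<open>uvec j\<close>
  of \<open>V\<close>; pairing with it shows that the projected gradient is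
  \<open>L_gradient = \<Sum>j\<in>J. (slope j - slope k) *\<^sub>R uvec j\<close>. Since the cotangent decreases, its coefficients are
  positive exactly where \<open>\<theta>\<^sub>j < \<theta>\<^sub>k\<close> for all \<open>j \<in> J\<close>, which is the interior of the neighborhood (\<open>IntWtil_eq\<close>).

  The projection to the smaller coamoeba changes only the \<open>\<theta>\<^sub>j\<close> with \<open>j \<in> J\<close> and \<open>\<theta>\<^sub>k\<close>. On a fibre, the
  projected gradient is therefore the gradient of the restriction of \<open>F\<close>, and only \<open>card J + 1 \<le> n + 1\<close> of the
  factors of the product vary. An \<open>(n + 1)\<close>-st root of so few factors is strictly concave
  (\<open>hessian_negative\<close>), hence its gradient is injective (\<open>L_gradient_inj\<close>) and the inverse function theorem
  applies (\<open>fibre_solution_smooth\<close>). For \<open>x\<close> in the open cone, \<open>F\<close> minus the linear function given by \<open>x\<close> attains a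
  positive maximum on the closed fibre; on the boundary \<open>F\<close> vanishes, so the maximum is a critical point, that is,
  a point with gradient \<open>x\<close> (\<open>L_gradient_surj\<close>).

  The same argument covers the exceptional points. In the blow up coordinates \<open>(t, a)\<close> at a vertex, \<open>F / t\<close> and the
  slopes are smooth up to \<open>t = 0\<close>, because only \<open>sin (t * x) / t\<close> enters, and the formulas for their derivatives
  are uniform in \<open>t\<close>: the derivative of \<open>q = t * cot (t * x)\<close> with respect to \<open>x\<close> is \<open>- (q\<^sup>2 + t\<^sup>2)\<close>. Only over the
  exceptional points at \<open>k\<close> the fibre is not bounded; there the equations are solved explicitly.

  For the last part, \<open>G = - F + x \<bullet> (y - y')\<close> with \<open>dF = h \<bullet> dy\<close>, and the derivative of the fibre coordinate of
  \<open>y\<close> enters only through its pairing with \<open>h - x\<close>. The former lies in \<open>L\<close> and the latter in the orthogonal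
  complement of \<open>L\<close>, which leaves \<open>dG = (y - y') \<bullet> dx - (h - x) \<bullet> dy'\<close> (\<open>legendre_has_derivative\<close>).
\<close>

section \<open>Calculus of iterated directional derivatives\<close>

lemma Ck_on_cong:
  assumes "open U" "\<And>x. x \<in> U \<Longrightarrow> f x = g x"
  shows "Ck_on k U f \<longleftrightarrow> Ck_on k U g"
proof -
  have "Ck_on k U g" if "Ck_on k U f" "\<And>x. x \<in> U \<Longrightarrow> f x = g x" for f g
    using that
  proof (induction k arbitrary: f g)
    case 0
    then show ?case by (simp cong: continuous_on_cong)
  next
    case (Suc k)
    have der: "(g has_derivative frechet_derivative f (at x)) (at x)" if "x \<in> U" for x
      using Suc.prems that frechet_derivative_works[of f "at x"] assms(1)
      by (auto intro!: has_derivative_transform_within_open[of f _ x UNIV U g])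
    have eq: "frechet_derivative f (at x) = frechet_derivative g (at x)" if "x \<in> U" for x
      using frechet_derivative_at[OF der[OF that]] .
    have "Ck_on k U (\<lambda>x. frechet_derivative g (at x) v)" for v
      by (rule Suc.IH[of "\<lambda>x. frechet_derivative f (at x) v"]) (use Suc.prems eq in auto)
    then show ?case using der by (auto simp: differentiable_def)
  qed
  then show ?thesis using assms(2) by metis
qed

lemma Ck_on_SucI:
  assumes "open U" "\<And>x. x \<in> U \<Longrightarrow> (f has_derivative f' x) (at x)"
    and "\<And>v. Ck_on k U (\<lambda>x. f' x v)"
  shows "Ck_on (Suc k) U f"
proof -
  have "Ck_on k U (\<lambda>x. frechet_derivative f (at x) v)" for v
    using assms(3)[of v] Ck_on_cong[OF assms(1), of "\<lambda>x. f' x v" "\<lambda>x. frechet_derivative f (at x) v" k]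
      frechet_derivative_at[OF assms(2)] by simp
  then show ?thesis using assms(2) by (auto simp: differentiable_def)
qed

lemma Ck_on_SucD:
  assumes "Ck_on (Suc k) U f"
  shows "Ck_on k U f"
  using assms
proof (induction k arbitrary: f)
  case 0
  then show ?case
    by (auto intro!: continuous_at_imp_continuous_on differentiable_imp_continuous_within)
next
  case (Suc k)
  then show ?case by auto
qed

lemma Ck_on_subset:
  assumes "Ck_on k U f" "V \<subseteq> U"
  shows "Ck_on k V f"
  using assms(1)
  by (induction k arbitrary: f) (use assms(2) continuous_on_subset in auto)

lemma Ck_on_const: "Ck_on k U (\<lambda>x. c)"
  by (induction k arbitrary: c) (auto simp: frechet_derivative_const)

lemma Ck_on_bounded_linear_comp:
  assumes "open U" "bounded_linear h" "Ck_on k U f"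
  shows "Ck_on k U (\<lambda>x. h (f x))"
  using assms(3)
proof (induction k arbitrary: f)
  case 0
  then show ?case using assms(2) by (simp add: bounded_linear.continuous_on)
next
  case (Suc k)
  show ?case
  proof (rule Ck_on_SucI[OF assms(1)])
    show "((\<lambda>x. h (f x)) has_derivative (\<lambda>v. h (frechet_derivative f (at x) v))) (at x)"
      if "x \<in> U" for x
      using Suc.prems that frechet_derivative_works bounded_linear.has_derivative[OF assms(2)]
      by fastforce
    show "Ck_on k U (\<lambda>x. h (frechet_derivative f (at x) v))" for v
      using Suc by auto
  qed
qed

lemma Ck_on_id: assumes "open U" shows "Ck_on k U (\<lambda>x. x)"
proof (cases k)
  case (Suc m)
  show ?thesis unfolding Suc
    by (rule Ck_on_SucI[OF assms, of _ "\<lambda>x v. v"]) (auto intro: derivative_eq_intros Ck_on_const)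
qed simp

lemma Ck_on_add:
  assumes "open U" "Ck_on k U f" "Ck_on k U g"
  shows "Ck_on k U (\<lambda>x. f x + g x)"
  using assms(2,3)
proof (induction k arbitrary: f g)
  case 0
  then show ?case by (simp add: continuous_on_add)
next
  case (Suc k)
  show ?case
  proof (rule Ck_on_SucI[OF assms(1)])
    show "((\<lambda>x. f x + g x) has_derivative
        (\<lambda>v. frechet_derivative f (at x) v + frechet_derivative g (at x) v)) (at x)"
      if "x \<in> U" for x
      using Suc.prems that by (intro has_derivative_add) (auto simp: frechet_derivative_works[symmetric])
    show "Ck_on k U (\<lambda>x. frechet_derivative f (at x) v + frechet_derivative g (at x) v)" for v
      using Suc by auto
  qed
qed

lemma Ck_on_sum:
  assumes "open U" "\<And>i. i \<in> I \<Longrightarrow> Ck_on k U (f i)"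
  shows "Ck_on k U (\<lambda>x. \<Sum>i\<in>I. f i x)"
  using assms(2)
  by (induction I rule: infinite_finite_induct) (auto intro: Ck_on_const Ck_on_add[OF assms(1)])

lemma Ck_on_bilinear:
  assumes "open U" "bounded_bilinear h" "Ck_on k U f" "Ck_on k U g"
  shows "Ck_on k U (\<lambda>x. h (f x) (g x))"
  using assms(3,4)
proof (induction k arbitrary: f g)
  case 0
  then show ?case using assms(2) by (simp add: bounded_bilinear.continuous_on)
next
  case (Suc k)
  show ?case
  proof (rule Ck_on_SucI[OF assms(1)])
    show "((\<lambda>x. h (f x) (g x)) has_derivative
        (\<lambda>v. h (f x) (frechet_derivative g (at x) v) + h (frechet_derivative f (at x) v) (g x))) (at x)"
      if "x \<in> U" for x
      using Suc.prems that
      by (intro bounded_bilinear.FDERIV[OF assms(2)]) (auto simp: frechet_derivative_works[symmetric])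
    show "Ck_on k U (\<lambda>x. h (f x) (frechet_derivative g (at x) v) + h (frechet_derivative f (at x) v) (g x))" for v
      using Ck_on_SucD[OF Suc.prems(1)] Ck_on_SucD[OF Suc.prems(2)] Suc.prems
      by (intro Ck_on_add assms(1) Suc.IH) auto
  qed
qed

lemma Ck_on_compose:
  fixes f :: "'b::euclidean_space \<Rightarrow> 'c::real_normed_vector" and g :: "'a::euclidean_space \<Rightarrow> 'b"
  assumes "open U" "open V" "Ck_on k U g" "Ck_on k V f" "g ` U \<subseteq> V"
  shows "Ck_on k U (\<lambda>x. f (g x))"
  using assms(3,4)
proof (induction k arbitrary: f)
  case 0
  then show ?case using assms(5) by (auto intro: continuous_on_compose2)
next
  case (Suc k)
  let ?f' = "\<lambda>y. frechet_derivative f (at y)" and ?g' = "\<lambda>x. frechet_derivative g (at x)"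
  show ?case
  proof (rule Ck_on_SucI[OF assms(1)])
    fix x assume x: "x \<in> U"
    have f: "(f has_derivative ?f' (g x)) (at (g x))" and g: "(g has_derivative ?g' x) (at x)"
      using Suc.prems x assms(5) by (auto simp: frechet_derivative_works[symmetric])
    have lin: "linear (?f' (g x))" using f has_derivative_linear by blast
    have "?f' (g x) (?g' x v) = (\<Sum>b\<in>Basis. (?g' x v \<bullet> b) *\<^sub>R ?f' (g x) b)" for v
      by (subst euclidean_representation[symmetric, of "?g' x v"])
        (simp add: linear_sum[OF lin] linear_scale[OF lin])
    then show "((\<lambda>x. f (g x)) has_derivative
        (\<lambda>v. \<Sum>b\<in>Basis. (?g' x v \<bullet> b) *\<^sub>R ?f' (g x) b)) (at x)"
      using has_derivative_compose[OF g f] by simp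
  next
    fix v
    show "Ck_on k U (\<lambda>x. \<Sum>b\<in>Basis. (?g' x v \<bullet> b) *\<^sub>R ?f' (g x) b)"
      using Suc.prems Ck_on_SucD[OF Suc.prems(1)]
      by (intro Ck_on_sum Ck_on_bilinear[OF assms(1) bounded_bilinear_scaleR] assms(1)
          Ck_on_bounded_linear_comp[OF assms(1) bounded_linear_inner_left] Suc.IH) auto
  qed
qed

subsection \<open>Smooth maps on open sets\<close>

abbreviation smooth :: "'a::euclidean_space set \<Rightarrow> ('a \<Rightarrow> 'b::real_normed_vector) \<Rightarrow> bool" where
  "smooth U f \<equiv> \<forall>k. Ck_on k U f"

lemma smooth_compose:
  assumes "open U" "open V" "smooth U g" "smooth V f" "\<And>x. x \<in> U \<Longrightarrow> g x \<in> V"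
  shows "smooth U (\<lambda>x. f (g x))"
  by (rule allI, rule Ck_on_compose[OF assms(1,2) spec[OF assms(3)] spec[OF assms(4)]]) (use assms(5) in auto)

lemma smooth_Pair:
  assumes "open U" "smooth U f" "smooth U g"
  shows "smooth U (\<lambda>x. (f x, g x))"
proof
  fix k
  have 1: "bounded_linear (\<lambda>a. (a, 0))" "bounded_linear (\<lambda>b. (0, b))"
    by (auto intro: bounded_linear_Pair bounded_linear_ident bounded_linear_zero)
  have "Ck_on k U (\<lambda>x. (f x, 0) + (0, g x))"
    using assms by (intro Ck_on_add Ck_on_bounded_linear_comp[OF _ 1(1)]
        Ck_on_bounded_linear_comp[OF _ 1(2)]) auto
  then show "Ck_on k U (\<lambda>x. (f x, g x))" by simp
qed

lemma smooth_imp_continuous: "smooth U f \<Longrightarrow> continuous_on U f"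
  using Ck_on.simps(1) by blast

lemma smooth_has_derivative:
  assumes "smooth U f" "x \<in> U"
  shows "(f has_derivative frechet_derivative f (at x)) (at x)"
proof -
  have "Ck_on (Suc 0) U f" using assms(1) by blast
  then show ?thesis using assms(2) by (simp add: frechet_derivative_works[symmetric])
qed

lemma smooth_frechet: "smooth U f \<Longrightarrow> smooth U (\<lambda>x. frechet_derivative f (at x) v)"
proof
  fix k assume "smooth U f"
  then have "Ck_on (Suc k) U f" by blast
  then show "Ck_on k U (\<lambda>x. frechet_derivative f (at x) v)" by simp
qed

lemma smooth_real_step:
  fixes f :: "real \<Rightarrow> real"
  assumes "open U" "\<And>x. x \<in> U \<Longrightarrow> (f has_real_derivative f' x) (at x)" "Ck_on k U f'"
  shows "Ck_on (Suc k) U f"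
  using assms
  by (intro Ck_on_SucI[OF assms(1), of f "\<lambda>x v. v * f' x"] Ck_on_bilinear[OF _ bounded_bilinear_mult] Ck_on_const)
    (auto simp: has_field_derivative_def mult_commute_abs)

text \<open>A power series with infinite radius of convergence is smooth because its derivative is
  again such a series; this makes \<open>sin x / x\<close> smooth at the removable singularity.\<close>

lemma smooth_power_series:
  fixes c :: "nat \<Rightarrow> real"
  assumes "\<And>x. summable (\<lambda>n. c n * x ^ n)"
  shows "smooth UNIV (\<lambda>x. \<Sum>n. c n * x ^ n)"
proof
  fix k show "Ck_on k UNIV (\<lambda>x. \<Sum>n. c n * x ^ n)"
    using assms
  proof (induction k arbitrary: c)
    case 0
    have "((\<lambda>x. \<Sum>n. c n * x ^ n) has_real_derivative (\<Sum>n. diffs c n * x ^ n)) (at x)" for x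
      by (rule termdiffs_strong_converges_everywhere[OF 0])
    then show ?case by (auto intro!: continuous_at_imp_continuous_on intro: DERIV_isCont)
  next
    case (Suc k)
    have "Ck_on k UNIV (\<lambda>x. \<Sum>n. diffs c n * x ^ n)"
      by (rule Suc.IH) (rule termdiff_converges_all[OF Suc.prems])
    then show ?case
      by (intro smooth_real_step[OF open_UNIV termdiffs_strong_converges_everywhere[OF Suc.prems]])
  qed
qed

lemma smooth_sin: "smooth UNIV (sin :: real \<Rightarrow> real)" and smooth_cos: "smooth UNIV (cos :: real \<Rightarrow> real)"
proof -
  have "Ck_on k UNIV (sin :: real \<Rightarrow> real) \<and> Ck_on k UNIV (cos :: real \<Rightarrow> real)" for k
  proof (induction k)
    case 0 show ?case by (auto intro: continuous_intros)
  next
    case (Suc k)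
    then have "Ck_on k UNIV (\<lambda>x::real. - sin x)"
      by (intro Ck_on_bounded_linear_comp[of UNIV uminus]) (auto intro: bounded_linear_minus bounded_linear_ident)
    then show ?case using Suc
      by (auto intro!: smooth_real_step[of UNIV "sin :: real \<Rightarrow> real" cos]
          smooth_real_step[of UNIV "cos :: real \<Rightarrow> real" "\<lambda>x. - sin x"] derivative_eq_intros
          simp del: Ck_on.simps)
  qed
  then show "smooth UNIV (sin :: real \<Rightarrow> real)" "smooth UNIV (cos :: real \<Rightarrow> real)" by blast+
qed

lemma smooth_exp: "smooth UNIV (exp :: real \<Rightarrow> real)"
proof
  show "Ck_on k UNIV (exp :: real \<Rightarrow> real)" for k
  proof (induction k)
    case (Suc k)
    then show ?case by (rule smooth_real_step[rotated 2]) (auto intro: derivative_eq_intros)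
  qed (auto intro: continuous_intros)
qed

lemma smooth_inverse: "smooth (- {0}) (inverse :: real \<Rightarrow> real)"
proof
  show "Ck_on k (- {0}) (inverse :: real \<Rightarrow> real)" for k
  proof (induction k)
    case (Suc k)
    have o: "open (- {0::real})" by auto
    have "Ck_on k (- {0}) (\<lambda>x::real. - (inverse x * inverse x))"
      by (intro Ck_on_bounded_linear_comp[OF o, of uminus] Ck_on_bilinear[OF o bounded_bilinear_mult] Suc)
        (auto intro: bounded_linear_minus bounded_linear_ident)
    then show ?case
      by (rule smooth_real_step[OF o, rotated 1]) (auto intro!: derivative_eq_intros)
  qed (auto intro!: continuous_intros)
qed

lemma smooth_ln: "smooth {0<..} (ln :: real \<Rightarrow> real)"
proof -
  have "Ck_on (Suc k) {0<..} (ln :: real \<Rightarrow> real)" for k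
    by (rule smooth_real_step[of _ _ inverse])
      (auto intro!: derivative_eq_intros Ck_on_subset[OF spec[OF smooth_inverse]] simp: divide_inverse)
  then show ?thesis using Ck_on_SucD by blast
qed

lemma smooth_const: "smooth U (\<lambda>x. c)"
  by (rule allI) (rule Ck_on_const)

lemma smooth_subset: "smooth U f \<Longrightarrow> V \<subseteq> U \<Longrightarrow> smooth V f"
  by (meson Ck_on_subset)

lemma smooth_linear_comp:
  assumes "open U" "bounded_linear h" "smooth U f"
  shows "smooth U (\<lambda>x. h (f x))"
  by (rule allI) (rule Ck_on_bounded_linear_comp[OF assms(1,2) spec[OF assms(3)]])

lemma smooth_ident: "open U \<Longrightarrow> smooth U (\<lambda>x. x)"
  by (rule allI) (rule Ck_on_id)

lemma smooth_fst: "open U \<Longrightarrow> smooth U f \<Longrightarrow> smooth U (\<lambda>x. fst (f x))"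
  by (rule smooth_linear_comp[OF _ bounded_linear_fst])

lemma smooth_snd: "open U \<Longrightarrow> smooth U f \<Longrightarrow> smooth U (\<lambda>x. snd (f x))"
  by (rule smooth_linear_comp[OF _ bounded_linear_snd])

lemma smooth_add:
  assumes "open U" "smooth U f" "smooth U g"
  shows "smooth U (\<lambda>x. f x + g x)"
  by (rule allI) (rule Ck_on_add[OF assms(1) spec[OF assms(2)] spec[OF assms(3)]])

lemma smooth_minus:
  assumes "open U" "smooth U f"
  shows "smooth U (\<lambda>x. - f x)"
  by (rule smooth_linear_comp[OF assms(1) bounded_linear_minus[OF bounded_linear_ident] assms(2)])

lemma smooth_diff:
  assumes "open U" "smooth U f" "smooth U g"
  shows "smooth U (\<lambda>x. f x - g x)"
  using smooth_add[OF assms(1,2) smooth_minus[OF assms(1,3)]] by simp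

lemma smooth_sum:
  assumes "open U" "\<And>i. i \<in> I \<Longrightarrow> smooth U (f i)"
  shows "smooth U (\<lambda>x. \<Sum>i\<in>I. f i x)"
  by (rule allI) (rule Ck_on_sum[OF assms(1) spec[OF assms(2)]])

lemma smooth_mult:
  fixes f g :: "'a::euclidean_space \<Rightarrow> real"
  assumes "open U" "smooth U f" "smooth U g"
  shows "smooth U (\<lambda>x. f x * g x)"
  by (rule allI)
    (rule Ck_on_bilinear[OF assms(1) bounded_bilinear_mult spec[OF assms(2)] spec[OF assms(3)]])

lemma smooth_scaleR:
  assumes "open U" "smooth U f" "smooth U g"
  shows "smooth U (\<lambda>x. f x *\<^sub>R g x)"
  by (rule allI)
    (rule Ck_on_bilinear[OF assms(1) bounded_bilinear_scaleR spec[OF assms(2)] spec[OF assms(3)]])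

lemma smooth_inner:
  assumes "open U" "smooth U f" "smooth U g"
  shows "smooth U (\<lambda>x. f x \<bullet> g x)"
  by (rule allI)
    (rule Ck_on_bilinear[OF assms(1) bounded_bilinear_inner spec[OF assms(2)] spec[OF assms(3)]])

lemma smooth_real_inverse:
  fixes f :: "'a::euclidean_space \<Rightarrow> real"
  assumes "open U" "smooth U f" "\<And>x. x \<in> U \<Longrightarrow> f x \<noteq> 0"
  shows "smooth U (\<lambda>x. inverse (f x))"
  by (rule smooth_compose[OF assms(1) _ assms(2) smooth_inverse]) (use assms(3) in auto)

lemma smooth_divide:
  assumes "open U" "smooth U f" "smooth U g" "\<And>x. x \<in> U \<Longrightarrow> g x \<noteq> 0"
  shows "smooth U (\<lambda>x. f x / g x :: real)"
  unfolding divide_inverse by (intro smooth_mult smooth_real_inverse assms)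

lemma smooth_exp_comp:
  assumes "open U" "smooth U f" shows "smooth U (\<lambda>x. exp (f x :: real))"
  by (rule smooth_compose[OF assms(1) open_UNIV assms(2) smooth_exp]) simp

lemma smooth_ln_comp:
  assumes "open U" "smooth U f" "\<And>x. x \<in> U \<Longrightarrow> 0 < f x" shows "smooth U (\<lambda>x. ln (f x :: real))"
  by (rule smooth_compose[OF assms(1) _ assms(2) smooth_ln]) (use assms(3) in auto)

lemma smooth_sin_comp:
  assumes "open U" "smooth U f" shows "smooth U (\<lambda>x. sin (f x :: real))"
  by (rule smooth_compose[OF assms(1) open_UNIV assms(2) smooth_sin]) simp

lemma smooth_cos_comp:
  assumes "open U" "smooth U f" shows "smooth U (\<lambda>x. cos (f x :: real))"
  by (rule smooth_compose[OF assms(1) open_UNIV assms(2) smooth_cos]) simp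

lemmas smooth_intros = smooth_const smooth_ident smooth_Pair smooth_add smooth_diff smooth_minus smooth_sum
  smooth_mult smooth_scaleR smooth_inner smooth_divide smooth_fst smooth_snd

lemma open_Collect_positive:
  fixes f :: "'a::topological_space \<Rightarrow> real"
  assumes "open U" "continuous_on U f"
  shows "open {x \<in> U. 0 < f x}"
proof -
  have "{x \<in> U. 0 < f x} = U \<inter> f -` {0<..}" by auto
  then show ?thesis using continuous_open_preimage[OF assms(2,1), of "{0<..}"] by simp
qed

subsection \<open>The inverse function theorem\<close>

text \<open>The local inverse of a smooth map is smooth. Its derivative is the pointwise inverse of the
  derivative, so everything rests on the smoothness of \<open>x \<mapsto> (A x)\<inverse> v\<close> for a smooth family \<open>A\<close> of
  invertible operators. Differentiability of that map is itself read off from the inverse function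
  theorem, applied to \<open>(x, w) \<mapsto> (x, A x w)\<close>.\<close>

lemma blinfun_family_continuous:
  fixes A :: "'a::euclidean_space \<Rightarrow> 'b::euclidean_space \<Rightarrow> 'c::real_normed_vector"
  assumes "\<And>x. x \<in> U \<Longrightarrow> bounded_linear (A x)" "\<And>v. continuous_on U (\<lambda>x. A x v)"
  shows "continuous_on U (\<lambda>x. Blinfun (A x))"
proof (rule continuous_on_blinfun_componentwise)
  fix v :: 'b
  show "continuous_on U (\<lambda>x. blinfun_apply (Blinfun (A x)) v)"
    by (rule continuous_on_eq[OF assms(2)[of v]]) (simp add: bounded_linear_Blinfun_apply assms(1))
qed

lemma smooth_local_inverse_derivative:
  fixes f :: "'a::euclidean_space \<Rightarrow> 'a"
  assumes "open U" "\<And>x. x \<in> U \<Longrightarrow> (f has_derivative f' x) (at x)"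
    and "\<And>v. continuous_on U (\<lambda>x. f' x v)"
    and "x0 \<in> U" and "inj (f' x0)"
  obtains U' V g where "open U'" "U' \<subseteq> U" "x0 \<in> U'" "open V" "f x0 \<in> V" "homeomorphism U' V f g"
    "\<And>y. y \<in> V \<Longrightarrow> (g has_derivative inv (f' (g y))) (at y)"
    "\<And>y. y \<in> V \<Longrightarrow> bij (f' (g y))"
proof -
  have bl: "bounded_linear (f' x)" if "x \<in> U" for x using assms(2)[OF that] by (rule has_derivative_bounded_linear)
  have lin: "linear (f' x0)" using bl assms(4) bounded_linear.linear by blast
  obtain h where h: "linear h" "h \<circ> f' x0 = id" using linear_injective_left_inverse[OF lin assms(5)] by blast
  have inv: "Blinfun h o\<^sub>L Blinfun (f' x0) = id_blinfun"
    by (rule blinfun_eqI) (use h bl assms(4) in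
        \<open>auto simp: bounded_linear_Blinfun_apply linear_conv_bounded_linear fun_eq_iff\<close>)
  have app: "blinfun_apply (Blinfun (f' x)) = f' x" if "x \<in> U" for x
    using bl[OF that] bounded_linear_Blinfun_apply by blast
  obtain U' V g g' where 1: "open U'" "U' \<subseteq> U" "x0 \<in> U'" "open V" "f x0 \<in> V" "homeomorphism U' V f g"
    and 2: "\<And>y. y \<in> V \<Longrightarrow> (g has_derivative (g' y)) (at y)"
    "\<And>y. y \<in> V \<Longrightarrow> g' y = inv (blinfun_apply (Blinfun (f' (g y))))"
    "\<And>y. y \<in> V \<Longrightarrow> bij (blinfun_apply (Blinfun (f' (g y))))"
    by (rule inverse_function_theorem[OF assms(1), of f "\<lambda>x. Blinfun (f' x)" x0 "Blinfun h"])
      (use assms app inv blinfun_family_continuous[OF bl assms(3)] in auto)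
  have "g y \<in> U" if "y \<in> V" for y using 1 that by (auto simp: homeomorphism_def)
  with 1 2 app show ?thesis using that by metis
qed

lemma smooth_inverse_operator:
  fixes A :: "'a::euclidean_space \<Rightarrow> 'b::euclidean_space \<Rightarrow> 'b"
  assumes U: "open U" and lin: "\<And>x. x \<in> U \<Longrightarrow> linear (A x)" and bij: "\<And>x. x \<in> U \<Longrightarrow> bij (A x)"
    and sm: "\<And>v. smooth U (\<lambda>x. A x v)"
  shows "smooth U (\<lambda>x. inv (A x) v)"
proof -
  define D where "D b x = frechet_derivative (\<lambda>x. A x b) (at x)" for b x
  define B where "B x = inv (A x)" for x
  have AB: "A x (B x v) = v" and BA: "B x (A x v) = v" if "x \<in> U" for x v
    using bij[OF that] by (auto simp: B_def bij_def surj_f_inv_f inv_f_f)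
  have Blin: "linear (B x)" if "x \<in> U" for x
    unfolding B_def using lin[OF that] bij[OF that] inj_linear_imp_inv_linear by (auto simp: bij_def)
  have Dd: "((\<lambda>x. A x b) has_derivative D b x) (at x)" if "x \<in> U" for x b
    unfolding D_def using smooth_has_derivative[OF sm that] .
  have Arep: "A x w = (\<Sum>b\<in>Basis. (w \<bullet> b) *\<^sub>R A x b)" if "x \<in> U" for x w
    by (subst euclidean_representation[symmetric, of w])
      (simp add: linear_sum[OF lin[OF that]] linear_scale[OF lin[OF that]])
  have diffB: "((\<lambda>x. B x v) has_derivative
      (\<lambda>u. - B x (\<Sum>b\<in>Basis. (B x v \<bullet> b) *\<^sub>R D b x u))) (at x)" if x: "x \<in> U" for x v
  proof -
    define P where "P = (\<lambda>(x, w). (x, A x w))"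
    define P' where "P' = (\<lambda>(x, w) (u, z). (u, (\<Sum>b\<in>Basis. (w \<bullet> b) *\<^sub>R D b x u + (z \<bullet> b) *\<^sub>R A x b)))"
    have o: "open (U \<times> (UNIV :: 'b set))" using U by (simp add: open_Times)
    have dP: "(P has_derivative P' p) (at p)" if "p \<in> U \<times> UNIV" for p
    proof -
      have 1: "((\<lambda>p. (fst p, \<Sum>b\<in>Basis. (snd p \<bullet> b) *\<^sub>R A (fst p) b)) has_derivative P' p) (at p)"
        using that unfolding P'_def
        by (auto simp: split_beta intro!: derivative_eq_intros has_derivative_compose[OF has_derivative_fst[OF has_derivative_ident] Dd])
      show ?thesis
        by (rule has_derivative_transform_within_open[OF 1 o that]) (auto simp: P_def Arep[symmetric])
    qed
    have cP: "continuous_on (U \<times> UNIV) (\<lambda>p. P' p v)" for v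
    proof -
      have 1: "continuous_on (U \<times> UNIV) (\<lambda>p. D b (fst p) u)" for b u
        using smooth_imp_continuous[OF smooth_frechet[OF sm[of b]]] unfolding D_def
        by (rule continuous_on_compose2) (auto intro: continuous_intros)
      have 2: "continuous_on (U \<times> UNIV) (\<lambda>p. A (fst p) b)" for b
        using smooth_imp_continuous[OF sm[of b]]
        by (rule continuous_on_compose2) (auto intro: continuous_intros)
      show ?thesis unfolding P'_def split_beta by (intro continuous_intros 1 2)
    qed
    have P'0: "P' (x, w) (0, z) = (0, A x z)" for w z
      using linear_0[OF has_derivative_linear[OF Dd[OF x]]] Arep[OF x, of z] by (simp add: P'_def)
    have inj: "inj (P' (x, B x v))"
    proof -
      have l: "linear (P' (x, B x v))" using dP[of "(x, B x v)"] x has_derivative_linear by blast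
      have "p = 0" if p: "P' (x, B x v) p = 0" for p
      proof -
        have "fst p = 0" using p by (auto simp: P'_def split_beta zero_prod_def)
        then obtain z where z: "p = (0, z)" by (cases p) auto
        then have "A x z = 0" using p P'0 by (simp add: zero_prod_def)
        then have "z = 0" using BA[OF x, of z] linear_0[OF Blin[OF x]] by simp
        then show ?thesis using z by (simp add: zero_prod_def)
      qed
      then show ?thesis using linear_injective_0[OF l] by blast
    qed
    have mem: "(x, B x v) \<in> U \<times> UNIV" using x by simp
    obtain U' V g where g: "open U'" "U' \<subseteq> U \<times> UNIV" "(x, B x v) \<in> U'" "open V" "P (x, B x v) \<in> V"
      "homeomorphism U' V P g" "\<And>y. y \<in> V \<Longrightarrow> (g has_derivative inv (P' (g y))) (at y)"
      "\<And>y. y \<in> V \<Longrightarrow> bij (P' (g y))"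
      using smooth_local_inverse_derivative[OF o dP cP mem inj] by metis
    have Pv: "P (x, B x v) = (x, v)" using AB[OF x] by (simp add: P_def)
    then have xv: "(x, v) \<in> V" using g(5) by simp
    have geq: "snd (g (x', v')) = B x' v'" if "(x', v') \<in> V" for x' v'
    proof -
      obtain x2 w2 where xw: "g (x', v') = (x2, w2)" by (cases "g (x', v')")
      have gu: "g (x', v') \<in> U'" "P (g (x', v')) = (x', v')"
        using that g(6) by (auto simp: homeomorphism_def)
      then have "x2 = x'" "A x' w2 = v'" using xw by (auto simp: P_def)
      moreover have "x' \<in> U" using gu(1) g(2) xw \<open>x2 = x'\<close> by auto
      ultimately show ?thesis using BA[of x' w2] xw by simp
    qed
    have gx: "g (x, v) = (x, B x v)"
      using g(3,6) Pv by (metis homeomorphism_apply1)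
    let ?g' = "inv (P' (x, B x v))"
    have dg: "(g has_derivative ?g') (at (x, v))" using g(7)[OF xv] gx by simp
    have "((\<lambda>x'. snd (g (x', v))) has_derivative (\<lambda>u. snd (?g' (u, 0)))) (at x)"
      using has_derivative_compose[OF has_derivative_Pair[OF has_derivative_ident has_derivative_const] dg]
      by (rule has_derivative_snd)
    moreover have "open ((\<lambda>x'. (x', v)) -` V)"
      by (rule open_vimage[OF g(4)]) (auto intro: continuous_intros)
    ultimately have "((\<lambda>x. B x v) has_derivative (\<lambda>u. snd (?g' (u, 0)))) (at x)"
      by (rule has_derivative_transform_within_open) (use xv geq in auto)
    moreover have "snd (?g' (u, 0)) = - B x (\<Sum>b\<in>Basis. (B x v \<bullet> b) *\<^sub>R D b x u)" for u
    proof -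
      let ?s = "\<Sum>b\<in>Basis. (B x v \<bullet> b) *\<^sub>R D b x u"
      have "A x (- B x ?s) = - ?s" using AB[OF x] linear_neg[OF lin[OF x]] by simp
      then have "P' (x, B x v) (u, - B x ?s) = (u, 0)"
        unfolding P'_def split by (simp only: sum.distrib Arep[OF x, of "- B x ?s", symmetric]) simp
      then have "?g' (u, 0) = (u, - B x ?s)" using inv_f_f[OF inj, of "(u, - B x ?s)"] by simp
      then show ?thesis by simp
    qed
    ultimately show ?thesis by simp
  qed
  have "Ck_on k U (\<lambda>x. B x v)" for k v
  proof (induction k arbitrary: v)
    case 0
    show ?case using diffB U by (auto intro!: continuous_at_imp_continuous_on has_derivative_continuous)
  next
    case (Suc k)
    show ?case
    proof (rule Ck_on_SucI[OF U diffB])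
      fix u
      have eq: "- B x (\<Sum>b\<in>Basis. (B x v \<bullet> b) *\<^sub>R D b x u) =
        - (\<Sum>b\<in>Basis. (B x v \<bullet> b) *\<^sub>R (\<Sum>c\<in>Basis. (D b x u \<bullet> c) *\<^sub>R B x c))" if x: "x \<in> U" for x
      proof -
        have 1: "(\<Sum>c\<in>Basis. (w \<bullet> c) *\<^sub>R B x c) = B x w" for w
          by (subst (2) euclidean_representation[symmetric, of w])
            (simp add: linear_sum[OF Blin[OF x]] linear_scale[OF Blin[OF x]])
        show ?thesis unfolding 1 by (simp add: linear_sum[OF Blin[OF x]] linear_scale[OF Blin[OF x]])
      qed
      have "Ck_on k U (\<lambda>x. - (\<Sum>b\<in>Basis. (B x v \<bullet> b) *\<^sub>R (\<Sum>c\<in>Basis. (D b x u \<bullet> c) *\<^sub>R B x c)))"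
        unfolding D_def
        by (intro Ck_on_bounded_linear_comp[OF U bounded_linear_minus[OF bounded_linear_ident]] Ck_on_sum[OF U]
            Ck_on_bilinear[OF U bounded_bilinear_scaleR] Suc.IH
            Ck_on_bounded_linear_comp[OF U bounded_linear_inner_left] spec[OF smooth_frechet[OF sm]])
      then show "Ck_on k U (\<lambda>x. - B x (\<Sum>b\<in>Basis. (B x v \<bullet> b) *\<^sub>R D b x u))"
        by (rule iffD2[OF Ck_on_cong[OF U], rotated]) (rule eq)
    qed
  qed
  then show ?thesis by (simp add: B_def)
qed

theorem smooth_inverse_function:
  fixes f :: "'a::euclidean_space \<Rightarrow> 'a"
  assumes U: "open U" and sm: "smooth U f" and x0: "x0 \<in> U" and d: "(f has_derivative f') (at x0)" "inj f'"
  obtains U' V g where "open U'" "U' \<subseteq> U" "x0 \<in> U'" "open V" "f x0 \<in> V" "homeomorphism U' V f g"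
    "smooth V g"
proof -
  let ?f' = "\<lambda>x. frechet_derivative f (at x)"
  have f': "?f' x0 = f'" using frechet_derivative_at[OF d(1)] by simp
  obtain U' V g where g: "open U'" "U' \<subseteq> U" "x0 \<in> U'" "open V" "f x0 \<in> V" "homeomorphism U' V f g"
    "\<And>y. y \<in> V \<Longrightarrow> (g has_derivative inv (?f' (g y))) (at y)" "\<And>y. y \<in> V \<Longrightarrow> bij (?f' (g y))"
    using smooth_local_inverse_derivative[OF U smooth_has_derivative[OF sm]
        smooth_imp_continuous[OF smooth_frechet[OF sm]] x0] f' d(2) by metis
  have gU: "g y \<in> U'" if "y \<in> V" for y using g(6) that by (auto simp: homeomorphism_def)
  have bij: "bij (?f' x)" if "x \<in> U'" for x
    using g(6,8) that by (metis homeomorphism_apply1 homeomorphism_image1 imageI)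
  have inv: "smooth U' (\<lambda>x. inv (?f' x) v)" for v
  proof (rule smooth_inverse_operator[OF g(1)])
    show "linear (?f' x)" if "x \<in> U'" for x
      using smooth_has_derivative[OF sm] that g(2) has_derivative_linear by blast
    show "smooth U' (\<lambda>x. ?f' x v)" for v using smooth_subset[OF smooth_frechet[OF sm] g(2)] .
  qed (use bij in blast)
  have "Ck_on k V g" for k
  proof (induction k)
    case 0
    then show ?case using g(6) by (simp add: homeomorphism_def)
  next
    case (Suc k)
    show ?case
    proof (rule Ck_on_SucI[OF g(4,7)])
      show "Ck_on k V (\<lambda>y. inv (?f' (g y)) v)" for v
        by (rule Ck_on_compose[OF g(4,1) Suc spec[OF inv]]) (use gU in auto)
    qed
  qed
  then have "smooth V g" by simp
  then show ?thesis by (rule that[OF g(1-6)])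
qed


section \<open>Smooth maps between manifolds\<close>

text \<open>For atlases with smooth changes of charts, a map is smooth as soon as around every point it
  has a smooth expression in one pair of charts.\<close>

definition chart_smooth ::
    "'e::euclidean_space set \<Rightarrow> ('e \<Rightarrow> 'p) \<Rightarrow> 'f::euclidean_space set \<Rightarrow> ('f \<Rightarrow> 'q) \<Rightarrow> ('p \<Rightarrow> 'q) \<Rightarrow> 'e \<Rightarrow> bool" where
  "chart_smooth D \<phi> D' \<psi> f z \<longleftrightarrow> (\<exists>U g. open U \<and> z \<in> U \<and> smooth U g \<and>
     (\<forall>z'\<in>D \<inter> U. g z' \<in> D' \<and> f (\<phi> z') = \<psi> (g z')))"

definition smooth_atlas :: "('e::euclidean_space, 'p) mfd \<Rightarrow> bool" where
  "smooth_atlas X \<longleftrightarrow> (\<forall>(D, \<phi>)\<in>X. inj_on \<phi> D) \<and>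
     (\<forall>(D, \<phi>)\<in>X. \<forall>(D', \<psi>)\<in>X. \<forall>z\<in>D. \<phi> z \<in> \<psi> ` D' \<longrightarrow> chart_smooth D \<phi> D' \<psi> (\<lambda>p. p) z)"

definition locally_smooth ::
    "('e::euclidean_space, 'p) mfd \<Rightarrow> ('f::euclidean_space, 'q) mfd \<Rightarrow> ('p \<Rightarrow> 'q) \<Rightarrow> bool" where
  "locally_smooth X Y f \<longleftrightarrow> (\<forall>p\<in>mpts X. \<exists>(D, \<phi>)\<in>X. \<exists>(D', \<psi>)\<in>Y. \<exists>z\<in>D.
     \<phi> z = p \<and> chart_smooth D \<phi> D' \<psi> f z)"

lemma chart_smoothI:
  assumes "open U" "z \<in> U" "smooth U g" "\<And>z'. z' \<in> D \<Longrightarrow> z' \<in> U \<Longrightarrow> g z' \<in> D'"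
    "\<And>z'. z' \<in> D \<Longrightarrow> z' \<in> U \<Longrightarrow> f (\<phi> z') = \<psi> (g z')"
  shows "chart_smooth D \<phi> D' \<psi> f z"
  unfolding chart_smooth_def by (intro exI[of _ U] exI[of _ g] conjI ballI) (use assms in auto)

lemma chart_smooth_trans:
  assumes "chart_smooth D \<phi> D' \<psi> f z" "z \<in> D" "inj_on \<psi> D'" "w \<in> D'" "\<psi> w = f (\<phi> z)"
    and "chart_smooth D' \<psi> D'' \<rho> h w"
  shows "chart_smooth D \<phi> D'' \<rho> (\<lambda>p. h (f p)) z"
proof -
  obtain U g where g: "open U" "z \<in> U" "smooth U g" "\<And>z'. z' \<in> D \<inter> U \<Longrightarrow> g z' \<in> D' \<and> f (\<phi> z') = \<psi> (g z')"
    using assms(1) unfolding chart_smooth_def by metis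
  obtain V k where k: "open V" "w \<in> V" "smooth V k" "\<And>z'. z' \<in> D' \<inter> V \<Longrightarrow> k z' \<in> D'' \<and> h (\<psi> z') = \<rho> (k z')"
    using assms(6) unfolding chart_smooth_def by metis
  have "g z = w" using g(4)[of z] g(2) assms(2-5) by (auto dest: inj_onD)
  moreover have "open (U \<inter> g -` V)"
    using continuous_open_preimage[OF smooth_imp_continuous[OF g(3)] g(1) k(1)] .
  moreover from this have "smooth (U \<inter> g -` V) (\<lambda>z. k (g z))"
    by (rule smooth_compose[OF _ k(1) smooth_subset[OF g(3)] k(3)]) auto
  ultimately show ?thesis
    by (intro chart_smoothI[of "U \<inter> g -` V" _ "\<lambda>z. k (g z)"]) (use g k in auto)
qed

lemma smooth_atlasI:
  assumes "\<And>D \<phi>. (D, \<phi>) \<in> X \<Longrightarrow> inj_on \<phi> D"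
    and "\<And>D \<phi> D' \<psi> z. (D, \<phi>) \<in> X \<Longrightarrow> (D', \<psi>) \<in> X \<Longrightarrow> z \<in> D \<Longrightarrow> \<phi> z \<in> \<psi> ` D' \<Longrightarrow>
      chart_smooth D \<phi> D' \<psi> (\<lambda>p. p) z"
  shows "smooth_atlas X"
  unfolding smooth_atlas_def using assms by blast

lemma smooth_atlas_inj: "smooth_atlas X \<Longrightarrow> (D, \<phi>) \<in> X \<Longrightarrow> inj_on \<phi> D"
  unfolding smooth_atlas_def by blast

lemma smooth_atlas_transition:
  "smooth_atlas X \<Longrightarrow> (D, \<phi>) \<in> X \<Longrightarrow> (D', \<psi>) \<in> X \<Longrightarrow> z \<in> D \<Longrightarrow> \<phi> z \<in> \<psi> ` D' \<Longrightarrow>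
    chart_smooth D \<phi> D' \<psi> (\<lambda>p. p) z"
  unfolding smooth_atlas_def by blast

lemma locally_smoothE:
  assumes "locally_smooth X Y f" "p \<in> mpts X"
  obtains D \<phi> D' \<psi> z where "(D, \<phi>) \<in> X" "(D', \<psi>) \<in> Y" "z \<in> D" "\<phi> z = p" "chart_smooth D \<phi> D' \<psi> f z"
  using assms unfolding locally_smooth_def by blast

lemma mptsI: "(D, \<phi>) \<in> X \<Longrightarrow> z \<in> D \<Longrightarrow> \<phi> z \<in> mpts X"
  unfolding mpts_def by blast

lemma locally_smooth_domain_chart:
  assumes "smooth_atlas X" "locally_smooth X Y f" "(D, \<phi>) \<in> X" "z \<in> D"
  obtains D' \<psi> where "(D', \<psi>) \<in> Y" "chart_smooth D \<phi> D' \<psi> f z"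
proof -
  obtain D1 \<phi>1 D' \<psi> z1 where 1: "(D1, \<phi>1) \<in> X" "(D', \<psi>) \<in> Y" "z1 \<in> D1" "\<phi>1 z1 = \<phi> z"
    "chart_smooth D1 \<phi>1 D' \<psi> f z1"
    using locally_smoothE[OF assms(2) mptsI[OF assms(3,4)]] by metis
  have "\<phi> z \<in> \<phi>1 ` D1" using 1(3,4) by force
  then have "chart_smooth D \<phi> D1 \<phi>1 (\<lambda>p. p) z"
    using smooth_atlas_transition[OF assms(1,3) 1(1) assms(4)] by blast
  then have "chart_smooth D \<phi> D' \<psi> f z"
    using chart_smooth_trans[of D \<phi> D1 \<phi>1 "\<lambda>p. p" z z1 D' \<psi> f]
      assms(4) smooth_atlas_inj[OF assms(1) 1(1)] 1(3,4,5) by simp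
  then show ?thesis using that 1(2) by blast
qed

lemma locally_smooth_chart:
  assumes "smooth_atlas X" "smooth_atlas Y" "locally_smooth X Y f" "(D, \<phi>) \<in> X" "z \<in> D"
    "(D', \<psi>) \<in> Y" "f (\<phi> z) \<in> \<psi> ` D'"
  shows "chart_smooth D \<phi> D' \<psi> f z"
proof -
  obtain D1 \<psi>1 where 1: "(D1, \<psi>1) \<in> Y" "chart_smooth D \<phi> D1 \<psi>1 f z"
    using locally_smooth_domain_chart[OF assms(1,3-5)] .
  then obtain w where w: "w \<in> D1" "\<psi>1 w = f (\<phi> z)"
    using assms(5) unfolding chart_smooth_def by (metis IntI)
  have "chart_smooth D1 \<psi>1 D' \<psi> (\<lambda>p. p) w"
    using smooth_atlas_transition[OF assms(2) 1(1) assms(6) w(1)] w(2) assms(7) by simp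
  then show ?thesis
    using chart_smooth_trans[of D \<phi> D1 \<psi>1 f z w D' \<psi> "\<lambda>p. p"]
      1(2) assms(5) smooth_atlas_inj[OF assms(2) 1(1)] w by simp
qed

lemma topspace_mtop [simp]: "topspace (mtop X) = mpts X"
proof -
  have "openin (mtop X) (mpts X)"
    unfolding openin_mtop
  proof (intro conjI ballI, simp, clarify)
    fix D \<phi> assume "(D, \<phi>) \<in> X"
    then have "{z \<in> D. \<phi> z \<in> mpts X} = D" using mptsI by auto
    then show "openin (top_of_set D) {z \<in> D. \<phi> z \<in> mpts X}" by simp
  qed
  moreover have "U \<subseteq> mpts X" if "openin (mtop X) U" for U using that unfolding openin_mtop by blast
  ultimately show ?thesis by (metis openin_subset openin_topspace subset_antisym)
qed

lemma openin_chart_preimage: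
  "openin (mtop X) W \<Longrightarrow> (D, \<phi>) \<in> X \<Longrightarrow> openin (top_of_set D) {z \<in> D. \<phi> z \<in> W}"
  unfolding openin_mtop by blast

lemma openin_chart_nbhd:
  assumes "chart_smooth D \<phi> D' \<psi> f z" "z \<in> D" "openin (top_of_set D') A" "inj_on \<psi> D'" "f (\<phi> z) \<in> \<psi> ` A"
  shows "\<exists>T. openin (top_of_set D) T \<and> z \<in> T \<and> (\<forall>z'\<in>T. f (\<phi> z') \<in> \<psi> ` A)"
proof -
  obtain U g where g: "open U" "z \<in> U" "smooth U g" "\<And>z'. z' \<in> D \<inter> U \<Longrightarrow> g z' \<in> D' \<and> f (\<phi> z') = \<psi> (g z')"
    using assms(1) unfolding chart_smooth_def by metis
  obtain V where V: "open V" "A = D' \<inter> V" using assms(3) by (auto simp: openin_open)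
  have o: "open (U \<inter> g -` V)"
    using continuous_open_preimage[OF smooth_imp_continuous[OF g(3)] g(1) V(1)] .
  obtain a where a: "a \<in> A" "f (\<phi> z) = \<psi> a" using assms(5) by blast
  have "g z = a" using g(4)[of z] g(2) assms(2,4) a V(2) by (auto dest: inj_onD)
  then show ?thesis using o g(2,4) a(1) V(2) assms(2)
    by (intro exI[of _ "D \<inter> (U \<inter> g -` V)"]) auto
qed

lemma openin_chart_image:
  assumes "smooth_atlas X" "(D, \<phi>) \<in> X" "openin (top_of_set D) A"
  shows "openin (mtop X) (\<phi> ` A)"
  unfolding openin_mtop
proof (intro conjI ballI, goal_cases)
  case 1
  then show ?case using assms(2) openin_imp_subset[OF assms(3)] by (auto intro: mptsI)
next
  case (2 c)
  obtain D' \<psi> where c: "c = (D', \<psi>)" by (cases c)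
  have "openin (top_of_set D') {z \<in> D'. \<psi> z \<in> \<phi> ` A}"
  proof (subst openin_subopen, intro ballI)
    fix z assume z: "z \<in> {z \<in> D'. \<psi> z \<in> \<phi> ` A}"
    then have "\<psi> z \<in> \<phi> ` D" using openin_imp_subset[OF assms(3)] by auto
    then have "chart_smooth D' \<psi> D \<phi> (\<lambda>p. p) z"
      using smooth_atlas_transition[OF assms(1) _ assms(2), of D' \<psi> z] 2 c z by blast
    from openin_chart_nbhd[OF this _ assms(3) smooth_atlas_inj[OF assms(1,2)]] z
    obtain T where "openin (top_of_set D') T" "z \<in> T" "\<forall>z'\<in>T. \<psi> z' \<in> \<phi> ` A" by blast
    moreover have "T \<subseteq> {z \<in> D'. \<psi> z \<in> \<phi> ` A}" using calculation openin_imp_subset by blast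
    ultimately show "\<exists>T. openin (top_of_set D') T \<and> z \<in> T \<and> T \<subseteq> {z \<in> D'. \<psi> z \<in> \<phi> ` A}" by blast
  qed
  then show ?case using c by simp
qed

lemma locally_smooth_imp_continuous:
  assumes "smooth_atlas X" "locally_smooth X Y f"
  shows "continuous_map (mtop X) (mtop Y) f"
  unfolding continuous_map topspace_mtop
proof (intro conjI allI impI)
  show "f ` mpts X \<subseteq> mpts Y"
  proof clarify
    fix p assume "p \<in> mpts X"
    from locally_smoothE[OF assms(2) this] obtain D \<phi> D' \<psi> z where
      "(D, \<phi>) \<in> X" "(D', \<psi>) \<in> Y" "z \<in> D" "\<phi> z = p" "chart_smooth D \<phi> D' \<psi> f z" by metis
    then show "f p \<in> mpts Y" unfolding chart_smooth_def by (metis IntI mptsI)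
  qed
next
  fix W assume W: "openin (mtop Y) W"
  have "openin (top_of_set D) {z \<in> D. \<phi> z \<in> {x \<in> mpts X. f x \<in> W}}" if c: "(D, \<phi>) \<in> X" for D \<phi>
  proof (subst openin_subopen, intro ballI)
    fix z assume z: "z \<in> {z \<in> D. \<phi> z \<in> {x \<in> mpts X. f x \<in> W}}"
    then obtain D' \<psi> where 1: "(D', \<psi>) \<in> Y" "chart_smooth D \<phi> D' \<psi> f z"
      using locally_smooth_domain_chart[OF assms c] by blast
    obtain U g where g: "open U" "z \<in> U" "smooth U g" "\<And>z'. z' \<in> D \<inter> U \<Longrightarrow> g z' \<in> D' \<and> f (\<phi> z') = \<psi> (g z')"
      using 1(2) unfolding chart_smooth_def by metis
    obtain V where V: "open V" "{w \<in> D'. \<psi> w \<in> W} = D' \<inter> V"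
      using openin_chart_preimage[OF W 1(1)] by (auto simp: openin_open)
    have o: "open (U \<inter> g -` V)"
      using continuous_open_preimage[OF smooth_imp_continuous[OF g(3)] g(1) V(1)] .
    have "z \<in> U \<inter> g -` V" using g(2) g(4)[of z] z V(2) by auto
    moreover have "D \<inter> (U \<inter> g -` V) \<subseteq> {z \<in> D. \<phi> z \<in> {x \<in> mpts X. f x \<in> W}}"
      using g(4) V(2) mptsI[OF c] by auto
    ultimately show "\<exists>T. openin (top_of_set D) T \<and> z \<in> T \<and> T \<subseteq> {z \<in> D. \<phi> z \<in> {x \<in> mpts X. f x \<in> W}}"
      using o z by (intro exI[of _ "D \<inter> (U \<inter> g -` V)"]) auto
  qed
  then show "openin (mtop X) {x \<in> mpts X. f x \<in> W}" unfolding openin_mtop by blast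
qed

theorem locally_smooth_imp_smooth_map:
  assumes "smooth_atlas X" "smooth_atlas Y" "locally_smooth X Y f"
  shows "smooth_map X Y f"
proof -
  have "smooth_on_set {z \<in> D. f (\<phi> z) \<in> \<psi> ` D'} (\<lambda>z. inv_into D' \<psi> (f (\<phi> z)))"
    if c: "(D, \<phi>) \<in> X" "(D', \<psi>) \<in> Y" for D \<phi> D' \<psi>
    unfolding smooth_on_set_def
  proof (intro ballI)
    fix z assume z: "z \<in> {z \<in> D. f (\<phi> z) \<in> \<psi> ` D'}"
    then have "chart_smooth D \<phi> D' \<psi> f z"
      using locally_smooth_chart[OF assms c(1) _ c(2)] by blast
    then obtain U g where g: "open U" "z \<in> U" "smooth U g" "\<And>z'. z' \<in> D \<inter> U \<Longrightarrow> g z' \<in> D' \<and> f (\<phi> z') = \<psi> (g z')"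
      unfolding chart_smooth_def by metis
    then have "g y = inv_into D' \<psi> (f (\<phi> y))" if "y \<in> {z \<in> D. f (\<phi> z) \<in> \<psi> ` D'} \<inter> U" for y
      using that smooth_atlas_inj[OF assms(2) c(2)] by (simp add: inv_into_f_f)
    then show "\<exists>U g. open U \<and> z \<in> U \<and> smooth U g \<and>
      (\<forall>y\<in>{z \<in> D. f (\<phi> z) \<in> \<psi> ` D'} \<inter> U. g y = inv_into D' \<psi> (f (\<phi> y)))"
      using g by blast
  qed
  then show ?thesis unfolding smooth_map_def
    using locally_smooth_imp_continuous[OF assms(1,3)] by blast
qed

lemma diffeomorphismI:
  assumes "smooth_atlas X" "smooth_atlas Y" "bij_betw f (mpts X) (mpts Y)"
    and "locally_smooth X Y f" "locally_smooth Y X (inv_into (mpts X) f)"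
  shows "diffeomorphism X Y f"
  unfolding diffeomorphism_def using assms by (blast intro: locally_smooth_imp_smooth_map)

subsection \<open>Open subsets, subsets of Euclidean space, and products\<close>

lemma mpts_mopen: "mpts (mopen X W) = mpts X \<inter> W"
  by (auto simp: mpts_def mopen_def)

lemma smooth_atlas_mopen:
  assumes "smooth_atlas X" shows "smooth_atlas (mopen X W)"
proof (rule smooth_atlasI)
  fix D \<phi> assume "(D, \<phi>) \<in> mopen X W"
  then show "inj_on \<phi> D" using smooth_atlas_inj[OF assms] by (auto simp: mopen_def inj_on_def)
next
  fix E \<phi> E' \<psi> z
  assume "(E, \<phi>) \<in> mopen X W" "(E', \<psi>) \<in> mopen X W" and z: "z \<in> E" "\<phi> z \<in> \<psi> ` E'"
  then obtain D D' where c: "(D, \<phi>) \<in> X" "E = {z \<in> D. \<phi> z \<in> W}" "(D', \<psi>) \<in> X" "E' = {z \<in> D'. \<psi> z \<in> W}"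
    by (auto simp: mopen_def)
  have "chart_smooth D \<phi> D' \<psi> (\<lambda>p. p) z"
    using smooth_atlas_transition[OF assms c(1,3)] z c by auto
  then obtain U g where "open U" "z \<in> U" "smooth U g" "\<And>w. w \<in> D \<inter> U \<Longrightarrow> g w \<in> D' \<and> \<phi> w = \<psi> (g w)"
    unfolding chart_smooth_def by metis
  then show "chart_smooth E \<phi> E' \<psi> (\<lambda>p. p) z"
    using c by (intro chart_smoothI[of U z g]) auto
qed

lemma locally_smooth_mopen:
  assumes "locally_smooth X Y f" shows "locally_smooth (mopen X W) Y f"
  unfolding locally_smooth_def mpts_mopen
proof
  fix p assume p: "p \<in> mpts X \<inter> W"
  then obtain D \<phi> D' \<psi> z where 1: "(D, \<phi>) \<in> X" "(D', \<psi>) \<in> Y" "z \<in> D" "\<phi> z = p" "chart_smooth D \<phi> D' \<psi> f z"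
    using locally_smoothE[OF assms] by (metis IntD1)
  then have "chart_smooth {z \<in> D. \<phi> z \<in> W} \<phi> D' \<psi> f z" unfolding chart_smooth_def by blast
  moreover have "({z \<in> D. \<phi> z \<in> W}, \<phi>) \<in> mopen X W" unfolding mopen_def using 1(1) by force
  ultimately show "\<exists>(D, \<phi>)\<in>mopen X W. \<exists>(D', \<psi>)\<in>Y. \<exists>z\<in>D. \<phi> z = p \<and> chart_smooth D \<phi> D' \<psi> f z"
    using 1 p by (intro bexI[of _ "({z \<in> D. \<phi> z \<in> W}, \<phi>)"]) auto
qed

lemma mpts_msub [simp]: "mpts (msub S) = S"
  by (simp add: mpts_def msub_def)

lemma mtop_msub: "mtop (msub S) = top_of_set S"
proof -
  have "openin (mtop (msub S)) U \<longleftrightarrow> openin (top_of_set S) U" for U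
  proof -
    have "{z \<in> S. z \<in> U} = U" if "U \<subseteq> S" using that by auto
    then show ?thesis using openin_imp_subset[of euclidean S U] unfolding openin_mtop mpts_msub by (auto simp: msub_def)
  qed
  then show ?thesis by (simp add: topology_eq)
qed

lemma smooth_atlas_msub: "smooth_atlas (msub S)"
  unfolding smooth_atlas_def msub_def
  by (auto intro!: chart_smoothI[of UNIV _ "\<lambda>x. x"] smooth_ident[rule_format])

lemma mpts_mprod: "mpts (mprod X Y) = mpts X \<times> mpts Y"
  by (force simp: mpts_def mprod_def)

lemma mprodI: "(D, \<phi>) \<in> X \<Longrightarrow> (D', \<psi>) \<in> Y \<Longrightarrow> (D \<times> D', map_prod \<phi> \<psi>) \<in> mprod X Y"
  by (force simp: mprod_def)

lemma mprodE:
  assumes "(E, \<theta>) \<in> mprod X Y"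
  obtains D \<phi> D' \<psi> where "(D, \<phi>) \<in> X" "(D', \<psi>) \<in> Y" "E = D \<times> D'" "\<theta> = map_prod \<phi> \<psi>"
  using assms by (auto simp: mprod_def)

lemma chart_smooth_map_prod:
  assumes "chart_smooth D \<phi> E \<theta> f z" "chart_smooth D' \<psi> E' \<theta>' h z'"
  shows "chart_smooth (D \<times> D') (map_prod \<phi> \<psi>) (E \<times> E') (map_prod \<theta> \<theta>') (map_prod f h) (z, z')"
proof -
  obtain U g where g: "open U" "z \<in> U" "smooth U g" "\<And>w. w \<in> D \<inter> U \<Longrightarrow> g w \<in> E \<and> f (\<phi> w) = \<theta> (g w)"
    using assms(1) unfolding chart_smooth_def by metis
  obtain U' g' where g': "open U'" "z' \<in> U'" "smooth U' g'" "\<And>w. w \<in> D' \<inter> U' \<Longrightarrow> g' w \<in> E' \<and> h (\<psi> w) = \<theta>' (g' w)"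
    using assms(2) unfolding chart_smooth_def by metis
  have o: "open (U \<times> U')" using g(1) g'(1) by (rule open_Times)
  have "smooth (U \<times> U') (\<lambda>p. (g (fst p), g' (snd p)))"
    by (intro smooth_Pair o smooth_compose[OF o g(1) _ g(3)] smooth_compose[OF o g'(1) _ g'(3)]
        smooth_fst smooth_snd smooth_ident) auto
  then show ?thesis
    by (intro chart_smoothI[of "U \<times> U'" _ "\<lambda>p. (g (fst p), g' (snd p))"] o) (use g g' in auto)
qed

lemma smooth_atlas_mprod:
  assumes "smooth_atlas X" "smooth_atlas Y" shows "smooth_atlas (mprod X Y)"
proof -
  have "inj_on \<theta> E" if "(E, \<theta>) \<in> mprod X Y" for E \<theta>
    using that
    by (rule mprodE) (use smooth_atlas_inj[OF assms(1)] smooth_atlas_inj[OF assms(2)] in \<open>auto simp: map_prod_inj_on\<close>)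
  moreover have "chart_smooth E \<theta> E' \<theta>' (\<lambda>p. p) z"
    if p: "(E, \<theta>) \<in> mprod X Y" "(E', \<theta>') \<in> mprod X Y" "z \<in> E" "\<theta> z \<in> \<theta>' ` E'" for E \<theta> E' \<theta>' z
  proof -
    obtain D \<phi> C \<psi> where 1: "(D, \<phi>) \<in> X" "(C, \<psi>) \<in> Y" "E = D \<times> C" "\<theta> = map_prod \<phi> \<psi>"
      using mprodE[OF p(1)] .
    obtain D' \<phi>' C' \<psi>' where 2: "(D', \<phi>') \<in> X" "(C', \<psi>') \<in> Y" "E' = D' \<times> C'" "\<theta>' = map_prod \<phi>' \<psi>'"
      using mprodE[OF p(2)] .
    obtain u v where z: "z = (u, v)" by (cases z)
    have "chart_smooth D \<phi> D' \<phi>' (\<lambda>p. p) u" "chart_smooth C \<psi> C' \<psi>' (\<lambda>p. p) v"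
      using p(3,4) 1 2 z smooth_atlas_transition[OF assms(1) 1(1) 2(1)]
        smooth_atlas_transition[OF assms(2) 1(2) 2(2)] by auto
    from chart_smooth_map_prod[OF this] show ?thesis unfolding 1 2 z
      by (simp add: map_prod.identity[unfolded id_def])
  qed
  ultimately show ?thesis unfolding smooth_atlas_def by blast
qed

lemma locally_smooth_swap_target:
  assumes "locally_smooth X (mprod Y Z) f" shows "locally_smooth X (mprod Z Y) (\<lambda>p. prod.swap (f p))"
  unfolding locally_smooth_def
proof
  fix p assume "p \<in> mpts X"
  then obtain D \<phi> E \<theta> z where 1: "(D, \<phi>) \<in> X" "(E, \<theta>) \<in> mprod Y Z" "z \<in> D" "\<phi> z = p" "chart_smooth D \<phi> E \<theta> f z"
    using locally_smoothE[OF assms] by metis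
  obtain A \<alpha> B \<beta> where 2: "(A, \<alpha>) \<in> Y" "(B, \<beta>) \<in> Z" "E = A \<times> B" "\<theta> = map_prod \<alpha> \<beta>"
    using mprodE[OF 1(2)] .
  obtain U g where g: "open U" "z \<in> U" "smooth U g" "\<And>w. w \<in> D \<inter> U \<Longrightarrow> g w \<in> E \<and> f (\<phi> w) = \<theta> (g w)"
    using 1(5) unfolding chart_smooth_def by metis
  have "smooth U (\<lambda>w. (snd (g w), fst (g w)))"
    by (intro smooth_Pair smooth_fst smooth_snd g)
  then have "chart_smooth D \<phi> (B \<times> A) (map_prod \<beta> \<alpha>) (\<lambda>p. prod.swap (f p)) z"
    using g 2 by (intro chart_smoothI[of U _ "\<lambda>w. (snd (g w), fst (g w))"]) (auto simp: mem_Times_iff map_prod_def split_beta)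
  then show "\<exists>(D, \<phi>)\<in>X. \<exists>(D', \<psi>)\<in>mprod Z Y. \<exists>z\<in>D. \<phi> z = p \<and> chart_smooth D \<phi> D' \<psi> (\<lambda>p. prod.swap (f p)) z"
    using 1 mprodI[OF 2(2,1)] by blast
qed

lemma locally_smooth_swap_source:
  assumes "locally_smooth (mprod Y Z) X f" shows "locally_smooth (mprod Z Y) X (\<lambda>p. f (prod.swap p))"
  unfolding locally_smooth_def
proof
  fix p assume "p \<in> mpts (mprod Z Y)"
  then have "prod.swap p \<in> mpts (mprod Y Z)" by (auto simp: mpts_mprod)
  then obtain E \<theta> D \<phi> z where 1: "(E, \<theta>) \<in> mprod Y Z" "(D, \<phi>) \<in> X" "z \<in> E" "\<theta> z = prod.swap p" "chart_smooth E \<theta> D \<phi> f z"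
    using locally_smoothE[OF assms] by metis
  obtain A \<alpha> B \<beta> where 2: "(A, \<alpha>) \<in> Y" "(B, \<beta>) \<in> Z" "E = A \<times> B" "\<theta> = map_prod \<alpha> \<beta>"
    using mprodE[OF 1(1)] .
  obtain U g where g: "open U" "z \<in> U" "smooth U g" "\<And>w. w \<in> E \<inter> U \<Longrightarrow> g w \<in> D \<and> f (\<theta> w) = \<phi> (g w)"
    using 1(5) unfolding chart_smooth_def by metis
  let ?s = "\<lambda>w. (snd w, fst w)"
  have o: "open (?s -` U)" by (rule open_vimage[OF g(1)]) (auto intro!: continuous_intros)
  have "smooth (?s -` U) (\<lambda>w. g (?s w))"
    by (intro smooth_compose[OF o g(1) _ g(3)] smooth_Pair smooth_fst smooth_snd smooth_ident o) auto
  then have "chart_smooth (B \<times> A) (map_prod \<beta> \<alpha>) D \<phi> (\<lambda>p. f (prod.swap p)) (?s z)"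
    using g 2 by (intro chart_smoothI[of "?s -` U" _ "\<lambda>w. g (?s w)"] o) (auto simp: mem_Times_iff)
  moreover have "?s z \<in> B \<times> A" "map_prod \<beta> \<alpha> (?s z) = p"
    using 1(3,4) 2 by (auto simp: mem_Times_iff prod_eq_iff)
  ultimately show "\<exists>(D, \<phi>)\<in>mprod Z Y. \<exists>(D', \<psi>)\<in>X. \<exists>z\<in>D. \<phi> z = p \<and> chart_smooth D \<phi> D' \<psi> (\<lambda>p. f (prod.swap p)) z"
    using 1(2) mprodI[OF 2(2,1)] by blast
qed

text \<open>A trivialization is the given diffeomorphism with its two factors exchanged.\<close>

lemma trivial_fibre_bundleI:
  assumes "smooth_atlas X" "smooth_atlas Y" "smooth_atlas Z" "bij_betw f (mpts X) (mpts (mprod Y Z))"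
    and "locally_smooth X (mprod Y Z) f" "locally_smooth (mprod Y Z) X (inv_into (mpts X) f)"
    and "\<And>p. p \<in> mpts X \<Longrightarrow> snd (f p) = h p"
  shows "trivial_fibre_bundle X Z Y h"
proof -
  let ?f = "\<lambda>p. prod.swap (f p)"
  have bij: "bij_betw ?f (mpts X) (mpts (mprod Z Y))"
    using bij_betw_trans[OF assms(4), of prod.swap "mpts (mprod Z Y)"]
    by (auto simp: comp_def mpts_mprod bij_betw_def inj_on_def product_swap)
  have inv: "inv_into (mpts X) ?f q = inv_into (mpts X) f (prod.swap q)" if "q \<in> mpts (mprod Z Y)" for q
  proof -
    have "prod.swap q \<in> f ` mpts X" using assms(4) that by (auto simp: bij_betw_def mpts_mprod)
    then have "inv_into (mpts X) f (prod.swap q) \<in> mpts X" "f (inv_into (mpts X) f (prod.swap q)) = prod.swap q"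
      by (auto intro: inv_into_into f_inv_into_f)
    then show ?thesis using bij by (intro inv_into_f_eq) (auto simp: bij_betw_def)
  qed
  have "locally_smooth (mprod Z Y) X (inv_into (mpts X) ?f)"
    unfolding locally_smooth_def
  proof
    fix p assume "p \<in> mpts (mprod Z Y)"
    then obtain E \<theta> D \<phi> z where 1: "(E, \<theta>) \<in> mprod Z Y" "(D, \<phi>) \<in> X" "z \<in> E" "\<theta> z = p"
      "chart_smooth E \<theta> D \<phi> (\<lambda>p. inv_into (mpts X) f (prod.swap p)) z"
      using locally_smoothE[OF locally_smooth_swap_source[OF assms(6)]] by metis
    have "chart_smooth E \<theta> D \<phi> (inv_into (mpts X) ?f) z"
      using 1(5) inv[OF mptsI[OF 1(1)]] unfolding chart_smooth_def by (metis IntD1)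
    then show "\<exists>(D, \<phi>)\<in>mprod Z Y. \<exists>(D', \<psi>)\<in>X. \<exists>z\<in>D. \<phi> z = p \<and> chart_smooth D \<phi> D' \<psi> (inv_into (mpts X) ?f) z"
      using 1 by blast
  qed
  then have "diffeomorphism X (mprod Z Y) ?f"
    by (intro diffeomorphismI smooth_atlas_mprod assms bij locally_smooth_swap_target)
  then show ?thesis unfolding trivial_fibre_bundle_def using assms(7) by (intro exI[of _ ?f]) auto
qed


section \<open>Barycentric coordinates and the simplex\<close>

text \<open>The covectors \<open>uvec l\<close> are, up to the factor \<open>2 / pi\<close>, the differentials of the barycentric
  coordinates. All formulas below are written in them, which makes the \<open>n + 2\<close> vertices
  interchangeable.\<close>

lemma uvec_inner:
  fixes a :: "real^'n"
  shows "uvec None \<bullet> a = - (\<Sum>j\<in>UNIV. a $ j)" "uvec (Some j) \<bullet> a = a $ j"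
  by (simp_all add: uvec_def inner_sum_left inner_axis inner_commute[of "axis _ _"])

lemma sum_uvec_inner:
  fixes a :: "real^'n"
  shows "(\<Sum>l\<in>UNIV. uvec l \<bullet> a) = 0"
  by (simp add: sum_UNIV_option uvec_inner)

lemma uvec_inner_eq_sum:
  fixes a :: "real^'n"
  shows "- (uvec i \<bullet> a) = (\<Sum>l\<in>- {i}. uvec l \<bullet> a)"
proof -
  have "(\<Sum>l\<in>UNIV. uvec l \<bullet> a) = uvec i \<bullet> a + (\<Sum>l\<in>- {i}. uvec l \<bullet> a)"
    by (subst sum.remove[of UNIV i]) (auto simp: Compl_eq_Diff_UNIV)
  then show ?thesis using sum_uvec_inner[of a] by simp
qed

lemma uvec_ext:
  fixes a b :: "real^'n"
  assumes "\<And>l. uvec l \<bullet> a = uvec l \<bullet> b"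
  shows "a = b"
  using assms[of "Some _"] by (simp add: vec_eq_iff uvec_inner)

lemma bary_add:
  fixes y a :: "real^'n"
  shows "bary (y + a) l = bary y l + 2 / pi * (uvec l \<bullet> a)"
  by (cases l) (simp_all add: bary_def uvec_inner sum.distrib sum_divide_distrib sum_distrib_left
      algebra_simps add_divide_distrib)

lemma bary_pvert:
  fixes i :: "'n::finite option"
  shows "bary (pvert i) l = (if l = i then 1 else 0)"
proof (cases i)
  case None
  then show ?thesis by (cases l) (simp_all add: bary_def pvert_def)
next
  case (Some m)
  have "(\<Sum>j\<in>UNIV. 2 * pvert i $ j / pi) = (\<Sum>j\<in>UNIV. if j = m then 1 else 0)"
    by (intro sum.cong) (auto simp: pvert_def Some axis_def)
  then show ?thesis using Some by (cases l) (auto simp: bary_def pvert_def axis_def)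
qed

lemma uvec_pvert_diff:
  fixes i :: "'n::finite option"
  shows "uvec l \<bullet> (pvert j - pvert i) = pi / 2 * ((if l = j then 1 else 0) - (if l = i then 1 else 0))"
  using bary_add[of "pvert i" "pvert j - pvert i" l] by (simp add: bary_pvert field_simps)

lemma bary_sum_pvert:
  fixes c :: "'n::finite option \<Rightarrow> real"
  assumes "sum c UNIV = 1"
  shows "bary (\<Sum>i\<in>UNIV. c i *\<^sub>R pvert i) l = c l"
proof (cases l)
  case None
  have "(\<Sum>j\<in>UNIV. 2 * (\<Sum>i\<in>UNIV. c i *\<^sub>R pvert i) $ j / pi) = (\<Sum>j\<in>UNIV. c (Some j))"
    by (intro sum.cong refl, subst sum_pvert) simp
  then show ?thesis using None assms by (simp add: bary_def sum_UNIV_option)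
next
  case (Some j)
  show ?thesis unfolding Some bary_def option.case sum_pvert by simp
qed

lemma sum_Compl_extend:
  fixes c :: "'n::finite option \<Rightarrow> real" and v :: "'n option \<Rightarrow> 'b::real_vector"
  shows "(\<Sum>i\<in>- J. c i *\<^sub>R v i) = (\<Sum>i\<in>UNIV. (if i \<in> J then 0 else c i) *\<^sub>R v i)"
    "sum c (- J) = (\<Sum>i\<in>UNIV. if i \<in> J then 0 else c i)"
  by (rule sum.mono_neutral_cong_left; simp)+

lemma rel_interior_face_iff:
  fixes y :: "real^'n"
  shows "y \<in> rel_interior (face J) \<longleftrightarrow> (\<forall>j\<in>J. bary y j = 0) \<and> (\<forall>l. l \<notin> J \<longrightarrow> 0 < bary y l)"
proof
  assume "y \<in> rel_interior (face J)"
  then obtain c where c: "y = (\<Sum>i\<in>- J. c i *\<^sub>R pvert i)" "\<forall>i\<in>- J. 0 < c i" "sum c (- J) = 1"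
    unfolding rel_interior_face by blast
  let ?c = "\<lambda>i. if i \<in> J then 0 else c i"
  have "bary y l = ?c l" for l
    unfolding c(1) sum_Compl_extend(1) using c(3) by (intro bary_sum_pvert) (simp add: sum_Compl_extend(2))
  then show "(\<forall>j\<in>J. bary y j = 0) \<and> (\<forall>l. l \<notin> J \<longrightarrow> 0 < bary y l)" using c(2) by simp
next
  assume a: "(\<forall>j\<in>J. bary y j = 0) \<and> (\<forall>l. l \<notin> J \<longrightarrow> 0 < bary y l)"
  then have "(if i \<in> J then 0 else bary y i) = bary y i" for i by simp
  then have "y = (\<Sum>i\<in>- J. bary y i *\<^sub>R pvert i)" "sum (bary y) (- J) = 1"
    unfolding sum_Compl_extend by (simp_all add: bary)
  then show "y \<in> rel_interior (face J)" unfolding rel_interior_face using a by blast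
qed

lemma face_iff:
  fixes y :: "real^'n"
  shows "y \<in> face {} \<longleftrightarrow> (\<forall>l. 0 \<le> bary y l)"
proof
  assume "y \<in> face {}"
  then obtain u where u: "\<forall>x\<in>range pvert. 0 \<le> u x" "sum u (range pvert) = 1"
    "(\<Sum>x\<in>range pvert. u x *\<^sub>R x) = y"
    unfolding face_def by (auto simp: convex_hull_finite)
  let ?c = "\<lambda>i. u (pvert i)"
  have "sum ?c UNIV = 1" "(\<Sum>i\<in>UNIV. ?c i *\<^sub>R pvert i) = y"
    using u(2,3) by (simp_all add: sum.reindex[OF inj_pvert])
  then have "bary y l = ?c l" for l using bary_sum_pvert[of ?c l] by simp
  then show "\<forall>l. 0 \<le> bary y l" using u(1) by simp
next
  assume a: "\<forall>l. 0 \<le> bary y l"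
  have "(\<Sum>i\<in>UNIV. bary y i *\<^sub>R pvert i) \<in> convex hull (range pvert)"
    by (rule convex_sum) (use a bary(1)[of y] in \<open>auto intro: hull_inc\<close>)
  then show "y \<in> face {}" by (simp add: face_def bary)
qed

lemma rel_interior_face_subset: "rel_interior (face J) \<subseteq> face {}" for J :: "'n::finite option set"
proof
  fix y assume y: "y \<in> rel_interior (face J)"
  have "0 \<le> bary y l" for l using y unfolding rel_interior_face_iff by (cases "l \<in> J") (auto intro: less_imp_le)
  then show "y \<in> face {}" by (simp add: face_iff)
qed

lemma pvert_in_face: "pvert l \<in> face {}" for l :: "'n::finite option"
  by (simp add: face_iff bary_pvert)

lemma rel_interior_face_not_pvert:
  fixes y :: "real^'n"
  assumes "y \<in> rel_interior (face J)" "2 \<le> card (- J)"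
  shows "y \<noteq> pvert l"
proof
  assume y: "y = pvert l"
  have "- J \<subseteq> {l}" using assms(1) unfolding rel_interior_face_iff y bary_pvert by (auto split: if_splits)
  then have "card (- J) \<le> 1" by (metis card.empty card_insert_disjoint card_mono empty_iff finite.intros(1) finite.intros(2) One_nat_def)
  then show False using assms(2) by simp
qed


section \<open>Representatives on the torus\<close>

lemma face_coordinates:
  fixes y :: "real^'n"
  assumes "y \<in> face {}"
  shows "0 \<le> y $ m" "(\<Sum>m\<in>UNIV. y $ m) \<le> pi / 2" "y $ m \<le> pi / 2"
proof -
  have b: "0 \<le> bary y l" for l using assms face_iff by blast
  show 1: "0 \<le> y $ m" for m using b[of "Some m"] by (auto simp: bary_def zero_le_divide_iff dest: leD)
  have "0 \<le> 1 - 2 / pi * (\<Sum>m\<in>UNIV. y $ m)"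
    using b[of None] by (simp add: bary_def sum_distrib_left sum_divide_distrib[symmetric])
  then show 2: "(\<Sum>m\<in>UNIV. y $ m) \<le> pi / 2" by (simp add: field_simps)
  have "y $ m \<le> (\<Sum>m\<in>UNIV. y $ m)" by (rule member_le_sum) (use 1 in auto)
  then show "y $ m \<le> pi / 2" using 2 by simp
qed

lemma tor_eq_iff:
  fixes y y' :: "real^'n"
  shows "tor y = tor y' \<longleftrightarrow> (\<exists>z. (\<forall>i. z $ i \<in> \<int>) \<and> y' = y + pi *\<^sub>R z)"
proof
  assume "tor y = tor y'"
  moreover have "y' \<in> tor y'" unfolding tor_def by (auto intro!: exI[of _ "0 :: real^'n"])
  ultimately have "y' \<in> tor y" by simp
  then show "\<exists>z. (\<forall>i. z $ i \<in> \<int>) \<and> y' = y + pi *\<^sub>R z" unfolding tor_def by blast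
next
  assume "\<exists>z. (\<forall>i. z $ i \<in> \<int>) \<and> y' = y + pi *\<^sub>R z"
  then show "tor y = tor y'" using tor_shift by metis
qed

lemma tor_inj_near:
  fixes y y' :: "real^'n"
  assumes "tor y = tor y'" "\<And>m. \<bar>y $ m - y' $ m\<bar> < pi"
  shows "y = y'"
proof -
  obtain z where z: "\<forall>i. z $ i \<in> \<int>" "y' = y + pi *\<^sub>R z" using assms(1) tor_eq_iff by blast
  have "z $ m = 0" for m
  proof -
    have "pi * \<bar>z $ m\<bar> < pi * 1" using assms(2)[of m] z(2) by (simp add: abs_mult)
    then have "\<bar>z $ m\<bar> < 1" by simp
    then show ?thesis using z(1) Ints_nonzero_abs_less1 by blast
  qed
  then have "z = 0" by (simp add: vec_eq_iff)
  then show ?thesis using z(2) by simp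
qed

lemma tor_inj_face:
  fixes y y' :: "real^'n"
  assumes "y \<in> face {}" "y' \<in> face {}" "tor y = tor y'"
  shows "y = y'"
proof (rule tor_inj_near[OF assms(3)])
  fix m
  show "\<bar>y $ m - y' $ m\<bar> < pi"
    using face_coordinates(1,3)[OF assms(1), of m] face_coordinates(1,3)[OF assms(2), of m] pi_gt_zero
    by linarith
qed

text \<open>If \<open>tor y = tor (- y')\<close>, the coordinates of \<open>y + y'\<close> are multiples of \<open>pi\<close>. They are nonnegative with
  sum at most \<open>pi\<close>, so they are all \<open>0\<close>, or one of them is \<open>pi\<close> and the others are \<open>0\<close>.\<close>

lemma tor_opposite_faces:
  fixes y y' :: "real^'n"
  assumes "y \<in> face {}" "y' \<in> face {}" "tor y = tor (- y')"
  shows "\<exists>l. y = pvert l \<and> y' = pvert l"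
proof -
  obtain z where z: "\<forall>i. z $ i \<in> \<int>" "- y' = y + pi *\<^sub>R z" using assms(3) tor_eq_iff by blast
  note c = face_coordinates[OF assms(1)] and c' = face_coordinates[OF assms(2)]
  have e: "y $ m + y' $ m = - pi * z $ m" for m
    using arg_cong[OF z(2), of "\<lambda>x. x $ m"] by simp
  show ?thesis
  proof (cases "\<forall>m. z $ m = 0")
    case True
    then have "y $ m = 0 \<and> y' $ m = 0" for m using e[of m] c(1)[of m] c'(1)[of m] by simp
    then have "y = pvert None" "y' = pvert None" by (simp_all add: vec_eq_iff pvert_def)
    then show ?thesis by blast
  next
    case False
    then obtain m where m: "z $ m \<noteq> 0" by blast
    then have "1 \<le> \<bar>z $ m\<bar>" using z(1) Ints_nonzero_abs_ge1 by blast
    then have "pi * 1 \<le> pi * \<bar>z $ m\<bar>" by (intro mult_left_mono) auto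
    moreover have "pi * \<bar>z $ m\<bar> = \<bar>y $ m + y' $ m\<bar>" unfolding e by (simp add: abs_mult)
    ultimately have "pi \<le> y $ m + y' $ m" using c(1)[of m] c'(1)[of m] by simp
    then have ym: "y $ m = pi / 2" "y' $ m = pi / 2" using c(3)[of m] c'(3)[of m] by simp_all
    have v: "v = pvert (Some m)" if "v $ m = pi / 2" "\<And>l. 0 \<le> v $ l" "(\<Sum>l\<in>UNIV. v $ l) \<le> pi / 2" for v :: "real^'n"
    proof -
      have "(\<Sum>l\<in>UNIV. v $ l) = v $ m + (\<Sum>l\<in>UNIV - {m}. v $ l)" by (simp add: sum.remove)
      then have "(\<Sum>l\<in>UNIV - {m}. v $ l) \<le> 0" using that by simp
      then have "(\<Sum>l\<in>UNIV - {m}. v $ l) = 0" using that(2) by (meson order_antisym sum_nonneg)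
      then have "\<forall>l\<in>UNIV - {m}. v $ l = 0" using that(2) by (subst (asm) sum_nonneg_eq_0_iff) auto
      then show ?thesis using that(1) by (auto simp: vec_eq_iff pvert_def axis_def)
    qed
    show ?thesis using v[OF ym(1) c(1,2)] v[OF ym(2) c'(1,2)] by blast
  qed
qed

lemma lift_tor:
  fixes y :: "real^'n"
  assumes "y \<in> face {}" "\<And>l. y \<noteq> pvert l"
  shows "lift (tor y) = y" "lift (tor (- y)) = - y"
proof -
  have 1: "x = y" if "x \<in> face {} \<or> - x \<in> face {}" "tor x = tor y" for x
    using that(1)
  proof
    assume "- x \<in> face {}"
    then have "\<exists>l. y = pvert l \<and> - x = pvert l"
      using tor_opposite_faces[OF assms(1), of "- x"] that(2) by simp
    then show ?thesis using assms(2) by blast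
  qed (use tor_inj_face[OF _ assms(1)] that(2) in blast)
  show "lift (tor y) = y" unfolding lift_def by (rule some_equality) (use assms(1) 1 in auto)
  have 2: "x = - y" if x: "x \<in> face {} \<or> - x \<in> face {}" "tor x = tor (- y)" for x
  proof -
    have "tor (- x) = tor y" using arg_cong[OF x(2), of tneg] by (simp add: tor_uminus[symmetric])
    then show ?thesis using 1[of "- x"] x(1) by auto
  qed
  show "lift (tor (- y)) = - y" unfolding lift_def by (rule some_equality) (use assms(1) 2 in auto)
qed

lemma lift_tor_pvert:
  fixes l :: "'n::finite option"
  shows "lift (tor (pvert l)) = pvert l \<or> lift (tor (pvert l)) = - pvert l"
proof -
  let ?x = "lift (tor (pvert l))"
  have "(?x \<in> face {} \<or> - ?x \<in> face {}) \<and> tor ?x = tor (pvert l)"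
    unfolding lift_def by (rule someI[of _ "pvert l"]) (simp add: pvert_in_face)
  then show ?thesis
    using tor_inj_face[OF _ pvert_in_face, of ?x l] tor_opposite_faces[OF pvert_in_face, of "- ?x" l]
    by (metis add.inverse_inverse injD inj_pvert)
qed


section \<open>Blow up coordinates without normalization\<close>

text \<open>It is convenient to let the direction \<open>a\<close> in the coordinates \<open>(t, a)\<close> at the vertex \<open>i\<close> range over
  the whole open cone: \<open>(t, a)\<close> and \<open>(c t, a / c)\<close> then describe the same point. The domain for \<open>J = {}\<close>
  is open, so no affine constraint has to be carried along when differentiating, and the projection
  along \<open>L\<close> does not have to be renormalized.\<close>

definition cone_dom :: "'n::finite option set \<Rightarrow> 'n option \<Rightarrow> (real \<times> (real^'n)) set" where
  "cone_dom J i = {(t, a). (\<forall>j\<in>J. uvec j \<bullet> a = 0) \<and> (\<forall>l. l \<notin> J \<longrightarrow> l \<noteq> i \<longrightarrow> 0 < uvec l \<bullet> a) \<and>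
     \<bar>t\<bar> * - (uvec i \<bullet> a) < pi / 2}"

definition scale :: "'n::finite option \<Rightarrow> real^'n \<Rightarrow> real" where
  "scale i a = - 2 / pi * (uvec i \<bullet> a)"

definition normalize :: "'n::finite option \<Rightarrow> real \<times> (real^'n) \<Rightarrow> real \<times> (real^'n)" where
  "normalize i = (\<lambda>(t, a). (t * scale i a, (1 / scale i a) *\<^sub>R a))"

lemma scale_pos:
  fixes J :: "'n::finite option set"
  assumes "(t, a) \<in> cone_dom J i" "i \<notin> J" "2 \<le> card (- J)"
  shows "0 < scale i a" "uvec i \<bullet> a < 0"
proof -
  have "- J \<noteq> {i}" using assms(3) by auto
  then obtain m where m: "m \<notin> J" "m \<noteq> i" using assms(2) by auto
  have "0 < (\<Sum>l\<in>- {i}. uvec l \<bullet> a)"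
    by (rule sum_pos2[of _ m]) (use assms(1) m in \<open>auto simp: cone_dom_def less_eq_real_def\<close>)
  then show "uvec i \<bullet> a < 0" using uvec_inner_eq_sum[of i a] by simp
  then show "0 < scale i a" by (simp add: scale_def field_simps)
qed

lemma blow_dom_eq:
  fixes J :: "'n::finite option set"
  assumes "i \<notin> J"
  shows "blow_dom J i = {(t, a) \<in> cone_dom J i. scale i a = 1}"
proof -
  have "(t, a) \<in> blow_dom J i \<longleftrightarrow> (t, a) \<in> cone_dom J i \<and> scale i a = 1" for t a
  proof -
    have b: "bary (pvert i + a) l = (if l = i then 1 else 0) + 2 / pi * (uvec l \<bullet> a)" for l
      by (simp add: bary_add bary_pvert)
    have s: "scale i a = 1 \<longleftrightarrow> uvec i \<bullet> a = - (pi / 2)" by (auto simp: scale_def field_simps)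
    have 1: "bary (pvert i + a) i = 0 \<longleftrightarrow> uvec i \<bullet> a = - (pi / 2)" unfolding b by (auto simp: field_simps)
    have 2: "(bary (pvert i + a) l = 0 \<longleftrightarrow> uvec l \<bullet> a = 0) \<and> (0 < bary (pvert i + a) l \<longleftrightarrow> 0 < uvec l \<bullet> a)"
      if "l \<noteq> i" for l unfolding b using that by (auto simp: zero_less_divide_iff)
    have 3: "\<bar>t\<bar> * - (uvec i \<bullet> a) < pi / 2 \<longleftrightarrow> - 1 < t \<and> t < 1" if "uvec i \<bullet> a = - (pi / 2)"
      using that pi_gt_zero by (auto simp: abs_less_iff field_simps)
    have 4: "l \<noteq> i" if "l \<in> J" for l using that assms by blast
    show ?thesis unfolding blow_dom_def cone_dom_def rel_interior_face_iff s
      mem_Sigma_iff mem_Collect_eq split_conv greaterThanLessThan_iff insert_iff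
      using 1 2 3 4 by blast
  qed
  then show ?thesis by auto
qed

lemma scale_scaleR: "scale i (c *\<^sub>R a) = c * scale i a"
  by (simp add: scale_def)

lemma cone_dom_scale:
  assumes "(t, a) \<in> cone_dom J i" "0 < c"
  shows "(t * c, (1 / c) *\<^sub>R a) \<in> cone_dom J i"
  using assms by (auto simp: cone_dom_def abs_mult)

lemma normalize_blow_dom:
  fixes J :: "'n::finite option set"
  assumes "(t, a) \<in> cone_dom J i" "i \<notin> J" "2 \<le> card (- J)"
  shows "normalize i (t, a) \<in> blow_dom J i"
  using cone_dom_scale[OF assms(1) scale_pos(1)[OF assms]] scale_pos(1)[OF assms]
  by (simp add: normalize_def blow_dom_eq[OF assms(2)] scale_scaleR)

lemma blow_par_scale:
  fixes a :: "real^'n::finite"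
  assumes "c \<noteq> 0"
  shows "blow_par J i (t * c, (1 / c) *\<^sub>R a) = blow_par J i (t, a)"
proof -
  have "span {(1 / c) *\<^sub>R a} = span {a}" using span_image_scale[of "{a}" "\<lambda>_. 1 / c"] assms by simp
  then show ?thesis using assms by (simp add: blow_par_def)
qed

lemma blow_par_normalize:
  fixes J :: "'n::finite option set"
  assumes "(t, a) \<in> cone_dom J i" "i \<notin> J" "2 \<le> card (- J)"
  shows "blow_par J i (normalize i (t, a)) = blow_par J i (t, a)"
  unfolding normalize_def using blow_par_scale[of "scale i a" J i t a] scale_pos(1)[OF assms] by simp

lemma cone_dom_nonzero_iff:
  fixes J :: "'n::finite option set"
  assumes "t \<noteq> 0" "i \<notin> J"
  shows "(t, a) \<in> cone_dom J i \<longleftrightarrow> pvert i + \<bar>t\<bar> *\<^sub>R a \<in> rel_interior (face J)"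
proof -
  have b: "bary (pvert i + \<bar>t\<bar> *\<^sub>R a) l = (if l = i then 1 else 0) + 2 / pi * (\<bar>t\<bar> * (uvec l \<bullet> a))" for l
    by (simp add: bary_add bary_pvert)
  have 1: "0 < bary (pvert i + \<bar>t\<bar> *\<^sub>R a) i \<longleftrightarrow> \<bar>t\<bar> * - (uvec i \<bullet> a) < pi / 2" unfolding b
    by (auto simp: field_simps)
  have 2: "(bary (pvert i + \<bar>t\<bar> *\<^sub>R a) l = 0 \<longleftrightarrow> uvec l \<bullet> a = 0) \<and>
      (0 < bary (pvert i + \<bar>t\<bar> *\<^sub>R a) l \<longleftrightarrow> 0 < uvec l \<bullet> a)" if "l \<noteq> i" for l
    unfolding b using that assms(1) by (auto simp: zero_less_divide_iff zero_less_mult_iff)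
  have 3: "l \<noteq> i" if "l \<in> J" for l using that assms by blast
  show ?thesis unfolding cone_dom_def rel_interior_face_iff mem_Collect_eq split_conv
  proof -
    let ?b = "bary (pvert i + \<bar>t\<bar> *\<^sub>R a)"
    have A: "(\<forall>j\<in>J. ?b j = 0) \<longleftrightarrow> (\<forall>j\<in>J. uvec j \<bullet> a = 0)" using 2 3 by simp
    have "(\<forall>l. l \<notin> J \<longrightarrow> 0 < ?b l) \<longleftrightarrow> 0 < ?b i \<and> (\<forall>l. l \<notin> J \<longrightarrow> l \<noteq> i \<longrightarrow> 0 < ?b l)"
      using assms(2) by metis
    also have "\<dots> \<longleftrightarrow> 0 < ?b i \<and> (\<forall>l. l \<notin> J \<longrightarrow> l \<noteq> i \<longrightarrow> 0 < uvec l \<bullet> a)" using 2 by simp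
    finally show "((\<forall>j\<in>J. uvec j \<bullet> a = 0) \<and> (\<forall>l. l \<notin> J \<longrightarrow> l \<noteq> i \<longrightarrow> 0 < uvec l \<bullet> a) \<and>
      \<bar>t\<bar> * - (uvec i \<bullet> a) < pi / 2) =
      ((\<forall>j\<in>J. ?b j = 0) \<and> (\<forall>l. l \<notin> J \<longrightarrow> 0 < ?b l))" unfolding A 1 by argo
  qed
qed

lemma blow_par_nonzero:
  fixes a :: "real^'n::finite"
  assumes "t \<noteq> 0"
  shows "blow_par J i (t, a) = Pt (tor (sgn t *\<^sub>R (pvert i + \<bar>t\<bar> *\<^sub>R a)))"
proof (cases "t > 0")
  case False
  then have "tor (pvert i + t *\<^sub>R a) = tor (- (pvert i + \<bar>t\<bar> *\<^sub>R a))"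
    using tor_pvert_minus[of i "\<bar>t\<bar> *\<^sub>R a"] tor_uminus[of "pvert i + \<bar>t\<bar> *\<^sub>R a"] by simp
  then show ?thesis using False assms by (simp add: blow_par_def)
qed (simp add: blow_par_def)

lemma tor_signed_eq:
  fixes y y' :: "real^'n::finite"
  assumes "y \<in> rel_interior (face J)" "y' \<in> rel_interior (face J)" "2 \<le> card (- J)"
    and "t \<noteq> 0" "t' \<noteq> 0" "tor (sgn t *\<^sub>R y) = tor (sgn t' *\<^sub>R y')"
  shows "sgn t = sgn t' \<and> y = y'"
proof -
  have f: "y \<in> face {}" "y' \<in> face {}" using assms(1,2) rel_interior_face_subset by blast+
  have n: "y \<noteq> pvert l" "y' \<noteq> pvert l" for l using rel_interior_face_not_pvert assms(1-3) by blast+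
  have l: "lift (tor (sgn t *\<^sub>R y)) = sgn t *\<^sub>R y" "lift (tor (sgn t' *\<^sub>R y')) = sgn t' *\<^sub>R y'"
    using lift_tor[OF f(1) n(1)] lift_tor[OF f(2) n(2)] assms(4,5) by (auto simp: sgn_real_def)
  have e: "sgn t *\<^sub>R y = sgn t' *\<^sub>R y'" using arg_cong[OF assms(6), of lift] unfolding l .
  have "y = - y' \<Longrightarrow> False"
  proof -
    assume "y = - y'"
    then have "tor y = tor (- y')" by simp
    then show False using tor_opposite_faces[OF f] n by blast
  qed
  then show ?thesis using e assms(4,5) by (auto simp: sgn_real_def split: if_splits)
qed

text \<open>A regular point determines its representative in the simplex and the sign of \<open>t\<close>, an exceptional point its
  vertex and the line. On a circle there are no lines, but a vertex still differs from all regular points.\<close>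

lemma blow_par_eqD:
  fixes J :: "'n::finite option set"
  assumes "(t, a) \<in> cone_dom J i" "(t', a') \<in> cone_dom J i'" "i \<notin> J" "i' \<notin> J" "2 \<le> card (- J)"
    and eq: "blow_par J i (t, a) = blow_par J i' (t', a')"
  shows "t = 0 \<and> t' = 0 \<and> i = i' \<and> (2 < card (- J) \<longrightarrow> span {a} = span {a'}) \<or>
    t \<noteq> 0 \<and> t' \<noteq> 0 \<and> sgn t = sgn t' \<and> pvert i + \<bar>t\<bar> *\<^sub>R a = pvert i' + \<bar>t'\<bar> *\<^sub>R a'"
proof -
  have no: False if "s \<noteq> 0" "(s, b) \<in> cone_dom J m" "m \<notin> J" "blow_par J m (s, b) = blow_par J m' (0, b')" for s b m b' m'
  proof -
    let ?y = "pvert m + \<bar>s\<bar> *\<^sub>R b"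
    have y: "?y \<in> rel_interior (face J)" using cone_dom_nonzero_iff that by blast
    have "tor (sgn s *\<^sub>R ?y) = tor (pvert m')"
      using that(4) unfolding blow_par_nonzero[OF that(1)] by (auto simp: blow_par_def split: if_splits)
    then have "tor ?y = tor (pvert m') \<or> tor (pvert m') = tor (- ?y)" using that(1) by (auto simp: sgn_real_def split: if_splits)
    then have "\<exists>l. ?y = pvert l"
      using tor_inj_face[OF _ pvert_in_face, of ?y m'] tor_opposite_faces[OF pvert_in_face, of ?y m']
        y rel_interior_face_subset by blast
    then show False using rel_interior_face_not_pvert[OF y assms(5)] by blast
  qed
  consider "t = 0" "t' = 0" | "t = 0" "t' \<noteq> 0" | "t \<noteq> 0" "t' = 0" | "t \<noteq> 0" "t' \<noteq> 0" by blast
  then show ?thesis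
  proof cases
    case 1
    have "i = i'" if "tor (pvert i) = tor (pvert i')"
      using tor_inj_face[OF pvert_in_face pvert_in_face that] injD[OF inj_pvert] by blast
    then show ?thesis using 1 eq by (auto simp: blow_par_def split: if_splits)
  next
    case 2
    then show ?thesis using no[OF 2(2) assms(2,4)] eq by metis
  next
    case 3
    then show ?thesis using no[OF 3(1) assms(1,3)] eq by metis
  next
    case 4
    have "tor (sgn t *\<^sub>R (pvert i + \<bar>t\<bar> *\<^sub>R a)) = tor (sgn t' *\<^sub>R (pvert i' + \<bar>t'\<bar> *\<^sub>R a'))"
      using eq unfolding blow_par_nonzero[OF 4(1)] blow_par_nonzero[OF 4(2)] by simp
    then show ?thesis
      using tor_signed_eq[OF _ _ assms(5) 4] cone_dom_nonzero_iff[OF 4(1) assms(3)] cone_dom_nonzero_iff[OF 4(2) assms(4)]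
        assms(1,2) 4 by blast
  qed
qed

lemma blow_par_inj:
  fixes J :: "'n::finite option set"
  assumes "i \<notin> J" "2 \<le> card (- J)"
  shows "inj_on (blow_par J i) (blow_dom J i)"
proof (rule inj_onI, clarify)
  fix t t' and a a' :: "real^'n"
  assume z: "(t, a) \<in> blow_dom J i" "(t', a') \<in> blow_dom J i" and eq: "blow_par J i (t, a) = blow_par J i (t', a')"
  have c: "(t, a) \<in> cone_dom J i" "(t', a') \<in> cone_dom J i" and s: "scale i a = 1" "scale i a' = 1"
    using z by (auto simp: blow_dom_eq[OF assms(1)])
  from blow_par_eqD[OF c assms(1,1,2) eq] consider
    "t = 0" "t' = 0" "2 < card (- J) \<longrightarrow> span {a} = span {a'}" |
    "t \<noteq> 0" "t' \<noteq> 0" "sgn t = sgn t'" "\<bar>t\<bar> *\<^sub>R a = \<bar>t'\<bar> *\<^sub>R a'" by auto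
  then show "t = t' \<and> a = a'"
  proof cases
    case 1
    have "a = a'"
    proof (cases "2 < card (- J)")
      case True
      then have "a \<in> span {a'}" using 1(3) span_base[of a "{a}"] by auto
      then obtain c where "a = c *\<^sub>R a'" by (auto simp: span_singleton)
      then show ?thesis using s by (auto simp: scale_scaleR)
    next
      case False
      then have "card (- J) = 2" using assms(2) by simp
      then have "card (- J - {i}) = 1" using assms(1) by simp
      then obtain m where m: "- J - {i} = {m}" by (auto simp: card_1_singleton_iff)
      have m': "m \<notin> J" "m \<noteq> i" "\<And>l. l \<noteq> i \<Longrightarrow> l \<noteq> m \<Longrightarrow> l \<in> J" using m by auto
      have e: "uvec l \<bullet> v = (if l = i then - (pi / 2) else if l = m then pi / 2 else 0)"
        if v: "(0, v) \<in> cone_dom J i" "scale i v = 1" for v l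
      proof -
        have i: "uvec i \<bullet> v = - (pi / 2)" using v(2) by (simp add: scale_def field_simps)
        have j: "uvec j \<bullet> v = 0" if "j \<noteq> i" "j \<noteq> m" for j using v(1) m'(3) that by (auto simp: cone_dom_def)
        have "pi / 2 = (\<Sum>l\<in>- {i}. uvec l \<bullet> v)" using uvec_inner_eq_sum[of i v] i by simp
        also have "\<dots> = (\<Sum>l\<in>{m}. uvec l \<bullet> v)" using m' j by (intro sum.mono_neutral_right) auto
        finally show ?thesis using i j m' by auto
      qed
      show ?thesis using e[of a] e[of a'] c s 1 by (intro uvec_ext) simp
    qed
    then show ?thesis using 1 by simp
  next
    case 2
    have "\<bar>t\<bar> = \<bar>t'\<bar>" using arg_cong[OF 2(4), of "scale i"] s by (simp add: scale_scaleR)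
    then have "t = t'" using 2(3) by (metis mult_sgn_abs)
    then show ?thesis using 2 by simp
  qed
qed

text \<open>The representative in the simplex is the same: \<open>pvert m + \<bar>t\<bar> *\<^sub>R a' = pvert i + \<bar>t\<bar> *\<^sub>R a\<close>. No
  normalization of the direction is needed, so \<open>t\<close> does not change.\<close>

lemma blow_par_change_vertex:
  fixes J :: "'n::finite option set"
  assumes "(t, a) \<in> cone_dom J i" "t \<noteq> 0" "i \<notin> J" "m \<notin> J"
  shows "(t, a + (1 / \<bar>t\<bar>) *\<^sub>R (pvert i - pvert m)) \<in> cone_dom J m"
    "blow_par J m (t, a + (1 / \<bar>t\<bar>) *\<^sub>R (pvert i - pvert m)) = blow_par J i (t, a)"
proof -
  have "pvert m + \<bar>t\<bar> *\<^sub>R (a + (1 / \<bar>t\<bar>) *\<^sub>R (pvert i - pvert m)) = pvert i + \<bar>t\<bar> *\<^sub>R a"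
    using assms(2) by (simp add: scaleR_right_distrib)
  then show "(t, a + (1 / \<bar>t\<bar>) *\<^sub>R (pvert i - pvert m)) \<in> cone_dom J m"
    "blow_par J m (t, a + (1 / \<bar>t\<bar>) *\<^sub>R (pvert i - pvert m)) = blow_par J i (t, a)"
    using assms cone_dom_nonzero_iff[OF assms(2,3), of a] by (auto simp: cone_dom_nonzero_iff blow_par_nonzero)
qed

lemma smooth_scale: "open U \<Longrightarrow> smooth U f \<Longrightarrow> smooth U (\<lambda>x. scale i (f x))"
  unfolding scale_def by (intro smooth_intros)

lemma smooth_normalize:
  assumes "open U" "smooth U f" "\<And>x. x \<in> U \<Longrightarrow> 0 < scale i (snd (f x))"
  shows "smooth U (\<lambda>x. normalize i (f x))"
  unfolding normalize_def split_beta
  by (intro smooth_intros smooth_scale assms(1,2)) (use assms(3) in fastforce)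

lemma smooth_atlas_Emfd:
  fixes J :: "'n::finite option set"
  assumes "2 \<le> card (- J)"
  shows "smooth_atlas (Emfd J)"
proof (rule smooth_atlasI)
  fix D \<phi> assume "(D, \<phi>) \<in> Emfd J"
  then show "inj_on \<phi> D" using blow_par_inj[OF _ assms] by (auto simp: Emfd_def)
next
  fix D \<phi> D' \<psi> z
  assume "(D, \<phi>) \<in> Emfd J" "(D', \<psi>) \<in> Emfd J" and z: "z \<in> D" "\<phi> z \<in> \<psi> ` D'"
  then obtain i m where i: "i \<notin> J" "D = blow_dom J i" "\<phi> = blow_par J i"
    and m: "m \<notin> J" "D' = blow_dom J m" "\<psi> = blow_par J m" by (auto simp: Emfd_def)
  show "chart_smooth D \<phi> D' \<psi> (\<lambda>p. p) z"
  proof (cases "m = i")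
    case True
    then show ?thesis using i m by (intro chart_smoothI[of UNIV z "\<lambda>z. z"] smooth_intros) auto
  next
    case False
    obtain t a where ta: "z = (t, a)" by (cases z)
    obtain t' a' where z': "(t', a') \<in> blow_dom J m" "blow_par J i (t, a) = blow_par J m (t', a')"
      using z(2) unfolding i m ta by auto
    have t: "t \<noteq> 0"
      using blow_par_eqD[of t a J i t' a' m] z(1) z' i m ta assms False by (auto simp: blow_dom_eq)
    define g where "g z = (fst z, snd z + (sgn t / fst z) *\<^sub>R (pvert i - pvert m))" for z :: "real \<times> (real^'n)"
    define V where "V = {z :: real \<times> (real^'n). z \<in> UNIV \<and> 0 < sgn t * fst z}"
    define U where "U = {z \<in> V. 0 < scale m (snd (g z))}"
    have oV: "open V" unfolding V_def by (rule open_Collect_positive) (auto intro!: continuous_intros)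
    have sg: "smooth V g" unfolding g_def by (intro smooth_intros oV) (auto simp: V_def)
    have oU: "open U" unfolding U_def
      by (rule open_Collect_positive[OF oV]) (rule smooth_imp_continuous, intro smooth_scale smooth_snd sg oV)
    have sU: "smooth U g" by (rule smooth_subset[OF sg]) (auto simp: U_def)
    have V: "fst z \<noteq> 0 \<and> sgn t / fst z = 1 / \<bar>fst z\<bar>" if "z \<in> V" for z
      using that by (auto simp: V_def sgn_real_def split: if_splits)
    have g: "g w \<in> cone_dom J m \<and> blow_par J m (g w) = blow_par J i w" if "w \<in> blow_dom J i" "w \<in> V" for w
      using blow_par_change_vertex[of "fst w" "snd w" J i m] that V[OF that(2)] i(1) m(1)
      by (auto simp: g_def blow_dom_eq)
    have tV: "(t, a) \<in> V" using t by (simp add: V_def sgn_mult_self_eq[symmetric] sgn_real_def)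
    have "0 < scale m (snd (g z))" using scale_pos(1)[of "fst (g z)" "snd (g z)" J m] g[of z] z(1) tV ta i m assms by simp
    then have zU: "z \<in> U" using tV ta by (simp add: U_def)
    have "smooth U (\<lambda>w. normalize m (g w))" by (rule smooth_normalize[OF oU sU]) (simp add: U_def)
    then show ?thesis
    proof (rule chart_smoothI[OF oU zU])
      fix w assume w: "w \<in> D" "w \<in> U"
      have gw: "g w \<in> cone_dom J m" "blow_par J m (g w) = blow_par J i w" using g w i(2) by (auto simp: U_def)
      show "normalize m (g w) \<in> D'"
        using normalize_blow_dom[of "fst (g w)" "snd (g w)" J m] gw m assms by simp
      show "\<phi> w = \<psi> (normalize m (g w))"
        using blow_par_normalize[of "fst (g w)" "snd (g w)" J m] gw m i assms by simp
    qed
  qed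
qed


section \<open>The function in blow up coordinates\<close>

subsection \<open>A sine with its slope at the origin scaled out\<close>

definition sinc_series :: "real \<Rightarrow> real" where
  "sinc_series z = (\<Sum>n. sin_coeff (Suc n) * z ^ n)"

lemma summable_sinc: "summable (\<lambda>n. sin_coeff (Suc n) * z ^ n :: real)"
proof -
  have 1: "summable (\<lambda>n. sin_coeff (Suc n) * x ^ n :: real)" if "x \<noteq> 0" for x
  proof -
    have "summable (\<lambda>n. sin_coeff n * x ^ n)" using sums_summable[OF sin_converges[of x]] by simp
    then have "summable (\<lambda>n. sin_coeff (Suc n) * x ^ Suc n)" using summable_Suc_iff[of "\<lambda>n. sin_coeff n * x ^ n"] by blast
    then have "summable (\<lambda>n. (sin_coeff (Suc n) * x ^ Suc n) * (1 / x))" by (rule summable_mult2)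
    then show ?thesis using that by (simp add: field_simps)
  qed
  show ?thesis by (rule powser_inside[OF 1[of "\<bar>z\<bar> + 1"]]) auto
qed

lemma smooth_sinc: "smooth UNIV sinc_series"
  unfolding sinc_series_def by (rule smooth_power_series[OF summable_sinc])

lemma sinc_series_mult: "z * sinc_series z = sin z"
proof -
  have "(\<lambda>n. sin_coeff n * z ^ n) sums sin z" using sin_converges[of z] by simp
  then have "(\<lambda>n. sin_coeff (Suc n) * z ^ Suc n) sums sin z"
    using sums_Suc_iff[of "\<lambda>n. sin_coeff n * z ^ n" "sin z"] by simp
  moreover have "(\<lambda>n. z * (sin_coeff (Suc n) * z ^ n)) sums (z * sinc_series z)"
    unfolding sinc_series_def by (intro sums_mult summable_sums summable_sinc)
  ultimately show ?thesis by (simp add: mult.left_commute sums_unique2)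
qed

lemma sinc_series_0: "sinc_series 0 = 1"
  by (simp add: sinc_series_def powser_zero sin_coeff_def)

definition sn :: "real \<Rightarrow> real \<Rightarrow> real" where
  "sn t x = (if t = 0 then x else sin (t * x) / t)"

lemma sn_sinc: "sn t x = x * sinc_series (t * x)"
  using sinc_series_mult[of "t * x"] by (auto simp: sn_def sinc_series_0 field_simps)

lemma smooth_sn:
  assumes "open U" "smooth U f" "smooth U g"
  shows "smooth U (\<lambda>z. sn (f z) (g z))"
  unfolding sn_sinc
  by (intro smooth_mult assms smooth_compose[OF assms(1) open_UNIV _ smooth_sinc]) auto

lemma sn_pos:
  assumes "0 < x" "\<bar>t\<bar> * x < pi"
  shows "0 < sn t x"
proof (cases "t = 0")
  case False
  have "0 < sin (\<bar>t\<bar> * x)" by (rule sin_gt_zero) (use assms False in auto)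
  moreover have "sn t x = sin (\<bar>t\<bar> * x) / \<bar>t\<bar>" using False by (simp add: sn_def abs_if)
  ultimately show ?thesis using False by simp
qed (use assms in \<open>simp add: sn_def\<close>)

lemma sn_zero [simp]: "sn t 0 = 0"
  by (simp add: sn_def)

lemma sn_scale: "c \<noteq> 0 \<Longrightarrow> sn (t * c) (x / c) = sn t x / c"
  by (simp add: sn_def)

lemma DERIV_sn: "(sn t has_real_derivative cos (t * x)) (at x)"
  by (cases "t = 0") (auto simp: sn_def[abs_def] intro!: derivative_eq_intros)

lemma sin_mult_sn: "sin (\<bar>t\<bar> * x) = \<bar>t\<bar> * sn t x" if "t \<noteq> 0"
  using that by (simp add: sn_def abs_if)


subsection \<open>The logarithmic derivatives\<close>

text \<open>With \<open>\<theta>\<^sub>l = pi / 2 * bary y l\<close> the function is the \<open>(n + 1)\<close>-st root of the product of all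
  \<open>sin \<theta>\<^sub>l\<close>. In the coordinates \<open>(t, a)\<close> at a vertex, \<open>fun_blow\<close> is \<open>F / t\<close> and \<open>log_slope l\<close> is
  \<open>t\<close> times the cotangent of \<open>\<theta>\<^sub>l\<close>; both are regular at \<open>t = 0\<close>.\<close>

definition fun_blow :: "'n::finite option \<Rightarrow> real \<Rightarrow> real^'n \<Rightarrow> real" where
  "fun_blow i t a = exp (((\<Sum>l\<in>- {i}. ln (sn t (uvec l \<bullet> a))) + ln (cos (t * (uvec i \<bullet> a)))) / CARD('n))"

definition log_slope :: "'n::finite option \<Rightarrow> real \<Rightarrow> real^'n \<Rightarrow> 'n option \<Rightarrow> real" where
  "log_slope i t a l = (if l = i then - t * sin (t * (uvec i \<bullet> a)) / cos (t * (uvec i \<bullet> a))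
     else cos (t * (uvec l \<bullet> a)) / sn t (uvec l \<bullet> a))"

definition slope :: "'n::finite option \<Rightarrow> real \<times> (real^'n) \<Rightarrow> 'n option \<Rightarrow> real" where
  "slope i z l = fun_blow i (fst z) (snd z) / CARD('n) * log_slope i (fst z) (snd z) l"

definition grad_blow :: "'n::finite option \<Rightarrow> real \<times> (real^'n) \<Rightarrow> real^'n" where
  "grad_blow i z = (\<Sum>l\<in>UNIV. slope i z l *\<^sub>R uvec l)"

lemma fun_blow_pos: "0 < fun_blow i t a"
  by (simp add: fun_blow_def)

lemma open_cone_dom: "open (cone_dom {} i :: (real \<times> (real^'n::finite)) set)"
proof -
  have "cone_dom {} i = (\<Inter>l\<in>- {i}. {z :: real \<times> (real^'n). 0 < uvec l \<bullet> snd z}) \<inter>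
    {z. \<bar>fst z\<bar> * - (uvec i \<bullet> snd z) < pi / 2}" by (auto simp: cone_dom_def)
  then show ?thesis
    by (simp only:) (intro open_Int open_INT ballI open_Collect_less continuous_intros; simp)
qed

lemma cone_dom_bounds:
  fixes a :: "real^'n::finite"
  assumes "(t, a) \<in> cone_dom {} i"
  shows "l \<noteq> i \<Longrightarrow> 0 < uvec l \<bullet> a" "l \<noteq> i \<Longrightarrow> \<bar>t\<bar> * (uvec l \<bullet> a) < pi / 2"
    "\<bar>t * (uvec i \<bullet> a)\<bar> < pi / 2" "uvec i \<bullet> a \<le> 0"
proof -
  have p: "0 < uvec l \<bullet> a" if "l \<noteq> i" for l using assms that by (auto simp: cone_dom_def)
  show "l \<noteq> i \<Longrightarrow> 0 < uvec l \<bullet> a" using p .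
  have 0: "0 \<le> (\<Sum>l\<in>- {i}. uvec l \<bullet> a)" by (rule sum_nonneg) (use p in \<open>auto intro: less_imp_le\<close>)
  then show n: "uvec i \<bullet> a \<le> 0" using uvec_inner_eq_sum[of i a] by simp
  have b: "\<bar>t\<bar> * - (uvec i \<bullet> a) < pi / 2" using assms by (auto simp: cone_dom_def)
  then show "\<bar>t * (uvec i \<bullet> a)\<bar> < pi / 2" using n by (simp add: abs_mult)
  show "\<bar>t\<bar> * (uvec l \<bullet> a) < pi / 2" if "l \<noteq> i"
  proof -
    have "uvec l \<bullet> a \<le> - (uvec i \<bullet> a)" unfolding uvec_inner_eq_sum
      by (rule member_le_sum) (use p that in \<open>auto intro: less_imp_le\<close>)
    then have "\<bar>t\<bar> * (uvec l \<bullet> a) \<le> \<bar>t\<bar> * - (uvec i \<bullet> a)" by (rule mult_left_mono) simp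
    then show ?thesis using b by linarith
  qed
qed

lemma cone_dom_pos:
  fixes a :: "real^'n::finite"
  assumes "(t, a) \<in> cone_dom {} i"
  shows "l \<noteq> i \<Longrightarrow> 0 < sn t (uvec l \<bullet> a)" "0 < cos (t * (uvec i \<bullet> a))" "l \<noteq> i \<Longrightarrow> 0 < cos (t * (uvec l \<bullet> a))"
proof -
  note b = cone_dom_bounds[OF assms]
  show "0 < sn t (uvec l \<bullet> a)" if "l \<noteq> i" by (rule sn_pos) (use b(1,2)[OF that] pi_gt_zero in linarith)+
  show "0 < cos (t * (uvec i \<bullet> a))" by (rule cos_gt_zero_pi) (use b(3) in auto)
  show "0 < cos (t * (uvec l \<bullet> a))" if "l \<noteq> i"
  proof (rule cos_gt_zero_pi)
    have "\<bar>t * (uvec l \<bullet> a)\<bar> < pi / 2" using b(1,2)[OF that] by (simp add: abs_mult)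
    then show "- (pi / 2) < t * (uvec l \<bullet> a)" "t * (uvec l \<bullet> a) < pi / 2" by (auto simp: abs_less_iff)
  qed
qed

lemma smooth_fun_blow: "smooth (cone_dom {} i) (\<lambda>z. fun_blow i (fst z) (snd z))"
  unfolding fun_blow_def
  by (intro smooth_exp_comp smooth_intros smooth_ln_comp smooth_cos_comp smooth_sn open_cone_dom)
    (use cone_dom_pos[of "fst z" "snd z" i for z] in auto)

lemma smooth_log_slope: "smooth (cone_dom {} i) (\<lambda>z. log_slope i (fst z) (snd z) l)"
proof (cases "l = i")
  case True
  show ?thesis unfolding log_slope_def using True
    by (simp del: minus_mult_left[symmetric], intro smooth_intros smooth_sin_comp smooth_cos_comp open_cone_dom)
      (use cone_dom_pos(2)[of "fst z" "snd z" i for z] in fastforce)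
next
  case False
  show ?thesis unfolding log_slope_def using False
    by (simp, intro smooth_intros smooth_sn smooth_cos_comp open_cone_dom)
      (use cone_dom_pos(1)[of "fst z" "snd z" i l for z] in fastforce)
qed

lemma smooth_slope: "smooth (cone_dom {} i) (\<lambda>z. slope i z l)"
  unfolding slope_def
  by (intro smooth_mult smooth_divide smooth_const open_cone_dom smooth_fun_blow smooth_log_slope) simp

lemma smooth_grad_blow: "smooth (cone_dom {} i) (grad_blow i)"
  unfolding grad_blow_def
  by (intro smooth_sum smooth_scaleR smooth_const open_cone_dom smooth_slope)

lemma has_derivative_fun_blow:
  fixes a :: "real^'n::finite"
  assumes "(t, a) \<in> cone_dom {} i"
  shows "((\<lambda>a. fun_blow i t a) has_derivative
    (\<lambda>v. fun_blow i t a / CARD('n) * (\<Sum>l\<in>UNIV. log_slope i t a l * (uvec l \<bullet> v)))) (at a)"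
proof -
  note p = cone_dom_pos[OF assms]
  have 1: "((\<lambda>a. ln (sn t (uvec l \<bullet> a))) has_derivative (\<lambda>v. log_slope i t a l * (uvec l \<bullet> v))) (at a)"
    if "l \<noteq> i" for l
  proof -
    have "((\<lambda>a. sn t (uvec l \<bullet> a)) has_derivative (\<lambda>v. cos (t * (uvec l \<bullet> a)) * (uvec l \<bullet> v))) (at a)"
      using DERIV_sn[of t "uvec l \<bullet> a", unfolded has_field_derivative_def]
      by (rule has_derivative_compose[rotated]) (auto intro!: derivative_eq_intros)
    from has_derivative_ln[OF p(1)[OF that] this] show ?thesis using that
      by (simp add: log_slope_def divide_inverse mult_ac)
  qed
  have 2: "((\<lambda>a. ln (cos (t * (uvec i \<bullet> a)))) has_derivative (\<lambda>v. log_slope i t a i * (uvec i \<bullet> v))) (at a)"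
    using p(2) by (auto intro!: derivative_eq_intros simp: log_slope_def field_simps)
  have 3: "(\<Sum>l\<in>UNIV. f l) = (\<Sum>l\<in>- {i}. f l) + f i" for f :: "'n option \<Rightarrow> real"
    by (subst sum.remove[of UNIV i]) (auto simp: Compl_eq_Diff_UNIV)
  show ?thesis unfolding fun_blow_def
    by (rule derivative_eq_intros has_derivative_sum refl 1 2 | simp)+
      (auto simp: 3 fun_eq_iff divide_inverse algebra_simps)
qed

text \<open>The Riccati equation of the cotangent, uniformly in \<open>t\<close> and in \<open>l\<close>.\<close>

lemma has_derivative_log_slope:
  fixes a :: "real^'n::finite"
  assumes "(t, a) \<in> cone_dom {} i"
  shows "((\<lambda>a. log_slope i t a l) has_derivative (\<lambda>v. - ((log_slope i t a l)\<^sup>2 + t\<^sup>2) * (uvec l \<bullet> v))) (at a)"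
proof (cases "l = i")
  case True
  have "((\<lambda>x. - t * sin (t * x) / cos (t * x)) has_real_derivative - ((- t * sin (t * x) / cos (t * x))\<^sup>2 + t\<^sup>2)) (at x)"
    if "0 < cos (t * x)" for x
    using that by (auto intro!: derivative_eq_intros simp: field_simps power2_eq_square)
  from this[OF cone_dom_pos(2)[OF assms], unfolded has_field_derivative_def]
  have "((\<lambda>a. - t * sin (t * (uvec i \<bullet> a)) / cos (t * (uvec i \<bullet> a))) has_derivative
      (\<lambda>v. - ((- t * sin (t * (uvec i \<bullet> a)) / cos (t * (uvec i \<bullet> a)))\<^sup>2 + t\<^sup>2) * (uvec i \<bullet> v))) (at a)"
    by (rule has_derivative_compose[rotated]) (auto intro!: derivative_eq_intros)
  then show ?thesis using True by (simp add: log_slope_def)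
next
  case False
  have "((\<lambda>x. cos (t * x) / sn t x) has_real_derivative - ((cos (t * x) / sn t x)\<^sup>2 + t\<^sup>2)) (at x)"
    if "0 < sn t x" for x
  proof -
    have e: "t * sin (t * x) = t\<^sup>2 * sn t x" by (auto simp: sn_def power2_eq_square)
    have "((\<lambda>x. cos (t * x) / sn t x) has_real_derivative
      (- (t * sin (t * x)) * sn t x - cos (t * x) * cos (t * x)) / (sn t x * sn t x)) (at x)"
      using that DERIV_sn[of t x] by (auto intro!: derivative_eq_intros)
    moreover have "(- (t * sin (t * x)) * sn t x - cos (t * x) * cos (t * x)) / (sn t x * sn t x) =
       - ((cos (t * x) / sn t x)\<^sup>2 + t\<^sup>2)"
      unfolding e using that by (simp add: field_simps power2_eq_square)
    ultimately show ?thesis by simp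
  qed
  from this[OF cone_dom_pos(1)[OF assms False], unfolded has_field_derivative_def]
  have "((\<lambda>a. cos (t * (uvec l \<bullet> a)) / sn t (uvec l \<bullet> a)) has_derivative
      (\<lambda>v. - ((cos (t * (uvec l \<bullet> a)) / sn t (uvec l \<bullet> a))\<^sup>2 + t\<^sup>2) * (uvec l \<bullet> v))) (at a)"
    by (rule has_derivative_compose[rotated]) (auto intro!: derivative_eq_intros)
  then show ?thesis using False by (simp add: log_slope_def)
qed

lemma log_slope_nonneg:
  fixes a :: "real^'n::finite"
  assumes "(t, a) \<in> cone_dom {} i"
  shows "0 \<le> log_slope i t a l"
proof (cases "l = i")
  case True
  have "t * sin (t * (uvec i \<bullet> a)) \<le> 0"
  proof (cases "t = 0")
    case False
    have "0 \<le> sin (\<bar>t\<bar> * - (uvec i \<bullet> a))"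
    proof (rule sin_ge_zero)
      have "\<bar>t\<bar> * - (uvec i \<bullet> a) = \<bar>t * (uvec i \<bullet> a)\<bar>"
        using cone_dom_bounds(4)[OF assms] by (simp add: abs_mult)
      then show "0 \<le> \<bar>t\<bar> * - (uvec i \<bullet> a)" "\<bar>t\<bar> * - (uvec i \<bullet> a) \<le> pi"
        using cone_dom_bounds(3)[OF assms] by simp_all
    qed
    then have "0 \<le> \<bar>t\<bar> * sin (\<bar>t\<bar> * - (uvec i \<bullet> a))" by (rule mult_nonneg_nonneg[OF abs_ge_zero])
    then show ?thesis by (cases "t > 0") auto
  qed simp
  then show ?thesis using True cone_dom_pos(2)[OF assms] by (simp add: log_slope_def divide_nonpos_pos)
next
  case False
  then show ?thesis using cone_dom_pos(1,3)[OF assms False] by (simp add: log_slope_def)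
qed

subsection \<open>Homogeneity\<close>

lemma card_Compl_single: "card (- {i :: 'n::finite option}) = CARD('n)"
  by (simp add: Compl_eq_Diff_UNIV card_Diff_singleton)

lemma fun_blow_scale:
  fixes a :: "real^'n::finite"
  assumes "(t, a) \<in> cone_dom {} i" "0 < c"
  shows "fun_blow i (t * c) ((1 / c) *\<^sub>R a) = fun_blow i t a / c"
proof -
  have "(\<Sum>l\<in>- {i}. ln (sn (t * c) ((uvec l \<bullet> a) / c))) = (\<Sum>l\<in>- {i}. ln (sn t (uvec l \<bullet> a)) - ln c)"
  proof (intro sum.cong refl)
    fix l assume "l \<in> - {i}"
    then have "0 < sn t (uvec l \<bullet> a)" using cone_dom_pos(1)[OF assms(1)] by simp
    moreover have "sn (t * c) ((uvec l \<bullet> a) / c) = sn t (uvec l \<bullet> a) / c" using assms(2) by (intro sn_scale) simp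
    ultimately show "ln (sn (t * c) ((uvec l \<bullet> a) / c)) = ln (sn t (uvec l \<bullet> a)) - ln c"
      using assms(2) ln_divide_pos by simp
  qed
  also have "\<dots> = (\<Sum>l\<in>- {i}. ln (sn t (uvec l \<bullet> a))) - CARD('n) * ln c"
    by (simp add: sum_subtractf card_Compl_single)
  finally have "fun_blow i (t * c) ((1 / c) *\<^sub>R a) =
    exp (((\<Sum>l\<in>- {i}. ln (sn t (uvec l \<bullet> a))) + ln (cos (t * (uvec i \<bullet> a)))) / CARD('n) - ln c)"
    using assms(2) by (simp add: fun_blow_def diff_divide_distrib add_divide_distrib)
  then show ?thesis using assms(2) by (simp add: fun_blow_def exp_diff)
qed

lemma log_slope_scale:
  assumes "0 < c"
  shows "log_slope i (t * c) ((1 / c) *\<^sub>R a) l = c * log_slope i t a l"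
  using assms by (simp add: log_slope_def sn_scale)

lemma slope_scale:
  assumes "(t, a) \<in> cone_dom {} i" "0 < c"
  shows "slope i (t * c, (1 / c) *\<^sub>R a) l = slope i (t, a) l"
  using fun_blow_scale[OF assms] log_slope_scale[OF assms(2), of i t a l] assms(2) by (simp add: slope_def)

subsection \<open>The gradient\<close>

lemma Fplus_bary:
  fixes y :: "real^'n::finite"
  shows "Fplus y = root CARD('n) (\<Prod>l\<in>UNIV. sin (pi / 2 * bary y l))"
proof -
  have "(\<Prod>l\<in>UNIV. sin (pi / 2 * bary y l)) = sin (pi / 2 * bary y None) * (\<Prod>j\<in>UNIV. sin (pi / 2 * bary y (Some j)))"
    by (simp add: UNIV_option_conv prod.reindex)
  moreover have "pi / 2 * bary y None = pi / 2 - (\<Sum>j\<in>UNIV. y $ j)"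
  proof -
    have "(\<Sum>j\<in>UNIV. 2 * y $ j / pi) = 2 / pi * (\<Sum>j\<in>UNIV. y $ j)"
      by (simp add: sum_distrib_left sum_divide_distrib)
    then show ?thesis by (simp add: bary_def field_simps)
  qed
  moreover have "pi / 2 * bary y (Some j) = y $ j" for j by (simp add: bary_def)
  ultimately show ?thesis unfolding Fplus_def cos_sin_eq by (simp only: of_real_eq_id id_apply)
qed

lemma bary_blow:
  fixes a :: "real^'n::finite"
  shows "pi / 2 * bary (pvert i + s *\<^sub>R a) l = (if l = i then pi / 2 else 0) + s * (uvec l \<bullet> a)"
  by (simp add: bary_add bary_pvert field_simps)

lemma fun_blow_root:
  fixes a :: "real^'n::finite"
  assumes "(t, a) \<in> cone_dom {} i"
  shows "fun_blow i t a = root CARD('n) ((\<Prod>l\<in>- {i}. sn t (uvec l \<bullet> a)) * cos (t * (uvec i \<bullet> a)))"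
proof -
  let ?N = "CARD('n)" and ?s = "\<lambda>l. sn t (uvec l \<bullet> a)"
  note p = cone_dom_pos[OF assms]
  define X where "X = (\<Prod>l\<in>- {i}. ?s l) * cos (t * (uvec i \<bullet> a))"
  have P: "0 < (\<Prod>l\<in>- {i}. ?s l)" by (rule prod_pos) (use p in auto)
  then have X: "0 < X" using p by (simp add: X_def)
  then have "root ?N X = X powr (1 / ?N)" by (simp add: root_powr_inverse)
  also have "\<dots> = exp (ln X / ?N)" using X by (simp add: powr_def)
  also have "ln X = (\<Sum>l\<in>- {i}. ln (?s l)) + ln (cos (t * (uvec i \<bullet> a)))"
  proof -
    have "ln (\<Prod>l\<in>- {i}. ?s l) = (\<Sum>l\<in>- {i}. ln (?s l))"
      by (rule ln_prod) (use p(1) in \<open>metis ComplD finite less_irrefl singletonI\<close>)+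
    then show ?thesis unfolding X_def using ln_mult_pos[OF P p(2)] by simp
  qed
  finally show ?thesis by (simp add: fun_blow_def X_def)
qed

lemma Fplus_blow:
  fixes a :: "real^'n::finite"
  assumes "(t, a) \<in> cone_dom {} i" "t \<noteq> 0"
  shows "Fplus (pvert i + \<bar>t\<bar> *\<^sub>R a) = \<bar>t\<bar> * fun_blow i t a"
proof -
  let ?N = "CARD('n)" and ?s = "\<lambda>l. sn t (uvec l \<bullet> a)"
  have ci: "sin (pi / 2 + \<bar>t\<bar> * (uvec i \<bullet> a)) = cos (t * (uvec i \<bullet> a))"
    by (simp add: sin_add abs_if)
  have "(\<Prod>l\<in>UNIV. sin (pi / 2 * bary (pvert i + \<bar>t\<bar> *\<^sub>R a) l)) =
    sin (pi / 2 + \<bar>t\<bar> * (uvec i \<bullet> a)) * (\<Prod>l\<in>- {i}. sin (\<bar>t\<bar> * (uvec l \<bullet> a)))"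
    unfolding bary_blow by (subst prod.remove[of UNIV i]) (auto simp: Compl_eq_Diff_UNIV intro!: prod.cong)
  also have "\<dots> = cos (t * (uvec i \<bullet> a)) * (\<Prod>l\<in>- {i}. \<bar>t\<bar> * ?s l)"
    using assms(2) by (simp add: ci sin_mult_sn)
  also have "\<dots> = \<bar>t\<bar> ^ ?N * ((\<Prod>l\<in>- {i}. ?s l) * cos (t * (uvec i \<bullet> a)))"
    by (simp add: prod.distrib card_Compl_single)
  finally have "Fplus (pvert i + \<bar>t\<bar> *\<^sub>R a) = root ?N (\<bar>t\<bar> ^ ?N) * fun_blow i t a"
    by (simp add: Fplus_bary real_root_mult fun_blow_root[OF assms(1)])
  then show ?thesis by (simp add: real_root_power_cancel)
qed

definition grad_simplex :: "real^'n::finite \<Rightarrow> real^'n" where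
  "grad_simplex y = (\<Sum>l\<in>UNIV. (Fplus y / CARD('n) * cot (pi / 2 * bary y l)) *\<^sub>R uvec l)"

lemma log_slope_cot:
  fixes a :: "real^'n::finite"
  assumes "t \<noteq> 0"
  shows "log_slope i t a l = \<bar>t\<bar> * cot (pi / 2 * bary (pvert i + \<bar>t\<bar> *\<^sub>R a) l)"
  unfolding bary_blow using assms
  by (cases "t > 0") (auto simp: log_slope_def cot_def sn_def sin_add cos_add sin_diff cos_diff abs_if)

lemma slope_cot:
  fixes a :: "real^'n::finite"
  assumes "(t, a) \<in> cone_dom {} i" "t \<noteq> 0"
  shows "slope i (t, a) l = Fplus (pvert i + \<bar>t\<bar> *\<^sub>R a) / CARD('n) * cot (pi / 2 * bary (pvert i + \<bar>t\<bar> *\<^sub>R a) l)"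
  by (simp add: slope_def log_slope_cot[OF assms(2)] Fplus_blow[OF assms])

lemma grad_blow_simplex:
  fixes a :: "real^'n::finite"
  assumes "(t, a) \<in> cone_dom {} i" "t \<noteq> 0"
  shows "grad_blow i (t, a) = grad_simplex (pvert i + \<bar>t\<bar> *\<^sub>R a)"
  by (simp add: grad_blow_def grad_simplex_def slope_cot[OF assms])

lemma open_rel_interior_simplex: "open (rel_interior (face {}) :: (real^'n::finite) set)"
proof -
  have "rel_interior (face {}) = (\<lambda>y :: real^'n. (1, y)) -` cone_dom {} None"
    using cone_dom_nonzero_iff[of 1 None "{}"] by (auto simp: pvert_def)
  moreover have "open ((\<lambda>y :: real^'n. (1 :: real, y)) -` cone_dom {} None)"
    by (rule open_vimage[OF open_cone_dom]) (intro continuous_intros)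
  ultimately show ?thesis by simp
qed

lemma has_derivative_Fplus:
  fixes y :: "real^'n::finite"
  assumes "y \<in> rel_interior (face {})"
  shows "(Fplus has_derivative (\<lambda>v. grad_simplex y \<bullet> v)) (at y)"
proof -
  have c: "(1, x) \<in> cone_dom {} None \<longleftrightarrow> x \<in> rel_interior (face {})" for x :: "real^'n"
    using cone_dom_nonzero_iff[of 1 None "{}" x] by (simp add: pvert_def)
  have F: "fun_blow None 1 x = Fplus x" if "x \<in> rel_interior (face {})" for x :: "real^'n"
    using Fplus_blow[of 1 x None] c that by (simp add: pvert_def)
  have "fun_blow None 1 y / CARD('n) * (\<Sum>l\<in>UNIV. log_slope None 1 y l * (uvec l \<bullet> v)) = grad_simplex y \<bullet> v" for v
    using log_slope_cot[of 1 None y]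
    by (simp add: grad_simplex_def F[OF assms] pvert_def inner_sum_left sum_distrib_left mult_ac)
  then have "((\<lambda>a. fun_blow None 1 a) has_derivative (\<lambda>v. grad_simplex y \<bullet> v)) (at y)"
    using has_derivative_fun_blow[of 1 y None] c assms by simp
  then show ?thesis
    by (rule has_derivative_transform_within_open[OF _ open_rel_interior_simplex assms]) (rule F)
qed

lemma neg_not_face:
  fixes y :: "real^'n::finite"
  assumes "y \<in> rel_interior (face {})"
  shows "- y \<notin> face {}"
proof
  assume n: "- y \<in> face {}"
  have y: "y \<in> face {}" using assms rel_interior_face_subset by blast
  have "y $ m = 0" for m using face_coordinates(1)[OF y, of m] face_coordinates(1)[OF n, of m] by simp
  then have "bary y (Some m) = 0" for m by (simp add: bary_def)
  then show False using assms unfolding rel_interior_face_iff by (metis empty_iff less_irrefl)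
qed

lemma Flift_interior:
  fixes y :: "real^'n::finite"
  assumes "y \<in> rel_interior (face {})"
  shows "Flift y = Fplus y" "Flift (- y) = - Fplus y"
  using assms rel_interior_face_subset neg_not_face[OF assms] by (auto simp: Flift_def)

lemma gradF_tor:
  fixes y :: "real^'n::finite"
  assumes y: "y \<in> rel_interior (face {})" "t \<noteq> 0"
  shows "gradF (tor (sgn t *\<^sub>R y)) = grad_simplex y"
proof -
  have "card (- {} :: 'n option set) \<ge> 2" by (simp add: Suc_leI)
  then have n: "y \<noteq> pvert l" for l using rel_interior_face_not_pvert[OF y(1)] by blast
  have yf: "y \<in> face {}" using y rel_interior_face_subset by blast
  have l: "lift (tor (sgn t *\<^sub>R y)) = sgn t *\<^sub>R y"
    using lift_tor[OF yf n] y(2) by (auto simp: sgn_real_def)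
  have s: "sgn t * sgn t = 1" using y(2) by (simp add: sgn_mult_self_eq)
  have "((\<lambda>s. Flift (sgn t *\<^sub>R y + s *\<^sub>R axis i 1)) has_real_derivative grad_simplex y $ i) (at 0)" for i
  proof -
    have o: "open {s. y + (sgn t * s) *\<^sub>R axis i 1 \<in> rel_interior (face {})}"
      using open_vimage[OF open_rel_interior_simplex, of "\<lambda>s. y + (sgn t * s) *\<^sub>R axis i 1"]
      by (simp add: vimage_def continuous_intros)
    have "((\<lambda>s. Fplus (y + (sgn t * s) *\<^sub>R axis i 1)) has_derivative (\<lambda>s. grad_simplex y \<bullet> ((sgn t * s) *\<^sub>R axis i 1))) (at 0)"
      by (rule has_derivative_compose[of "\<lambda>s. y + (sgn t * s) *\<^sub>R axis i 1" _ 0 UNIV Fplus])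
        (use has_derivative_Fplus[OF y(1)] in \<open>auto intro!: derivative_eq_intros\<close>)
    then have "((\<lambda>s. sgn t * Fplus (y + (sgn t * s) *\<^sub>R axis i 1)) has_derivative
        (\<lambda>s. sgn t * (grad_simplex y \<bullet> ((sgn t * s) *\<^sub>R axis i 1)))) (at 0)"
      by (rule has_derivative_mult_right)
    moreover have "(\<lambda>s. sgn t * (grad_simplex y \<bullet> ((sgn t * s) *\<^sub>R axis i 1))) = (*) (grad_simplex y $ i)"
    proof
      fix r
      have "sgn t * (grad_simplex y \<bullet> ((sgn t * r) *\<^sub>R axis i 1)) = (sgn t * sgn t) * (grad_simplex y $ i * r)"
        by (simp add: inner_axis)
      then show "sgn t * (grad_simplex y \<bullet> ((sgn t * r) *\<^sub>R axis i 1)) = grad_simplex y $ i * r"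
        unfolding s by simp
    qed
    ultimately have "((\<lambda>s. sgn t * Fplus (y + (sgn t * s) *\<^sub>R axis i 1)) has_real_derivative grad_simplex y $ i) (at 0)"
      unfolding has_field_derivative_def by (simp only:)
    then show ?thesis
    proof (rule has_field_derivative_transform_within_open[OF _ o])
      show "0 \<in> {s. y + (sgn t * s) *\<^sub>R axis i 1 \<in> rel_interior (face {})}" using y by simp
      fix s assume "s \<in> {s. y + (sgn t * s) *\<^sub>R axis i 1 \<in> rel_interior (face {})}"
      then show "sgn t * Fplus (y + (sgn t * s) *\<^sub>R axis i 1) = Flift (sgn t *\<^sub>R y + s *\<^sub>R axis i 1)"
        using Flift_interior[of "y + (sgn t * s) *\<^sub>R axis i 1"] y(2)
        by (cases "t > 0") auto
    qed
  qed
  then have "deriv (\<lambda>s. Flift (sgn t *\<^sub>R y + s *\<^sub>R axis i 1)) 0 = grad_simplex y $ i" for i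
    by (rule DERIV_imp_deriv)
  then show ?thesis by (simp add: gradF_def l vec_eq_iff)
qed


section \<open>The function and its gradient on the blow up\<close>

lemma proj_blow_par: "proj (blow_par J i (t, a)) = tor (pvert i + t *\<^sub>R a)"
  by (simp add: blow_par_def)

lemma IntE_I:
  assumes "y \<in> rel_interior (face J)" "t \<noteq> 0"
  shows "tor (sgn t *\<^sub>R y) \<in> IntE J"
proof (cases "t > 0")
  case True
  then show ?thesis using assms by (auto simp: IntE_def)
next
  case False
  then show ?thesis using assms by (auto simp: IntE_def tor_uminus image_image)
qed

lemma IntE_E:
  assumes "q \<in> IntE J"
  obtains t y where "t \<noteq> 0" "y \<in> rel_interior (face J)" "q = tor (sgn t *\<^sub>R y)"
proof -
  from assms consider y where "y \<in> rel_interior (face J)" "q = tor y" | y where "y \<in> rel_interior (face J)" "q = tneg (tor y)"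
    unfolding IntE_def by blast
  then show ?thesis
  proof cases
    case 1
    then show ?thesis using that[of 1 y] by simp
  next
    case 2
    then show ?thesis using that[of "- 1" y] by (simp add: tor_uminus)
  qed
qed

lemma Pt_IntE_chart:
  fixes J :: "'n::finite option set"
  assumes "q \<in> IntE J" "i \<notin> J"
  obtains t a where "t \<noteq> 0" "(t, a) \<in> cone_dom J i" "Pt q = blow_par J i (t, a)"
proof -
  obtain t y where t: "t \<noteq> 0" "y \<in> rel_interior (face J)" "q = tor (sgn t *\<^sub>R y)"
    using IntE_E[OF assms(1)] .
  let ?a = "(1 / \<bar>t\<bar>) *\<^sub>R (y - pvert i)"
  have y: "pvert i + \<bar>t\<bar> *\<^sub>R ?a = y" using t(1) by simp
  have "(t, ?a) \<in> cone_dom J i" using cone_dom_nonzero_iff[OF t(1) assms(2), of ?a] t(2) y by simp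
  moreover have "Pt q = blow_par J i (t, ?a)" unfolding blow_par_nonzero[OF t(1)] y using t(3) by simp
  ultimately show ?thesis using that t(1) by blast
qed

lemma blow_par_IntE:
  fixes J :: "'n::finite option set"
  assumes "(t, a) \<in> cone_dom J i" "t \<noteq> 0" "i \<notin> J"
  shows "blow_par J i (t, a) \<in> Pt ` IntE J"
  unfolding blow_par_nonzero[OF assms(2)]
  by (intro imageI IntE_I assms(2)) (use cone_dom_nonzero_iff[OF assms(2,3)] assms(1) in blast)

lemma two_le_card_simplex: "2 \<le> card (- {} :: 'n::finite option set)"
  by (simp add: Suc_leI)

lemma lift_blow:
  fixes J :: "'n::finite option set"
  assumes "(t, a) \<in> cone_dom J i" "t \<noteq> 0" "i \<notin> J" "2 \<le> card (- J)"
  shows "lift (proj (blow_par J i (t, a))) = sgn t *\<^sub>R (pvert i + \<bar>t\<bar> *\<^sub>R a)"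
proof -
  let ?y = "pvert i + \<bar>t\<bar> *\<^sub>R a"
  have y: "?y \<in> rel_interior (face J)" using cone_dom_nonzero_iff[OF assms(2,3)] assms(1) by blast
  have "?y \<in> face {}" "\<And>l. ?y \<noteq> pvert l"
    using y rel_interior_face_subset rel_interior_face_not_pvert[OF y assms(4)] by blast+
  from lift_tor[OF this] show ?thesis
    unfolding blow_par_nonzero[OF assms(2)] using assms(2) by (auto simp: sgn_real_def)
qed

lemma Fplus_pvert: "Fplus (pvert i :: real^'n::finite) = 0"
proof -
  obtain l :: "'n option" where l: "l \<noteq> i" by (metis option.distinct(1) option.exhaust)
  have "(\<Prod>l\<in>UNIV. sin (pi / 2 * bary (pvert i :: real^'n) l)) = 0"
    by (rule prod_zero) (use l in \<open>auto simp: bary_pvert intro!: bexI[of _ l]\<close>)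
  then show ?thesis by (simp add: Fplus_bary)
qed

lemma Flift_pvert: "Flift (pvert i :: real^'n::finite) = 0" "Flift (- pvert i :: real^'n) = 0"
proof -
  show "Flift (pvert i :: real^'n) = 0" by (simp add: Flift_def Fplus_pvert pvert_in_face)
  show "Flift (- pvert i :: real^'n) = 0"
  proof (cases "- pvert i \<in> (face {} :: (real^'n) set)")
    case True
    have "(pvert i :: real^'n) $ m = 0" for m
      using face_coordinates(1)[OF True, of m] face_coordinates(1)[OF pvert_in_face, of i m] by simp
    then have "- pvert i = (pvert i :: real^'n)" by (simp add: vec_eq_iff)
    then show ?thesis using Flift_def Fplus_pvert pvert_in_face by metis
  qed (simp add: Flift_def Fplus_pvert)
qed

lemma F_blow:
  fixes a :: "real^'n::finite"
  assumes "(t, a) \<in> cone_dom {} i"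
  shows "F (proj (blow_par {} i (t, a))) = t * fun_blow i t a"
proof (cases "t = 0")
  case True
  then show ?thesis using lift_tor_pvert[of i] Flift_pvert[of i] by (auto simp: F_def proj_blow_par)
next
  case False
  let ?y = "pvert i + \<bar>t\<bar> *\<^sub>R a"
  have y: "?y \<in> rel_interior (face {})" using cone_dom_nonzero_iff[OF False, of i "{}" a] assms by simp
  have "F (proj (blow_par {} i (t, a))) = sgn t * Fplus ?y"
    using lift_blow[OF assms False _ two_le_card_simplex] Flift_interior[OF y] False
    by (cases "t > 0") (auto simp: F_def)
  also have "\<dots> = t * fun_blow i t a"
    unfolding Fplus_blow[OF assms False] by (simp add: mult.assoc[symmetric] sgn_mult_abs)
  finally show ?thesis .
qed

text \<open>For \<open>t \<noteq> 0\<close> this is the definition of the gradient. Both sides are continuous, which gives the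
  statement at the exceptional points.\<close>

lemma has_derivative_fun:
  fixes a :: "real^'n::finite"
  assumes "(t, a) \<in> cone_dom {} i"
  shows "((\<lambda>z. fst z * fun_blow i (fst z) (snd z)) has_derivative
    (\<lambda>v. grad_blow i (t, a) \<bullet> (fst v *\<^sub>R a + t *\<^sub>R snd v))) (at (t, a))"
proof -
  let ?f = "\<lambda>z. fst z * fun_blow i (fst z) (snd z)"
  have sf: "smooth (cone_dom {} i) ?f"
    by (intro smooth_mult smooth_fst smooth_ident smooth_fun_blow open_cone_dom)
  let ?D = "\<lambda>z. frechet_derivative ?f (at z)" and ?E = "\<lambda>z v. grad_blow i z \<bullet> (fst v *\<^sub>R snd z + fst z *\<^sub>R snd v)"
  have nz: "(?f has_derivative ?E (s, b)) (at (s, b))" if sb: "(s, b) \<in> cone_dom {} i" and s: "s \<noteq> 0" for s b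
  proof -
    define e where "e = sgn s"
    have e: "e * e = 1" "\<bar>s\<bar> = e * s" using s by (auto simp: e_def sgn_mult_self_eq abs_sgn mult.commute)
    let ?y = "\<lambda>z. pvert i + (e * fst z) *\<^sub>R snd z"
    have y: "?y (s, b) \<in> rel_interior (face {})"
      using cone_dom_nonzero_iff[OF s, of i "{}" b] sb e by simp
    have "(?y has_derivative (\<lambda>v. e *\<^sub>R (fst v *\<^sub>R b + s *\<^sub>R snd v))) (at (s, b))"
      by (auto intro!: derivative_eq_intros simp: algebra_simps)
    then have "((\<lambda>z. Fplus (?y z)) has_derivative (\<lambda>v. grad_simplex (?y (s, b)) \<bullet> (e *\<^sub>R (fst v *\<^sub>R b + s *\<^sub>R snd v)))) (at (s, b))"
      using has_derivative_Fplus[OF y] by (rule has_derivative_compose[where f = ?y and g = Fplus])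
    then have "((\<lambda>z. e * Fplus (?y z)) has_derivative
        (\<lambda>v. e * (grad_simplex (?y (s, b)) \<bullet> (e *\<^sub>R (fst v *\<^sub>R b + s *\<^sub>R snd v))))) (at (s, b))"
      by (rule has_derivative_mult_right)
    moreover have "(\<lambda>v. e * (grad_simplex (?y (s, b)) \<bullet> (e *\<^sub>R (fst v *\<^sub>R b + s *\<^sub>R snd v)))) = ?E (s, b)"
    proof
      fix v
      have "e * (grad_simplex (?y (s, b)) \<bullet> (e *\<^sub>R (fst v *\<^sub>R b + s *\<^sub>R snd v))) =
        (e * e) * (grad_simplex (?y (s, b)) \<bullet> (fst v *\<^sub>R b + s *\<^sub>R snd v))" by simp
      then show "e * (grad_simplex (?y (s, b)) \<bullet> (e *\<^sub>R (fst v *\<^sub>R b + s *\<^sub>R snd v))) = ?E (s, b) v"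
        unfolding e(1) using grad_blow_simplex[OF sb s] e(2) by simp
    qed
    ultimately have d: "((\<lambda>z. e * Fplus (?y z)) has_derivative ?E (s, b)) (at (s, b))" by simp
    have o: "open {z \<in> cone_dom {} i. 0 < e * fst z}"
      by (rule open_Collect_positive[OF open_cone_dom]) (intro continuous_intros)
    have m: "(s, b) \<in> {z \<in> cone_dom {} i. 0 < e * fst z}" using s e(2)[symmetric] sb by simp
    have eq: "e * Fplus (?y z) = ?f z" if zm: "z \<in> {z \<in> cone_dom {} i. 0 < e * fst z}" for z
    proof -
      have z: "z \<in> cone_dom {} i" "0 < e * fst z" using zm by auto
      have ez: "e * fst z = \<bar>fst z\<bar>" using z(2) s by (auto simp: e_def sgn_real_def split: if_splits)
      then have "fst z \<noteq> 0" using z(2) by auto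
      then have "Fplus (?y z) = \<bar>fst z\<bar> * fun_blow i (fst z) (snd z)"
        using Fplus_blow[of "fst z" "snd z" i] z(1) ez by simp
      then have "e * Fplus (?y z) = (e * e) * ?f z" unfolding ez[symmetric] by simp
      then show ?thesis using e(1) by simp
    qed
    show ?thesis by (rule has_derivative_transform_within_open[OF d o m eq])
  qed
  have nzD: "?D (s, b) v = ?E (s, b) v" if "(s, b) \<in> cone_dom {} i" "s \<noteq> 0" for s b v
    by (rule fun_cong[OF frechet_derivative_at[OF nz[OF that], symmetric]])
  have "?D (t, a) v = ?E (t, a) v" for v
  proof (cases "t = 0")
    case False
    then show ?thesis by (rule nzD[OF assms])
  next
    case True
    let ?g = "\<lambda>z. ?D z v - ?E z v"
    have "continuous_on (cone_dom {} i) ?g"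
      using smooth_imp_continuous[OF smooth_frechet[OF sf]] smooth_imp_continuous[OF smooth_grad_blow]
      by (intro continuous_intros)
    then have c: "isCont ?g (0, a)" using continuous_on_eq_continuous_at[OF open_cone_dom, of i ?g] assms True by simp
    have "isCont (\<lambda>s :: real. (s, a)) 0" by (intro continuous_intros)
    from isCont_o2[OF this c] have lim: "(\<lambda>s. ?g (s, a)) \<midarrow>0\<rightarrow> ?g (0, a)" unfolding isCont_def .
    have "open ((\<lambda>s. (s, a)) -` cone_dom {} i)"
      by (rule open_vimage[OF open_cone_dom]) (intro continuous_intros)
    then have "\<forall>\<^sub>F s in nhds 0. (s, a) \<in> cone_dom {} i"
      using assms True by (auto simp: eventually_nhds intro!: exI[of _ "(\<lambda>s. (s, a)) -` cone_dom {} i"])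
    then have "\<forall>\<^sub>F s in at 0. (s, a) \<in> cone_dom {} i" unfolding eventually_at_filter by (rule eventually_mono) simp
    moreover have "\<forall>\<^sub>F s :: real in at 0. s \<noteq> 0" by (simp add: eventually_at_filter)
    ultimately have "\<forall>\<^sub>F s in at 0. ?g (s, a) = 0"
    proof eventually_elim
      fix s assume "(s, a) \<in> cone_dom {} i" "s \<noteq> 0"
      from nzD[OF this, of v] show "?g (s, a) = 0" by (simp only: diff_self)
    qed
    then have "(\<lambda>s. ?g (s, a)) \<midarrow>0\<rightarrow> 0" by (rule tendsto_eventually)
    from LIM_unique[OF lim this] show ?thesis using True by simp
  qed
  then have "?D (t, a) = ?E (t, a)" by (rule ext)
  then show ?thesis using smooth_has_derivative[OF sf assms] by (simp only: fst_conv snd_conv)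
qed

subsection \<open>The extension of the gradient\<close>

text \<open>At regular points the slopes are given by the cotangents. At exceptional points two directions of the same
  line differ by a positive factor, and the slopes are homogeneous of degree \<open>0\<close>.\<close>

lemma slope_well_defined:
  fixes a a' :: "real^'n::finite"
  assumes "2 \<le> CARD('n)" "(t, a) \<in> cone_dom {} i" "(t', a') \<in> cone_dom {} i'"
    "blow_par {} i (t, a) = blow_par {} i' (t', a')"
  shows "slope i (t, a) = slope i' (t', a')"
proof
  fix l
  have c: "2 < card (- {} :: 'n option set)" using assms(1) by simp
  from blow_par_eqD[OF assms(2,3) _ _ _ assms(4)] c
  consider "t = 0" "t' = 0" "i = i'" "span {a} = span {a'}" |
    "t \<noteq> 0" "t' \<noteq> 0" "pvert i + \<bar>t\<bar> *\<^sub>R a = pvert i' + \<bar>t'\<bar> *\<^sub>R a'" by auto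
  then show "slope i (t, a) l = slope i' (t', a') l"
  proof cases
    case 1
    then have "a' \<in> span {a}" using span_base[of a' "{a'}"] by auto
    then obtain r where r: "a' = r *\<^sub>R a" by (auto simp: span_singleton)
    have "scale i a > 0" "scale i a' > 0"
      using scale_pos(1)[OF assms(2)] scale_pos(1)[OF assms(3)] two_le_card_simplex 1 by blast+
    then have r0: "0 < r" unfolding r by (simp add: scale_scaleR zero_less_mult_iff)
    then show ?thesis using slope_scale[OF assms(2), of "1 / r" l] 1 r by simp
  next
    case 2
    then show ?thesis using slope_cot[OF assms(2)] slope_cot[OF assms(3)] by simp
  qed
qed

definition ext_grad :: "'n::finite bpoint \<Rightarrow> real^'n" where
  "ext_grad \<xi> = (SOME v. \<exists>i z. z \<in> cone_dom {} i \<and> blow_par {} i z = \<xi> \<and> v = grad_blow i z)"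

lemma ext_grad_eq:
  fixes z :: "real \<times> (real^'n::finite)"
  assumes "2 \<le> CARD('n)" "z \<in> cone_dom {} i"
  shows "ext_grad (blow_par {} i z) = grad_blow i z"
proof -
  have "\<exists>v i' z'. z' \<in> cone_dom {} i' \<and> blow_par {} i' z' = blow_par {} i z \<and> v = grad_blow i' z'"
    using assms(2) by blast
  from someI_ex[OF this] obtain i' z' where 1: "z' \<in> cone_dom {} i'" "blow_par {} i' z' = blow_par {} i z"
    "ext_grad (blow_par {} i z) = grad_blow i' z'"
    unfolding ext_grad_def by blast
  then have "slope i' z' = slope i z"
    using slope_well_defined[of "fst z'" "snd z'" i' "fst z" "snd z" i] assms by simp
  then show ?thesis using 1(3) by (simp add: grad_blow_def)
qed

lemma Emfd_chart: "i \<notin> J \<Longrightarrow> (blow_dom J i, blow_par J i) \<in> Emfd J"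
  by (auto simp: Emfd_def)

lemma Emfd_pointE:
  fixes J :: "'n::finite option set"
  assumes "\<xi> \<in> mpts (Emfd J)"
  obtains i z where "i \<notin> J" "z \<in> blow_dom J i" "\<xi> = blow_par J i z"
  using assms by (auto simp: mpts_def Emfd_def)

lemma blow_dom_cone: "i \<notin> J \<Longrightarrow> z \<in> blow_dom J i \<Longrightarrow> z \<in> cone_dom J i" for J :: "'n::finite option set"
  by (auto simp: blow_dom_eq)

lemma blow_par_mpts:
  fixes J :: "'n::finite option set"
  assumes "z \<in> cone_dom J i" "i \<notin> J" "2 \<le> card (- J)"
  shows "blow_par J i z \<in> mpts (Emfd J)"
  using mptsI[OF Emfd_chart[OF assms(2)] normalize_blow_dom[of "fst z" "snd z" J i]] assms
    blow_par_normalize[of "fst z" "snd z" J i] by simp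

lemma locally_smooth_ext_grad:
  assumes "2 \<le> CARD('n::finite)"
  shows "locally_smooth (Cmfd :: (_, 'n bpoint) mfd) (msub UNIV) ext_grad"
  unfolding locally_smooth_def
proof
  fix \<xi> assume "\<xi> \<in> mpts (Cmfd :: (_, 'n bpoint) mfd)"
  then obtain i z where z: "z \<in> blow_dom {} i" "\<xi> = blow_par {} i z" by (rule Emfd_pointE)
  have "chart_smooth (blow_dom {} i) (blow_par {} i) UNIV id ext_grad z"
    using ext_grad_eq[OF assms] blow_dom_cone[of i "{}"] z(1)
    by (intro chart_smoothI[OF open_cone_dom[of i] _ smooth_grad_blow]) auto
  then show "\<exists>(D, \<phi>)\<in>Cmfd. \<exists>(D', \<psi>)\<in>msub UNIV. \<exists>z\<in>D. \<phi> z = \<xi> \<and> chart_smooth D \<phi> D' \<psi> ext_grad z"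
    using z Emfd_chart[of i "{}"] by (force simp: msub_def)
qed

lemma gradF_blow:
  fixes a :: "real^'n::finite"
  assumes "t \<noteq> 0" "(t, a) \<in> cone_dom {} i" "Pt q = blow_par {} i (t, a)"
  shows "gradF q = grad_blow i (t, a)"
proof -
  have "q = tor (sgn t *\<^sub>R (pvert i + \<bar>t\<bar> *\<^sub>R a))" using assms(3) blow_par_nonzero[OF assms(1), of "{}" i a] by simp
  then show ?thesis
    using gradF_tor[OF _ assms(1)] cone_dom_nonzero_iff[OF assms(1), of i "{}" a] assms(2)
      grad_blow_simplex[OF assms(2,1)] by simp
qed

lemma hmap_spec:
  assumes "2 \<le> CARD('n::finite)"
  shows "smooth_map Cmfd (msub UNIV) (hmap :: 'n bpoint \<Rightarrow> _)" "\<And>q. q \<in> IntC \<Longrightarrow> hmap (Pt q :: 'n bpoint) = gradF q"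
proof -
  have "smooth_map Cmfd (msub UNIV) (ext_grad :: 'n bpoint \<Rightarrow> _)"
    by (intro locally_smooth_imp_smooth_map smooth_atlas_Emfd smooth_atlas_msub locally_smooth_ext_grad
        two_le_card_simplex assms)
  moreover have "ext_grad (Pt q :: 'n bpoint) = gradF q" if q: "q \<in> IntC" for q
  proof -
    obtain t a where "t \<noteq> 0" "(t, a) \<in> cone_dom {} None" "Pt q = blow_par {} None (t, a)"
      using Pt_IntE_chart[OF q, of None] by auto
    then show ?thesis using gradF_blow ext_grad_eq[OF assms] by metis
  qed
  ultimately have "\<exists>g. smooth_map Cmfd (msub UNIV) g \<and> (\<forall>q\<in>IntC. g (Pt q :: 'n bpoint) = gradF q)" by blast
  from someI_ex[OF this] show "smooth_map Cmfd (msub UNIV) (hmap :: 'n bpoint \<Rightarrow> _)"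
    "\<And>q. q \<in> IntC \<Longrightarrow> hmap (Pt q :: 'n bpoint) = gradF q"
    unfolding hmap_def by blast+
qed

text \<open>The extension is unique because exceptional points are limits \<open>t \<rightarrow> 0\<close> of regular ones.\<close>

lemma hmap_blow_par:
  fixes z :: "real \<times> (real^'n::finite)"
  assumes "2 \<le> CARD('n)" "z \<in> cone_dom {} i"
  shows "hmap (blow_par {} i z) = grad_blow i z"
proof -
  have nz: "hmap (blow_par {} i (t, a)) = grad_blow i (t, a)" if "(t, a) \<in> cone_dom {} i" "t \<noteq> 0" for t and a :: "real^'n"
    using blow_par_IntE[OF that] hmap_spec(2)[OF assms(1)] gradF_blow[OF that(2,1)] by force
  let ?\<phi> = "blow_par {} i :: real \<times> (real^'n) \<Rightarrow> _"
  have cont: "continuous_on (blow_dom {} i) (\<lambda>z. hmap (?\<phi> z))"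
  proof (subst continuous_openin_preimage_eq, intro allI impI)
    fix T :: "(real^'n) set" assume "open T"
    then have "openin (mtop Cmfd) {\<xi> \<in> mpts Cmfd. hmap \<xi> \<in> T}"
      using hmap_spec(1)[OF assms(1)] unfolding smooth_map_def continuous_map mtop_msub by auto
    from openin_chart_preimage[OF this Emfd_chart[of i]]
    have "openin (top_of_set (blow_dom {} i)) {z \<in> blow_dom {} i. ?\<phi> z \<in> {\<xi> \<in> mpts Cmfd. hmap \<xi> \<in> T}}" by simp
    moreover have "{z \<in> blow_dom {} i. ?\<phi> z \<in> {\<xi> \<in> mpts Cmfd. hmap \<xi> \<in> T}} = blow_dom {} i \<inter> (\<lambda>z. hmap (?\<phi> z)) -` T"
      using mptsI[OF Emfd_chart[of i "{}"]] by auto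
    ultimately show "openin (top_of_set (blow_dom {} i)) (blow_dom {} i \<inter> (\<lambda>z. hmap (?\<phi> z)) -` T)" by simp
  qed
  have norm: "hmap (?\<phi> w) = grad_blow i w" if w: "w \<in> blow_dom {} i" for w
  proof (cases "fst w = 0")
    case False
    then show ?thesis using nz[of "fst w" "snd w"] blow_dom_cone[OF _ w] by simp
  next
    case True
    then obtain a where a: "w = (0, a)" by (cases w) auto
    have d: "(t, a) \<in> blow_dom {} i" if "\<bar>t\<bar> < 1" for t using w that unfolding a blow_dom_def by auto
    let ?g = "\<lambda>t. hmap (?\<phi> (t, a)) - grad_blow i (t, a)"
    have "continuous_on {- 1<..<1} (\<lambda>t. hmap (?\<phi> (t, a)))"
      by (rule continuous_on_compose2[OF cont]) (use d in \<open>auto intro!: continuous_intros\<close>)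
    moreover have "continuous_on {- 1<..<1} (\<lambda>t. grad_blow i (t, a))"
      by (rule continuous_on_compose2[OF smooth_imp_continuous[OF smooth_grad_blow]])
        (use d blow_dom_cone[of i "{}"] in \<open>auto intro!: continuous_intros\<close>)
    ultimately have "continuous_on {- 1<..<1} ?g" by (rule continuous_on_diff)
    then have "isCont ?g 0" using continuous_on_eq_continuous_at[of "{- 1<..<1 :: real}" ?g] by auto
    then have lim: "?g \<midarrow>0\<rightarrow> ?g 0" by (simp add: isCont_def)
    have "\<forall>\<^sub>F t in at (0 :: real). \<bar>t\<bar> < 1 \<and> t \<noteq> 0"
      by (auto simp: eventually_at intro!: exI[of _ 1])
    then have "\<forall>\<^sub>F t in at 0. ?g t = 0"
      by eventually_elim (use nz d blow_dom_cone[of i "{}"] in auto)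
    then have "?g \<midarrow>0\<rightarrow> 0" by (rule tendsto_eventually)
    from LIM_unique[OF lim this] show ?thesis using a by simp
  qed
  have zc: "(fst z, snd z) \<in> cone_dom {} i" using assms(2) by simp
  have n: "normalize i z \<in> blow_dom {} i" "?\<phi> (normalize i z) = ?\<phi> z"
    using normalize_blow_dom[OF zc _ two_le_card_simplex] blow_par_normalize[OF zc _ two_le_card_simplex] by auto
  then have "hmap (?\<phi> z) = grad_blow i (normalize i z)" using norm by metis
  also have "\<dots> = grad_blow i z" using n blow_dom_cone[of i "{}"] ext_grad_eq[OF assms(1)] assms(2) by (metis empty_iff)
  finally show ?thesis .
qed


section \<open>Projection along \<open>L\<close> and onto \<open>V\<close>\<close>

text \<open>The vectors \<open>wvec k j\<close>, \<open>j \<in> J\<close>, form the basis of \<open>L\<close> dual to the basis \<open>uvec j\<close> of \<open>V\<close>. This is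
  what makes both projections explicit.\<close>

definition wvec :: "'n::finite option \<Rightarrow> 'n option \<Rightarrow> real^'n" where
  "wvec k j = (2 / pi) *\<^sub>R (pvert j - pvert k)"

definition proj_L :: "'n::finite option set \<Rightarrow> 'n option \<Rightarrow> real^'n \<Rightarrow> real^'n" where
  "proj_L J k a = (\<Sum>j\<in>J. (uvec j \<bullet> a) *\<^sub>R wvec k j)"

lemma uvec_wvec: "uvec l \<bullet> wvec k j = (if l = j then 1 else 0) - (if l = k then 1 else 0)"
  by (simp add: wvec_def uvec_pvert_diff)

lemma uvec_sum_wvec:
  fixes c :: "'n::finite option \<Rightarrow> real"
  assumes "k \<notin> J"
  shows "uvec l \<bullet> (\<Sum>j\<in>J. c j *\<^sub>R wvec k j) = (if l \<in> J then c l else if l = k then - sum c J else 0)"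
proof -
  have "uvec l \<bullet> (\<Sum>j\<in>J. c j *\<^sub>R wvec k j) = (\<Sum>j\<in>J. (if j = l then c j else 0) - (if l = k then c j else 0))"
    unfolding inner_sum_right by (intro sum.cong) (auto simp: uvec_wvec)
  also have "\<dots> = (if l \<in> J then c l else 0) - (if l = k then sum c J else 0)"
    by (simp add: sum_subtractf)
  finally show ?thesis using assms by auto
qed

lemma uvec_proj_L:
  assumes "k \<notin> J"
  shows "uvec l \<bullet> proj_L J k a = (if l \<in> J then uvec l \<bullet> a else if l = k then - (\<Sum>j\<in>J. uvec j \<bullet> a) else 0)"
  unfolding proj_L_def using uvec_sum_wvec[OF assms] .

lemma bounded_linear_proj_L: "bounded_linear (proj_L J k)"
  unfolding proj_L_def
  by (intro bounded_linear_sum bounded_linear_compose[OF bounded_linear_scaleR_left] bounded_linear_inner_right)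

lemmas proj_L_add = linear_add[OF bounded_linear.linear[OF bounded_linear_proj_L]]
lemmas proj_L_diff = linear_diff[OF bounded_linear.linear[OF bounded_linear_proj_L]]
lemmas proj_L_scaleR = linear_scale[OF bounded_linear.linear[OF bounded_linear_proj_L]]

lemma proj_L_eq_0: "(\<And>j. j \<in> J \<Longrightarrow> uvec j \<bullet> a = 0) \<Longrightarrow> proj_L J k a = 0"
  by (simp add: proj_L_def)

lemma proj_L_sum_wvec:
  assumes "k \<notin> J"
  shows "proj_L J k (\<Sum>j\<in>J. c j *\<^sub>R wvec k j) = (\<Sum>j\<in>J. c j *\<^sub>R wvec k j)"
  unfolding proj_L_def[of J k "\<Sum>j\<in>J. c j *\<^sub>R wvec k j"]
  by (intro sum.cong refl) (simp add: uvec_sum_wvec[OF assms])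

lemma proj_L_idem: "k \<notin> J \<Longrightarrow> proj_L J k (proj_L J k a) = proj_L J k a"
  unfolding proj_L_def[of J k a] by (rule proj_L_sum_wvec)

lemma LJ_iff:
  assumes "k \<notin> J"
  shows "X \<in> LJ J k \<longleftrightarrow> proj_L J k X = X"
proof
  assume "X \<in> LJ J k"
  then show "proj_L J k X = X" unfolding LJ_def
  proof (induction rule: span_induct)
    case base
    show "subspace {X. proj_L J k X = X}"
      by (auto simp: subspace_def proj_L_add proj_L_scaleR) (simp add: proj_L_eq_0)
  next
    case (step x)
    then obtain j where j: "j \<in> J" "x = pvert j - pvert k" by blast
    then have "x = (\<Sum>l\<in>J. (if l = j then pi / 2 else 0) *\<^sub>R wvec k l)"
      by (simp add: if_distrib[of "\<lambda>c. c *\<^sub>R _"] cong: if_cong) (simp add: wvec_def)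
    then show ?case using proj_L_sum_wvec[OF assms] by metis
  qed
next
  assume X: "proj_L J k X = X"
  have "wvec k j \<in> LJ J k" if "j \<in> J" for j
    unfolding LJ_def wvec_def using that by (intro span_scale span_base) blast
  then have "proj_L J k X \<in> LJ J k" unfolding proj_L_def LJ_def
    by (intro span_sum span_scale) auto
  then show "X \<in> LJ J k" using X by simp
qed

lemma proj_L_in_LJ: "k \<notin> J \<Longrightarrow> proj_L J k a \<in> LJ J k"
  by (simp add: LJ_iff proj_L_idem)

lemma VJ_eq: "VJ J = span (uvec ` J)"
proof
  have "Gam J \<subseteq> span (uvec ` J)"
    by (auto simp: Gam_def intro!: span_sum span_scale intro: span_base)
  then show "VJ J \<subseteq> span (uvec ` J)" by (rule span_minimal) (rule subspace_span)
  have "uvec j \<in> Gam J" if "j \<in> J" for j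
  proof -
    have "uvec j = (\<Sum>l\<in>J. (if l = j then 1 else 0) *\<^sub>R uvec l)"
      using that by (simp add: if_distrib[of "\<lambda>c. c *\<^sub>R _"] cong: if_cong)
    then show ?thesis unfolding Gam_def
      by (intro CollectI exI[of _ "\<lambda>l. if l = j then 1 else 0"]) auto
  qed
  then show "span (uvec ` J) \<subseteq> VJ J" by (intro span_mono) blast
qed

lemma wvec_sum_uvec:
  fixes c :: "'n::finite option \<Rightarrow> real"
  shows "wvec k j \<bullet> (\<Sum>l\<in>UNIV. c l *\<^sub>R uvec l) = c j - c k"
proof -
  have "wvec k j \<bullet> (\<Sum>l\<in>UNIV. c l *\<^sub>R uvec l) = (\<Sum>l\<in>UNIV. (if l = j then c l else 0) - (if l = k then c l else 0))"
    unfolding inner_sum_right by (intro sum.cong) (auto simp: inner_commute[of "wvec k j"] uvec_wvec)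
  then show ?thesis by (simp add: sum_subtractf)
qed

lemma wvec_sum_uvec_J:
  fixes c :: "'n::finite option \<Rightarrow> real"
  assumes "j \<in> J" "k \<notin> J"
  shows "wvec k j \<bullet> (\<Sum>l\<in>J. c l *\<^sub>R uvec l) = c j"
proof -
  have "(\<Sum>l\<in>J. c l *\<^sub>R uvec l) = (\<Sum>l\<in>UNIV. (if l \<in> J then c l else 0) *\<^sub>R uvec l)"
    by (rule sum.mono_neutral_cong_left) auto
  then show ?thesis using wvec_sum_uvec[of k j "\<lambda>l. if l \<in> J then c l else 0"] assms by simp
qed

lemma Lperp_iff:
  assumes "k \<notin> J"
  shows "x \<in> Lperp J k \<longleftrightarrow> (\<forall>j\<in>J. wvec k j \<bullet> x = 0)"
proof
  assume x: "x \<in> Lperp J k"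
  have "wvec k j \<in> LJ J k" if "j \<in> J" for j
    unfolding LJ_def wvec_def using that by (intro span_scale span_base) blast
  then show "\<forall>j\<in>J. wvec k j \<bullet> x = 0" using x unfolding Lperp_def mem_Collect_eq inner_commute[of x] by blast
next
  assume x: "\<forall>j\<in>J. wvec k j \<bullet> x = 0"
  have 1: "x \<bullet> proj_L J k y = 0" for y
    unfolding proj_L_def using x by (simp add: inner_sum_right inner_commute[of x])
  have "x \<bullet> y = 0" if "y \<in> LJ J k" for y
    using 1[of y] that LJ_iff[OF assms, of y] by simp
  then show "x \<in> Lperp J k" unfolding Lperp_def by blast
qed

lemma VJ_expansion:
  assumes "v \<in> VJ J" "k \<notin> J"
  shows "v = (\<Sum>j\<in>J. (wvec k j \<bullet> v) *\<^sub>R uvec j)"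
  using assms(1) unfolding VJ_eq
proof (induction rule: span_induct)
  case base
  show "subspace {v. v = (\<Sum>j\<in>J. (wvec k j \<bullet> v) *\<^sub>R uvec j)}"
  proof (rule subspaceI; clarsimp)
    fix x y assume xy: "x = (\<Sum>j\<in>J. (wvec k j \<bullet> x) *\<^sub>R uvec j)" "y = (\<Sum>j\<in>J. (wvec k j \<bullet> y) *\<^sub>R uvec j)"
    have "x + y = (\<Sum>j\<in>J. (wvec k j \<bullet> x) *\<^sub>R uvec j) + (\<Sum>j\<in>J. (wvec k j \<bullet> y) *\<^sub>R uvec j)"
      by (rule arg_cong2[OF xy, of "(+)"])
    also have "\<dots> = (\<Sum>j\<in>J. (wvec k j \<bullet> (x + y)) *\<^sub>R uvec j)"
      by (simp add: inner_add_right scaleR_add_left sum.distrib)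
    finally show "x + y = (\<Sum>j\<in>J. (wvec k j \<bullet> (x + y)) *\<^sub>R uvec j)" .
  next
    fix c x assume x: "x = (\<Sum>j\<in>J. (wvec k j \<bullet> x) *\<^sub>R uvec j)"
    have "c *\<^sub>R x = c *\<^sub>R (\<Sum>j\<in>J. (wvec k j \<bullet> x) *\<^sub>R uvec j)" by (rule arg_cong[OF x])
    also have "\<dots> = (\<Sum>j\<in>J. (c * (wvec k j \<bullet> x)) *\<^sub>R uvec j)"
      by (simp add: scaleR_sum_right)
    finally show "c *\<^sub>R x = (\<Sum>j\<in>J. (c * (wvec k j \<bullet> x)) *\<^sub>R uvec j)" .
  qed
next
  case (step x)
  then obtain j where j: "j \<in> J" "x = uvec j" by blast
  then have x: "x = (\<Sum>l\<in>J. (if l = j then 1 else 0) *\<^sub>R uvec l)"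
    by (simp add: if_distrib[of "\<lambda>c. c *\<^sub>R _"] cong: if_cong)
  have "(\<Sum>l\<in>J. (wvec k l \<bullet> x) *\<^sub>R uvec l) = (\<Sum>l\<in>J. (if l = j then 1 else 0) *\<^sub>R uvec l)"
  proof (intro sum.cong refl)
    fix l assume "l \<in> J"
    from wvec_sum_uvec_J[OF this assms(2), of "\<lambda>l. if l = j then 1 else 0"]
    show "(wvec k l \<bullet> x) *\<^sub>R uvec l = (if l = j then 1 else 0) *\<^sub>R uvec l" unfolding x[symmetric] by simp
  qed
  then show ?case using x by (simp only: mem_Collect_eq)
qed

lemma sum_uvec_VJ: "(\<Sum>j\<in>J. c j *\<^sub>R uvec j) \<in> VJ J"
  unfolding VJ_eq by (intro span_sum span_scale span_base imageI)

lemma xproj_eq: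
  assumes "k \<notin> J"
  shows "xproj J k x = (\<Sum>j\<in>J. (wvec k j \<bullet> x) *\<^sub>R uvec j)"
  unfolding xproj_def
proof (rule the_equality)
  let ?v = "\<Sum>j\<in>J. (wvec k j \<bullet> x) *\<^sub>R uvec j"
  show "?v \<in> VJ J \<and> x - ?v \<in> Lperp J k"
    using sum_uvec_VJ[of "\<lambda>j. wvec k j \<bullet> x" J] wvec_sum_uvec_J[OF _ assms]
    by (simp add: Lperp_iff[OF assms] inner_diff_right)
  fix v assume v: "v \<in> VJ J \<and> x - v \<in> Lperp J k"
  then have e: "wvec k j \<bullet> v = wvec k j \<bullet> x" if "j \<in> J" for j
    using that unfolding Lperp_iff[OF assms] by (simp add: inner_diff_right)
  have "v = (\<Sum>j\<in>J. (wvec k j \<bullet> v) *\<^sub>R uvec j)" using VJ_expansion[of v J k] v assms by blast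
  also have "\<dots> = ?v" by (intro sum.cong refl) (simp add: e)
  finally show "v = ?v" .
qed

lemma VJ_orthogonal:
  assumes "x \<in> VJ J" "\<And>j. j \<in> J \<Longrightarrow> uvec j \<bullet> w = 0"
  shows "x \<bullet> w = 0"
  using assms(1) unfolding VJ_eq
proof (induction rule: span_induct)
  case base
  show "subspace {x. x \<bullet> w = 0}" by (simp add: subspace_def inner_add_left)
qed (use assms(2) in auto)

text \<open>The open cone is the image of an open orthant under an injective linear map.\<close>

lemma rel_interior_orthant: "rel_interior {x :: real^'m. \<forall>i. 0 \<le> x $ i} = {x. \<forall>i. 0 < x $ i}"
proof -
  have eq: "{x :: real^'m. \<forall>i. 0 < x $ i} = (\<Inter>i\<in>UNIV. {x. 0 < x $ i})" by auto
  have o: "open {x :: real^'m. \<forall>i. 0 < x $ i}" unfolding eq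
    by (intro open_INT ballI open_Collect_less continuous_intros) simp
  have "interior {x :: real^'m. \<forall>i. 0 \<le> x $ i} = {x. \<forall>i. 0 < x $ i}"
  proof
    show "interior {x :: real^'m. \<forall>i. 0 \<le> x $ i} \<subseteq> {x. \<forall>i. 0 < x $ i}"
    proof
      fix x :: "real^'m" assume "x \<in> interior {x. \<forall>i. 0 \<le> x $ i}"
      then obtain e where e: "0 < e" "ball x e \<subseteq> {x. \<forall>i. 0 \<le> x $ i}" by (auto simp: mem_interior)
      have "0 < x $ i" for i
      proof -
        have "dist x (x - (e / 2) *\<^sub>R axis i 1) < e" using e(1) by (simp add: dist_norm norm_axis_1)
        then have "x - (e / 2) *\<^sub>R axis i 1 \<in> ball x e" by (simp only: mem_ball)
        from subsetD[OF e(2) this] have "x - (e / 2) *\<^sub>R axis i 1 \<in> {x. \<forall>i. 0 \<le> x $ i}" .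
        then have "0 \<le> (x - (e / 2) *\<^sub>R axis i 1) $ i" by blast
        then show ?thesis using e(1) by simp
      qed
      then show "x \<in> {x. \<forall>i. 0 < x $ i}" by simp
    qed
    show "{x. \<forall>i. 0 < x $ i} \<subseteq> interior {x :: real^'m. \<forall>i. 0 \<le> x $ i}"
      by (rule interior_maximal[OF _ o]) (auto intro: less_imp_le)
  qed
  moreover have "(\<chi> i. 1) \<in> {x :: real^'m. \<forall>i. 0 < x $ i}" by simp
  ultimately show ?thesis by (metis empty_iff rel_interior_nonempty_interior)
qed

lemma IntGam_eq:
  fixes J :: "'n::finite option set"
  shows "IntGam J = {\<Sum>j\<in>J. s j *\<^sub>R uvec j | s. \<forall>j\<in>J. 0 < s j}"
proof -
  let ?f = "\<lambda>x :: real^'n option. \<Sum>j\<in>J. (x $ j) *\<^sub>R (uvec j :: real^'n)"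
  have lin: "linear ?f" by (auto intro!: linearI simp: sum.distrib scaleR_add_left scaleR_sum_right)
  have G: "Gam J = ?f ` {x. \<forall>i. 0 \<le> x $ i}"
  proof (intro equalityI subsetI)
    fix v assume "v \<in> Gam J"
    then obtain t where t: "v = (\<Sum>j\<in>J. t j *\<^sub>R uvec j)" "\<forall>j\<in>J. 0 \<le> t j" by (auto simp: Gam_def)
    then have "v = ?f (\<chi> j. if j \<in> J then t j else 0)" by simp
    moreover have "(\<chi> j. if j \<in> J then t j else 0) \<in> {x. \<forall>i. 0 \<le> x $ i}" using t(2) by simp
    ultimately show "v \<in> ?f ` {x. \<forall>i. 0 \<le> x $ i}" by blast
  qed (auto simp: Gam_def)
  have conv: "convex {x :: real^'n option. \<forall>i. 0 \<le> x $ i}" by (auto simp: convex_def)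
  have "IntGam J = rel_interior (?f ` {x. \<forall>i. 0 \<le> x $ i})" by (simp only: G)
  also have "\<dots> = ?f ` rel_interior {x. \<forall>i. 0 \<le> x $ i}"
    by (rule rel_interior_convex_linear_image[OF lin conv, symmetric])
  also have "\<dots> = ?f ` {x. \<forall>i. 0 < x $ i}" by (simp only: rel_interior_orthant)
  also have "\<dots> = {\<Sum>j\<in>J. s j *\<^sub>R uvec j | s. \<forall>j\<in>J. 0 < s j}"
  proof (intro equalityI subsetI)
    fix v :: "real^'n" assume "v \<in> {\<Sum>j\<in>J. s j *\<^sub>R uvec j | s. \<forall>j\<in>J. 0 < s j}"
    then obtain s where s: "v = (\<Sum>j\<in>J. s j *\<^sub>R uvec j)" "\<forall>j\<in>J. 0 < s j" by blast
    then have "v = ?f (\<chi> j. if j \<in> J then s j else 1)" by simp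
    moreover have "(\<chi> j. if j \<in> J then s j else 1) \<in> {x. \<forall>i. 0 < x $ i}" using s(2) by simp
    ultimately show "v \<in> ?f ` {x. \<forall>i. 0 < x $ i}" by blast
  qed auto
  finally show ?thesis .
qed

lemma IntGam_iff:
  assumes "k \<notin> J"
  shows "x \<in> IntGam J \<longleftrightarrow> x \<in> VJ J \<and> (\<forall>j\<in>J. 0 < wvec k j \<bullet> x)"
proof
  assume "x \<in> IntGam J"
  then show "x \<in> VJ J \<and> (\<forall>j\<in>J. 0 < wvec k j \<bullet> x)"
    unfolding IntGam_eq using sum_uvec_VJ wvec_sum_uvec_J[OF _ assms] by fastforce
next
  assume "x \<in> VJ J \<and> (\<forall>j\<in>J. 0 < wvec k j \<bullet> x)"
  then show "x \<in> IntGam J" unfolding IntGam_eq using VJ_expansion[of x J k] assms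
    by (intro CollectI exI[of _ "\<lambda>j. wvec k j \<bullet> x"]) simp
qed

lemma hJ_blow_par:
  fixes z :: "real \<times> (real^'n::finite)"
  assumes "2 \<le> CARD('n)" "k \<notin> J" "z \<in> cone_dom {} i"
  shows "hJ J k (blow_par {} i z) = (\<Sum>j\<in>J. (slope i z j - slope i z k) *\<^sub>R uvec j)"
  unfolding hJ_def hmap_blow_par[OF assms(1,3)] xproj_eq[OF assms(2)] grad_blow_def wvec_sum_uvec ..


section \<open>The projection to the smaller coamoeba\<close>

lemma cone_dom_base:
  fixes a :: "real^'n::finite"
  assumes "(t, a) \<in> cone_dom {} i" "i \<notin> J" "k \<notin> J"
  shows "(t, a - proj_L J k a) \<in> cone_dom J i"
proof -
  note b = cone_dom_bounds[OF assms(1)]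
  have pos: "0 < uvec l \<bullet> a" if "l \<noteq> i" for l using b(1) that by blast
  have s: "0 \<le> (\<Sum>j\<in>J. uvec j \<bullet> a)" by (rule sum_nonneg) (use pos assms(2) in \<open>metis less_imp_le\<close>)
  have "\<bar>t\<bar> * - (uvec i \<bullet> (a - proj_L J k a)) \<le> \<bar>t\<bar> * - (uvec i \<bullet> a)"
    using s assms by (intro mult_left_mono) (auto simp: inner_diff_right uvec_proj_L)
  also have "\<dots> < pi / 2" using assms(1) by (auto simp: cone_dom_def)
  finally have m: "\<bar>t\<bar> * - (uvec i \<bullet> (a - proj_L J k a)) < pi / 2" .
  have "0 < uvec l \<bullet> (a - proj_L J k a)" if "l \<notin> J" "l \<noteq> i" for l
    using pos[OF that(2)] s that(1) assms(3) by (auto simp: inner_diff_right uvec_proj_L)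
  moreover have "uvec j \<bullet> (a - proj_L J k a) = 0" if "j \<in> J" for j
    using that assms(3) by (simp add: inner_diff_right uvec_proj_L)
  ultimately show ?thesis using m by (auto simp: cone_dom_def)
qed

lemma yproj_eq:
  fixes y y0 :: "real^'n::finite"
  assumes y: "y \<in> rel_interior (face {})" and y0: "y0 \<in> rel_interior (face J)" "y - y0 \<in> LJ J k"
    and k: "k \<notin> J" and t: "t \<noteq> 0"
  shows "yproj J k (tor (sgn t *\<^sub>R y)) = tor (sgn t *\<^sub>R y0)"
proof -
  have uniq: "y' = y0" if "y' \<in> rel_interior (face J)" "y - y' \<in> LJ J k" for y'
  proof -
    have "(y - y0) - (y - y') \<in> LJ J k" using y0(2) that(2) unfolding LJ_def by (rule span_diff)
    then have "proj_L J k (y' - y0) = y' - y0" using LJ_iff[OF k] by simp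
    moreover have "uvec j \<bullet> (y' - y0) = 0" if "j \<in> J" for j
      using bary_add[of y0 "y' - y0" j] that y0(1) \<open>y' \<in> rel_interior (face J)\<close>
      by (auto simp: rel_interior_face_iff)
    ultimately show ?thesis using proj_L_eq_0[of J "y' - y0" k] by simp
  qed
  have "y \<in> face {}" using y rel_interior_face_subset by blast
  moreover have "y \<noteq> pvert l" for l using rel_interior_face_not_pvert[OF y two_le_card_simplex] .
  ultimately have lift: "lift (tor y) = y" "lift (tor (- y)) = - y" using lift_tor by blast+
  have n: "- y \<notin> rel_interior (face {})" using neg_not_face[OF y] rel_interior_face_subset by blast
  have neg: "- a - b \<in> LJ J k \<longleftrightarrow> a - - b \<in> LJ J k" for a b
  proof -
    have 1: "- a - b = - (a - - b)" by simp
    have 2: "- X \<in> LJ J k \<longleftrightarrow> X \<in> LJ J k" for X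
      unfolding LJ_def using span_neg[of X] span_neg[of "- X"] by auto
    show ?thesis unfolding 1 2 ..
  qed
  show ?thesis
  proof (cases "t > 0")
    case True
    have "(THE y'. lift (tor y) - y' \<in> LJ J k \<and> (lift (tor y) \<in> rel_interior (face {}) \<and> y' \<in> rel_interior (face J) \<or>
      - lift (tor y) \<in> rel_interior (face {}) \<and> - y' \<in> rel_interior (face J))) = y0"
      unfolding lift by (rule the_equality) (use y y0 n uniq in blast)+
    then show ?thesis using True by (simp add: yproj_def)
  next
    case False
    have "(THE y'. lift (tor (- y)) - y' \<in> LJ J k \<and> (lift (tor (- y)) \<in> rel_interior (face {}) \<and> y' \<in> rel_interior (face J) \<or>
      - lift (tor (- y)) \<in> rel_interior (face {}) \<and> - y' \<in> rel_interior (face J))) = - y0"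
      unfolding lift neg
    proof (rule the_equality)
      show "y - - (- y0) \<in> LJ J k \<and> (- y \<in> rel_interior (face {}) \<and> - y0 \<in> rel_interior (face J) \<or>
        - (- y) \<in> rel_interior (face {}) \<and> - (- y0) \<in> rel_interior (face J))"
        unfolding minus_minus using y y0 by blast
    next
      fix y' assume "y - - y' \<in> LJ J k \<and> (- y \<in> rel_interior (face {}) \<and> y' \<in> rel_interior (face J) \<or>
        - (- y) \<in> rel_interior (face {}) \<and> - y' \<in> rel_interior (face J))"
      then have "- y' = y0" using n by (intro uniq) blast+
      then show "y' = - y0" by (metis minus_minus)
    qed
    then show ?thesis using False t by (simp add: yproj_def)
  qed
qed

definition base_blow :: "'n::finite option set \<Rightarrow> 'n option \<Rightarrow> real \<times> (real^'n) \<Rightarrow> real \<times> (real^'n)" where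
  "base_blow J k z = (fst z, snd z - proj_L J k (snd z))"

lemma base_blow_cone:
  fixes z :: "real \<times> (real^'n::finite)"
  assumes "z \<in> cone_dom {} i" "i \<notin> J" "k \<notin> J"
  shows "base_blow J k z \<in> cone_dom J i"
  using cone_dom_base[of "fst z" "snd z" i J k] assms by (simp add: base_blow_def)

lemma yproj_blow:
  fixes a :: "real^'n::finite"
  assumes "(t, a) \<in> cone_dom {} i" "t \<noteq> 0" "i \<notin> J" "k \<notin> J" "blow_par {} i (t, a) = Pt q"
  shows "Pt (yproj J k q) = blow_par J i (base_blow J k (t, a))"
proof -
  let ?y = "pvert i + \<bar>t\<bar> *\<^sub>R a" and ?yb = "pvert i + \<bar>t\<bar> *\<^sub>R (a - proj_L J k a)"
  have "?y - ?yb = \<bar>t\<bar> *\<^sub>R proj_L J k a" by (simp add: algebra_simps)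
  then have "?y - ?yb \<in> LJ J k" using proj_L_in_LJ[OF assms(4), of a] span_scale unfolding LJ_def by fastforce
  moreover have "?y \<in> rel_interior (face {})" using cone_dom_nonzero_iff[OF assms(2), of i "{}"] assms(1) by simp
  moreover have "?yb \<in> rel_interior (face J)"
    using cone_dom_nonzero_iff[OF assms(2,3)] cone_dom_base[OF assms(1,3,4)] by blast
  moreover have "q = tor (sgn t *\<^sub>R ?y)" using assms(5) blow_par_nonzero[OF assms(2), of "{}" i a] by simp
  ultimately show ?thesis
    using yproj_eq[OF _ _ _ assms(4,2)] by (simp add: base_blow_def blow_par_nonzero[OF assms(2)])
qed

definition ymap_dom :: "'n::finite option set \<Rightarrow> 'n bpoint set" where
  "ymap_dom J = {\<xi> \<in> Ctil. proj \<xi> \<in> IntC \<union> tor ` pvert ` (- J)}"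

lemma tor_pvert_not_IntE:
  fixes J :: "'n::finite option set"
  assumes "2 \<le> card (- J)" shows "tor (pvert m) \<notin> IntE J"
proof
  assume "tor (pvert m) \<in> IntE J"
  then obtain t y where y: "t \<noteq> 0" "y \<in> rel_interior (face J)" "tor (pvert m) = tor (sgn t *\<^sub>R y)" by (rule IntE_E)
  then have "tor (pvert m) = tor y \<or> tor (pvert m) = tor (- y)" by (auto simp: sgn_real_def split: if_splits)
  then have "\<exists>l. y = pvert l"
    using tor_inj_face[OF pvert_in_face, of y m] tor_opposite_faces[OF pvert_in_face, of y m] y(2)
      rel_interior_face_subset by blast
  then show False using rel_interior_face_not_pvert[OF y(2) assms] by blast
qed

lemma Ctil_eq_mpts: "Ctil = mpts Cmfd"
  by (rule mpts_Emfd[OF two_le_card_simplex, symmetric])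

lemma interior_point_chart:
  fixes a :: "real^'n::finite"
  assumes "(t, a) \<in> cone_dom {} m" "t \<noteq> 0"
  obtains t' a' where "t' \<noteq> 0" "(t', a') \<in> blow_dom {} i" "blow_par {} i (t', a') = blow_par {} m (t, a)"
proof -
  obtain q where q: "q \<in> IntE {}" "blow_par {} m (t, a) = Pt q" using blow_par_IntE[OF assms] by auto
  obtain s b where s: "s \<noteq> 0" "(s, b) \<in> cone_dom {} i" "Pt q = blow_par {} i (s, b)"
    using Pt_IntE_chart[OF q(1), of i] by auto
  have "normalize i (s, b) \<in> blow_dom {} i" "blow_par {} i (normalize i (s, b)) = blow_par {} i (s, b)"
    using normalize_blow_dom[OF s(2) _ two_le_card_simplex] blow_par_normalize[OF s(2) _ two_le_card_simplex] by auto
  then show ?thesis using that[of "s * scale i b" "(1 / scale i b) *\<^sub>R b"] s q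
      scale_pos(1)[OF s(2) _ two_le_card_simplex] by (simp add: normalize_def)
qed

text \<open>A point over the interior of the coamoeba lies in the charts at all vertices, an exceptional point only in the
  chart at its own vertex.\<close>

lemma ymap_dom_eq:
  fixes J :: "'n::finite option set"
  assumes "2 \<le> card (- J)"
  shows "ymap_dom J = (\<Union>i\<in>- J. blow_par {} i ` blow_dom {} i)"
proof (intro equalityI subsetI)
  fix \<xi> assume x: "\<xi> \<in> ymap_dom J"
  then obtain m z where m: "z \<in> blow_dom {} m" "\<xi> = blow_par {} m z"
    unfolding ymap_dom_def Ctil_eq_mpts using Emfd_pointE[of \<xi> "{}"] by blast
  obtain t a where z: "z = (t, a)" by (cases z)
  show "\<xi> \<in> (\<Union>i\<in>- J. blow_par {} i ` blow_dom {} i)"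
  proof (cases "t = 0")
    case True
    then have "proj \<xi> = tor (pvert m)" using m z by (simp add: proj_blow_par)
    then obtain i where i: "i \<notin> J" "tor (pvert m) = tor (pvert i)"
      using x tor_pvert_not_IntE[OF two_le_card_simplex, of m] by (auto simp: ymap_dom_def)
    then have "m = i" using tor_inj_face[OF pvert_in_face pvert_in_face] injD[OF inj_pvert] by blast
    then show ?thesis using m i by blast
  next
    case False
    have "- J \<noteq> {}" using assms by auto
    then obtain i where i: "i \<notin> J" by blast
    obtain t' a' where "(t', a') \<in> blow_dom {} i" "blow_par {} i (t', a') = \<xi>"
      using interior_point_chart[of t a m i] False m z blow_dom_cone[of m "{}"] by blast
    then show ?thesis using i by blast
  qed
next
  fix \<xi> :: "'n bpoint" assume "\<xi> \<in> (\<Union>i\<in>- J. blow_par {} i ` blow_dom {} i)"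
  then obtain i t a where i: "i \<notin> J" "(t, a) \<in> blow_dom {} i" "\<xi> = blow_par {} i (t, a)" by auto
  have c: "(t, a) \<in> cone_dom {} i" using blow_dom_cone[of i "{}"] i(2) by simp
  have "\<xi> \<in> mpts Cmfd" using mptsI[OF Emfd_chart[of i "{}"]] i by simp
  moreover have "proj \<xi> \<in> IntC \<union> tor ` pvert ` (- J)"
  proof (cases "t = 0")
    case True
    then show ?thesis using i by (simp add: proj_blow_par)
  next
    case False
    then show ?thesis using blow_par_IntE[OF c False] i(3) by auto
  qed
  ultimately show "\<xi> \<in> ymap_dom J" by (simp add: ymap_dom_def Ctil_eq_mpts)
qed

lemma openin_ymap_dom:
  fixes J :: "'n::finite option set"
  assumes "2 \<le> card (- J)"
  shows "openin (mtop Cmfd) (ymap_dom J)"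
  unfolding ymap_dom_eq[OF assms]
  by (intro openin_Union ballI, clarify)
    (intro openin_chart_image[OF smooth_atlas_Emfd[OF two_le_card_simplex] Emfd_chart]; simp)

lemma mtop_mopen:
  assumes "openin (mtop X) W"
  shows "mtop (mopen X W) = subtopology (mtop X) W"
proof -
  have "openin (mtop (mopen X W)) U \<longleftrightarrow> openin (mtop X) U \<and> U \<subseteq> W" for U
  proof -
    have "openin (top_of_set {z \<in> D. \<phi> z \<in> W}) {z \<in> {z \<in> D. \<phi> z \<in> W}. \<phi> z \<in> U} \<longleftrightarrow>
        openin (top_of_set D) {z \<in> D. \<phi> z \<in> U}" if "(D, \<phi>) \<in> X" "U \<subseteq> W" for D \<phi>
    proof -
      have o: "openin (top_of_set D) {z \<in> D. \<phi> z \<in> W}" by (rule openin_chart_preimage[OF assms that(1)])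
      have e: "{z \<in> {z \<in> D. \<phi> z \<in> W}. \<phi> z \<in> U} = {z \<in> D. \<phi> z \<in> U}" using that(2) by auto
      have "subtopology (top_of_set D) {z \<in> D. \<phi> z \<in> W} = top_of_set {z \<in> D. \<phi> z \<in> W}"
        by (simp add: subtopology_subtopology Int_absorb1)
      then show ?thesis unfolding e using openin_open_subtopology[OF o, of "{z \<in> D. \<phi> z \<in> U}"] that(2) by auto
    qed
    then show ?thesis unfolding openin_mtop mpts_mopen by (auto simp: mopen_def)
  qed
  then show ?thesis by (simp add: topology_eq openin_open_subtopology[OF assms])
qed

lemma base_blow_well_defined:
  fixes a a' :: "real^'n::finite"
  assumes "2 \<le> CARD('n)" "(t, a) \<in> cone_dom {} i" "(t', a') \<in> cone_dom {} i'" "i \<notin> J" "i' \<notin> J"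
    "blow_par {} i (t, a) = blow_par {} i' (t', a')"
  shows "blow_par J i (base_blow J k (t, a)) = blow_par J i' (base_blow J k (t', a'))"
proof -
  have c: "2 < card (- {} :: 'n option set)" using assms(1) by simp
  from blow_par_eqD[OF assms(2,3) _ _ _ assms(6)] c
  consider "t = 0" "t' = 0" "i = i'" "span {a} = span {a'}" |
    "t \<noteq> 0" "t' \<noteq> 0" "sgn t = sgn t'" "pvert i + \<bar>t\<bar> *\<^sub>R a = pvert i' + \<bar>t'\<bar> *\<^sub>R a'" by auto
  then show ?thesis
  proof cases
    case 1
    then have "a' \<in> span {a}" using span_base[of a' "{a'}"] by auto
    then obtain r where r: "a' = r *\<^sub>R a" by (auto simp: span_singleton)
    have "scale i a' > 0" using scale_pos(1)[OF assms(3)] two_le_card_simplex 1 by blast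
    then have r0: "r \<noteq> 0" unfolding r by (auto simp: scale_def)
    have "a' - proj_L J k a' = r *\<^sub>R (a - proj_L J k a)" unfolding r by (simp add: proj_L_scaleR algebra_simps)
    then show ?thesis using blow_par_scale[of "1 / r" J i 0 "a - proj_L J k a"] r0 1 by (simp add: base_blow_def)
  next
    case 2
    have "proj_L J k (pvert i' - pvert i) = 0"
      using assms(4,5) by (intro proj_L_eq_0) (auto simp: uvec_pvert_diff)
    moreover have "\<bar>t\<bar> *\<^sub>R a = \<bar>t'\<bar> *\<^sub>R a' + (pvert i' - pvert i)" using 2(4) by (simp add: algebra_simps)
    ultimately have "proj_L J k (\<bar>t\<bar> *\<^sub>R a) = proj_L J k (\<bar>t'\<bar> *\<^sub>R a')"
      by (simp only: proj_L_add add.right_neutral)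
    then have "pvert i + \<bar>t\<bar> *\<^sub>R (a - proj_L J k a) = pvert i' + \<bar>t'\<bar> *\<^sub>R (a' - proj_L J k a')"
      using 2(4) by (simp add: proj_L_scaleR algebra_simps)
    then show ?thesis using 2 by (simp add: base_blow_def blow_par_nonzero)
  qed
qed

definition ext_base :: "'n::finite option set \<Rightarrow> 'n option \<Rightarrow> 'n bpoint \<Rightarrow> 'n bpoint" where
  "ext_base J k \<xi> = (SOME \<eta>. \<exists>i z. i \<notin> J \<and> z \<in> cone_dom {} i \<and> blow_par {} i z = \<xi> \<and>
     \<eta> = blow_par J i (base_blow J k z))"

lemma ext_base_eq:
  fixes z :: "real \<times> (real^'n::finite)"
  assumes "2 \<le> CARD('n)" "z \<in> cone_dom {} i" "i \<notin> J"
  shows "ext_base J k (blow_par {} i z) = blow_par J i (base_blow J k z)"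
proof -
  have "\<exists>\<eta> i' z'. i' \<notin> J \<and> z' \<in> cone_dom {} i' \<and> blow_par {} i' z' = blow_par {} i z \<and> \<eta> = blow_par J i' (base_blow J k z')"
    using assms(2,3) by blast
  from someI_ex[OF this] obtain i' z' where 1: "i' \<notin> J" "z' \<in> cone_dom {} i'" "blow_par {} i' z' = blow_par {} i z"
    "ext_base J k (blow_par {} i z) = blow_par J i' (base_blow J k z')"
    unfolding ext_base_def by blast
  then show ?thesis
    using base_blow_well_defined[of "fst z'" "snd z'" i' "fst z" "snd z" i J k] assms by simp
qed

lemma smooth_base_blow: "open U \<Longrightarrow> smooth U f \<Longrightarrow> smooth U (\<lambda>z. base_blow J k (f z))"
  unfolding base_blow_def
  by (intro smooth_intros smooth_linear_comp[OF _ bounded_linear_proj_L])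

lemma base_blow_chart:
  fixes J :: "'n::finite option set"
  assumes "i \<notin> J" "k \<notin> J" "2 \<le> card (- J)" "z \<in> cone_dom {} i"
  shows "normalize i (base_blow J k z) \<in> blow_dom J i"
    "blow_par J i (normalize i (base_blow J k z)) = blow_par J i (base_blow J k z)"
    "0 < scale i (snd (base_blow J k z))"
  using normalize_blow_dom[of "fst (base_blow J k z)" "snd (base_blow J k z)" J i]
    blow_par_normalize[of "fst (base_blow J k z)" "snd (base_blow J k z)" J i]
    scale_pos(1)[of "fst (base_blow J k z)" "snd (base_blow J k z)" J i]
    base_blow_cone[OF assms(4,1,2)] assms by simp_all

lemma smooth_base_chart:
  fixes J :: "'n::finite option set"
  assumes "i \<notin> J" "k \<notin> J" "2 \<le> card (- J)"
  shows "smooth (cone_dom {} i) (\<lambda>z. normalize i (base_blow J k z))"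
  by (intro smooth_normalize smooth_base_blow smooth_ident open_cone_dom base_blow_chart(3) assms)

lemma continuous_ext_base:
  fixes J :: "'n::finite option set"
  assumes "2 \<le> CARD('n)" "k \<notin> J" "2 \<le> card (- J)"
  shows "continuous_map (subtopology (mtop Cmfd) (ymap_dom J)) (mtop (Emfd J)) (ext_base J k)"
proof -
  have "locally_smooth (mopen Cmfd (ymap_dom J)) (Emfd J) (ext_base J k)"
    unfolding locally_smooth_def
  proof
    fix \<xi> assume "\<xi> \<in> mpts (mopen Cmfd (ymap_dom J))"
    then have "\<xi> \<in> ymap_dom J" by (simp add: mpts_mopen)
    then obtain i z where z: "i \<notin> J" "z \<in> blow_dom {} i" "\<xi> = blow_par {} i z" unfolding ymap_dom_eq[OF assms(3)] by blast
    let ?D = "{z \<in> blow_dom {} i. blow_par {} i z \<in> ymap_dom J}"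
    have "chart_smooth ?D (blow_par {} i) (blow_dom J i) (blow_par J i) (ext_base J k) z"
      using base_blow_chart[OF z(1) assms(2,3)] ext_base_eq[OF assms(1) _ z(1)] blow_dom_cone[of i "{}"] z
      by (intro chart_smoothI[OF open_cone_dom[of i] _ smooth_base_chart[OF z(1) assms(2,3)]]) auto
    moreover have "(?D, blow_par {} i) \<in> mopen Cmfd (ymap_dom J)"
      using Emfd_chart[of i "{}"] unfolding mopen_def by force
    moreover have "z \<in> ?D" using z \<open>\<xi> \<in> ymap_dom J\<close> by simp
    ultimately show "\<exists>(D, \<phi>)\<in>mopen Cmfd (ymap_dom J). \<exists>(D', \<psi>)\<in>Emfd J. \<exists>z\<in>D.
        \<phi> z = \<xi> \<and> chart_smooth D \<phi> D' \<psi> (ext_base J k) z"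
      using z(3) Emfd_chart[OF z(1)] by blast
  qed
  from locally_smooth_imp_continuous[OF smooth_atlas_mopen[OF smooth_atlas_Emfd[OF two_le_card_simplex]] this]
  show ?thesis by (simp add: mtop_mopen[OF openin_ymap_dom[OF assms(3)]])
qed

lemma ymap_spec:
  fixes J :: "'n::finite option set"
  assumes "2 \<le> CARD('n)" "k \<notin> J" "2 \<le> card (- J)"
  shows "continuous_map (subtopology (mtop Cmfd) (ymap_dom J)) (mtop (Emfd J)) (ymap J k)"
    "\<And>q. q \<in> IntC \<Longrightarrow> ymap J k (Pt q) = Pt (yproj J k q)"
proof -
  have "- J \<noteq> {}" using assms(3) by auto
  then obtain i where i: "i \<notin> J" by blast
  have "ext_base J k (Pt q) = Pt (yproj J k q)" if q: "q \<in> IntC" for q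
  proof -
    obtain t a where "t \<noteq> 0" "(t, a) \<in> cone_dom {} i" "Pt q = blow_par {} i (t, a)"
      using Pt_IntE_chart[OF q, of i] by auto
    then show ?thesis using yproj_blow[of t a i J k q] ext_base_eq[OF assms(1) _ i] i assms(2) by metis
  qed
  then have "\<exists>g. continuous_map (subtopology (mtop Cmfd) (ymap_dom J)) (mtop (Emfd J)) g \<and>
     (\<forall>q\<in>IntC. g (Pt q) = Pt (yproj J k q))" using continuous_ext_base[OF assms] by blast
  from someI_ex[OF this]
  show "continuous_map (subtopology (mtop Cmfd) (ymap_dom J)) (mtop (Emfd J)) (ymap J k)"
    "\<And>q. q \<in> IntC \<Longrightarrow> ymap J k (Pt q) = Pt (yproj J k q)"
    unfolding ymap_def ymap_dom_def by blast+
qed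

text \<open>Limits in the smaller blow up are unique: a curve approaching an exceptional point in the chart at
  the vertex \<open>i\<close> leaves every chart at another vertex, and charts are injective.\<close>

lemma blow_limit_separated:
  fixes J :: "'n::finite option set"
  assumes "i \<notin> J" "m \<notin> J" "2 \<le> card (- J)" "(0, b) \<in> blow_dom J i" "w \<in> blow_dom J m"
    "blow_par J m w \<noteq> blow_par J i (0, b)"
  obtains A \<delta> where "openin (top_of_set (blow_dom J m)) A" "w \<in> A" "0 < \<delta>"
    "\<And>t. 0 < t \<Longrightarrow> t < \<delta> \<Longrightarrow> blow_par J i (t, b) \<notin> blow_par J m ` A"
proof -
  have d: "(t, b) \<in> blow_dom J i" if "\<bar>t\<bar> < 1" for t using assms(4) that unfolding blow_dom_def by auto
  show ?thesis
  proof (cases "m = i")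
    case True
    let ?A = "blow_dom J i \<inter> ball w (dist w (0, b) / 2)"
    have ne: "w \<noteq> (0, b)" using assms(6) True by auto
    show ?thesis
    proof (rule that[of ?A "min 1 (dist w (0, b) / 2)"])
      show "openin (top_of_set (blow_dom J m)) ?A" using True by auto
      show "w \<in> ?A" "0 < min 1 (dist w (0, b) / 2)" using ne assms(5) True by auto
      fix t :: real assume t: "0 < t" "t < min 1 (dist w (0, b) / 2)"
      show "blow_par J i (t, b) \<notin> blow_par J m ` ?A"
      proof
        assume "blow_par J i (t, b) \<in> blow_par J m ` ?A"
        then obtain v where v: "v \<in> ?A" "blow_par J i (t, b) = blow_par J i v" using True by auto
        then have "v = (t, b)" using inj_onD[OF blow_par_inj[OF assms(1,3)] v(2)] d t by auto
        then have "dist w (t, b) < dist w (0, b) / 2" using v(1) by simp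
        moreover have "dist w (0, b) \<le> dist w (t, b) + dist (t, b) (0, b)" by (rule dist_triangle)
        moreover have "dist (t, b) (0, b) = t" using t by (simp add: dist_Pair_Pair)
        ultimately show False using t by simp
      qed
    qed
  next
    case False
    define e c where "e = (1 + \<bar>fst w\<bar>) / 2" and "c = 2 / pi * (uvec m \<bullet> b)"
    have w1: "\<bar>fst w\<bar> < 1" using assms(5) by (cases w) (auto simp: blow_dom_def)
    have um: "0 < uvec m \<bullet> b" using blow_dom_cone[OF assms(1,4)] False assms(2) by (auto simp: cone_dom_def)
    then have c: "0 < c" by (simp add: c_def)
    have e: "\<bar>fst w\<bar> < e" "e < 1" using w1 by (simp_all add: e_def)
    let ?A = "{z \<in> blow_dom J m. \<bar>fst z\<bar> < e}"
    have A: "?A = blow_dom J m \<inter> {z. \<bar>fst z\<bar> < e}" by auto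
    have "open {z :: real \<times> (real^'n). \<bar>fst z\<bar> < e}" by (intro open_Collect_less continuous_intros)
    then have oA: "openin (top_of_set (blow_dom J m)) ?A" unfolding A by (rule openin_open_Int)
    show ?thesis
    proof (rule that[of ?A "min 1 ((1 - e) / c)", OF oA])
      show "w \<in> ?A" "0 < min 1 ((1 - e) / c)" using e assms(5) c by auto
      fix t :: real assume t: "0 < t" "t < min 1 ((1 - e) / c)"
      show "blow_par J i (t, b) \<notin> blow_par J m ` ?A"
      proof
        assume "blow_par J i (t, b) \<in> blow_par J m ` ?A"
        then obtain s v where v: "(s, v) \<in> blow_dom J m" "\<bar>s\<bar> < e" "blow_par J i (t, b) = blow_par J m (s, v)" by auto
        have "pvert i + \<bar>t\<bar> *\<^sub>R b = pvert m + \<bar>s\<bar> *\<^sub>R v"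
          using blow_par_eqD[OF _ _ assms(1,2,3) v(3)] blow_dom_cone[OF assms(1) d[of t]] blow_dom_cone[OF assms(2) v(1)] t False
          by auto
        then have "bary (pvert i + \<bar>t\<bar> *\<^sub>R b) m = bary (pvert m + \<bar>s\<bar> *\<^sub>R v) m" by simp
        moreover have "scale m v = 1" using v(1) assms(2) by (simp add: blow_dom_eq)
        ultimately have "t * c = 1 - \<bar>s\<bar>" using t False
          by (simp add: bary_add bary_pvert scale_def c_def field_simps)
        moreover have "t * c < 1 - e" using t c by (simp add: pos_less_divide_eq)
        ultimately show False using v(2) by simp
      qed
    qed
  qed
qed

lemma ymap_blow_par:
  fixes z :: "real \<times> (real^'n::finite)"
  assumes "2 \<le> CARD('n)" "k \<notin> J" "2 \<le> card (- J)" "i \<notin> J" "z \<in> cone_dom {} i"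
  shows "ymap J k (blow_par {} i z) = blow_par J i (base_blow J k z)"
proof -
  have nz: "ymap J k (blow_par {} i (t, a)) = blow_par J i (base_blow J k (t, a))"
    if ta: "(t, a) \<in> cone_dom {} i" "t \<noteq> 0" for t and a :: "real^'n"
  proof -
    obtain q where q: "q \<in> IntC" "blow_par {} i (t, a) = Pt q" using blow_par_IntE[OF ta] by auto
    then show ?thesis using yproj_blow[OF ta assms(4,2) q(2)] ymap_spec(2)[OF assms(1-3)] by simp
  qed
  have norm: "ymap J k (blow_par {} i z) = blow_par J i (base_blow J k z)" if z: "z \<in> blow_dom {} i" for z
  proof (cases "fst z = 0")
    case False
    then show ?thesis using nz[of "fst z" "snd z"] blow_dom_cone[of i "{}"] z by simp
  next
    case True
    then obtain a where a: "z = (0, a)" by (cases z) auto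
    have d: "(t, a) \<in> blow_dom {} i" if "\<bar>t\<bar> < 1" for t using z that unfolding a blow_dom_def by auto
    have dc: "(t, a) \<in> cone_dom {} i" if "\<bar>t\<bar> < 1" for t using d[OF that] blow_dom_cone[of i "{}"] by simp
    let ?b = "a - proj_L J k a"
    define b where "b = (1 / scale i ?b) *\<^sub>R ?b"
    define \<sigma> where "\<sigma> = scale i ?b"
    have bb: "(t * \<sigma>, b) \<in> blow_dom J i" "blow_par J i (t * \<sigma>, b) = blow_par J i (base_blow J k (t, a))" "0 < \<sigma>"
      if "\<bar>t\<bar> < 1" for t
      using base_blow_chart[OF assms(4,2,3) dc[OF that]]
      by (simp_all add: base_blow_def normalize_def b_def \<sigma>_def)
    have \<sigma>0: "0 < \<sigma>" using bb(3)[of 0] by simp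
    let ?\<xi> = "blow_par {} i (0, a)"
    have x: "?\<xi> \<in> ymap_dom J" unfolding ymap_dom_eq[OF assms(3)] using assms(4) z a by blast
    have top: "topspace (subtopology (mtop Cmfd) (ymap_dom J)) = ymap_dom J"
      using openin_subset[OF openin_ymap_dom[OF assms(3)]] by (simp add: Int_absorb1)
    have "ymap J k ?\<xi> \<in> mpts (Emfd J)"
      using continuous_map_image_subset_topspace[OF ymap_spec(1)[OF assms(1-3)]] x top by auto
    then obtain m w where m: "m \<notin> J" "w \<in> blow_dom J m" "ymap J k ?\<xi> = blow_par J m w" by (rule Emfd_pointE)
    have "blow_par J m w = blow_par J i (0, b)"
    proof (rule ccontr)
      assume ne: "blow_par J m w \<noteq> blow_par J i (0, b)"
      have b0: "(0, b) \<in> blow_dom J i" using bb(1)[of 0] by simp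
      obtain A \<delta> where A: "openin (top_of_set (blow_dom J m)) A" "w \<in> A" "0 < \<delta>"
        "\<And>t. 0 < t \<Longrightarrow> t < \<delta> \<Longrightarrow> blow_par J i (t, b) \<notin> blow_par J m ` A"
        using blow_limit_separated[OF assms(4) m(1) assms(3) b0 m(2) ne] by blast
      have "openin (mtop (Emfd J)) (blow_par J m ` A)"
        by (rule openin_chart_image[OF smooth_atlas_Emfd[OF assms(3)] Emfd_chart[OF m(1)] A(1)])
      then have "openin (subtopology (mtop Cmfd) (ymap_dom J)) {\<xi> \<in> ymap_dom J. ymap J k \<xi> \<in> blow_par J m ` A}"
        using ymap_spec(1)[OF assms(1-3)] unfolding continuous_map top by blast
      then have "openin (mtop Cmfd) {\<xi> \<in> ymap_dom J. ymap J k \<xi> \<in> blow_par J m ` A}"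
        using openin_open_subtopology[OF openin_ymap_dom[OF assms(3)]] by blast
      from openin_chart_preimage[OF this Emfd_chart[of i]]
      obtain T where T: "open T" "{z \<in> blow_dom {} i. blow_par {} i z \<in> {\<xi> \<in> ymap_dom J. ymap J k \<xi> \<in> blow_par J m ` A}} = blow_dom {} i \<inter> T"
        by (auto simp: openin_open)
      have "(0, a) \<in> blow_dom {} i" using d[of 0] by simp
      then have "(0, a) \<in> T" using T(2) x m(3) A(2) by auto
      then have "open ((\<lambda>t. (t, a)) -` T)" "0 \<in> (\<lambda>t. (t, a)) -` T"
        using T(1) by (auto intro!: open_vimage continuous_intros)
      then obtain e where e: "0 < e" "ball 0 e \<subseteq> (\<lambda>t :: real. (t, a)) -` T" by (meson open_contains_ball)
      define t where "t = min (e / 2) (min (1 / 2) (\<delta> / (2 * \<sigma>)))"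
      have t: "0 < t" "t < e" "\<bar>t\<bar> < 1" "t * \<sigma> < \<delta>"
      proof -
        show "0 < t" using e A(3) \<sigma>0 by (simp add: t_def)
        then show "t < e" "\<bar>t\<bar> < 1" using e by (auto simp: t_def)
        have "t * \<sigma> \<le> \<delta> / (2 * \<sigma>) * \<sigma>" using \<sigma>0 by (intro mult_right_mono) (auto simp: t_def)
        then show "t * \<sigma> < \<delta>" using \<sigma>0 A(3) by simp
      qed
      have "t \<in> ball 0 e" using t by simp
      then have "(t, a) \<in> T" using e(2) by blast
      then have "(t, a) \<in> blow_dom {} i \<inter> T" using d[OF t(3)] by blast
      then have "ymap J k (blow_par {} i (t, a)) \<in> blow_par J m ` A" unfolding T(2)[symmetric] by blast
      then have "blow_par J i (t * \<sigma>, b) \<in> blow_par J m ` A" using nz[OF dc[OF t(3)]] t(1) bb(2)[OF t(3)] by simp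
      then show False using A(4)[of "t * \<sigma>"] t \<sigma>0 by simp
    qed
    then show ?thesis using m(3) bb(2)[of 0] a by simp
  qed
  have zc: "(fst z, snd z) \<in> cone_dom {} i" using assms(5) by simp
  have n: "normalize i z \<in> blow_dom {} i" "blow_par {} i (normalize i z) = blow_par {} i z"
    using normalize_blow_dom[OF zc _ two_le_card_simplex] blow_par_normalize[OF zc _ two_le_card_simplex] by auto
  have "ymap J k (blow_par {} i z) = blow_par J i (base_blow J k (normalize i z))" using norm[OF n(1)] n(2) by simp
  also have "\<dots> = blow_par J i (base_blow J k z)"
    using base_blow_well_defined[of "fst (normalize i z)" "snd (normalize i z)" i "fst z" "snd z" i J k]
      n blow_dom_cone[of i "{}"] assms by simp
  finally show ?thesis .
qed


section \<open>The interior of the neighborhood\<close>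

lemma cot_strict_antimono:
  fixes x y :: real
  assumes "0 < x" "x < y" "y < pi"
  shows "cot y < cot x"
proof -
  have s: "0 < sin x" "0 < sin y" "0 < sin (y - x)" by (auto intro!: sin_gt_zero simp: assms less_trans[OF assms(1,2)] less_trans[OF assms(2,3)])
    (use assms in linarith)
  have "cot x - cot y = sin (y - x) / (sin x * sin y)"
    using s by (simp add: cot_def sin_diff field_simps)
  also have "\<dots> > 0" using s by simp
  finally show ?thesis by simp
qed

lemma bary_le_1:
  fixes y :: "real^'n::finite"
  assumes "y \<in> face {}" shows "bary y l \<le> 1"
  using member_le_sum[of l UNIV "bary y"] assms by (simp add: face_iff bary)

lemma slope_less_iff_bary:
  fixes a :: "real^'n::finite"
  assumes "(t, a) \<in> cone_dom {} i" "t \<noteq> 0"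
  shows "slope i (t, a) k < slope i (t, a) j \<longleftrightarrow> bary (pvert i + \<bar>t\<bar> *\<^sub>R a) j < bary (pvert i + \<bar>t\<bar> *\<^sub>R a) k"
proof -
  let ?y = "pvert i + \<bar>t\<bar> *\<^sub>R a"
  have y: "?y \<in> rel_interior (face {})" using cone_dom_nonzero_iff[OF assms(2), of i "{}" a] assms(1) by simp
  then have "?y \<in> face {}" using rel_interior_face_subset by blast
  then have b: "0 < bary ?y l" "bary ?y l \<le> 1" for l
    using y bary_le_1 by (auto simp: rel_interior_face_iff)
  have F: "0 < Fplus ?y / CARD('n)" using Fplus_blow[OF assms] fun_blow_pos[of i t a] assms(2) by simp
  have lt: "cot (pi / 2 * bary ?y l') < cot (pi / 2 * bary ?y l)" if "bary ?y l < bary ?y l'" for l l'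
  proof (rule cot_strict_antimono)
    have "pi / 2 * bary ?y l' \<le> pi / 2 * 1" by (rule mult_left_mono) (use b in auto)
    then show "pi / 2 * bary ?y l' < pi" using pi_gt_zero by linarith
  qed (use b that in auto)
  have "slope i (t, a) k < slope i (t, a) j \<longleftrightarrow> cot (pi / 2 * bary ?y k) < cot (pi / 2 * bary ?y j)"
    unfolding slope_cot[OF assms] using F by (simp only: mult_less_cancel_left_pos)
  also have "\<dots> \<longleftrightarrow> bary ?y j < bary ?y k"
    using lt[of j k] lt[of k j] by (cases "bary ?y j" "bary ?y k" rule: linorder_cases) auto
  finally show ?thesis .
qed

lemma sn_diff: "cos (t * x) * sn t y - cos (t * y) * sn t x = sn t (y - x)"
  by (simp add: sn_def right_diff_distrib sin_diff field_simps)

lemma slope_less_of_uvec: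
  fixes a :: "real^'n::finite"
  assumes "(t, a) \<in> cone_dom {} i" "k \<noteq> i" "j \<noteq> i" "uvec j \<bullet> a < uvec k \<bullet> a"
  shows "slope i (t, a) k < slope i (t, a) j"
proof -
  let ?s = "\<lambda>l. sn t (uvec l \<bullet> a)"
  have s: "0 < ?s j" "0 < ?s k" using cone_dom_pos(1)[OF assms(1)] assms(2,3) by auto
  have "\<bar>t\<bar> * (uvec k \<bullet> a - uvec j \<bullet> a) \<le> \<bar>t\<bar> * (uvec k \<bullet> a)"
    using cone_dom_bounds(1)[OF assms(1,3)] by (intro mult_left_mono) auto
  then have "0 < sn t (uvec k \<bullet> a - uvec j \<bullet> a)"
    using cone_dom_bounds(2)[OF assms(1,2)] assms(4) pi_gt_zero by (intro sn_pos; linarith)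
  then have "cos (t * (uvec k \<bullet> a)) * ?s j < cos (t * (uvec j \<bullet> a)) * ?s k" using sn_diff[of t "uvec j \<bullet> a" "uvec k \<bullet> a"] by simp
  then have "log_slope i t a k < log_slope i t a j"
    using s assms(2,3) by (simp add: log_slope_def field_simps)
  then show ?thesis unfolding slope_def fst_conv snd_conv
    by (rule mult_strict_left_mono) (simp add: fun_blow_pos)
qed

lemma slope_at_vertex:
  fixes a :: "real^'n::finite"
  assumes "(0, a) \<in> cone_dom {} i"
  shows "slope i (0, a) i = 0" "j \<noteq> i \<Longrightarrow> 0 < slope i (0, a) j"
  using cone_dom_bounds(1)[OF assms] fun_blow_pos[of i 0 a] by (auto simp: slope_def log_slope_def sn_def)

lemma Wtil_regular:
  fixes a :: "real^'n::finite"
  assumes "(t, a) \<in> cone_dom {} i" "t \<noteq> 0" "J \<noteq> {}"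
  shows "blow_par {} i (t, a) \<in> Wtil J k \<longleftrightarrow>
    (\<forall>j\<in>J. bary (pvert i + \<bar>t\<bar> *\<^sub>R a) j \<le> bary (pvert i + \<bar>t\<bar> *\<^sub>R a) k)"
proof -
  let ?y = "pvert i + \<bar>t\<bar> *\<^sub>R a"
  have y: "?y \<in> rel_interior (face {})" using cone_dom_nonzero_iff[OF assms(2), of i "{}" a] assms(1) by simp
  have p: "proj (blow_par {} i (t, a)) = tor (sgn t *\<^sub>R ?y)" using blow_par_nonzero[OF assms(2), of "{}" i a] by simp
  have C: "blow_par {} i (t, a) \<in> Ctil" unfolding Ctil_eq_mpts
    using blow_par_mpts[OF assms(1) _ two_le_card_simplex] by simp
  have uniq: "sgn t = sgn r \<and> y'' = ?y" if D: "y'' \<in> pvert ` UNIV \<union> rel_interior (face {})" "r \<noteq> 0"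
    "tor (sgn t *\<^sub>R ?y) = tor (sgn r *\<^sub>R y'')" for r y''
  proof -
    have "y'' \<notin> pvert ` UNIV"
    proof
      assume "y'' \<in> pvert ` UNIV"
      then obtain l where l: "y'' = pvert l" by blast
      have "tor (sgn r *\<^sub>R pvert l) = tor (pvert l :: real^'n)"
        using tor_pvert_minus[of l 0] tor_uminus[of "pvert l :: real^'n"] D(2) by (auto simp: sgn_real_def)
      then have "tor (pvert l) = tor (sgn t *\<^sub>R ?y)" using D(3) l by simp
      then show False using IntE_I[OF y assms(2)] tor_pvert_not_IntE[OF two_le_card_simplex, of l] by simp
    qed
    then have "y'' \<in> rel_interior (face {})" using D(1) by blast
    from tor_signed_eq[OF y this two_le_card_simplex assms(2) D(2,3)] show ?thesis by simp
  qed
  obtain j where j: "j \<in> J" using assms(3) by blast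
  show ?thesis
  proof
    assume "blow_par {} i (t, a) \<in> Wtil J k"
    then have "tor (sgn t *\<^sub>R ?y) \<in> Wplus J k \<or> tor (sgn t *\<^sub>R ?y) \<in> tneg ` Wplus J k"
      unfolding Wtil_def p[symmetric] by blast
    then show "\<forall>j\<in>J. bary ?y j \<le> bary ?y k"
    proof
      assume w: "tor (sgn t *\<^sub>R ?y) \<in> Wplus J k"
      show ?thesis
      proof
        fix j assume "j \<in> J"
        then have "tor (sgn t *\<^sub>R ?y) \<in> Delta j k" using w by (auto simp: Wplus_def)
        then obtain y'' where "y'' \<in> pvert ` UNIV \<union> rel_interior (face {})" "bary y'' j \<le> bary y'' k"
          "tor (sgn t *\<^sub>R ?y) = tor (sgn 1 *\<^sub>R y'')" by (auto simp: Delta_def)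
        with uniq[of y'' 1] show "bary ?y j \<le> bary ?y k" by simp
      qed
    next
      assume "tor (sgn t *\<^sub>R ?y) \<in> tneg ` Wplus J k"
      then obtain q where w: "q \<in> Wplus J k" "tor (sgn t *\<^sub>R ?y) = tneg q" by blast
      show ?thesis
      proof
        fix j assume "j \<in> J"
        then have "q \<in> Delta j k" using w by (auto simp: Wplus_def)
        then obtain y'' where "y'' \<in> pvert ` UNIV \<union> rel_interior (face {})" "bary y'' j \<le> bary y'' k"
          "q = tor y''" by (auto simp: Delta_def)
        moreover from this have "tor (sgn t *\<^sub>R ?y) = tor (sgn (- 1) *\<^sub>R y'')" using w(2) by (simp add: tor_uminus)
        ultimately show "bary ?y j \<le> bary ?y k" using uniq[of y'' "- 1"] by simp
      qed
    qed
  next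
    assume "\<forall>j\<in>J. bary ?y j \<le> bary ?y k"
    then have w: "tor ?y \<in> Wplus J k" using y by (auto simp: Wplus_def Delta_def)
    have s: "tor (sgn t *\<^sub>R y) = tor y \<or> tor (sgn t *\<^sub>R y) = tneg (tor y)" for y :: "real^'n"
      using assms(2) by (auto simp: sgn_real_def tor_uminus)
    show "blow_par {} i (t, a) \<in> Wtil J k"
      unfolding Wtil_def mem_Collect_eq p using C w s[of ?y] by auto
  qed
qed

lemma Wtil_vertex:
  fixes a :: "real^'n::finite"
  assumes "(0, a) \<in> cone_dom {} m" "k \<notin> J"
  shows "blow_par {} m (0, a) \<in> Wtil J k \<longleftrightarrow> m \<notin> J"
proof -
  have C: "blow_par {} m (0, a) \<in> Ctil" unfolding Ctil_eq_mpts
    using blow_par_mpts[OF assms(1) _ two_le_card_simplex] by simp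
  have p: "proj (blow_par {} m (0, a)) = tor (pvert m)" by (simp add: proj_blow_par)
  have neg: "tneg (tor (pvert m :: real^'n)) = tor (pvert m)" using tor_pvert_minus[of m 0] by simp
  have nn: "tneg (tneg q) = q" for q :: "(real^'n) set" by (auto simp: tneg_def image_image)
  have "tor (pvert m) \<in> Wplus J k \<longleftrightarrow> m \<notin> J"
  proof
    assume w: "tor (pvert m) \<in> Wplus J k"
    show "m \<notin> J"
    proof
      assume m: "m \<in> J"
      then have "tor (pvert m) \<in> Delta m k" using w by (auto simp: Wplus_def)
      then obtain y where y: "y \<in> pvert ` UNIV \<union> rel_interior (face {})" "bary y m \<le> bary y k" "tor (pvert m) = tor y"
        unfolding Delta_def by blast
      have "y \<in> face {}" using y(1) rel_interior_face_subset pvert_in_face by blast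
      then have "y = pvert m" using tor_inj_face[OF pvert_in_face _ y(3)] by simp
      then show False using y(2) m assms(2) by (auto simp: bary_pvert split: if_splits)
    qed
  next
    assume "m \<notin> J"
    then show "tor (pvert m) \<in> Wplus J k"
      by (auto simp: Wplus_def Delta_def bary_pvert intro!: image_eqI[of _ _ "pvert m"])
  qed
  then show ?thesis unfolding Wtil_def using C p neg nn by (auto simp: image_iff)
qed

definition slope_region :: "'n::finite option set \<Rightarrow> 'n option \<Rightarrow> 'n option \<Rightarrow> (real \<times> (real^'n)) set" where
  "slope_region J k i = {z \<in> cone_dom {} i. \<forall>j\<in>J. slope i z k < slope i z j}"

lemma open_slope_region: "open (slope_region J k i)"
proof -
  have "slope_region J k i = (\<Inter>j\<in>J. {z \<in> cone_dom {} i. 0 < slope i z j - slope i z k}) \<inter> cone_dom {} i"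
    by (auto simp: slope_region_def)
  moreover have "open {z \<in> cone_dom {} i. 0 < slope i z j - slope i z k}" for j
    by (intro open_Collect_positive open_cone_dom continuous_on_diff smooth_imp_continuous smooth_slope)
  ultimately show ?thesis by (simp add: open_Int open_INT open_cone_dom)
qed

text \<open>In the charts at the vertices outside \<open>J\<close> the neighborhood is given by weak inequalities between the slopes.
  The strict ones define its interior, because \<open>uvec j - uvec k\<close> increases in the direction of \<open>wvec k j\<close>. The
  exceptional points at the vertices in \<open>J\<close> are not in the neighborhood.\<close>

lemma IntWtil_eq:
  fixes J :: "'n::finite option set"
  assumes "k \<notin> J" "2 \<le> card (- J)" "J \<noteq> {}"
  shows "IntWtil J k = (\<Union>i\<in>- J. blow_par {} i ` (blow_dom {} i \<inter> slope_region J k i))" (is "_ = ?W")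
proof -
  have ble: "slope_region J k i \<subseteq> cone_dom {} i" for i by (auto simp: slope_region_def)
  have open_W: "openin (mtop Cmfd) ?W"
    by (intro openin_Union ballI, clarify)
      (intro openin_chart_image[OF smooth_atlas_Emfd[OF two_le_card_simplex] Emfd_chart] openin_open_Int open_slope_region; simp)
  have W_sub: "?W \<subseteq> Wtil J k"
  proof clarify
    fix i t and a :: "real^'n" assume i: "i \<notin> J" and z: "(t, a) \<in> blow_dom {} i" "(t, a) \<in> slope_region J k i"
    have c: "(t, a) \<in> cone_dom {} i" using z(2) by (simp add: slope_region_def)
    show "blow_par {} i (t, a) \<in> Wtil J k"
    proof (cases "t = 0")
      case True
      then show ?thesis using Wtil_vertex[of a i k J] c assms(1) i by simp
    next
      case False
      show ?thesis unfolding Wtil_regular[OF c False assms(3)]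
        using z(2) slope_less_iff_bary[OF c False] by (auto simp: slope_region_def intro: less_imp_le)
    qed
  qed
  have max: "\<xi> \<in> ?W" if O: "openin (mtop Cmfd) O'" "O' \<subseteq> Wtil J k" "\<xi> \<in> O'" for O' \<xi>
  proof -
    have "\<xi> \<in> mpts Cmfd" using O openin_subset by fastforce
    then obtain m t0 a0 where m: "(t0, a0) \<in> blow_dom {} m" "\<xi> = blow_par {} m (t0, a0)"
      using Emfd_pointE[of \<xi> "{}"] by (metis surj_pair)
    have mc: "(t0, a0) \<in> cone_dom {} m" using blow_dom_cone[of m "{}"] m(1) by simp
    have "card (- J - {k}) \<ge> 1" using assms(1,2) by simp
    then obtain i' where i': "i' \<notin> J" "i' \<noteq> k" by (metis Compl_iff DiffE all_not_in_conv card.empty not_one_le_zero singletonI)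
    have cases: "\<xi> \<in> ?W \<or> (\<exists>i t a. i \<notin> J \<and> i \<noteq> k \<and> (t, a) \<in> blow_dom {} i \<and> \<xi> = blow_par {} i (t, a))"
    proof (cases "t0 = 0")
      case True
      then have "m \<notin> J" using Wtil_vertex[of a0 m k J] mc assms(1) m O by auto
      show ?thesis
      proof (cases "m = k")
        case True
        have "slope m (t0, a0) k < slope m (t0, a0) j" if "j \<in> J" for j
          using slope_at_vertex(1)[of a0 m] slope_at_vertex(2)[of a0 m j] mc \<open>t0 = 0\<close> assms(1) True that by fastforce
        then have "(t0, a0) \<in> slope_region J k m" using mc by (simp add: slope_region_def)
        then show ?thesis using m \<open>m \<notin> J\<close> by blast
      qed (use m \<open>m \<notin> J\<close> in blast)
    next
      case False
      from interior_point_chart[OF mc False, of i'] show ?thesis using i' m by metis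
    qed
    show ?thesis
    proof (rule ccontr)
      assume nW: "\<xi> \<notin> ?W"
      then obtain i t a where i: "i \<notin> J" "i \<noteq> k" and z: "(t, a) \<in> blow_dom {} i" "\<xi> = blow_par {} i (t, a)" using cases by blast
      have c: "(t, a) \<in> cone_dom {} i" using blow_dom_cone[of i "{}"] z(1) by simp
      have "(t, a) \<notin> slope_region J k i" using nW z i by blast
      then obtain j where j: "j \<in> J" "\<not> slope i (t, a) k < slope i (t, a) j" using c by (auto simp: slope_region_def)
      have jk: "j \<noteq> i" "j \<noteq> k" using j i assms(1) by auto
      have le: "uvec k \<bullet> a \<le> uvec j \<bullet> a" using slope_less_of_uvec[OF c _ jk(1), of k] i j by force
      \<comment> \<open>Moving towards the vertex \<open>j\<close>, and off the exceptional set, leaves the neighborhood.\<close>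
      define g where "g \<epsilon> = (if t = 0 then \<epsilon> else t, a + \<epsilon> *\<^sub>R wvec k j)" for \<epsilon> :: real
      have cg: "isCont g 0" unfolding g_def by (cases "t = 0") (auto intro!: continuous_intros)
      have g0: "g 0 = (t, a)" by (simp add: g_def)
      obtain T where T: "open T" "{z \<in> blow_dom {} i. blow_par {} i z \<in> O'} = blow_dom {} i \<inter> T"
        using openin_chart_preimage[OF O(1) Emfd_chart[of i]] by (auto simp: openin_open)
      have "(t, a) \<in> T" using T(2) z O(3) by auto
      then have "\<forall>\<^sub>F p in nhds (t, a). p \<in> T \<inter> cone_dom {} i"
        using c by (intro eventually_nhds_in_open open_Int T open_cone_dom) auto
      then have "\<forall>\<^sub>F \<epsilon> in at 0. g \<epsilon> \<in> T \<inter> cone_dom {} i"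
        using cg unfolding isCont_def g0 by (rule eventually_compose_filterlim)
      then obtain d where d: "0 < d" "\<And>\<epsilon>. \<epsilon> \<noteq> 0 \<Longrightarrow> dist \<epsilon> 0 < d \<Longrightarrow> g \<epsilon> \<in> T \<inter> cone_dom {} i"
        unfolding eventually_at by blast
      define \<epsilon> where "\<epsilon> = d / 2"
      have e: "0 < \<epsilon>" and ge: "g \<epsilon> \<in> T" "g \<epsilon> \<in> cone_dom {} i" using d by (auto simp: \<epsilon>_def)
      have "scale i (snd (g \<epsilon>)) = 1"
        using z(1) jk i by (simp add: g_def blow_dom_eq scale_def inner_add_right uvec_wvec)
      then have gb: "g \<epsilon> \<in> blow_dom {} i" using ge(2) by (auto simp: blow_dom_eq split_beta)
      then have "blow_par {} i (g \<epsilon>) \<in> O'" using T(2) ge(1) by blast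
      then have W: "blow_par {} i (fst (g \<epsilon>), snd (g \<epsilon>)) \<in> Wtil J k" using O(2) by auto
      have t0: "fst (g \<epsilon>) \<noteq> 0" using e by (simp add: g_def)
      have "bary (pvert i + \<bar>fst (g \<epsilon>)\<bar> *\<^sub>R snd (g \<epsilon>)) j \<le> bary (pvert i + \<bar>fst (g \<epsilon>)\<bar> *\<^sub>R snd (g \<epsilon>)) k"
        using W Wtil_regular[OF _ t0 assms(3), of "snd (g \<epsilon>)" i k] ge(2) j(1) by simp
      then have "uvec j \<bullet> snd (g \<epsilon>) \<le> uvec k \<bullet> snd (g \<epsilon>)"
        using jk i t0 by (simp add: bary_add bary_pvert divide_le_cancel)
      then show False using le e jk by (simp add: g_def inner_add_right uvec_wvec)
    qed
  qed
  show ?thesis unfolding IntWtil_def interior_of_def using open_W W_sub max by blast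
qed


section \<open>Concavity along \<open>L\<close>\<close>

lemma slope_has_derivative:
  fixes a :: "real^'n::finite"
  assumes "(t, a) \<in> cone_dom {} i"
  shows "((\<lambda>a. slope i (t, a) l) has_derivative (\<lambda>v. fun_blow i t a / CARD('n) *
    ((\<Sum>m\<in>UNIV. log_slope i t a m * (uvec m \<bullet> v)) / CARD('n) * log_slope i t a l -
     ((log_slope i t a l)\<^sup>2 + t\<^sup>2) * (uvec l \<bullet> v)))) (at a)"
  unfolding slope_def fst_conv snd_conv
  by (rule derivative_eq_intros has_derivative_fun_blow[OF assms] has_derivative_log_slope[OF assms] refl | simp)+
    (simp add: fun_eq_iff field_simps)

text \<open>The Cauchy inequality, with strictness from the constraint \<open>v k = - sum v J\<close>: in the case of equality all
  \<open>q l * v l\<close> coincide, so that all \<open>v l\<close> have the same sign, but their sum is \<open>0\<close>.\<close>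

lemma sum_mult_less_sum_squares:
  fixes q v :: "'a \<Rightarrow> real"
  assumes "finite J" "k \<notin> J" "card J < N" "\<And>l. 0 \<le> q l" "t = 0 \<Longrightarrow> (\<And>j. j \<in> J \<Longrightarrow> 0 < q j)"
    and "v k = - sum v J" "\<exists>j\<in>J. v j \<noteq> 0"
  shows "(\<Sum>l\<in>insert k J. q l * v l)\<^sup>2 / real N < (\<Sum>l\<in>insert k J. ((q l)\<^sup>2 + t\<^sup>2) * (v l)\<^sup>2)"
proof -
  let ?I = "insert k J" and ?x = "\<lambda>l. q l * v l"
  define S Q c where "S = sum ?x ?I" and "Q = (\<Sum>l\<in>?I. (?x l)\<^sup>2)" and "c = real (card ?I)"
  have fI: "finite ?I" and c: "0 < c" "c \<le> N" using assms(1-3) by (auto simp: c_def)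
  have var: "(\<Sum>l\<in>?I. (?x l - S / c)\<^sup>2) = Q - S\<^sup>2 / c"
  proof -
    have "(\<Sum>l\<in>?I. (?x l - S / c)\<^sup>2) = (\<Sum>l\<in>?I. (?x l)\<^sup>2 - 2 * (S / c) * ?x l + (S / c)\<^sup>2)"
      by (intro sum.cong refl) (simp add: power2_eq_square algebra_simps)
    also have "\<dots> = Q - 2 * (S / c) * S + c * (S / c)\<^sup>2"
      by (simp only: sum.distrib sum_subtractf sum_distrib_left[symmetric] Q_def S_def c_def sum_constant of_nat_mult)
    also have "\<dots> = Q - S\<^sup>2 / c" using c by (simp add: power2_eq_square field_simps)
    finally show ?thesis .
  qed
  have var0: "0 \<le> Q - S\<^sup>2 / c" unfolding var[symmetric] by (intro sum_nonneg) simp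
  have le: "S\<^sup>2 / N \<le> S\<^sup>2 / c" using c by (intro divide_left_mono) auto
  have rhs: "(\<Sum>l\<in>?I. ((q l)\<^sup>2 + t\<^sup>2) * (v l)\<^sup>2) = Q + t\<^sup>2 * (\<Sum>l\<in>?I. (v l)\<^sup>2)"
    by (simp add: Q_def sum.distrib[symmetric] sum_distrib_left power_mult_distrib algebra_simps del: sum.insert)
  obtain j where j: "j \<in> J" "v j \<noteq> 0" using assms(7) by blast
  have vpos: "0 < (\<Sum>l\<in>?I. (v l)\<^sup>2)" by (rule sum_pos2[of _ j]) (use j fI in auto)
  show ?thesis
  proof (cases "t = 0")
    case False
    then have "0 < t\<^sup>2 * (\<Sum>l\<in>?I. (v l)\<^sup>2)" using vpos by simp
    then show ?thesis unfolding rhs S_def[symmetric] using var0 le by linarith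
  next
    case True
    have "S\<^sup>2 / c \<noteq> Q"
    proof
      assume "S\<^sup>2 / c = Q"
      then have "(\<Sum>l\<in>?I. (?x l - S / c)\<^sup>2) = 0" unfolding var by simp
      then have e: "?x l = S / c" if "l \<in> ?I" for l
        using sum_nonneg_eq_0_iff[OF fI, of "\<lambda>l. (?x l - S / c)\<^sup>2"] that by auto
      have qp: "0 < q j" if "j \<in> J" for j using assms(5)[OF True that] .
      then have vj: "v j = S / c * (1 / q j)" if "j \<in> J" for j
      proof -
        have "v j = q j * v j / q j" using qp[OF that] by simp
        then show ?thesis using e[of j] that by simp
      qed
      have "S / c = q k * v k" using e[of k] by simp
      also have "\<dots> = - (S / c) * (q k * (\<Sum>j\<in>J. 1 / q j))"
        unfolding assms(6) using vj by (simp add: sum_distrib_left sum_negf mult_ac)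
      finally have y: "S / c = - (S / c) * (q k * (\<Sum>j\<in>J. 1 / q j))" .
      have "y * (1 + R) = 0" if "y = - y * R" for y R :: real
        unfolding distrib_left using that by linarith
      from this[OF y] have "S / c * (1 + q k * (\<Sum>j\<in>J. 1 / q j)) = 0" .
      moreover have "0 \<le> q k * (\<Sum>j\<in>J. 1 / q j)" using assms(4) by (intro mult_nonneg_nonneg sum_nonneg) auto
      ultimately have "S / c = 0" by auto
      then show False using vj assms(7) by auto
    qed
    then show ?thesis unfolding rhs S_def[symmetric] using True var0 le by auto
  qed
qed

definition L_gradient :: "'n::finite option set \<Rightarrow> 'n option \<Rightarrow> 'n option \<Rightarrow> real \<times> (real^'n) \<Rightarrow> real^'n" where
  "L_gradient J k i z = (\<Sum>j\<in>J. (slope i z j - slope i z k) *\<^sub>R uvec j)"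

definition slope_deriv :: "'n::finite option \<Rightarrow> real \<Rightarrow> real^'n \<Rightarrow> 'n option \<Rightarrow> real^'n \<Rightarrow> real" where
  "slope_deriv i t a l v = fun_blow i t a / CARD('n) *
    ((\<Sum>m\<in>UNIV. log_slope i t a m * (uvec m \<bullet> v)) / CARD('n) * log_slope i t a l -
     ((log_slope i t a l)\<^sup>2 + t\<^sup>2) * (uvec l \<bullet> v))"

text \<open>The Hessian of \<open>F / t\<close> along \<open>L\<close> is negative definite, also at the exceptional points: only
  \<open>card J + 1 \<le> n + 1\<close> of the \<open>n + 2\<close> factors of the product vary, and the \<open>(n + 1)\<close>-st root of a product of
  \<open>n + 1\<close> factors is concave.\<close>

lemma hessian_negative:
  fixes a v :: "real^'n::finite"
  assumes c: "(t, a) \<in> cone_dom {} i" and J: "i \<notin> J" "k \<notin> J" "card J < CARD('n)"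
    and v: "proj_L J k v = v" "v \<noteq> 0"
  shows "(\<Sum>j\<in>J. (uvec j \<bullet> v) * (slope_deriv i t a j v - slope_deriv i t a k v)) < 0"
proof -
  let ?q = "log_slope i t a" and ?v = "\<lambda>l. uvec l \<bullet> v" and ?N = "CARD('n)"
  define S where "S = (\<Sum>m\<in>UNIV. ?q m * ?v m)"
  define P where "P = fun_blow i t a / ?N"
  have vl: "?v l = (if l \<in> J then ?v l else if l = k then - sum ?v J else 0)" for l
    using uvec_proj_L[OF J(2), of l v] v(1) by simp
  have vk: "?v k = - sum ?v J" using vl[of k] J(2) by simp
  have v0: "?v l = 0" if "l \<notin> insert k J" for l using vl[of l] that by simp
  have S: "S = (\<Sum>m\<in>insert k J. ?q m * ?v m)" unfolding S_def
    by (rule sum.mono_neutral_right) (use v0 in auto)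
  have ex: "\<exists>j\<in>J. ?v j \<noteq> 0"
  proof (rule ccontr)
    assume "\<not> ?thesis"
    then have "proj_L J k v = 0" by (intro proj_L_eq_0) auto
    then show False using v by simp
  qed
  have "(\<Sum>j\<in>J. ?v j * (slope_deriv i t a j v - slope_deriv i t a k v)) =
    (\<Sum>j\<in>J. ?v j * slope_deriv i t a j v) - (\<Sum>j\<in>J. ?v j) * slope_deriv i t a k v"
    by (simp add: right_diff_distrib sum_subtractf sum_distrib_right)
  also have "\<dots> = (\<Sum>l\<in>insert k J. ?v l * slope_deriv i t a l v)" using J(2) vk by simp
  also have "\<dots> = (\<Sum>l\<in>insert k J. P * (S / ?N * (?q l * ?v l)) - P * (((?q l)\<^sup>2 + t\<^sup>2) * (?v l)\<^sup>2))"
    by (intro sum.cong refl) (simp add: slope_deriv_def S_def P_def power2_eq_square algebra_simps)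
  also have "\<dots> = P * (S / ?N * S) - P * (\<Sum>l\<in>insert k J. ((?q l)\<^sup>2 + t\<^sup>2) * (?v l)\<^sup>2)"
    by (simp only: sum_subtractf sum_distrib_left[symmetric] S[symmetric])
  also have "\<dots> = P * (S\<^sup>2 / ?N - (\<Sum>l\<in>insert k J. ((?q l)\<^sup>2 + t\<^sup>2) * (?v l)\<^sup>2))"
    by (simp add: power2_eq_square right_diff_distrib)
  also have "\<dots> < 0"
  proof (rule mult_pos_neg)
    show "0 < P" using fun_blow_pos[of i t a] by (simp add: P_def)
    have "0 < ?q j" if "t = 0" "j \<in> J" for j
    proof -
      have "j \<noteq> i" using that J(1) by auto
      then show ?thesis using cone_dom_bounds(1)[OF c] that by (simp add: log_slope_def sn_def)
    qed
    then show "S\<^sup>2 / ?N - (\<Sum>l\<in>insert k J. ((?q l)\<^sup>2 + t\<^sup>2) * (?v l)\<^sup>2) < 0"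
      using sum_mult_less_sum_squares[of J k ?N ?q t ?v] J log_slope_nonneg[OF c] vk ex S by simp
  qed
  finally show ?thesis .
qed

lemma L_gradient_wvec:
  assumes "k \<notin> J" "j \<in> J"
  shows "wvec k j \<bullet> L_gradient J k i z = slope i z j - slope i z k"
  unfolding L_gradient_def using wvec_sum_uvec_J[OF assms(2,1)] .

lemma grad_blow_Lperp:
  assumes "k \<notin> J"
  shows "grad_blow i z - L_gradient J k i z \<in> Lperp J k"
  unfolding Lperp_iff[OF assms]
  using L_gradient_wvec[OF assms, of _ i z] wvec_sum_uvec[of k _ "slope i z"]
  by (simp add: inner_diff_right grad_blow_def)

lemma cone_dom_convex:
  fixes a a' :: "real^'n::finite"
  assumes "(t, a) \<in> cone_dom {} i" "(t, a') \<in> cone_dom {} i" "0 \<le> r" "r \<le> 1"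
  shows "(t, a + r *\<^sub>R (a' - a)) \<in> cone_dom {} i"
proof -
  have e: "uvec l \<bullet> (a + r *\<^sub>R (a' - a)) = (1 - r) * (uvec l \<bullet> a) + r * (uvec l \<bullet> a')" for l
    by (simp add: inner_add_right inner_diff_right algebra_simps)
  have p: "0 < (1 - r) * x + r * y" if "0 < x" "0 < y" for x y :: real
    by (cases "r = 0") (use assms(3,4) that in \<open>auto intro: add_nonneg_pos\<close>)
  define A A' where "A = \<bar>t\<bar> * - (uvec i \<bullet> a)" and "A' = \<bar>t\<bar> * - (uvec i \<bullet> a')"
  have "0 < (1 - r) * (pi / 2 - A) + r * (pi / 2 - A')"
    by (rule p) (use assms(1,2) in \<open>auto simp: cone_dom_def A_def A'_def\<close>)
  moreover have "(1 - r) * (pi / 2 - A) + r * (pi / 2 - A') = pi / 2 - ((1 - r) * A + r * A')"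
    by (simp add: field_simps)
  moreover have "\<bar>t\<bar> * - (uvec i \<bullet> (a + r *\<^sub>R (a' - a))) = (1 - r) * A + r * A'"
    unfolding e A_def A'_def by (simp add: algebra_simps)
  ultimately have m: "\<bar>t\<bar> * - (uvec i \<bullet> (a + r *\<^sub>R (a' - a))) < pi / 2" by linarith
  have "0 < uvec l \<bullet> (a + r *\<^sub>R (a' - a))" if "l \<noteq> i" for l
    unfolding e using assms(1,2) that by (intro p) (auto simp: cone_dom_def)
  then show ?thesis using m unfolding cone_dom_def by blast
qed

text \<open>The fibres are convex, and by the previous estimate the gradient is strictly monotone along segments.\<close>

lemma L_gradient_inj:
  fixes a a' :: "real^'n::finite"
  assumes c: "(t, a) \<in> cone_dom {} i" "(t, a') \<in> cone_dom {} i" and J: "i \<notin> J" "k \<notin> J" "card J < CARD('n)"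
    and L: "a' - a \<in> LJ J k" and eq: "L_gradient J k i (t, a) = L_gradient J k i (t, a')"
  shows "a = a'"
proof (rule ccontr)
  assume ne: "a \<noteq> a'"
  define v where "v = a' - a"
  have v: "proj_L J k v = v" "v \<noteq> 0" using L LJ_iff[OF J(2)] ne by (auto simp: v_def)
  define f where "f r = (\<Sum>j\<in>J. (uvec j \<bullet> v) * (slope i (t, a + r *\<^sub>R v) j - slope i (t, a + r *\<^sub>R v) k))" for r
  have "f 1 < f 0"
  proof (rule DERIV_neg_imp_decreasing[of 0 1 f])
    fix r :: real assume r: "0 \<le> r" "r \<le> 1"
    have cr: "(t, a + r *\<^sub>R v) \<in> cone_dom {} i" unfolding v_def by (rule cone_dom_convex[OF c r])
    have D: "((\<lambda>r. slope i (t, a + r *\<^sub>R v) l) has_real_derivative slope_deriv i t (a + r *\<^sub>R v) l v) (at r)" for l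
    proof -
      have "((\<lambda>r. a + r *\<^sub>R v) has_derivative (\<lambda>s. s *\<^sub>R v)) (at r)" by (auto intro!: derivative_eq_intros)
      from has_derivative_compose[OF this slope_has_derivative[OF cr]]
      have "((\<lambda>r. slope i (t, a + r *\<^sub>R v) l) has_derivative (\<lambda>s. slope_deriv i t (a + r *\<^sub>R v) l (s *\<^sub>R v))) (at r)"
        by (simp only: slope_deriv_def)
      moreover have "slope_deriv i t (a + r *\<^sub>R v) l (s *\<^sub>R v) = s * slope_deriv i t (a + r *\<^sub>R v) l v" for s
      proof -
        have "(\<Sum>m\<in>UNIV. log_slope i t (a + r *\<^sub>R v) m * (uvec m \<bullet> (s *\<^sub>R v))) =
          s * (\<Sum>m\<in>UNIV. log_slope i t (a + r *\<^sub>R v) m * (uvec m \<bullet> v))"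
          by (simp add: sum_distrib_left mult_ac)
        then show ?thesis by (simp add: slope_deriv_def algebra_simps)
      qed
      ultimately show ?thesis by (simp add: has_field_derivative_def mult_commute_abs)
    qed
    have "(f has_real_derivative (\<Sum>j\<in>J. (uvec j \<bullet> v) * (slope_deriv i t (a + r *\<^sub>R v) j v - slope_deriv i t (a + r *\<^sub>R v) k v))) (at r)"
      unfolding f_def by (intro DERIV_sum DERIV_cmult DERIV_diff D)
    then show "\<exists>y. (f has_real_derivative y) (at r) \<and> y < 0"
      using hessian_negative[OF cr J v] by blast
  qed simp
  moreover have "f 1 = f 0"
  proof -
    have "slope i (t, a') j - slope i (t, a') k = slope i (t, a) j - slope i (t, a) k" if "j \<in> J" for j
      using eq L_gradient_wvec[OF J(2) that, of i] by metis
    then show ?thesis by (simp add: f_def v_def)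
  qed
  ultimately show False by simp
qed

lemma smooth_L_gradient: "smooth (cone_dom {} i) (L_gradient J k i)"
  unfolding L_gradient_def
  by (intro smooth_sum smooth_scaleR smooth_diff smooth_const open_cone_dom smooth_slope)

text \<open>The map \<open>(t, b, X) \<mapsto> (t, b, h\<^sub>J(t, b + X) + (X - proj_L X))\<close> extends the fibrewise gradient to an open
  subset of the whole space; the added term measures how far \<open>X\<close> is from \<open>L\<close> and takes values in the
  orthogonal complement of \<open>V\<close>.\<close>

definition fibre_map :: "'n::finite option set \<Rightarrow> 'n option \<Rightarrow> 'n option \<Rightarrow> (real \<times> (real^'n)) \<times> (real^'n) \<Rightarrow> (real \<times> (real^'n)) \<times> (real^'n)" where
  "fibre_map J k i p = (fst p, L_gradient J k i (fst (fst p), snd (fst p) + snd p) + (snd p - proj_L J k (snd p)))"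

definition fibre_dom :: "'n::finite option \<Rightarrow> ((real \<times> (real^'n)) \<times> (real^'n)) set" where
  "fibre_dom i = {p. (fst (fst p), snd (fst p) + snd p) \<in> cone_dom {} i}"

lemma open_fibre_dom: "open (fibre_dom i)"
  using open_vimage[OF open_cone_dom, of "\<lambda>p. (fst (fst p), snd (fst p) + snd p)"]
  by (simp add: fibre_dom_def vimage_def continuous_intros)

lemma smooth_fibre_map: "smooth (fibre_dom i) (fibre_map J k i)"
  unfolding fibre_map_def
  by (intro smooth_intros open_fibre_dom smooth_linear_comp[OF _ bounded_linear_proj_L]
      smooth_compose[OF open_fibre_dom open_cone_dom _ smooth_L_gradient]) (auto simp: fibre_dom_def)

lemma VJ_complement:
  assumes "x + r = 0" "x \<in> VJ J" "\<And>j. j \<in> J \<Longrightarrow> uvec j \<bullet> r = 0"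
  shows "x = 0" "r = 0"
proof -
  have "x \<bullet> r = 0" by (rule VJ_orthogonal[OF assms(2,3)])
  moreover have "r = - x" using assms(1) by (simp add: add_eq_0_iff2)
  ultimately show "x = 0" "r = 0" by simp_all
qed

text \<open>A vector in the kernel is tangent to the fibre. Its components in \<open>V\<close> and in the orthogonal complement vanish
  separately: by the second one the vector is in \<open>L\<close>, and then the first one contradicts the definiteness of the
  Hessian.\<close>

lemma fibre_map_derivative_inj:
  fixes p :: "(real \<times> (real^'n::finite)) \<times> (real^'n)"
  assumes p: "p \<in> fibre_dom i" and J: "i \<notin> J" "k \<notin> J" "card J < CARD('n)"
  shows "inj (frechet_derivative (fibre_map J k i) (at p))"
proof -
  let ?D = "frechet_derivative (fibre_map J k i) (at p)"
  obtain t b X where p': "p = ((t, b), X)" by (metis surj_pair)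
  have c: "(t, b + X) \<in> cone_dom {} i" using p by (simp add: fibre_dom_def p')
  have D: "(fibre_map J k i has_derivative ?D) (at p)" by (rule smooth_has_derivative[OF smooth_fibre_map p])
  have lin: "linear ?D" using D has_derivative_linear by blast
  have "w = 0" if w: "?D w = 0" for w
  proof -
    have "((\<lambda>p. fst (fibre_map J k i p)) has_derivative (\<lambda>w. fst (?D w))) (at p)" by (rule has_derivative_fst[OF D])
    then have "(fst has_derivative (\<lambda>w. fst (?D w))) (at p)" by (simp add: fibre_map_def)
    moreover have "(fst has_derivative fst) (at p)"
      by (rule has_derivative_fst[OF has_derivative_ident])
    ultimately have "(\<lambda>w. fst (?D w)) = fst" by (rule has_derivative_unique)
    then have "fst w = 0" using w by (metis fst_zero)
    then obtain v where v: "w = (0, v)" by (cases w) auto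
    have "((\<lambda>X. ((t, b), X)) has_derivative (\<lambda>v. (0, v))) (at X)"
      by (auto intro!: derivative_eq_intros simp: zero_prod_def)
    then have "((\<lambda>X. fibre_map J k i ((t, b), X)) has_derivative (\<lambda>v. ?D (0, v))) (at X)"
      by (rule has_derivative_compose) (use D p' in simp)
    then have 1: "((\<lambda>X. snd (fibre_map J k i ((t, b), X))) has_derivative (\<lambda>v. snd (?D (0, v)))) (at X)"
      by (rule has_derivative_snd)
    have "((\<lambda>X. slope i (t, b + X) l) has_derivative (\<lambda>v. slope_deriv i t (b + X) l v)) (at X)" for l
    proof -
      have "((\<lambda>X. b + X) has_derivative (\<lambda>v. v)) (at X)" by (auto intro!: derivative_eq_intros)
      from has_derivative_compose[OF this slope_has_derivative[OF c]] show ?thesis by (simp only: slope_deriv_def)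
    qed
    then have "((\<lambda>X. snd (fibre_map J k i ((t, b), X))) has_derivative
      (\<lambda>v. (\<Sum>j\<in>J. (slope_deriv i t (b + X) j v - slope_deriv i t (b + X) k v) *\<^sub>R uvec j) + (v - proj_L J k v))) (at X)"
      unfolding fibre_map_def L_gradient_def fst_conv snd_conv
      by (intro has_derivative_add has_derivative_sum has_derivative_scaleR_left has_derivative_diff
          has_derivative_ident bounded_linear.has_derivative[OF bounded_linear_proj_L])
    from has_derivative_unique[OF 1 this]
    have "(\<Sum>j\<in>J. (slope_deriv i t (b + X) j v - slope_deriv i t (b + X) k v) *\<^sub>R uvec j) + (v - proj_L J k v) = snd (?D (0, v))"
      by metis
    then have z: "(\<Sum>j\<in>J. (slope_deriv i t (b + X) j v - slope_deriv i t (b + X) k v) *\<^sub>R uvec j) + (v - proj_L J k v) = 0"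
      using w v by simp
    note zz = VJ_complement[OF z sum_uvec_VJ]
    have orth: "uvec j \<bullet> (v - proj_L J k v) = 0" if "j \<in> J" for j
      using that J(2) by (simp add: inner_diff_right uvec_proj_L)
    have s0: "(\<Sum>j\<in>J. (slope_deriv i t (b + X) j v - slope_deriv i t (b + X) k v) *\<^sub>R uvec j) = 0" and vL: "proj_L J k v = v"
      using zz orth by auto
    have "slope_deriv i t (b + X) j v - slope_deriv i t (b + X) k v = 0" if "j \<in> J" for j
      using wvec_sum_uvec_J[OF that J(2), of "\<lambda>j. slope_deriv i t (b + X) j v - slope_deriv i t (b + X) k v"] s0 by simp
    then have "(\<Sum>j\<in>J. (uvec j \<bullet> v) * (slope_deriv i t (b + X) j v - slope_deriv i t (b + X) k v)) = 0" by simp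
    then have "v = 0" using hessian_negative[OF c J vL] by fastforce
    then show "w = 0" using v by (simp add: zero_prod_def)
  qed
  then show ?thesis using linear_injective_0[OF lin] by blast
qed


section \<open>Critical points on the fibres\<close>

lemma cone_dom_J_bounds:
  fixes b :: "real^'n::finite"
  assumes "(t, b) \<in> cone_dom J i" "i \<notin> J"
  shows "j \<in> J \<Longrightarrow> uvec j \<bullet> b = 0" "l \<notin> J \<Longrightarrow> l \<noteq> i \<Longrightarrow> 0 < uvec l \<bullet> b"
    "l \<notin> J \<Longrightarrow> l \<noteq> i \<Longrightarrow> \<bar>t\<bar> * (uvec l \<bullet> b) < pi / 2" "uvec i \<bullet> b \<le> 0" "\<bar>t\<bar> * - (uvec i \<bullet> b) < pi / 2"
proof -
  show z: "uvec j \<bullet> b = 0" if "j \<in> J" for j using assms(1) that by (simp add: cone_dom_def)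
  show p: "0 < uvec l \<bullet> b" if "l \<notin> J" "l \<noteq> i" for l using assms(1) that by (simp add: cone_dom_def)
  show m: "\<bar>t\<bar> * - (uvec i \<bullet> b) < pi / 2" using assms(1) by (simp add: cone_dom_def)
  have nn: "0 \<le> uvec l \<bullet> b" if "l \<noteq> i" for l using z[of l] p[of l] that by (cases "l \<in> J") auto
  have "0 \<le> (\<Sum>l\<in>- {i}. uvec l \<bullet> b)" by (rule sum_nonneg) (use nn in auto)
  then show "uvec i \<bullet> b \<le> 0" using uvec_inner_eq_sum[of i b] by simp
  show "\<bar>t\<bar> * (uvec l \<bullet> b) < pi / 2" if "l \<notin> J" "l \<noteq> i"
  proof -
    have "uvec l \<bullet> b \<le> - (uvec i \<bullet> b)" unfolding uvec_inner_eq_sum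
      by (rule member_le_sum) (use nn that in auto)
    then have "\<bar>t\<bar> * (uvec l \<bullet> b) \<le> \<bar>t\<bar> * - (uvec i \<bullet> b)" by (rule mult_left_mono) simp
    then show ?thesis using m by linarith
  qed
qed

text \<open>Over the exceptional points at the vertex \<open>k\<close> the fibre is unbounded, but there the equations can be solved in
  closed form: \<open>slope j\<close> is \<open>D / (N x\<^sub>j)\<close> where \<open>D\<close> is the value of the function.\<close>

lemma L_gradient_surj_vertex:
  fixes b :: "real^'n::finite"
  assumes b: "(0, b) \<in> cone_dom J k" and J: "k \<notin> J" "card J < CARD('n)" and s: "\<And>j. j \<in> J \<Longrightarrow> 0 < s j"
  obtains X where "proj_L J k X = X" "(0, b + X) \<in> cone_dom {} k"
    "\<And>j. j \<in> J \<Longrightarrow> slope k (0, b + X) j - slope k (0, b + X) k = s j"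
proof -
  let ?N = "real CARD('n)" and ?m = "real (card J)" and ?R = "- insert k J"
  define E where "E = (\<Sum>l\<in>?R. ln (uvec l \<bullet> b)) - (\<Sum>j\<in>J. ln (?N * s j))"
  define D where "D = exp (E / (?N - ?m))"
  define X where "X = (\<Sum>j\<in>J. (D / (?N * s j)) *\<^sub>R wvec k j)"
  note bb = cone_dom_J_bounds[OF b J(1)]
  have D: "0 < D" "(?N - ?m) * ln D = E" using J(2) by (auto simp: D_def)
  have uJ: "uvec j \<bullet> (b + X) = D / (?N * s j)" if "j \<in> J" for j
    using that bb(1) J(1) by (simp add: X_def inner_add_right uvec_sum_wvec)
  have uR: "uvec l \<bullet> (b + X) = uvec l \<bullet> b" if "l \<in> ?R" for l
    using that J(1) by (simp add: X_def inner_add_right uvec_sum_wvec)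
  have pos: "0 < uvec l \<bullet> (b + X)" if "l \<noteq> k" for l
    using that uJ[of l] uR[of l] bb(2)[of l] D(1) s[of l] by (cases "l \<in> J") auto
  have c: "(0, b + X) \<in> cone_dom {} k" using pos by (simp add: cone_dom_def)
  have un: "- {k} = J \<union> ?R" "J \<inter> ?R = {}" using J(1) by auto
  have "(\<Sum>l\<in>- {k}. ln (sn 0 (uvec l \<bullet> (b + X)))) = (\<Sum>l\<in>J. ln (uvec l \<bullet> (b + X))) + (\<Sum>l\<in>?R. ln (uvec l \<bullet> (b + X)))"
    unfolding sn_def un(1) by (subst sum.union_disjoint) (use un(2) in auto)
  also have "(\<Sum>l\<in>?R. ln (uvec l \<bullet> (b + X))) = (\<Sum>l\<in>?R. ln (uvec l \<bullet> b))"
    by (intro sum.cong refl) (simp add: uR)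
  also have "(\<Sum>l\<in>J. ln (uvec l \<bullet> (b + X))) = (\<Sum>l\<in>J. ln D - ln (?N * s l))"
    by (intro sum.cong refl) (use D(1) s in \<open>simp add: uJ ln_divide_pos\<close>)
  also have "(\<Sum>l\<in>J. ln D - ln (?N * s l)) + (\<Sum>l\<in>?R. ln (uvec l \<bullet> b)) = ?m * ln D + E"
    by (simp add: sum_subtractf E_def)
  also have "\<dots> = ?N * ln D" unfolding D(2)[symmetric] by (simp add: algebra_simps)
  finally have "fun_blow k 0 (b + X) = D" using D(1) by (simp add: fun_blow_def)
  then have "slope k (0, b + X) j = s j" if "j \<in> J" for j
  proof -
    have "j \<noteq> k" using that J(1) by auto
    then show ?thesis using uJ[OF that] D(1) s[OF that] \<open>fun_blow k 0 (b + X) = D\<close>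
      by (simp add: slope_def log_slope_def sn_def)
  qed
  then have "slope k (0, b + X) j - slope k (0, b + X) k = s j" if "j \<in> J" for j
    using that slope_at_vertex(1)[OF c] by simp
  moreover have "proj_L J k X = X" unfolding X_def by (rule proj_L_sum_wvec[OF J(1)])
  ultimately show ?thesis using that c by blast
qed

text \<open>In all other cases the closure of the fibre is a compact simplex, and the difference of \<open>F / t\<close> and the
  linear function given by \<open>s\<close> is maximized there. It is \<open>\<le> 0\<close> on the boundary, where the product vanishes. It
  is positive somewhere, because near the face of \<open>E\<^sub>J\<close> only \<open>card J\<close> of the factors tend to \<open>0\<close>, so that the
  \<open>(n + 1)\<close>-st root of the product decreases more slowly than any linear function. So the maximum is an interior critical
  point.\<close>

lemma L_gradient_surj_regular:
  fixes b :: "real^'n::finite"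
  assumes b: "(t, b) \<in> cone_dom J i" and J: "i \<notin> J" "k \<notin> J" "card J < CARD('n)" "J \<noteq> {}"
    and s: "\<And>j. j \<in> J \<Longrightarrow> 0 < s j" and reg: "i \<noteq> k \<or> t \<noteq> 0"
  obtains X where "proj_L J k X = X" "(t, b + X) \<in> cone_dom {} i"
    "\<And>j. j \<in> J \<Longrightarrow> slope i (t, b + X) j - slope i (t, b + X) k = s j"
proof -
  let ?N = "CARD('n)" and ?u = "\<lambda>l X. uvec l \<bullet> (b + X)"
  define M where "M = (if i = k then pi / 2 / \<bar>t\<bar> + uvec k \<bullet> b else uvec k \<bullet> b)"
  define T where "T X = (\<Sum>j\<in>J. uvec j \<bullet> X)" for X :: "real^'n"
  define p where "p X = (\<Prod>l\<in>- {i}. sn t (?u l X)) * cos (t * ?u i X)" for X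
  define g where "g X = root ?N (p X) - (\<Sum>j\<in>J. s j * (uvec j \<bullet> X))" for X
  define K where "K = {X. proj_L J k X = X \<and> (\<forall>j\<in>J. 0 \<le> uvec j \<bullet> X) \<and> T X \<le> M}"
  define K' where "K' = {X. proj_L J k X = X \<and> (\<forall>j\<in>J. 0 < uvec j \<bullet> X) \<and> T X < M}"
  note bb = cone_dom_J_bounds[OF b J(1)]
  have N: "0 < ?N" by simp
  have M: "0 < M"
  proof (cases "i = k")
    case True
    then have "0 < \<bar>t\<bar>" using reg by simp
    then have "- (uvec k \<bullet> b) < pi / 2 / \<bar>t\<bar>" using bb(5) True by (simp add: field_simps)
    then show ?thesis using True by (simp add: M_def)
  next
    case False
    then show ?thesis using bb(2)[of k] J by (simp add: M_def)
  qed
  have uX: "?u l X = (if l \<in> J then uvec l \<bullet> X else if l = k then uvec k \<bullet> b - T X else uvec l \<bullet> b)"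
    if "proj_L J k X = X" for l X
    using uvec_proj_L[OF J(2), of l X] that bb(1)[of l] by (auto simp: inner_add_right T_def)
  have cone: "(t, b + X) \<in> cone_dom {} i" if "X \<in> K'" for X
  proof -
    have X: "proj_L J k X = X" "\<And>j. j \<in> J \<Longrightarrow> 0 < uvec j \<bullet> X" "T X < M" using that by (auto simp: K'_def)
    have "0 < ?u l X" if "l \<noteq> i" for l
      using uX[OF X(1), of l] X bb(2)[of l] that by (auto simp: M_def)
    moreover have "\<bar>t\<bar> * - ?u i X < pi / 2"
    proof (cases "i = k")
      case True
      then have t: "0 < \<bar>t\<bar>" using reg by simp
      have "T X - uvec k \<bullet> b < pi / 2 / \<bar>t\<bar>" using X(3) True by (simp add: M_def)
      from mult_strict_left_mono[OF this t] have "\<bar>t\<bar> * (T X - uvec k \<bullet> b) < pi / 2" using t by simp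
      moreover have "- ?u i X = T X - uvec k \<bullet> b" using uX[OF X(1), of i] J True by simp
      ultimately show ?thesis by (simp only:)
    next
      case False
      then show ?thesis using uX[OF X(1), of i] J bb(5) by simp
    qed
    ultimately show ?thesis by (simp add: cone_dom_def)
  qed
  have bdry: "p X = 0" if "X \<in> K" "X \<notin> K'" for X
  proof -
    have X: "proj_L J k X = X" "\<And>j. j \<in> J \<Longrightarrow> 0 \<le> uvec j \<bullet> X" "T X \<le> M" using that by (auto simp: K_def)
    have "(\<exists>j\<in>J. uvec j \<bullet> X = 0) \<or> T X = M"
    proof (rule ccontr)
      assume n: "\<not> ?thesis"
      have "0 < uvec j \<bullet> X" if "j \<in> J" for j using n X(2)[OF that] that by (metis order_le_less)
      moreover have "T X < M" using n X(3) by simp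
      ultimately show False using that X(1) by (simp add: K'_def)
    qed
    then consider j where "j \<in> J" "uvec j \<bullet> X = 0" | "T X = M" by blast
    then show ?thesis
    proof cases
      case (1 j)
      then have "j \<in> - {i}" "sn t (?u j X) = 0" using uX[OF X(1), of j] J by auto
      then have "(\<Prod>l\<in>- {i}. sn t (?u l X)) = 0" by (intro prod_zero) auto
      then show ?thesis by (simp add: p_def)
    next
      case 2
      show ?thesis
      proof (cases "i = k")
        case True
        then have t: "t \<noteq> 0" using reg by simp
        have "?u i X = - (pi / 2 / \<bar>t\<bar>)" using uX[OF X(1), of i] J True 2 by (simp add: M_def)
        then have "t * ?u i X = - (pi / 2) \<or> t * ?u i X = pi / 2" using t by (cases "t > 0") auto
        then have "cos (t * ?u i X) = 0" by (elim disjE) (simp_all only: cos_minus cos_pi_half)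
        then show ?thesis by (simp add: p_def)
      next
        case False
        then have "k \<in> - {i}" "sn t (?u k X) = 0" using uX[OF X(1), of k] J 2 by (auto simp: M_def)
        then have "(\<Prod>l\<in>- {i}. sn t (?u l X)) = 0" by (intro prod_zero) auto
        then show ?thesis by (simp add: p_def)
      qed
    qed
  qed
  have cont_sn: "continuous_on UNIV (\<lambda>X. sn t (f X))" if "continuous_on UNIV f" for f :: "'x::topological_space \<Rightarrow> real"
    unfolding sn_sinc
    by (intro continuous_intros that continuous_on_compose2[OF smooth_imp_continuous[OF smooth_sinc]]) auto
  have cont_p: "continuous_on UNIV p"
    unfolding p_def by (intro continuous_intros cont_sn)
  have cont_g: "continuous_on K g"
    unfolding g_def by (rule continuous_on_subset[of UNIV]) (intro continuous_intros cont_p, simp)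
  have "compact K"
  proof -
    have "K = {X. proj_L J k X = X} \<inter> (\<Inter>j\<in>J. {X. 0 \<le> uvec j \<bullet> X}) \<inter> {X. T X \<le> M}" by (auto simp: K_def)
    moreover have "closed \<dots>"
      unfolding T_def
      by (intro closed_Int closed_INT ballI closed_Collect_eq closed_Collect_le continuous_intros
          bounded_linear.continuous_on[OF bounded_linear_proj_L])
    ultimately have "closed K" by simp
    moreover have "bounded K"
    proof (rule boundedI)
      fix X assume "X \<in> K"
      then have X: "proj_L J k X = X" "\<And>j. j \<in> J \<Longrightarrow> 0 \<le> uvec j \<bullet> X" "T X \<le> M" by (auto simp: K_def)
      have le: "\<bar>uvec j \<bullet> X\<bar> \<le> M" if "j \<in> J" for j
        using member_le_sum[of j J "\<lambda>j. uvec j \<bullet> X"] that X(2,3) by (force simp: T_def)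
      have "norm X = norm (\<Sum>j\<in>J. (uvec j \<bullet> X) *\<^sub>R wvec k j)" using X(1) by (simp add: proj_L_def)
      also have "\<dots> \<le> (\<Sum>j\<in>J. M * norm (wvec k j))"
        by (rule sum_norm_le) (use le in \<open>auto intro: mult_right_mono\<close>)
      finally show "norm X \<le> (\<Sum>j\<in>J. M * norm (wvec k j))" .
    qed
    ultimately show ?thesis by (simp add: compact_eq_bounded_closed)
  qed
  have "proj_L J k 0 = 0" by (rule proj_L_eq_0) simp
  then have "0 \<in> K" using M by (simp add: K_def T_def)
  then obtain X where X: "X \<in> K" "\<And>Y. Y \<in> K \<Longrightarrow> g Y \<le> g X"
    using continuous_attains_sup[OF \<open>compact K\<close> _ cont_g] by blast
  \<comment> \<open>A point of \<open>K\<close> where \<open>g\<close> is positive: all coordinates equal to a small \<open>\<epsilon>\<close>.\<close>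
  have "0 < g X"
  proof -
    define Y where "Y \<epsilon> = (\<Sum>j\<in>J. \<epsilon> *\<^sub>R wvec k j)" for \<epsilon> :: real
    define R where "R \<epsilon> = (\<Prod>l\<in>- insert i J. sn t (?u l (Y \<epsilon>))) * cos (t * ?u i (Y \<epsilon>))" for \<epsilon>
    define S where "S = sum s J"
    define Q where "Q \<epsilon> = sinc_series (t * \<epsilon>) ^ card J * R \<epsilon> - \<epsilon> ^ (?N - card J) * S ^ ?N" for \<epsilon>
    have PY: "proj_L J k (Y \<epsilon>) = Y \<epsilon>" for \<epsilon> unfolding Y_def by (rule proj_L_sum_wvec[OF J(2)])
    have uY: "uvec j \<bullet> Y \<epsilon> = \<epsilon>" if "j \<in> J" for j \<epsilon> using that unfolding Y_def uvec_sum_wvec[OF J(2)] by simp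
    have TY: "T (Y \<epsilon>) = card J * \<epsilon>" for \<epsilon> :: real by (simp add: T_def uY)
    have pY: "p (Y \<epsilon>) = \<epsilon> ^ card J * (sinc_series (t * \<epsilon>) ^ card J * R \<epsilon>)" for \<epsilon>
    proof -
      have un: "- {i} = J \<union> - insert i J" "J \<inter> - insert i J = {}" using J(1) by auto
      have "(\<Prod>l\<in>- {i}. sn t (?u l (Y \<epsilon>))) = (\<Prod>l\<in>J. sn t (?u l (Y \<epsilon>))) * (\<Prod>l\<in>- insert i J. sn t (?u l (Y \<epsilon>)))"
        unfolding un(1) by (rule prod.union_disjoint) (use un(2) in auto)
      also have "(\<Prod>l\<in>J. sn t (?u l (Y \<epsilon>))) = (\<Prod>l\<in>J. \<epsilon> * sinc_series (t * \<epsilon>))"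
        by (intro prod.cong refl) (simp add: uX[OF PY] uY sn_sinc)
      finally show ?thesis by (simp add: p_def R_def power_mult_distrib)
    qed
    have Y0: "Y 0 = 0" by (simp add: Y_def)
    have "0 < R 0" unfolding R_def Y0
    proof (rule mult_pos_pos)
      show "0 < (\<Prod>l\<in>- insert i J. sn t (uvec l \<bullet> (b + 0)))"
      proof (intro prod_pos)
        fix l assume "l \<in> - insert i J"
        then have l: "l \<notin> J" "l \<noteq> i" by auto
        have "0 < sn t (uvec l \<bullet> b)" by (rule sn_pos) (use bb(2,3)[OF l] pi_gt_zero in linarith)+
        then show "0 < sn t (uvec l \<bullet> (b + 0))" by simp
      qed
      have "\<bar>t * (uvec i \<bullet> b)\<bar> = \<bar>t\<bar> * - (uvec i \<bullet> b)" using bb(4) by (simp add: abs_mult)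
      then have "\<bar>t * (uvec i \<bullet> b)\<bar> < pi / 2" using bb(5) by simp
      then show "0 < cos (t * (uvec i \<bullet> (b + 0)))" by (intro cos_gt_zero_pi) (auto simp: abs_less_iff)
    qed
    then have Q0: "0 < Q 0" using J(3) by (simp add: Q_def sinc_series_0 zero_power)
    have cY: "continuous_on UNIV Y" unfolding Y_def by (intro continuous_intros)
    have cR: "continuous_on UNIV R" unfolding R_def by (intro continuous_intros cont_sn cY)
    have "continuous_on UNIV Q" unfolding Q_def
      by (intro continuous_intros cR continuous_on_compose2[OF smooth_imp_continuous[OF smooth_sinc]]) auto
    then have "open {\<epsilon> \<in> UNIV. 0 < Q \<epsilon>}" by (rule open_Collect_positive[OF open_UNIV])
    then obtain d where d: "0 < d" "ball 0 d \<subseteq> {\<epsilon>. 0 < Q \<epsilon>}"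
      using Q0 by (force simp: open_contains_ball)
    define \<epsilon> where "\<epsilon> = min (d / 2) (M / (card J + 1))"
    have e: "0 < \<epsilon>" "\<epsilon> < d" "card J * \<epsilon> \<le> M"
    proof -
      show "0 < \<epsilon>" "\<epsilon> < d" using d(1) M by (auto simp: \<epsilon>_def)
      have "card J * \<epsilon> \<le> card J * (M / (card J + 1))" by (intro mult_left_mono) (auto simp: \<epsilon>_def)
      also have "\<dots> \<le> M" using M by (simp add: field_simps)
      finally show "card J * \<epsilon> \<le> M" .
    qed
    have "\<epsilon> \<in> ball 0 d" using e by simp
    then have "0 < Q \<epsilon>" using d(2) by blast
    then have "\<epsilon> ^ card J * (\<epsilon> ^ (?N - card J) * S ^ ?N) < p (Y \<epsilon>)"
      unfolding pY using e(1) by (simp add: Q_def)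
    also have "\<epsilon> ^ card J * (\<epsilon> ^ (?N - card J) * S ^ ?N) = (\<epsilon> * S) ^ ?N"
      using J(3) by (simp add: power_mult_distrib power_add[symmetric] mult.assoc[symmetric])
    finally have "root ?N ((\<epsilon> * S) ^ ?N) < root ?N (p (Y \<epsilon>))" by simp
    moreover have "0 \<le> \<epsilon> * S" using e(1) s unfolding S_def by (intro mult_nonneg_nonneg sum_nonneg) (auto intro: less_imp_le)
    ultimately have "\<epsilon> * S < root ?N (p (Y \<epsilon>))" by (simp add: real_root_power_cancel)
    moreover have "(\<Sum>j\<in>J. s j * (uvec j \<bullet> Y \<epsilon>)) = \<epsilon> * S" by (simp add: uY S_def sum_distrib_left mult.commute)
    ultimately have "0 < g (Y \<epsilon>)" by (simp add: g_def)
    moreover have "Y \<epsilon> \<in> K" unfolding K_def mem_Collect_eq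
      using e by (simp add: PY uY TY)
    ultimately show ?thesis using X(2)[of "Y \<epsilon>"] by simp
  qed
  moreover have "0 \<le> (\<Sum>j\<in>J. s j * (uvec j \<bullet> X))"
    using X(1) s by (intro sum_nonneg mult_nonneg_nonneg) (auto simp: K_def intro: less_imp_le)
  ultimately have "p X \<noteq> 0" by (auto simp: g_def)
  then have X': "X \<in> K'" using bdry[OF X(1)] by blast
  have c: "(t, b + X) \<in> cone_dom {} i" by (rule cone[OF X'])
  have crit: "slope i (t, b + X) j - slope i (t, b + X) k = s j" if j: "j \<in> J" for j
  proof -
    define Z where "Z r = X + r *\<^sub>R wvec k j" for r :: real
    have PZ: "proj_L J k (Z r) = Z r" for r
    proof -
      have "wvec k j \<in> LJ J k" unfolding LJ_def wvec_def using j by (intro span_scale span_base) blast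
      then have "proj_L J k (wvec k j) = wvec k j" using LJ_iff[OF J(2)] by blast
      then show ?thesis using X' by (simp add: Z_def K'_def proj_L_add proj_L_scaleR)
    qed
    have "{r. Z r \<in> K'} = (\<Inter>j\<in>J. {r. 0 < uvec j \<bullet> Z r}) \<inter> {r. T (Z r) < M}" by (auto simp: K'_def PZ)
    moreover have "open \<dots>" unfolding Z_def T_def
      by (intro open_Int open_INT ballI open_Collect_less continuous_intros) auto
    ultimately have "open {r. Z r \<in> K'}" by simp
    moreover have "0 \<in> {r. Z r \<in> K'}" using X' by (simp add: Z_def)
    ultimately obtain d where d: "0 < d" "ball 0 d \<subseteq> {r. Z r \<in> K'}" by (meson open_contains_ball)
    have ZK: "Z r \<in> K'" if "\<bar>0 - r\<bar> < d" for r
    proof -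
      have "r \<in> ball 0 d" using that by simp
      then show ?thesis using d(2) by blast
    qed
    have gZ: "g (Z r) = fun_blow i t (b + Z r) - (\<Sum>j\<in>J. s j * (uvec j \<bullet> Z r))" if "\<bar>0 - r\<bar> < d" for r
      using fun_blow_root[OF cone[OF ZK[OF that]]] by (simp add: g_def p_def)
    let ?G = "\<lambda>r. fun_blow i t (b + Z r) - (\<Sum>j\<in>J. s j * (uvec j \<bullet> Z r))"
    have Z0: "b + Z 0 = b + X" by (simp add: Z_def)
    have dZ: "((\<lambda>r. b + Z r) has_derivative (\<lambda>h. h *\<^sub>R wvec k j)) (at 0)"
      unfolding Z_def by (auto intro!: derivative_eq_intros)
    have "((\<lambda>r. fun_blow i t (b + Z r)) has_derivative
        (\<lambda>h. fun_blow i t (b + X) / ?N * (\<Sum>l\<in>UNIV. log_slope i t (b + X) l * (uvec l \<bullet> (h *\<^sub>R wvec k j))))) (at 0)"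
      using has_derivative_compose[OF dZ, of "fun_blow i t"] has_derivative_fun_blow[OF c] unfolding Z0 by blast
    moreover have "fun_blow i t (b + X) / ?N * (\<Sum>l\<in>UNIV. log_slope i t (b + X) l * (uvec l \<bullet> (h *\<^sub>R wvec k j))) =
        h * (slope i (t, b + X) j - slope i (t, b + X) k)" for h
    proof -
      have "(\<Sum>l\<in>UNIV. log_slope i t (b + X) l * (uvec l \<bullet> (h *\<^sub>R wvec k j))) =
        (\<Sum>l\<in>UNIV. (if l = j then h * log_slope i t (b + X) l else 0) - (if l = k then h * log_slope i t (b + X) l else 0))"
        by (intro sum.cong refl) (auto simp: uvec_wvec)
      also have "\<dots> = h * log_slope i t (b + X) j - h * log_slope i t (b + X) k"
        by (simp add: sum_subtractf)
      finally show ?thesis by (simp only: slope_def fst_conv snd_conv) (simp only: right_diff_distrib mult_ac)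
    qed
    ultimately have 1: "((\<lambda>r. fun_blow i t (b + Z r)) has_real_derivative (slope i (t, b + X) j - slope i (t, b + X) k)) (at 0)"
      by (simp add: has_field_derivative_def mult_commute_abs)
    have "(\<Sum>j'\<in>J. s j' * (uvec j' \<bullet> Z r)) = (\<Sum>j'\<in>J. s j' * (uvec j' \<bullet> X)) + r * s j" for r
    proof -
      have "(\<Sum>j'\<in>J. s j' * (uvec j' \<bullet> Z r)) = (\<Sum>j'\<in>J. s j' * (uvec j' \<bullet> X) + (if j' = j then r * s j' else 0))"
        by (intro sum.cong refl) (use J(2) in \<open>auto simp: Z_def inner_add_right uvec_wvec algebra_simps\<close>)
      then show ?thesis using j by (simp add: sum.distrib)
    qed
    then have 2: "((\<lambda>r. \<Sum>j'\<in>J. s j' * (uvec j' \<bullet> Z r)) has_real_derivative s j) (at 0)"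
      by (auto intro!: derivative_eq_intros)
    have "(?G has_real_derivative (slope i (t, b + X) j - slope i (t, b + X) k - s j)) (at 0)"
      by (rule DERIV_diff[OF 1 2])
    then have "slope i (t, b + X) j - slope i (t, b + X) k - s j = 0"
    proof (rule DERIV_local_max[OF _ d(1)], intro allI impI)
      fix r assume r: "\<bar>0 - r\<bar> < d"
      have "Z r \<in> K" using ZK[OF r] by (auto simp: K_def K'_def intro: less_imp_le)
      then have "g (Z r) \<le> g (Z 0)" using X(2) by (simp add: Z_def)
      then show "?G r \<le> ?G 0" using gZ[OF r] gZ[of 0] d(1) by simp
    qed
    then show ?thesis by simp
  qed
  have "proj_L J k X = X" using X' by (simp add: K'_def)
  then show ?thesis using that c crit by blast
qed

theorem L_gradient_surj:
  fixes b x :: "real^'n::finite"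
  assumes b: "(t, b) \<in> cone_dom J i" and J: "i \<notin> J" "k \<notin> J" "card J < CARD('n)" "J \<noteq> {}" and x: "x \<in> IntGam J"
  obtains X where "proj_L J k X = X" "(t, b + X) \<in> slope_region J k i" "L_gradient J k i (t, b + X) = x"
proof -
  have s: "0 < wvec k j \<bullet> x" if "j \<in> J" for j using x that IntGam_iff[OF J(2)] by blast
  obtain X where X: "proj_L J k X = X" "(t, b + X) \<in> cone_dom {} i"
    "\<And>j. j \<in> J \<Longrightarrow> slope i (t, b + X) j - slope i (t, b + X) k = wvec k j \<bullet> x"
  proof (cases "i = k \<and> t = 0")
    case True
    then have b0: "(0, b) \<in> cone_dom J k" using b by simp
    show ?thesis
      by (rule L_gradient_surj_vertex[OF b0 J(2,3), of "\<lambda>j. wvec k j \<bullet> x"])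
        (erule s, rule that, use True in simp_all)
  next
    case False
    then have reg: "i \<noteq> k \<or> t \<noteq> 0" by blast
    show ?thesis
      by (rule L_gradient_surj_regular[OF b J, of "\<lambda>j. wvec k j \<bullet> x", OF _ reg])
        (erule s, rule that)
  qed
  have "L_gradient J k i (t, b + X) = (\<Sum>j\<in>J. (wvec k j \<bullet> x) *\<^sub>R uvec j)"
    unfolding L_gradient_def by (intro sum.cong refl) (simp add: X(3))
  also have "\<dots> = x" by (rule VJ_expansion[symmetric, OF _ J(2)]) (use x IntGam_iff[OF J(2)] in blast)
  finally have "L_gradient J k i (t, b + X) = x" .
  moreover have "(t, b + X) \<in> slope_region J k i" unfolding slope_region_def using X(2,3) s by fastforce
  ultimately show ?thesis using that X(1) by blast
qed


section \<open>The diffeomorphism\<close>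

lemma proj_L_base:
  assumes "k \<notin> J" "proj_L J k X = X" "\<And>j. j \<in> J \<Longrightarrow> uvec j \<bullet> b = 0"
  shows "base_blow J k (t, b + X) = (t, b)"
  using proj_L_eq_0[of J b k] assms by (simp add: base_blow_def proj_L_add)

lemma card_less_of_Compl:
  fixes J :: "'n::finite option set"
  assumes "2 \<le> card (- J)" shows "card J < CARD('n)"
proof -
  have "card (- J) = CARD('n) + 1 - card J" by (simp add: Compl_eq_Diff_UNIV card_Diff_subset)
  then show ?thesis using assms by simp
qed

lemma gmap_blow_par:
  fixes z :: "real \<times> (real^'n::finite)"
  assumes "2 \<le> CARD('n)" "k \<notin> J" "2 \<le> card (- J)" "i \<notin> J" "z \<in> cone_dom {} i"
  shows "gmap J k (blow_par {} i z) = (blow_par J i (base_blow J k z), L_gradient J k i z)"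
  unfolding gmap_def L_gradient_def
  by (simp add: ymap_blow_par[OF assms] hJ_blow_par[OF assms(1,2,5)])

lemma slope_region_cone: "z \<in> slope_region J k i \<Longrightarrow> z \<in> cone_dom {} i"
  by (simp add: slope_region_def)

lemma slope_region_normalize:
  fixes z :: "real \<times> (real^'n::finite)"
  assumes "2 \<le> CARD('n)" "z \<in> slope_region J k i"
  shows "normalize i z \<in> blow_dom {} i \<inter> slope_region J k i" "blow_par {} i (normalize i z) = blow_par {} i z"
proof -
  have c: "(fst z, snd z) \<in> cone_dom {} i" using slope_region_cone[OF assms(2)] by simp
  have n: "normalize i z \<in> blow_dom {} i" using normalize_blow_dom[OF c _ two_le_card_simplex] by simp
  show e: "blow_par {} i (normalize i z) = blow_par {} i z" using blow_par_normalize[OF c _ two_le_card_simplex] by simp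
  have nc: "normalize i z \<in> cone_dom {} i" using blow_dom_cone[OF _ n] by simp
  have "slope i (normalize i z) = slope i z"
    using slope_well_defined[OF assms(1), of "fst (normalize i z)" "snd (normalize i z)" i "fst z" "snd z" i] nc c e by simp
  then show "normalize i z \<in> blow_dom {} i \<inter> slope_region J k i"
    using n nc assms(2) by (simp add: slope_region_def)
qed

lemma slope_region_IntWtil:
  fixes z :: "real \<times> (real^'n::finite)"
  assumes "2 \<le> CARD('n)" "k \<notin> J" "2 \<le> card (- J)" "J \<noteq> {}" "i \<notin> J" "z \<in> slope_region J k i"
  shows "blow_par {} i z \<in> IntWtil J k"
  unfolding IntWtil_eq[OF assms(2-4)]
  using slope_region_normalize[OF assms(1,6)] assms(5) by (intro UN_I[of i] image_eqI[of _ _ "normalize i z"]) auto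

lemma IntWtil_E:
  fixes J :: "'n::finite option set"
  assumes "\<xi> \<in> IntWtil J k" "k \<notin> J" "2 \<le> card (- J)" "J \<noteq> {}"
  obtains i z where "i \<notin> J" "z \<in> blow_dom {} i" "z \<in> slope_region J k i" "\<xi> = blow_par {} i z"
  using assms(1) unfolding IntWtil_eq[OF assms(2-4)] by blast

lemma IntWtil_subset: "IntWtil J k \<subseteq> mpts Cmfd" for J :: "'n::finite option set"
  unfolding IntWtil_def using interior_of_subset_topspace[of "mtop Cmfd"] by simp

lemma mpts_IntWtil: "mpts (mopen Cmfd (IntWtil J k)) = IntWtil J k" for J :: "'n::finite option set"
  using IntWtil_subset[of J k] by (auto simp: mpts_mopen)

lemma L_gradient_IntGam:
  assumes "k \<notin> J" "z \<in> slope_region J k i"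
  shows "L_gradient J k i z \<in> IntGam J"
  unfolding IntGam_iff[OF assms(1)]
  using assms(2) L_gradient_wvec[OF assms(1)] sum_uvec_VJ by (auto simp: L_gradient_def slope_region_def)

lemma locally_smooth_gmap:
  fixes J :: "'n::finite option set"
  assumes "2 \<le> CARD('n)" "k \<notin> J" "2 \<le> card (- J)" "J \<noteq> {}"
  shows "locally_smooth (mopen Cmfd (IntWtil J k)) (mprod (Emfd J) (msub (IntGam J))) (gmap J k)"
  unfolding locally_smooth_def
proof
  fix \<xi> assume x: "\<xi> \<in> mpts (mopen Cmfd (IntWtil J k))"
  then obtain i z where z: "i \<notin> J" "z \<in> blow_dom {} i" "z \<in> slope_region J k i" "\<xi> = blow_par {} i z"
    using IntWtil_E[OF _ assms(2-4)] mpts_IntWtil[of J k] by metis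
  let ?D = "{z \<in> blow_dom {} i. blow_par {} i z \<in> IntWtil J k}"
  let ?g = "\<lambda>z. (normalize i (base_blow J k z), L_gradient J k i z)"
  have sg: "smooth (slope_region J k i) ?g"
    using slope_region_cone
    by (intro smooth_Pair open_slope_region smooth_subset[OF smooth_base_chart[OF z(1) assms(2,3)]]
        smooth_subset[OF smooth_L_gradient]) auto
  have "chart_smooth ?D (blow_par {} i) (blow_dom J i \<times> IntGam J) (map_prod (blow_par J i) id) (gmap J k) z"
  proof (rule chart_smoothI[OF open_slope_region z(3) sg])
    fix w assume w: "w \<in> ?D" "w \<in> slope_region J k i"
    note c = base_blow_chart[OF z(1) assms(2,3) slope_region_cone[OF w(2)]]
    show "?g w \<in> blow_dom J i \<times> IntGam J" using c(1) L_gradient_IntGam[OF assms(2) w(2)] by simp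
    show "gmap J k (blow_par {} i w) = map_prod (blow_par J i) id (?g w)"
      using c(2) gmap_blow_par[OF assms(1-3) z(1) slope_region_cone[OF w(2)]] by simp
  qed
  moreover have "(?D, blow_par {} i) \<in> mopen Cmfd (IntWtil J k)"
    using Emfd_chart[of i "{}"] unfolding mopen_def by force
  moreover have "z \<in> ?D" using z(2,4) x mpts_IntWtil[of J k] by simp
  moreover have "(blow_dom J i \<times> IntGam J, map_prod (blow_par J i) id) \<in> mprod (Emfd J) (msub (IntGam J))"
    by (rule mprodI[OF Emfd_chart[OF z(1)]]) (simp add: msub_def)
  ultimately show "\<exists>(D, \<phi>)\<in>mopen Cmfd (IntWtil J k). \<exists>(D', \<psi>)\<in>mprod (Emfd J) (msub (IntGam J)). \<exists>z\<in>D.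
      \<phi> z = \<xi> \<and> chart_smooth D \<phi> D' \<psi> (gmap J k) z"
    using z(4) by blast
qed

text \<open>Two points with the same image lie in one chart, and by homogeneity their coordinates can be chosen with
  the same \<open>t\<close> and the same base point. They are then in one fibre of the projection.\<close>

lemma gmap_inj:
  fixes J :: "'n::finite option set"
  assumes "2 \<le> CARD('n)" "k \<notin> J" "2 \<le> card (- J)" "J \<noteq> {}"
  shows "inj_on (gmap J k) (IntWtil J k)"
proof (rule inj_onI)
  fix \<xi> \<xi>' assume "\<xi> \<in> IntWtil J k" "\<xi>' \<in> IntWtil J k" and eq: "gmap J k \<xi> = gmap J k \<xi>'"
  then obtain i t a m z where z: "i \<notin> J" "(t, a) \<in> slope_region J k i" "\<xi> = blow_par {} i (t, a)"
    and z': "m \<notin> J" "z \<in> slope_region J k m" "\<xi>' = blow_par {} m z"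
    by (metis IntWtil_E[OF _ assms(2-4)] surj_pair)
  have c: "(t, a) \<in> cone_dom {} i" and c': "z \<in> cone_dom {} m"
    using slope_region_cone z(2) z'(2) by blast+
  have g: "blow_par J i (base_blow J k (t, a)) = blow_par J m (base_blow J k z)"
    using eq gmap_blow_par[OF assms(1-3) z(1) c] gmap_blow_par[OF assms(1-3) z'(1) c'] z(3) z'(3) by simp
  \<comment> \<open>Both points lie in the chart at \<open>i\<close>: if \<open>i \<noteq> m\<close> the images are regular, hence so are the points.\<close>
  obtain t' a' where c2: "(t', a') \<in> cone_dom {} i" "blow_par {} i (t', a') = \<xi>'"
  proof (cases "fst z = 0")
    case True
    have "i = m"
      using blow_par_eqD[of t "snd (base_blow J k (t, a))" J i "fst z" "snd (base_blow J k z)" m]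
        base_blow_cone[OF c z(1) assms(2)] base_blow_cone[OF c' z'(1) assms(2)] z(1) z'(1) assms(3) g True
      by (simp add: base_blow_def)
    then show ?thesis using that[of "fst z" "snd z"] c' z'(3) by simp
  next
    case False
    from interior_point_chart[of "fst z" "snd z" m i] show ?thesis
      using that c' z'(3) False blow_dom_cone[of i "{}"] by (metis empty_iff prod.collapse)
  qed
  have eq2: "blow_par J i (base_blow J k (t, a)) = blow_par J i (base_blow J k (t', a'))"
    "L_gradient J k i (t, a) = L_gradient J k i (t', a')"
    using eq gmap_blow_par[OF assms(1-3) z(1) c] gmap_blow_par[OF assms(1-3) z(1) c2(1)] z(3) c2(2) by auto
  define b b' where "b = a - proj_L J k a" and "b' = a' - proj_L J k a'"
  have bb: "base_blow J k (t, a) = (t, b)" "base_blow J k (t', a') = (t', b')" by (simp_all add: base_blow_def b_def b'_def)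
  note n = base_blow_chart[OF z(1) assms(2,3) c, unfolded bb snd_conv]
  note n' = base_blow_chart[OF z(1) assms(2,3) c2(1), unfolded bb snd_conv]
  have "normalize i (t, b) = normalize i (t', b')"
    using inj_onD[OF blow_par_inj[OF z(1) assms(3)] _ n(1) n'(1)] n(2) n'(2) eq2(1)[unfolded bb] by simp
  then have nn: "t * scale i b = t' * scale i b'" "(1 / scale i b) *\<^sub>R b = (1 / scale i b') *\<^sub>R b'"
    by (auto simp: normalize_def)
  define r where "r = scale i b' / scale i b"
  have r: "0 < r" using n(3) n'(3) by (simp add: r_def)
  have t3: "t' * r = t" using nn(1) n(3) by (simp add: r_def field_simps)
  have b3: "(1 / r) *\<^sub>R b' = b"
  proof -
    have "(1 / r) *\<^sub>R b' = scale i b *\<^sub>R ((1 / scale i b') *\<^sub>R b')" by (simp add: r_def)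
    also have "\<dots> = b" unfolding nn(2)[symmetric] using n(3) by simp
    finally show ?thesis .
  qed
  define a3 where "a3 = (1 / r) *\<^sub>R a'"
  have c3: "(t, a3) \<in> cone_dom {} i" using cone_dom_scale[OF c2(1) r] by (simp add: t3 a3_def)
  have p3: "blow_par {} i (t, a3) = \<xi>'" using blow_par_scale[of r "{}" i t' a'] r c2(2) by (simp add: t3 a3_def)
  have "slope i (t, a3) = slope i (t', a')"
    by (rule slope_well_defined[OF assms(1) c3 c2(1)]) (simp add: p3 c2(2))
  then have L3: "L_gradient J k i (t, a) = L_gradient J k i (t, a3)" using eq2(2) by (simp add: L_gradient_def)
  have "a3 - proj_L J k a3 = b" using b3 by (simp add: a3_def b'_def proj_L_scaleR scaleR_right_diff_distrib)
  then have "a3 - a = proj_L J k (a3 - a)" by (simp add: b_def proj_L_diff algebra_simps)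
  then have "a3 - a \<in> LJ J k" using LJ_iff[OF assms(2)] by metis
  then have "a = a3" by (rule L_gradient_inj[OF c c3 z(1) assms(2) card_less_of_Compl[OF assms(3)] _ L3])
  then show "\<xi> = \<xi>'" using z(3) p3 by simp
qed

lemma gmap_bij:
  fixes J :: "'n::finite option set"
  assumes "2 \<le> CARD('n)" "k \<notin> J" "2 \<le> card (- J)" "J \<noteq> {}"
  shows "bij_betw (gmap J k) (IntWtil J k) (mpts (Emfd J) \<times> IntGam J)"
  unfolding bij_betw_def
proof (intro conjI gmap_inj[OF assms] equalityI subsetI)
  fix p assume "p \<in> gmap J k ` IntWtil J k"
  then obtain \<xi> where x: "\<xi> \<in> IntWtil J k" "p = gmap J k \<xi>" by blast
  obtain i z where z: "i \<notin> J" "z \<in> slope_region J k i" "\<xi> = blow_par {} i z"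
    using IntWtil_E[OF x(1) assms(2-4)] by metis
  note c = slope_region_cone[OF z(2)]
  have "blow_par J i (base_blow J k z) \<in> mpts (Emfd J)"
    by (rule blow_par_mpts[OF base_blow_cone[OF c z(1) assms(2)] z(1) assms(3)])
  then show "p \<in> mpts (Emfd J) \<times> IntGam J"
    using gmap_blow_par[OF assms(1-3) z(1) c] L_gradient_IntGam[OF assms(2) z(2)] x(2) z(3) by simp
next
  fix p assume p: "p \<in> mpts (Emfd J) \<times> IntGam J"
  then have "fst p \<in> mpts (Emfd J)" by auto
  then obtain i w where w: "i \<notin> J" "w \<in> blow_dom J i" "fst p = blow_par J i w"
    by (rule Emfd_pointE)
  obtain t b where tb: "w = (t, b)" by (cases w)
  have cb: "(t, b) \<in> cone_dom J i" using blow_dom_cone[OF w(1,2)] tb by simp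
  obtain X where X: "proj_L J k X = X" "(t, b + X) \<in> slope_region J k i" "L_gradient J k i (t, b + X) = snd p"
    by (rule L_gradient_surj[OF cb w(1) assms(2) card_less_of_Compl[OF assms(3)] assms(4), of "snd p"]) (use p in auto)
  have "base_blow J k (t, b + X) = (t, b)"
    by (rule proj_L_base[OF assms(2) X(1)]) (rule cone_dom_J_bounds(1)[OF cb w(1)])
  then have "gmap J k (blow_par {} i (t, b + X)) = (fst p, snd p)"
    using gmap_blow_par[OF assms(1-3) w(1) slope_region_cone[OF X(2)]] X(3) w(3) tb by simp
  then have "gmap J k (blow_par {} i (t, b + X)) = p" by simp
  then show "p \<in> gmap J k ` IntWtil J k" using slope_region_IntWtil[OF assms w(1) X(2)] by blast
qed

text \<open>The inverse is given by solving for the fibre coordinate \<open>X\<close>, which is a smooth function of the base point and the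
  target vector.\<close>

lemma fibre_solution_smooth:
  fixes b X :: "real^'n::finite"
  assumes J: "i \<notin> J" "k \<notin> J" "card J < CARD('n)"
    and X: "(t, b + X) \<in> slope_region J k i" "proj_L J k X = X"
  obtains V sol where "open V" "((t, b), L_gradient J k i (t, b + X)) \<in> V" "smooth V sol"
    "sol ((t, b), L_gradient J k i (t, b + X)) = X"
    "\<And>w. w \<in> V \<Longrightarrow> (fst (fst w), snd (fst w) + sol w) \<in> slope_region J k i"
    "\<And>w. w \<in> V \<Longrightarrow> snd w \<in> VJ J \<Longrightarrow> proj_L J k (sol w) = sol w \<and>
      L_gradient J k i (fst (fst w), snd (fst w) + sol w) = snd w"
proof -
  define U where "U = {p. (fst (fst p), snd (fst p) + snd p) \<in> slope_region J k i}"
  have oU: "open U"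
    using open_vimage[OF open_slope_region, of "\<lambda>p. (fst (fst p), snd (fst p) + snd p)" J k i]
    by (simp add: U_def vimage_def continuous_intros)
  have UD: "U \<subseteq> fibre_dom i" using slope_region_cone by (auto simp: U_def fibre_dom_def)
  let ?p = "((t, b), X)"
  have pU: "?p \<in> U" using X(1) by (simp add: U_def)
  then have pD: "?p \<in> fibre_dom i" using UD by blast
  have fp: "fibre_map J k i ?p = ((t, b), L_gradient J k i (t, b + X))" using X(2) by (simp add: fibre_map_def)
  obtain U' V g where g: "open U'" "U' \<subseteq> U" "?p \<in> U'" "open V" "fibre_map J k i ?p \<in> V"
    "homeomorphism U' V (fibre_map J k i) g" "smooth V g"
    using smooth_inverse_function[OF oU smooth_subset[OF smooth_fibre_map UD] pU
        smooth_has_derivative[OF smooth_fibre_map pD] fibre_map_derivative_inj[OF pD J]] by metis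
  have gw: "g w \<in> U" "fibre_map J k i (g w) = w" if "w \<in> V" for w
    using g(2,6) that by (auto simp: homeomorphism_def)
  have fw: "fst (g w) = fst w" "L_gradient J k i (fst (fst w), snd (fst w) + snd (g w)) + (snd (g w) - proj_L J k (snd (g w))) = snd w"
    if "w \<in> V" for w
  proof -
    show f: "fst (g w) = fst w" using gw(2)[OF that] by (simp add: fibre_map_def prod_eq_iff)
    show "L_gradient J k i (fst (fst w), snd (fst w) + snd (g w)) + (snd (g w) - proj_L J k (snd (g w))) = snd w"
      using arg_cong[OF gw(2)[OF that], of snd] by (simp add: fibre_map_def f)
  qed
  show ?thesis
  proof (rule that[of V "\<lambda>w. snd (g w)"])
    show "open V" by (rule g(4))
    show "((t, b), L_gradient J k i (t, b + X)) \<in> V" using g(5) fp by simp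
    show "smooth V (\<lambda>w. snd (g w))" by (rule smooth_snd[OF g(4,7)])
    show "snd (g ((t, b), L_gradient J k i (t, b + X))) = X"
      using g(3,6) fp by (metis homeomorphism_apply1 snd_conv)
    fix w assume w: "w \<in> V"
    show "(fst (fst w), snd (fst w) + snd (g w)) \<in> slope_region J k i"
      using gw(1)[OF w] fw(1)[OF w] by (simp add: U_def)
    assume v: "snd w \<in> VJ J"
    have e: "(L_gradient J k i (fst (fst w), snd (fst w) + snd (g w)) - snd w) + (snd (g w) - proj_L J k (snd (g w))) = 0"
      using fw(2)[OF w] by (simp add: algebra_simps)
    have "L_gradient J k i (fst (fst w), snd (fst w) + snd (g w)) - snd w \<in> VJ J"
      by (rule span_diff) (use v sum_uvec_VJ in \<open>auto simp: L_gradient_def\<close>)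
    from VJ_complement[OF e this]
    show "proj_L J k (snd (g w)) = snd (g w) \<and> L_gradient J k i (fst (fst w), snd (fst w) + snd (g w)) = snd w"
      using J(2) by (simp add: inner_diff_right uvec_proj_L)
  qed
qed

lemma locally_smooth_gmap_inverse:
  fixes J :: "'n::finite option set"
  assumes "2 \<le> CARD('n)" "k \<notin> J" "2 \<le> card (- J)" "J \<noteq> {}"
  shows "locally_smooth (mprod (Emfd J) (msub (IntGam J))) (mopen Cmfd (IntWtil J k)) (inv_into (IntWtil J k) (gmap J k))"
  unfolding locally_smooth_def
proof
  let ?inv = "inv_into (IntWtil J k) (gmap J k)"
  fix p assume p: "p \<in> mpts (mprod (Emfd J) (msub (IntGam J)))"
  then have p1: "fst p \<in> mpts (Emfd J)" "snd p \<in> IntGam J" by (auto simp: mpts_mprod)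
  obtain i w where w: "i \<notin> J" "w \<in> blow_dom J i" "fst p = blow_par J i w"
    using Emfd_pointE[OF p1(1)] by metis
  obtain t b where tb: "w = (t, b)" by (cases w)
  note cJ = card_less_of_Compl[OF assms(3)]
  have cb: "(t, b) \<in> cone_dom J i" using blow_dom_cone[OF w(1,2)] tb by simp
  obtain X where X: "proj_L J k X = X" "(t, b + X) \<in> slope_region J k i" "L_gradient J k i (t, b + X) = snd p"
    using L_gradient_surj[OF cb w(1) assms(2) cJ assms(4) p1(2)] by metis
  obtain V sol where V: "open V" "((t, b), snd p) \<in> V" "smooth V sol"
    "\<And>w. w \<in> V \<Longrightarrow> (fst (fst w), snd (fst w) + sol w) \<in> slope_region J k i"
    "\<And>w. w \<in> V \<Longrightarrow> snd w \<in> VJ J \<Longrightarrow> proj_L J k (sol w) = sol w \<and> L_gradient J k i (fst (fst w), snd (fst w) + sol w) = snd w"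
    using fibre_solution_smooth[OF w(1) assms(2) cJ X(2,1)] unfolding X(3) by metis
  let ?z = "\<lambda>w. (fst (fst w), snd (fst w) + sol w)"
  let ?D = "{z \<in> blow_dom {} i. blow_par {} i z \<in> IntWtil J k}"
  have sz: "smooth V ?z" by (intro smooth_intros V(1,3))
  have "0 < scale i (snd (?z w))" if "w \<in> V" for w
    using scale_pos(1)[of "fst (?z w)" "snd (?z w)" "{}" i] slope_region_cone[OF V(4)[OF that]] two_le_card_simplex by simp
  then have sn: "smooth V (\<lambda>w. normalize i (?z w))" by (rule smooth_normalize[OF V(1) sz])
  have "chart_smooth (blow_dom J i \<times> IntGam J) (map_prod (blow_par J i) id) ?D (blow_par {} i) ?inv ((t, b), snd p)"
  proof (rule chart_smoothI[OF V(1,2) sn])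
    fix v assume v: "v \<in> blow_dom J i \<times> IntGam J" "v \<in> V"
    then have v1: "fst v \<in> blow_dom J i" "snd v \<in> IntGam J" by auto
    then have "snd v \<in> VJ J" using IntGam_iff[OF assms(2)] by blast
    note s = V(4)[OF v(2)] and e = V(5)[OF v(2) this]
    note n = slope_region_normalize[OF assms(1) s]
    note W = slope_region_IntWtil[OF assms w(1) s]
    show "normalize i (?z v) \<in> ?D" using n W by simp
    have "base_blow J k (?z v) = (fst (fst v), snd (fst v))"
      by (rule proj_L_base[OF assms(2)])
        (use e cone_dom_J_bounds(1)[of "fst (fst v)" "snd (fst v)" J i] blow_dom_cone[OF w(1) v1(1)] w(1) in auto)
    then have "base_blow J k (?z v) = fst v" by simp
    then have "gmap J k (blow_par {} i (?z v)) = map_prod (blow_par J i) id v"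
      using gmap_blow_par[OF assms(1-3) w(1) slope_region_cone[OF s]] e by (simp add: map_prod_def split_beta)
    then have "?inv (map_prod (blow_par J i) id v) = blow_par {} i (?z v)"
      by (rule inv_into_f_eq[OF gmap_inj[OF assms] W])
    then show "?inv (map_prod (blow_par J i) id v) = blow_par {} i (normalize i (?z v))" using n(2) by simp
  qed
  moreover have "(?D, blow_par {} i) \<in> mopen Cmfd (IntWtil J k)"
    using Emfd_chart[of i "{}"] unfolding mopen_def by force
  moreover have "(blow_dom J i \<times> IntGam J, map_prod (blow_par J i) id) \<in> mprod (Emfd J) (msub (IntGam J))"
    by (rule mprodI[OF Emfd_chart[OF w(1)]]) (simp add: msub_def)
  moreover have "((t, b), snd p) \<in> blow_dom J i \<times> IntGam J" "map_prod (blow_par J i) id ((t, b), snd p) = p"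
    using w(2,3) tb p1(2) by (simp_all add: prod_eq_iff)
  ultimately show "\<exists>(D, \<phi>)\<in>mprod (Emfd J) (msub (IntGam J)). \<exists>(D', \<psi>)\<in>mopen Cmfd (IntWtil J k). \<exists>z\<in>D.
      \<phi> z = p \<and> chart_smooth D \<phi> D' \<psi> ?inv z"
    by blast
qed


section \<open>The Legendre transform and the graph of its differential\<close>

lemma legendre_value:
  fixes a :: "real^'n::finite"
  assumes "2 \<le> CARD('n)" "k \<notin> J" "2 \<le> card (- J)" "i \<notin> J" "(t, a) \<in> cone_dom {} i"
  shows "- F (proj (blow_par {} i (t, a))) + hJ J k (blow_par {} i (t, a)) \<bullet>
      (lift (proj (blow_par {} i (t, a))) - lift (proj (ymap J k (blow_par {} i (t, a))))) =
    - (t * fun_blow i t a) + L_gradient J k i (t, a) \<bullet> (t *\<^sub>R proj_L J k a)"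
proof -
  have "lift (proj (blow_par {} i (t, a))) - lift (proj (blow_par J i (base_blow J k (t, a)))) = t *\<^sub>R proj_L J k a"
  proof (cases "t = 0")
    case True
    then show ?thesis by (simp add: base_blow_def proj_blow_par)
  next
    case False
    have "lift (proj (blow_par {} i (t, a))) - lift (proj (blow_par J i (base_blow J k (t, a)))) =
      (sgn t * \<bar>t\<bar>) *\<^sub>R proj_L J k a"
      using lift_blow[OF assms(5) False _ two_le_card_simplex]
        lift_blow[OF cone_dom_base[OF assms(5,4,2)] False assms(4,3)]
      by (simp add: base_blow_def algebra_simps)
    then show ?thesis by (simp add: sgn_mult_abs)
  qed
  then show ?thesis
    using ymap_blow_par[OF assms] hJ_blow_par[OF assms(1,2,5)] F_blow[OF assms(5)] by (simp add: L_gradient_def)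
qed

definition legendre :: "'n::finite option set \<Rightarrow> 'n option \<Rightarrow> 'n bpoint \<times> (real^'n) \<Rightarrow> real" where
  "legendre J k p = (let \<xi> = inv_into (IntWtil J k) (gmap J k) p in
     - F (proj \<xi>) + hJ J k \<xi> \<bullet> (lift (proj \<xi>) - lift (proj (ymap J k \<xi>))))"

lemma legendre_is_transform:
  fixes J :: "'n::finite option set"
  assumes "2 \<le> CARD('n)" "k \<notin> J" "2 \<le> card (- J)" "J \<noteq> {}"
  shows "is_legendre_transform J k (legendre J k)"
  unfolding is_legendre_transform_def legendre_def Let_def
  using inv_into_f_f[OF gmap_inj[OF assms]] by simp

lemma legendre_chart:
  fixes b x X :: "real^'n::finite"
  assumes "2 \<le> CARD('n)" "k \<notin> J" "2 \<le> card (- J)" "J \<noteq> {}" "i \<notin> J"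
    and b: "\<And>j. j \<in> J \<Longrightarrow> uvec j \<bullet> b = 0"
    and X: "proj_L J k X = X" "(t, b + X) \<in> slope_region J k i" "L_gradient J k i (t, b + X) = x"
  shows "inv_into (IntWtil J k) (gmap J k) (blow_par J i (t, b), x) = blow_par {} i (t, b + X)"
    "legendre J k (blow_par J i (t, b), x) = - (t * fun_blow i t (b + X)) + x \<bullet> (t *\<^sub>R X)"
proof -
  note c = slope_region_cone[OF X(2)]
  have "gmap J k (blow_par {} i (t, b + X)) = (blow_par J i (t, b), x)"
    using gmap_blow_par[OF assms(1-3,5) c] proj_L_base[OF assms(2) X(1) b] X(3) by simp
  then show i: "inv_into (IntWtil J k) (gmap J k) (blow_par J i (t, b), x) = blow_par {} i (t, b + X)"
    by (intro inv_into_f_eq[OF gmap_inj[OF assms(1-4)] slope_region_IntWtil[OF assms(1-5) X(2)]])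
  have "proj_L J k (b + X) = X" using proj_L_eq_0[of J b k] b X(1) by (simp add: proj_L_add)
  then show "legendre J k (blow_par J i (t, b), x) = - (t * fun_blow i t (b + X)) + x \<bullet> (t *\<^sub>R X)"
    unfolding legendre_def i Let_def legendre_value[OF assms(1-3,5) c] X(3) by simp
qed

subsection \<open>The torus containing the smaller coamoeba\<close>

lemma uvec_inner_Ints:
  fixes z :: "real^'n::finite"
  assumes "\<forall>m. z $ m \<in> \<int>" shows "uvec l \<bullet> z \<in> \<int>"
  using assms by (cases l) (auto simp: uvec_inner)

lemma subtorus_EJ:
  fixes J :: "'n::finite option set"
  assumes "k \<notin> J"
  shows "subtorus_translate (tor ` (\<lambda>v. pvert k + v) ` {v. \<forall>j\<in>J. uvec j \<bullet> v = 0})"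
proof -
  let ?S = "{v :: real^'n. \<forall>j\<in>J. uvec j \<bullet> v = 0}"
  have "{y. tor y \<in> tor ` ?S} = (\<Inter>j\<in>J. {y. (uvec j \<bullet> y) / pi \<in> \<int>})"
  proof (intro equalityI subsetI)
    fix y assume "y \<in> {y. tor y \<in> tor ` ?S}"
    then obtain s where s: "s \<in> ?S" "tor s = tor y" by auto
    then obtain z where z: "\<forall>m. z $ m \<in> \<int>" "y = s + pi *\<^sub>R z" using tor_eq_iff by blast
    show "y \<in> (\<Inter>j\<in>J. {y. (uvec j \<bullet> y) / pi \<in> \<int>})"
      using s(1) uvec_inner_Ints[OF z(1)] by (simp add: z(2) inner_add_right)
  next
    fix y assume y: "y \<in> (\<Inter>j\<in>J. {y. (uvec j \<bullet> y) / pi \<in> \<int>})"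
    define z where "z = (\<Sum>j\<in>J. ((uvec j \<bullet> y) / pi) *\<^sub>R wvec k j)"
    have w: "wvec k j $ m \<in> \<int>" for j m
      by (auto simp: wvec_def pvert_def axis_def split: option.split)
    have "z $ m \<in> \<int>" for m unfolding z_def sum_component vector_scaleR_component real_scaleR_def
    proof (rule Ints_sum)
      fix j assume "j \<in> J"
      then have "uvec j \<bullet> y / pi \<in> \<int>" using y by blast
      then show "uvec j \<bullet> y / pi * wvec k j $ m \<in> \<int>" using w by (rule Ints_mult)
    qed
    then have "tor (y - pi *\<^sub>R z) = tor y" unfolding tor_eq_iff by (intro exI[of _ z]) simp
    moreover have "y - pi *\<^sub>R z \<in> ?S"
      using uvec_sum_wvec[OF assms] by (simp add: z_def inner_diff_right)
    ultimately show "y \<in> {y. tor y \<in> tor ` ?S}" by (metis (mono_tags, lifting) imageI mem_Collect_eq)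
  qed
  moreover have "closed {y :: real^'n. (uvec j \<bullet> y) / pi \<in> \<int>}" for j :: "'n option"
    using continuous_closed_vimage[OF closed_Ints, of "\<lambda>y :: real^'n. (uvec j \<bullet> y) / pi"]
    by (simp add: vimage_def continuous_intros)
  ultimately have "closed {y. tor y \<in> tor ` ?S}" by (simp add: closed_INT)
  moreover have "subspace ?S" by (auto simp: subspace_def inner_add_right)
  ultimately show ?thesis unfolding subtorus_translate_def by blast
qed

lemma EJ_subset_subtorus:
  fixes J :: "'n::finite option set"
  assumes "k \<notin> J"
  shows "EJ J \<subseteq> tor ` (\<lambda>v. pvert k + v) ` {v. \<forall>j\<in>J. uvec j \<bullet> v = 0}" (is "_ \<subseteq> ?A")
proof -
  have "Eplus J \<subseteq> ?A"
  proof
    fix q assume "q \<in> Eplus J"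
    then obtain y where y: "y \<in> pvert ` (- J) \<union> rel_interior (face J)" "q = tor y" by (auto simp: Eplus_def)
    have "bary y j = 0" if "j \<in> J" for j using y(1) that by (auto simp: rel_interior_face_iff bary_pvert)
    then have "uvec j \<bullet> (y - pvert k) = 0" if "j \<in> J" for j
      using bary_add[of "pvert k" "y - pvert k" j] that assms by (auto simp: bary_pvert split: if_splits)
    then show "q \<in> ?A" using y(2) by (intro image_eqI[of _ _ y] image_eqI[of _ _ "y - pvert k"]) auto
  qed
  moreover have "tneg q \<in> ?A" if "q \<in> ?A" for q
  proof -
    obtain v where v: "q = tor (pvert k + v)" "\<forall>j\<in>J. uvec j \<bullet> v = 0" using \<open>q \<in> ?A\<close> by auto
    then have "tneg q = tor (pvert k + (- v))" using tor_pvert_minus[of k v] by simp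
    then show ?thesis using v(2) by (intro image_eqI[of _ _ "pvert k + (- v)"] image_eqI[of _ _ "- v"]) auto
  qed
  ultimately show ?thesis unfolding EJ_def by blast
qed

text \<open>The functions \<open>uvec j\<close>, \<open>j \<in> J\<close>, take values in a coset of \<open>pi * \<int>\<close> on the preimage of the torus, so
  they are locally constant there.\<close>

lemma TJ_near:
  fixes y y' :: "real^'n::finite"
  assumes "k \<notin> J" "tor y' \<in> TJ J" and y: "\<And>j. j \<in> J \<Longrightarrow> uvec j \<bullet> (y - pvert k) = 0"
    and near: "\<And>j. j \<in> J \<Longrightarrow> \<bar>uvec j \<bullet> (y' - y)\<bar> < pi" and j: "j \<in> J"
  shows "uvec j \<bullet> (y' - y) = 0"
proof -
  have "tor y' \<in> tor ` (\<lambda>v. pvert k + v) ` {v. \<forall>j\<in>J. uvec j \<bullet> v = 0}"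
    using assms(2) subtorus_EJ[OF assms(1)] EJ_subset_subtorus[OF assms(1)] unfolding TJ_def by blast
  then obtain v where v: "\<forall>j\<in>J. uvec j \<bullet> v = 0" "tor (pvert k + v) = tor y'" by auto
  then obtain z where z: "\<forall>m. z $ m \<in> \<int>" "y' = pvert k + v + pi *\<^sub>R z" using tor_eq_iff by blast
  have e: "uvec j \<bullet> (y' - y) = pi * (uvec j \<bullet> z)"
    using v(1) y[OF j] j by (simp add: z(2) inner_diff_right inner_add_right)
  have "uvec j \<bullet> z \<in> \<int>" by (rule uvec_inner_Ints[OF z(1)])
  moreover have "\<bar>uvec j \<bullet> z\<bar> < 1"
    using near[OF j] unfolding e by (simp add: abs_mult)
  ultimately have "uvec j \<bullet> z = 0" using Ints_nonzero_abs_less1 by blast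
  then show ?thesis using e by simp
qed

subsection \<open>Coordinates of the smaller coamoeba near a regular point\<close>

text \<open>Away from the vertices \<open>t\<close> can be kept fixed. At a vertex of a circle the direction is constant, and \<open>t\<close> is the
  coordinate.\<close>

lemma circle_direction:
  fixes b v :: "real^'n::finite"
  assumes "card (- J) = 2" "i \<notin> J" "(t, b) \<in> blow_dom J i" "\<And>j. j \<in> J \<Longrightarrow> uvec j \<bullet> v = 0"
  shows "scale i v *\<^sub>R b = v"
proof (rule uvec_ext)
  have cb: "(t, b) \<in> cone_dom J i" and s: "scale i b = 1" using assms(3) by (auto simp: blow_dom_eq[OF assms(2)])
  have J: "uvec j \<bullet> (scale i v *\<^sub>R b) = uvec j \<bullet> v" if "j \<in> J" for j
    using assms(4)[OF that] cone_dom_J_bounds(1)[OF cb assms(2) that] by simp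
  have "uvec i \<bullet> b = - (pi / 2)" using s by (simp add: scale_def field_simps)
  then have i: "uvec i \<bullet> (scale i v *\<^sub>R b) = uvec i \<bullet> v" by (simp add: scale_def)
  have "card (- J - {i}) = 1" using assms(1,2) by simp
  then obtain m where m: "- J - {i} = {m}" by (auto simp: card_1_singleton_iff)
  have "uvec m \<bullet> w = - (uvec i \<bullet> w) - (\<Sum>j\<in>J. uvec j \<bullet> w)" for w :: "real^'n"
  proof -
    have U: "UNIV = insert i (insert m J)" and m': "m \<notin> J" "m \<noteq> i" using m by auto
    have "(\<Sum>l\<in>UNIV. uvec l \<bullet> w) = uvec i \<bullet> w + (uvec m \<bullet> w + (\<Sum>j\<in>J. uvec j \<bullet> w))"
      by (subst U) (use assms(2) m' in simp)
    then show ?thesis using sum_uvec_inner[of w] by simp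
  qed
  note m2 = this
  have "uvec m \<bullet> (scale i v *\<^sub>R b) = uvec m \<bullet> v" unfolding m2 using i J by (simp cong: sum.cong)
  then show "uvec l \<bullet> (scale i v *\<^sub>R b) = uvec l \<bullet> v" for l
    using i J m by (metis Compl_iff DiffI singletonD)
qed

lemma regular_coordinates:
  fixes b :: "real^'n::finite"
  assumes "k \<notin> J" "2 \<le> card (- J)" "i \<notin> J" "(t, b) \<in> blow_dom J i" "t \<noteq> 0 \<or> card (- J) = 2"
  obtains \<tau> \<tau>' \<beta> \<beta>' where "\<tau> (pvert i + t *\<^sub>R b) = t" "\<beta> (pvert i + t *\<^sub>R b) = b"
    "(\<tau> has_derivative \<tau>') (at (pvert i + t *\<^sub>R b))" "(\<beta> has_derivative \<beta>') (at (pvert i + t *\<^sub>R b))"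
    "\<And>w. (\<And>j. j \<in> J \<Longrightarrow> uvec j \<bullet> w = 0) \<Longrightarrow> \<tau>' w *\<^sub>R b + t *\<^sub>R \<beta>' w = w"
    "\<And>y. (\<And>j. j \<in> J \<Longrightarrow> uvec j \<bullet> (y - (pvert i + t *\<^sub>R b)) = 0) \<Longrightarrow>
       blow_par J i (\<tau> y, \<beta> y) = Pt (tor y) \<and> (\<forall>j\<in>J. uvec j \<bullet> \<beta> y = 0)"
proof -
  let ?y = "pvert i + t *\<^sub>R b"
  have cb: "(t, b) \<in> cone_dom J i" and s: "scale i b = 1" using assms(4) by (auto simp: blow_dom_eq[OF assms(3)])
  note b0 = cone_dom_J_bounds(1)[OF cb assms(3)]
  show ?thesis
  proof (cases "t = 0")
    case False
    show ?thesis
    proof (rule that[of "\<lambda>y. t" "\<lambda>y. (1 / t) *\<^sub>R (y - pvert i)" "\<lambda>w. 0" "\<lambda>w. (1 / t) *\<^sub>R w"])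
      fix y assume y: "\<And>j. j \<in> J \<Longrightarrow> uvec j \<bullet> (y - ?y) = 0"
      have "uvec j \<bullet> (y - pvert i) = 0" if "j \<in> J" for j
        using y[OF that] b0[OF that] by (simp add: inner_diff_right inner_add_right)
      then show "blow_par J i (t, (1 / t) *\<^sub>R (y - pvert i)) = Pt (tor y) \<and> (\<forall>j\<in>J. uvec j \<bullet> ((1 / t) *\<^sub>R (y - pvert i)) = 0)"
        using False by (simp add: blow_par_def)
    qed (use False in \<open>auto intro!: derivative_eq_intros\<close>)
  next
    case True
    then have c2: "card (- J) = 2" using assms(5) by simp
    show ?thesis
    proof (rule that[of "\<lambda>y. scale i (y - pvert i)" "\<lambda>y. b" "scale i" "\<lambda>w. 0"])
      show "((\<lambda>y. scale i (y - pvert i)) has_derivative scale i) (at ?y)"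
        unfolding scale_def by (auto intro!: derivative_eq_intros)
      show "scale i w *\<^sub>R b + t *\<^sub>R 0 = w" if "\<And>j. j \<in> J \<Longrightarrow> uvec j \<bullet> w = 0" for w
        using circle_direction[OF c2 assms(3,4) that] by simp
      fix y assume y: "\<And>j. j \<in> J \<Longrightarrow> uvec j \<bullet> (y - ?y) = 0"
      have "scale i (y - pvert i) *\<^sub>R b = y - pvert i"
        by (rule circle_direction[OF c2 assms(3,4)]) (use y True in simp)
      then show "blow_par J i (scale i (y - pvert i), b) = Pt (tor y) \<and> (\<forall>j\<in>J. uvec j \<bullet> b = 0)"
        using c2 b0 by (simp add: blow_par_def)
    qed (use True s in \<open>auto simp: scale_def intro!: derivative_eq_intros\<close>)
  qed
qed

subsection \<open>The differential\<close>

lemma has_derivative_within_cong: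
  assumes "(f has_derivative f') (at x within S)" "bounded_linear g'" "0 < d"
    and "\<And>y. y \<in> S \<Longrightarrow> dist y x < d \<Longrightarrow> f' (y - x) = g' (y - x)"
  shows "(f has_derivative g') (at x within S)"
  unfolding has_derivative_within
proof
  have "((\<lambda>y. (1 / norm (y - x)) *\<^sub>R (f y - (f x + f' (y - x)))) \<longlongrightarrow> 0) (at x within S)"
    using assms(1) unfolding has_derivative_within by blast
  then show "((\<lambda>y. (1 / norm (y - x)) *\<^sub>R (f y - (f x + g' (y - x)))) \<longlongrightarrow> 0) (at x within S)"
    by (rule Lim_transform_within[OF _ assms(3)]) (simp add: assms(4))
qed (rule assms(2))

text \<open>In the formula for \<open>dG\<close> the derivative of the fibre coordinate drops out, because it is multiplied by the
  difference of the gradient and \<open>x\<close>, which is orthogonal to \<open>L\<close>.\<close>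

lemma legendre_has_derivative:
  fixes b x X :: "real^'n::finite"
  assumes "2 \<le> CARD('n)" and k: "k \<notin> J" and cJ: "2 \<le> card (- J)" "J \<noteq> {}" and i: "i \<notin> J"
    and b: "(t, b) \<in> blow_dom J i" "t \<noteq> 0 \<or> card (- J) = 2" and x: "x \<in> IntGam J"
    and X: "proj_L J k X = X" "(t, b + X) \<in> slope_region J k i" "L_gradient J k i (t, b + X) = x"
  defines "y \<equiv> pvert i + t *\<^sub>R b" and "l \<equiv> t *\<^sub>R X" and "l' \<equiv> grad_blow i (t, b + X) - x"
  shows "((\<lambda>(x, y). legendre J k (Pt (tor y), x)) has_derivative (\<lambda>(v, w). l \<bullet> v - l' \<bullet> w))
    (at (x, y) within (VJ J \<times> {y. tor y \<in> TJ J}))"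
proof -
  let ?S = "VJ J \<times> {y. tor y \<in> TJ J}"
  note c = slope_region_cone[OF X(2)]
  have cb: "(t, b) \<in> cone_dom J i" using blow_dom_cone[OF i b(1)] .
  note b0 = cone_dom_J_bounds(1)[OF cb i]
  obtain V sol where V: "open V" "((t, b), x) \<in> V" "smooth V sol" "sol ((t, b), x) = X"
    "\<And>w. w \<in> V \<Longrightarrow> (fst (fst w), snd (fst w) + sol w) \<in> slope_region J k i"
    "\<And>w. w \<in> V \<Longrightarrow> snd w \<in> VJ J \<Longrightarrow> proj_L J k (sol w) = sol w \<and> L_gradient J k i (fst (fst w), snd (fst w) + sol w) = snd w"
    using fibre_solution_smooth[OF i k card_less_of_Compl[OF cJ(1)] X(2,1)] unfolding X(3) by metis
  obtain \<tau> \<tau>' \<beta> \<beta>' where c0: "\<tau> y = t" "\<beta> y = b" and dc: "(\<tau> has_derivative \<tau>') (at y)" "(\<beta> has_derivative \<beta>') (at y)"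
    and tang: "\<And>w. (\<And>j. j \<in> J \<Longrightarrow> uvec j \<bullet> w = 0) \<Longrightarrow> \<tau>' w *\<^sub>R b + t *\<^sub>R \<beta>' w = w"
    and par: "\<And>y'. (\<And>j. j \<in> J \<Longrightarrow> uvec j \<bullet> (y' - y) = 0) \<Longrightarrow>
       blow_par J i (\<tau> y', \<beta> y') = Pt (tor y') \<and> (\<forall>j\<in>J. uvec j \<bullet> \<beta> y' = 0)"
    using regular_coordinates[OF k cJ(1) i b] unfolding y_def by metis
  define m where "m p = ((\<tau> (snd p), \<beta> (snd p)), fst p)" for p :: "(real^'n) \<times> (real^'n)"
  have m0: "m (x, y) = ((t, b), x)" by (simp add: m_def c0)
  have d\<tau>: "((\<lambda>p. \<tau> (snd p)) has_derivative (\<lambda>h. \<tau>' (snd h))) (at (x, y))"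
    and d\<beta>: "((\<lambda>p. \<beta> (snd p)) has_derivative (\<lambda>h. \<beta>' (snd h))) (at (x, y))"
    using dc by (auto intro!: has_derivative_compose[OF has_derivative_snd[OF has_derivative_ident]])
  have dm: "(m has_derivative (\<lambda>h. ((\<tau>' (snd h), \<beta>' (snd h)), fst h))) (at (x, y))"
    unfolding m_def by (intro has_derivative_Pair d\<tau> d\<beta> has_derivative_fst has_derivative_ident)
  define X' where "X' h = proj_L J k (frechet_derivative sol (at ((t, b), x)) ((\<tau>' (snd h), \<beta>' (snd h)), fst h))" for h
  have "(sol has_derivative frechet_derivative sol (at ((t, b), x))) (at (m (x, y)))"
    unfolding m0 by (rule smooth_has_derivative[OF V(3,2)])
  from has_derivative_compose[OF dm this]
  have "((\<lambda>p. sol (m p)) has_derivative (\<lambda>h. frechet_derivative sol (at ((t, b), x)) ((\<tau>' (snd h), \<beta>' (snd h)), fst h))) (at (x, y))" .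
  from bounded_linear.has_derivative[OF bounded_linear_proj_L this]
  have dX: "((\<lambda>p. proj_L J k (sol (m p))) has_derivative X') (at (x, y))" unfolding X'_def .
  define P where "P p = proj_L J k (sol (m p))" for p
  have P0: "P (x, y) = X" by (simp add: P_def m0 V(4) X(1))
  define K where "K p = - (\<tau> (snd p) * fun_blow i (\<tau> (snd p)) (\<beta> (snd p) + P p)) + fst p \<bullet> (\<tau> (snd p) *\<^sub>R P p)" for p
  let ?g = "grad_blow i (t, b + X)"
  let ?K' = "\<lambda>h. - (?g \<bullet> (\<tau>' (snd h) *\<^sub>R (b + X) + t *\<^sub>R (\<beta>' (snd h) + X' h))) +
     (x \<bullet> (t *\<^sub>R X' h + \<tau>' (snd h) *\<^sub>R X) + fst h \<bullet> (t *\<^sub>R X))"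
  have dK: "(K has_derivative ?K') (at (x, y))"
  proof -
    have dP: "(P has_derivative X') (at (x, y))" using dX by (simp add: P_def[abs_def])
    have "((\<lambda>p. (\<tau> (snd p), \<beta> (snd p) + P p)) has_derivative (\<lambda>h. (\<tau>' (snd h), \<beta>' (snd h) + X' h))) (at (x, y))"
      by (intro has_derivative_Pair has_derivative_add d\<tau> d\<beta> dP)
    moreover have "((\<lambda>z. fst z * fun_blow i (fst z) (snd z)) has_derivative (\<lambda>v. ?g \<bullet> (fst v *\<^sub>R (b + X) + t *\<^sub>R snd v)))
        (at (\<tau> (snd (x, y)), \<beta> (snd (x, y)) + P (x, y)))"
      using has_derivative_fun[OF c] by (simp add: c0 P0)
    ultimately have "((\<lambda>p. \<tau> (snd p) * fun_blow i (\<tau> (snd p)) (\<beta> (snd p) + P p)) has_derivative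
        (\<lambda>h. ?g \<bullet> (\<tau>' (snd h) *\<^sub>R (b + X) + t *\<^sub>R (\<beta>' (snd h) + X' h)))) (at (x, y))"
      using has_derivative_compose[of "\<lambda>p. (\<tau> (snd p), \<beta> (snd p) + P p)" "\<lambda>h. (\<tau>' (snd h), \<beta>' (snd h) + X' h)" "(x, y)" UNIV
          "\<lambda>z. fst z * fun_blow i (fst z) (snd z)" "\<lambda>v. ?g \<bullet> (fst v *\<^sub>R (b + X) + t *\<^sub>R snd v)"] by simp
    moreover have "((\<lambda>p. fst p \<bullet> (\<tau> (snd p) *\<^sub>R P p)) has_derivative
        (\<lambda>h. x \<bullet> (t *\<^sub>R X' h + \<tau>' (snd h) *\<^sub>R X) + fst h \<bullet> (t *\<^sub>R X))) (at (x, y))"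
      using has_derivative_inner[OF has_derivative_fst[OF has_derivative_ident] has_derivative_scaleR[OF d\<tau> dP]]
      by (simp add: c0 P0)
    ultimately show ?thesis unfolding K_def by (intro has_derivative_add has_derivative_minus)
  qed
  \<comment> \<open>Close to the base point, points of the torus have vanishing \<open>J\<close>-coordinates and lie in the domain of \<open>sol\<close>.\<close>
  have yk: "uvec j \<bullet> (y - pvert k) = 0" if "j \<in> J" for j
  proof -
    have "j \<noteq> i" "j \<noteq> k" using that i k by auto
    then have "uvec j \<bullet> (pvert i - pvert k) = 0" by (simp add: uvec_pvert_diff)
    then show ?thesis using b0[OF that] by (simp add: y_def inner_add_right inner_diff_right)
  qed
  have "isCont m (x, y)" using has_derivative_continuous[OF dm] .
  then have "(m \<longlongrightarrow> m (x, y)) (nhds (x, y))" unfolding isCont_def tendsto_at_iff_tendsto_nhds .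
  then have evV: "\<forall>\<^sub>F p in nhds (x, y). m p \<in> V" by (rule topological_tendstoD[OF _ V(1)]) (simp add: m0 V(2))
  have "open (\<Inter>j\<in>J. {p :: (real^'n) \<times> (real^'n). \<bar>uvec j \<bullet> (snd p - y)\<bar> < pi})"
    by (intro open_INT ballI open_Collect_less continuous_intros) simp
  then have "\<forall>\<^sub>F p in nhds (x, y). p \<in> (\<Inter>j\<in>J. {p. \<bar>uvec j \<bullet> (snd p - y)\<bar> < pi})"
    by (rule eventually_nhds_in_open) simp
  with evV have "\<forall>\<^sub>F p in nhds (x, y). m p \<in> V \<and> p \<in> (\<Inter>j\<in>J. {p. \<bar>uvec j \<bullet> (snd p - y)\<bar> < pi})"
    by (rule eventually_conj)
  then obtain d where d: "0 < d" "\<And>p. dist p (x, y) < d \<Longrightarrow> m p \<in> V \<and> p \<in> (\<Inter>j\<in>J. {p. \<bar>uvec j \<bullet> (snd p - y)\<bar> < pi})"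
    unfolding eventually_nhds_metric by blast
  have near: "(\<forall>j\<in>J. uvec j \<bullet> (snd p - y) = 0) \<and> m p \<in> V" if "p \<in> ?S" "dist p (x, y) < d" for p
    using TJ_near[OF k, of "snd p" y] yk that(1) d(2)[OF that(2)] by auto
  have eqK: "K p = (case p of (x, y) \<Rightarrow> legendre J k (Pt (tor y), x))" if p: "p \<in> ?S" "dist p (x, y) < d" for p
  proof -
    obtain x1 y1 where p1: "p = (x1, y1)" by (cases p)
    have n: "\<And>j. j \<in> J \<Longrightarrow> uvec j \<bullet> (y1 - y) = 0" "m p \<in> V" using near[OF p] p1 by auto
    have x1: "x1 \<in> VJ J" using p(1) p1 by simp
    have s: "(\<tau> y1, \<beta> y1 + sol (m p)) \<in> slope_region J k i" using V(5)[OF n(2)] by (simp add: m_def p1)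
    have e: "proj_L J k (sol (m p)) = sol (m p)" "L_gradient J k i (\<tau> y1, \<beta> y1 + sol (m p)) = x1"
      using V(6)[OF n(2)] x1 by (auto simp: m_def p1)
    from legendre_chart(2)[OF assms(1) k cJ i _ e(1) s e(2)] par[OF n(1)] e(1)
    show ?thesis by (simp add: K_def p1 P_def)
  qed
  have xyS: "(x, y) \<in> ?S"
  proof -
    have "tor y \<in> A" if "EJ J \<subseteq> A" for A
    proof -
      have "tor y \<in> EJ J"
      proof (cases "t = 0")
        case True
        then show ?thesis using i by (auto simp: y_def EJ_def Eplus_def)
      next
        case False
        have "Pt (tor y) \<in> Pt ` IntE J"
          using blow_par_IntE[OF cb False i] False by (simp add: blow_par_def y_def)
        then have "tor y \<in> IntE J" by auto
        then show ?thesis by (auto simp: IntE_def EJ_def Eplus_def)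
      qed
      then show ?thesis using that by blast
    qed
    then show ?thesis using x IntGam_iff[OF k] by (auto simp: TJ_def)
  qed
  have "((\<lambda>(x, y). legendre J k (Pt (tor y), x)) has_derivative ?K') (at (x, y) within ?S)"
    by (rule has_derivative_transform_within[OF has_derivative_at_withinI[OF dK] d(1) xyS]) (rule eqK)
  then show ?thesis
  proof (rule has_derivative_within_cong[OF _ _ d(1)])
    show "bounded_linear (\<lambda>(v, w). l \<bullet> v - l' \<bullet> w)"
      unfolding case_prod_beta
      by (intro bounded_linear_sub bounded_linear_inner_right_comp bounded_linear_fst bounded_linear_snd)
    fix p assume p: "p \<in> ?S" "dist p (x, y) < d"
    define h where "h = p - (x, y)"
    have w: "uvec j \<bullet> snd h = 0" if "j \<in> J" for j using near[OF p] that by (simp add: h_def)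
    have xw: "x \<bullet> snd h = 0" by (rule VJ_orthogonal[OF _ w]) (use xyS in auto)
    have lp: "l' \<bullet> z = 0" if "z \<in> LJ J k" for z
    proof -
      have "l' \<in> Lperp J k" using grad_blow_Lperp[OF k, of i "(t, b + X)"] by (simp add: l'_def X(3))
      then show ?thesis using that by (simp add: Lperp_def)
    qed
    have L: "X \<in> LJ J k" "X' h \<in> LJ J k" using X(1) LJ_iff[OF k] proj_L_in_LJ[OF k] by (auto simp: X'_def)
    have g: "?g = x + l'" by (simp add: l'_def)
    have "?K' h = - (?g \<bullet> (\<tau>' (snd h) *\<^sub>R b + t *\<^sub>R \<beta>' (snd h))) - l' \<bullet> (\<tau>' (snd h) *\<^sub>R X) - l' \<bullet> (t *\<^sub>R X' h) + fst h \<bullet> l"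
      unfolding g l_def by (simp add: inner_add_left inner_add_right algebra_simps)
    also have "\<dots> = - (?g \<bullet> snd h) + fst h \<bullet> l"
      using tang[OF w] lp[OF L(1)] lp[OF L(2)] by simp
    also have "\<dots> = l \<bullet> fst h - l' \<bullet> snd h"
      unfolding g inner_add_left xw by (simp add: inner_commute[of l])
    finally show "?K' (p - (x, y)) = (case p - (x, y) of (v, w) \<Rightarrow> l \<bullet> v - l' \<bullet> w)"
      unfolding h_def by (simp add: case_prod_beta)
  qed
qed

lemma locally_smooth_Phi:
  assumes "2 \<le> CARD('n::finite)"
  shows "locally_smooth (Cmfd :: (_, 'n bpoint) mfd) (mprod (msub UNIV) Tmfd) \<Phi>"
  unfolding locally_smooth_def
proof
  fix \<xi> assume "\<xi> \<in> mpts (Cmfd :: (_, 'n bpoint) mfd)"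
  then obtain i z where z: "z \<in> blow_dom {} i" "\<xi> = blow_par {} i z" by (rule Emfd_pointE)
  let ?Y = "\<lambda>z. pvert i + fst z *\<^sub>R snd z :: real^'n"
  let ?B = "ball (?Y z) 1" and ?U = "cone_dom {} i \<inter> ?Y -` ball (?Y z) 1"
  have "inj_on tor ?B"
  proof (rule inj_onI)
    fix y y' assume y: "y \<in> ?B" "y' \<in> ?B" "tor y = tor y'"
    have "\<bar>y $ m - y' $ m\<bar> < pi" for m
    proof -
      have "\<bar>(y - y') $ m\<bar> \<le> norm (y - y')" by (rule component_le_norm_cart)
      also have "\<dots> \<le> dist (?Y z) y + dist (?Y z) y'" unfolding dist_norm[symmetric] by (rule dist_triangle3)
      also have "\<dots> < 2" using y(1,2) by simp
      finally show ?thesis using pi_gt3 by simp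
    qed
    then show "y = y'" by (rule tor_inj_near[OF y(3)])
  qed
  then have T: "(?B, tor) \<in> Tmfd" by (simp add: Tmfd_def)
  have sY: "smooth (cone_dom {} i) ?Y" by (intro smooth_intros open_cone_dom)
  have oU: "open ?U" by (rule continuous_open_preimage[OF smooth_imp_continuous[OF sY] open_cone_dom open_ball])
  have "smooth ?U (\<lambda>z. (grad_blow i z, ?Y z))"
    by (intro smooth_Pair oU smooth_subset[OF smooth_grad_blow] smooth_subset[OF sY]) auto
  then have "chart_smooth (blow_dom {} i) (blow_par {} i) (UNIV \<times> ?B) (map_prod id tor) \<Phi> z"
    using z(1) blow_dom_cone[of i "{}"] hmap_blow_par[OF assms]
    by (intro chart_smoothI[OF oU]) (auto simp: \<Phi>_def proj_blow_par)
  moreover have "(UNIV \<times> ?B, map_prod id tor) \<in> mprod (msub UNIV) Tmfd"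
    by (rule mprodI[OF _ T]) (simp add: msub_def)
  ultimately show "\<exists>(D, \<phi>)\<in>Cmfd. \<exists>(D', \<psi>)\<in>mprod (msub UNIV) Tmfd. \<exists>z\<in>D. \<phi> z = \<xi> \<and> chart_smooth D \<phi> D' \<psi> \<Phi> z"
    using z Emfd_chart[of i "{}"] by blast
qed

lemma graph_of_differential:
  fixes J :: "'n::finite option set"
  assumes "2 \<le> CARD('n)" "k \<notin> J" "2 \<le> card (- J)" "J \<noteq> {}"
  shows "is_graph_of_differential J k (legendre J k) (\<Phi> ` IntWtil J k)"
  unfolding is_graph_of_differential_def
proof (rule exI[of _ "\<lambda>p. \<Phi> (inv_into (IntWtil J k) (gmap J k) p)"], intro conjI allI impI)
  let ?inv = "inv_into (IntWtil J k) (gmap J k)"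
  let ?\<sigma> = "\<lambda>p. \<Phi> (?inv p)"
  have bij: "bij_betw (gmap J k) (IntWtil J k) (Etil J \<times> IntGam J)"
    using gmap_bij[OF assms] by (simp add: mpts_Emfd[OF assms(3)])
  have "continuous_map (mtop (mprod (Emfd J) (msub (IntGam J)))) (mtop (mopen Cmfd (IntWtil J k))) ?inv"
    by (intro locally_smooth_imp_continuous locally_smooth_gmap_inverse smooth_atlas_mprod smooth_atlas_Emfd
        smooth_atlas_msub assms)
  moreover have "continuous_map (mtop (mopen Cmfd (IntWtil J k))) (mtop (mprod (msub UNIV) Tmfd)) \<Phi>"
    by (intro locally_smooth_imp_continuous smooth_atlas_mopen smooth_atlas_Emfd two_le_card_simplex
        locally_smooth_mopen locally_smooth_Phi assms(1))
  ultimately show "continuous_map (mtop (mprod (Emfd J) (msub (IntGam J)))) (mtop (mprod (msub UNIV) Tmfd)) ?\<sigma>"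
    using continuous_map_compose by (fastforce simp: comp_def)
  have "?inv ` (Etil J \<times> IntGam J) = IntWtil J k"
    using bij_betw_inv_into[OF bij] by (rule bij_betw_imp_surj_on)
  then show "\<Phi> ` IntWtil J k = ?\<sigma> ` (Etil J \<times> IntGam J)" by (metis image_image)
  fix q x assume "Pt q \<in> Etil J \<and> x \<in> IntGam J"
  then have q: "Pt q \<in> mpts (Emfd J)" and x: "x \<in> IntGam J" by (auto simp: mpts_Emfd[OF assms(3)])
  obtain i w where w: "i \<notin> J" "w \<in> blow_dom J i" "Pt q = blow_par J i w" using q by (rule Emfd_pointE)
  obtain t b where tb: "w = (t, b)" by (cases w)
  have cb: "(t, b) \<in> cone_dom J i" using blow_dom_cone[OF w(1,2)] tb by simp
  have reg: "t \<noteq> 0 \<or> card (- J) = 2" using w(3) assms(3) by (auto simp: tb blow_par_def split: if_splits)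
  obtain X where X: "proj_L J k X = X" "(t, b + X) \<in> slope_region J k i" "L_gradient J k i (t, b + X) = x"
    by (rule L_gradient_surj[OF cb w(1) assms(2) card_less_of_Compl[OF assms(3)] assms(4) x])
  let ?y = "pvert i + t *\<^sub>R b" and ?l = "t *\<^sub>R X" and ?l' = "grad_blow i (t, b + X) - x"
  have y: "tor ?y = q" using arg_cong[OF w(3), of proj] by (simp add: tb proj_blow_par)
  have inv: "?inv (Pt q, x) = blow_par {} i (t, b + X)"
    using legendre_chart(1)[OF assms w(1) cone_dom_J_bounds(1)[OF cb w(1)] X] w(3) tb by simp
  have \<sigma>: "?\<sigma> (Pt q, x) = (x + ?l', tor (?y + ?l))"
    unfolding inv \<Phi>_def using hmap_blow_par[OF assms(1) slope_region_cone[OF X(2)]]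
    by (simp add: proj_blow_par algebra_simps)
  have l: "?l \<in> LJ J k" using X(1) LJ_iff[OF assms(2), of ?l] by (simp add: proj_L_scaleR)
  have l': "?l' \<in> Lperp J k" using grad_blow_Lperp[OF assms(2), of i "(t, b + X)"] by (simp add: X(3))
  have "((\<lambda>(x, y). legendre J k (Pt (tor y), x)) has_derivative (\<lambda>(v, w). ?l \<bullet> v - ?l' \<bullet> w))
    (at (x, ?y) within (VJ J \<times> {y. tor y \<in> TJ J}))"
    using legendre_has_derivative[OF assms w(1) _ reg x X] w(2) tb by simp
  then show "\<exists>y. \<exists>l'\<in>Lperp J k. \<exists>l\<in>LJ J k. tor y = q \<and>
    ((\<lambda>(x, y). legendre J k (Pt (tor y), x)) has_derivative (\<lambda>(v, w). l \<bullet> v - l' \<bullet> w))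
      (at (x, y) within VJ J \<times> {y. tor y \<in> TJ J}) \<and> ?\<sigma> (Pt q, x) = (x + l', tor (y + l))"
    using y \<sigma> l l' by blast
qed


theorem corollary3p26:
  fixes n :: nat and J :: "'n::finite option set" and k :: "'n option"
  assumes "n \<in> {1, 2}" and "CARD('n) = n + 1"
    and "1 \<le> card J" and "card J \<le> n" and "k \<notin> J"
  shows "diffeomorphism (mopen Cmfd (IntWtil J k)) (mprod (Emfd J) (msub (IntGam J))) (gmap J k)
    \<and> (\<exists>G. is_legendre_transform J k G \<and>
          is_graph_of_differential J k G (\<Phi> ` IntWtil J k))
    \<and> trivial_fibre_bundle (mopen Cmfd (IntWtil J k)) (msub (IntGam J)) (Emfd J) (hJ J k)"
proof -
  have N: "2 \<le> CARD('n)" and J: "J \<noteq> {}" using assms(1-3) by auto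
  have "card (- J) = CARD('n) + 1 - card J" by (simp add: Compl_eq_Diff_UNIV card_Diff_subset)
  then have cJ: "2 \<le> card (- J)" using assms(2,4) by simp
  note a = N assms(5) cJ J
  let ?X = "mopen Cmfd (IntWtil J k)" and ?Y = "mprod (Emfd J) (msub (IntGam J))"
  have atlas: "smooth_atlas ?X" "smooth_atlas (Emfd J)" "smooth_atlas ?Y"
    by (intro smooth_atlas_mopen smooth_atlas_mprod smooth_atlas_Emfd smooth_atlas_msub two_le_card_simplex cJ)+
  have bij: "bij_betw (gmap J k) (mpts ?X) (mpts ?Y)"
    using gmap_bij[OF a] by (simp only: mpts_IntWtil mpts_mprod mpts_msub)
  have inv: "locally_smooth ?Y ?X (inv_into (mpts ?X) (gmap J k))"
    unfolding mpts_IntWtil by (rule locally_smooth_gmap_inverse[OF a])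
  note smooth = locally_smooth_gmap[OF a] inv
  have "diffeomorphism ?X ?Y (gmap J k)"
    by (rule diffeomorphismI[OF atlas(1,3) bij smooth])
  moreover have "trivial_fibre_bundle ?X (msub (IntGam J)) (Emfd J) (hJ J k)"
    by (rule trivial_fibre_bundleI[OF atlas(1,2) smooth_atlas_msub bij smooth]) (simp add: gmap_def)
  ultimately show ?thesis using legendre_is_transform[OF a] graph_of_differential[OF a] by blast
qed

end
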